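(* (1) For every $\lambda\in\Lambda_p$, $\bar\Delta(\lambda)$ has a unique maximal proper submodule. (2) For every $\lambda\in\Lambda_p$, let $L(\lambda)$ be the simple head of $\bar\Delta(\lambda)$. Then $L(\lambda)^s\cong D(\lambda)$ as $B^0$-modules. (3) $\{L(\lambda)\mid\lambda\in\Lambda_p\}$ is a complete set of pairwise non-isomorphic simple $B$-modules.
   Context: $K$ is an algebraically closed field of characteristic $p\neq2$ (so $p=0$ or $p$ is an odd prime), $\delta_0\in K$, $\mathbb N=\{0,1,2,\dots\}$. An $(m,s)$-Brauer diagram is a perfect matching of $m$ points on a bottom row and $s$ points on a top row. Pairs of bottom points are caps, pairs of top points are cups, other pairs are vertical strands. $B$ is the (non-unital) $K$-algebra with basis all Brauer diagrams. The product $gh$ of an $(m,n)$-diagram $g$ and an $(s,t)$-diagram $h$ is $0$ unless $t=m$, in which case $g$ is stacked on top of $h$ and each closed loop is replaced by the factor $\delta_0$. $1_m$ is the identity $(m,m)$-diagram. All $B$-modules are left modules $V=\bigoplus_{m\in\mathbb N}1_mV$; the category of these is $B$-mod. $B^0$ is the span of diagrams with neither cups nor caps, so $B^0\cong\bigoplus_mK\mathfrak S_m$. $B^\sharp$ is the span of diagrams without cups. $B^0$ is the quotient of $B^\sharp$ by the span of diagrams with at least one cap, so $B^0$-modules are $B^\sharp$-modules, and $\Delta(V):=B\otimes_{B^\sharp}V$ for a $B^0$-module $V$. $\Lambda_p$ is the set of $p$-regular partitions (no $p$ equal nonzero parts; all partitions if $p=0$). For $\lambda\in\Lambda_p$ a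 partition of $m$, $D(\lambda)$ is the simple head of the Specht module $S(\lambda)$ of $K\mathfrak S_m$ (James' convention), and $\bar\Delta(\lambda):=\Delta(D(\lambda))$. For a nonzero $B$-module $V$, the shortest word space is $V^s:=1_mV$, where $m$ is minimal with $1_mV\neq0$; it is a $B^0$-module. *)

theory Defs
  imports
    "HOL-Algebra.Module"
    "HOL-Algebra.AbelCoset"
    "HOL-Library.Poly_Mapping"
    "HOL-Library.Disjoint_Sets"
    "HOL-Combinatorics.Permutations"
    "HOL-Computational_Algebra.Polynomial"
begin

section \<open>Vector spaces with a basis\<close>

definition scalar_ring :: "'k::field ring" where
  "scalar_ring = \<lparr>carrier = UNIV, monoid.mult = (*), one = 1, zero = 0, add = (+)\<rparr>"

definition scale :: "'k::field \<Rightarrow> ('x \<Rightarrow>\<^sub>0 'k) \<Rightarrow> ('x \<Rightarrow>\<^sub>0 'k)" where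
  "scale c p = Poly_Mapping.map (\<lambda>d. c * d) p"

definition lin_ext :: "('x \<Rightarrow> ('y \<Rightarrow>\<^sub>0 'k::field)) \<Rightarrow> ('x \<Rightarrow>\<^sub>0 'k) \<Rightarrow> ('y \<Rightarrow>\<^sub>0 'k)" where
  "lin_ext f p = (\<Sum>x\<in>Poly_Mapping.keys p. scale (Poly_Mapping.lookup p x) (f x))"

definition lin_span :: "('x \<Rightarrow>\<^sub>0 'k::field) set \<Rightarrow> ('x \<Rightarrow>\<^sub>0 'k) set" where
  "lin_span = Modules.module.span scale"


section \<open>Modules over not necessarily unital algebras\<close>

text \<open>
  A \<open>K\<close>-algebra is given by a record of type \<open>('k, 'a) module\<close>; its unit field is
  never used, since the algebras need not be unital. In the records for modules the
  ring fields \<open>mult\<close> and \<open>one\<close> inherited from the library carry no information.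
\<close>

record ('k, 'v, 'a) amodule = "('k, 'v) module" +
  act :: "'a \<Rightarrow> 'v \<Rightarrow> 'v"

locale amodule = Module.module scalar_ring V
  for A :: "('k::field, 'a, 'm) module_scheme"
  and V :: "('k, 'v, 'a, 'n) amodule_scheme" +
  assumes act_closed:
      "\<lbrakk>a \<in> carrier A; v \<in> carrier V\<rbrakk> \<Longrightarrow> act V a v \<in> carrier V"
    and act_add_left:
      "\<lbrakk>a \<in> carrier A; b \<in> carrier A; v \<in> carrier V\<rbrakk>
        \<Longrightarrow> act V (a \<oplus>\<^bsub>A\<^esub> b) v = act V a v \<oplus>\<^bsub>V\<^esub> act V b v"
    and act_add_right:
      "\<lbrakk>a \<in> carrier A; v \<in> carrier V; w \<in> carrier V\<rbrakk>
        \<Longrightarrow> act V a (v \<oplus>\<^bsub>V\<^esub> w) = act V a v \<oplus>\<^bsub>V\<^esub> act V a w"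
    and act_smult_left:
      "\<lbrakk>a \<in> carrier A; v \<in> carrier V\<rbrakk> \<Longrightarrow> act V (c \<odot>\<^bsub>A\<^esub> a) v = c \<odot>\<^bsub>V\<^esub> act V a v"
    and act_smult_right:
      "\<lbrakk>a \<in> carrier A; v \<in> carrier V\<rbrakk> \<Longrightarrow> act V a (c \<odot>\<^bsub>V\<^esub> v) = c \<odot>\<^bsub>V\<^esub> act V a v"
    and act_mult:
      "\<lbrakk>a \<in> carrier A; b \<in> carrier A; v \<in> carrier V\<rbrakk>
        \<Longrightarrow> act V (a \<otimes>\<^bsub>A\<^esub> b) v = act V a (act V b v)"

definition asubmodule ::
  "('k::field, 'a, 'm) module_scheme \<Rightarrow> ('k, 'v, 'a, 'n) amodule_scheme \<Rightarrow> 'v set \<Rightarrow> bool" where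
  "asubmodule A V W \<longleftrightarrow>
    submodule W scalar_ring V \<and> (\<forall>a\<in>carrier A. \<forall>w\<in>W. act V a w \<in> W)"

definition maximal_submodule ::
  "('k::field, 'a, 'm) module_scheme \<Rightarrow> ('k, 'v, 'a, 'n) amodule_scheme \<Rightarrow> 'v set \<Rightarrow> bool" where
  "maximal_submodule A V W \<longleftrightarrow>
    asubmodule A V W \<and> W \<noteq> carrier V \<and>
    (\<forall>W'. asubmodule A V W' \<and> W \<subseteq> W' \<longrightarrow> W' = W \<or> W' = carrier V)"

definition simple_amodule ::
  "('k::field, 'a, 'm) module_scheme \<Rightarrow> ('k, 'v, 'a, 'n) amodule_scheme \<Rightarrow> bool" where
  "simple_amodule A V \<longleftrightarrow>
    amodule A V \<and> carrier V \<noteq> {\<zero>\<^bsub>V\<^esub>} \<and>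
    (\<forall>W. asubmodule A V W \<longrightarrow> W = {\<zero>\<^bsub>V\<^esub>} \<or> W = carrier V)"

definition amodule_iso ::
  "('k::field, 'a, 'm) module_scheme \<Rightarrow> ('k, 'v, 'a, 'n) amodule_scheme \<Rightarrow>
   ('k, 'w, 'a, 'l) amodule_scheme \<Rightarrow> bool" where
  "amodule_iso A V W \<longleftrightarrow>
    (\<exists>f. bij_betw f (carrier V) (carrier W) \<and>
      (\<forall>v\<in>carrier V. \<forall>w\<in>carrier V. f (v \<oplus>\<^bsub>V\<^esub> w) = f v \<oplus>\<^bsub>W\<^esub> f w) \<and>
      (\<forall>c. \<forall>v\<in>carrier V. f (c \<odot>\<^bsub>V\<^esub> v) = c \<odot>\<^bsub>W\<^esub> f v) \<and>
      (\<forall>a\<in>carrier A. \<forall>v\<in>carrier V. f (act V a v) = act W a (f v)))"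

definition quotient_amodule ::
  "('k::field, 'v, 'a, 'n) amodule_scheme \<Rightarrow> 'v set \<Rightarrow> ('k, 'v set, 'a) amodule" where
  "quotient_amodule V W =
    \<lparr>carrier = a_rcosets\<^bsub>V\<^esub> W, monoid.mult = undefined, one = undefined,
     zero = W, add = (\<lambda>X Y. X <+>\<^bsub>V\<^esub> Y),
     module.smult = (\<lambda>c X. \<Union>x\<in>X. W +>\<^bsub>V\<^esub> (c \<odot>\<^bsub>V\<^esub> x)),
     act = (\<lambda>a X. \<Union>x\<in>X. W +>\<^bsub>V\<^esub> act V a x)\<rparr>"

definition module_radical ::
  "('k::field, 'a, 'm) module_scheme \<Rightarrow> ('k, 'v, 'a, 'n) amodule_scheme \<Rightarrow> 'v set" where
  "module_radical A V = carrier V \<inter> \<Inter>{W. maximal_submodule A V W}"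

definition module_head ::
  "('k::field, 'a, 'm) module_scheme \<Rightarrow> ('k, 'v, 'a, 'n) amodule_scheme \<Rightarrow>
   ('k, 'v set, 'a) amodule" where
  "module_head A V = quotient_amodule V (module_radical A V)"

definition pullback ::
  "('b \<Rightarrow> 'a) \<Rightarrow> ('k::field, 'v, 'a) amodule \<Rightarrow> ('k, 'v, 'b) amodule" where
  "pullback \<phi> V =
    \<lparr>carrier = carrier V, monoid.mult = monoid.mult V, one = one V, zero = zero V, add = add V,
     module.smult = module.smult V, act = (\<lambda>b. act V (\<phi> b))\<rparr>"

text \<open>
  \<open>tensor_module A S V\<close> is \<open>A \<otimes>\<^sub>S V\<close> for a subalgebra \<open>S\<close> of \<open>A\<close> and an
  \<open>S\<close>-module \<open>V\<close>: the \<open>K\<close>-space on symbols \<open>(b, v)\<close> modulo the \<open>K\<close>-bilinear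
  \<open>S\<close>-balanced relations.
\<close>

definition symbol :: "'x \<Rightarrow> ('x \<Rightarrow>\<^sub>0 'k::field)" where
  "symbol x = Poly_Mapping.single x 1"

definition tensor_relations ::
  "('k::field, 'a, 'm) module_scheme \<Rightarrow> ('k, 'a, 'l) module_scheme \<Rightarrow>
   ('k, 'v, 'a, 'n) amodule_scheme \<Rightarrow> (('a \<times> 'v) \<Rightarrow>\<^sub>0 'k) set" where
  "tensor_relations A S V =
     {symbol (b \<oplus>\<^bsub>A\<^esub> b', v) - symbol (b, v) - symbol (b', v) |b b' v.
        b \<in> carrier A \<and> b' \<in> carrier A \<and> v \<in> carrier V} \<union>
     {symbol (b, v \<oplus>\<^bsub>V\<^esub> v') - symbol (b, v) - symbol (b, v') |b v v'.
        b \<in> carrier A \<and> v \<in> carrier V \<and> v' \<in> carrier V} \<union>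
     {symbol (c \<odot>\<^bsub>A\<^esub> b, v) - scale c (symbol (b, v)) |c b v.
        b \<in> carrier A \<and> v \<in> carrier V} \<union>
     {symbol (b, c \<odot>\<^bsub>V\<^esub> v) - scale c (symbol (b, v)) |c b v.
        b \<in> carrier A \<and> v \<in> carrier V} \<union>
     {symbol (b \<otimes>\<^bsub>A\<^esub> s, v) - symbol (b, act V s v) |b s v.
        b \<in> carrier A \<and> s \<in> carrier S \<and> v \<in> carrier V}"

definition free_symbols ::
  "('k::field, 'a, 'm) module_scheme \<Rightarrow> ('k, 'v, 'a, 'n) amodule_scheme \<Rightarrow>
   ('k, ('a \<times> 'v) \<Rightarrow>\<^sub>0 'k, 'a) amodule" where
  "free_symbols A V =
    \<lparr>carrier = {p. Poly_Mapping.keys p \<subseteq> carrier A \<times> carrier V}, monoid.mult = undefined, one = undefined,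
     zero = 0, add = (+), module.smult = scale,
     act = (\<lambda>a. lin_ext (\<lambda>(b, v). symbol (a \<otimes>\<^bsub>A\<^esub> b, v)))\<rparr>"

definition tensor_module ::
  "('k::field, 'a, 'm) module_scheme \<Rightarrow> ('k, 'a, 'l) module_scheme \<Rightarrow>
   ('k, 'v, 'a, 'n) amodule_scheme \<Rightarrow> ('k, (('a \<times> 'v) \<Rightarrow>\<^sub>0 'k) set, 'a) amodule" where
  "tensor_module A S V =
    quotient_amodule (free_symbols A V) (lin_span (tensor_relations A S V))"


section \<open>Brauer diagrams and the algebra \<open>B\<close>\<close>

text \<open>\<open>Mid\<close> occurs only in the middle row of a stack of two diagrams.\<close>

datatype point = Bot nat | Mid nat | Top nat

record diagram =
  n_bot :: nat
  n_top :: nat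
  strands :: "point set set"

definition brauer_diagram :: "diagram \<Rightarrow> bool" where
  "brauer_diagram g \<longleftrightarrow>
    partition_on (Bot ` {..<n_bot g} \<union> Top ` {..<n_top g}) (strands g) \<and>
    (\<forall>e\<in>strands g. card e = 2)"

definition caps :: "diagram \<Rightarrow> point set set" where
  "caps g = {e \<in> strands g. e \<subseteq> range Bot}"

definition cups :: "diagram \<Rightarrow> point set set" where
  "cups g = {e \<in> strands g. e \<subseteq> range Top}"

primrec bot_to_mid :: "point \<Rightarrow> point" where
  "bot_to_mid (Bot i) = Mid i"
| "bot_to_mid (Mid i) = Mid i"
| "bot_to_mid (Top i) = Top i"

primrec top_to_mid :: "point \<Rightarrow> point" where
  "top_to_mid (Bot i) = Bot i"
| "top_to_mid (Mid i) = Mid i"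
| "top_to_mid (Top i) = Mid i"

text \<open>
  The connected components of \<open>g\<close> stacked on top of \<open>h\<close>. Those that avoid the two
  outer rows are the closed loops; each of the others has exactly two outer points,
  which it joins in the composite diagram.
\<close>

definition stack_components :: "diagram \<Rightarrow> diagram \<Rightarrow> point set set" where
  "stack_components g h =
    (Bot ` {..<n_bot h} \<union> Mid ` {..<n_top h} \<union> Top ` {..<n_top g}) //
    {(x, y). {x, y} \<in> (image bot_to_mid) ` strands g \<union> (image top_to_mid) ` strands h}\<^sup>*"

definition stack :: "diagram \<Rightarrow> diagram \<Rightarrow> diagram" where
  "stack g h = \<lparr>n_bot = n_bot h, n_top = n_top g,
    strands = (\<lambda>C. C - range Mid) ` stack_components g h - {{}}\<rparr>"

definition loops :: "diagram \<Rightarrow> diagram \<Rightarrow> nat" where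
  "loops g h = card {C \<in> stack_components g h. C \<subseteq> range Mid}"

definition diagram_mult :: "'k::field \<Rightarrow> diagram \<Rightarrow> diagram \<Rightarrow> (diagram \<Rightarrow>\<^sub>0 'k)" where
  "diagram_mult \<delta>\<^sub>0 g h =
    (if n_top h = n_bot g then scale (\<delta>\<^sub>0 ^ loops g h) (symbol (stack g h)) else 0)"

type_synonym 'k brauer_element = "diagram \<Rightarrow>\<^sub>0 'k"

definition diagram_span ::
  "'k::field \<Rightarrow> (diagram \<Rightarrow> bool) \<Rightarrow> ('k, 'k brauer_element) module" where
  "diagram_span \<delta>\<^sub>0 P =
    \<lparr>carrier = {b. \<forall>g\<in>Poly_Mapping.keys b. brauer_diagram g \<and> P g},
     monoid.mult = (\<lambda>a b. lin_ext (\<lambda>g. lin_ext (\<lambda>h. diagram_mult \<delta>\<^sub>0 g h) b) a),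
     one = undefined, zero = 0, add = (+), module.smult = scale\<rparr>"

definition B_alg :: "'k::field \<Rightarrow> ('k, 'k brauer_element) module" where
  "B_alg \<delta>\<^sub>0 = diagram_span \<delta>\<^sub>0 (\<lambda>g. True)"

definition B_zero :: "'k::field \<Rightarrow> ('k, 'k brauer_element) module" where
  "B_zero \<delta>\<^sub>0 = diagram_span \<delta>\<^sub>0 (\<lambda>g. cups g = {} \<and> caps g = {})"

definition B_sharp :: "'k::field \<Rightarrow> ('k, 'k brauer_element) module" where
  "B_sharp \<delta>\<^sub>0 = diagram_span \<delta>\<^sub>0 (\<lambda>g. cups g = {})"

text \<open>The vertical strand at bottom point \<open>i\<close> ends at top point \<open>\<sigma> i\<close>.\<close>

definition perm_diagram :: "nat \<Rightarrow> (nat \<Rightarrow> nat) \<Rightarrow> diagram" where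
  "perm_diagram m \<sigma> =
    \<lparr>n_bot = m, n_top = m, strands = (\<lambda>i. {Bot i, Top (\<sigma> i)}) ` {..<m}\<rparr>"

definition B_id :: "nat \<Rightarrow> 'k::field brauer_element" where
  "B_id m = symbol (perm_diagram m id)"

definition word_space ::
  "('k::field, 'v, 'k brauer_element, 'n) amodule_scheme \<Rightarrow> nat \<Rightarrow> 'v set" where
  "word_space V m = act V (B_id m) ` carrier V"

text \<open>Objects of \<open>B\<close>-mod: \<open>V\<close> is the internal direct sum of the subspaces \<open>1\<^sub>m V\<close>.\<close>

definition B_module :: "'k::field \<Rightarrow> ('k, 'v, 'k brauer_element) amodule \<Rightarrow> bool" where
  "B_module \<delta>\<^sub>0 V \<longleftrightarrow>
    amodule (B_alg \<delta>\<^sub>0) V \<and>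
    (\<forall>v\<in>carrier V. \<exists>!w. (\<forall>m. w m \<in> word_space V m) \<and> finite {m. w m \<noteq> \<zero>\<^bsub>V\<^esub>} \<and>
      v = finsum V w {m. w m \<noteq> \<zero>\<^bsub>V\<^esub>})"

definition simple_B_module :: "'k::field \<Rightarrow> ('k, 'v, 'k brauer_element) amodule \<Rightarrow> bool" where
  "simple_B_module \<delta>\<^sub>0 V \<longleftrightarrow> B_module \<delta>\<^sub>0 V \<and> simple_amodule (B_alg \<delta>\<^sub>0) V"

definition shortest_word_space ::
  "('k::field, 'v, 'k brauer_element) amodule \<Rightarrow> ('k, 'v, 'k brauer_element) amodule" where
  "shortest_word_space V =
    V\<lparr>carrier := word_space V (LEAST m. word_space V m \<noteq> {\<zero>\<^bsub>V\<^esub>})\<rparr>"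

text \<open>The quotient map \<open>B\<^sup>\<sharp> \<rightarrow> B\<^sup>0\<close>.\<close>

definition kill_caps :: "'k::field brauer_element \<Rightarrow> 'k brauer_element" where
  "kill_caps = lin_ext (\<lambda>g. if caps g = {} then symbol g else 0)"

definition Delta ::
  "'k::field \<Rightarrow> ('k, 'v, 'k brauer_element) amodule \<Rightarrow>
   ('k, (('k brauer_element \<times> 'v) \<Rightarrow>\<^sub>0 'k) set, 'k brauer_element) amodule" where
  "Delta \<delta>\<^sub>0 V = tensor_module (B_alg \<delta>\<^sub>0) (B_sharp \<delta>\<^sub>0) (pullback kill_caps V)"


section \<open>Specht modules and their heads\<close>

definition group_algebra :: "nat \<Rightarrow> ('k::field, (nat \<Rightarrow> nat) \<Rightarrow>\<^sub>0 'k) module" where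
  "group_algebra m =
    \<lparr>carrier = {a. \<forall>\<sigma>\<in>Poly_Mapping.keys a. \<sigma> permutes {..<m}},
     monoid.mult = (\<lambda>a b. lin_ext (\<lambda>\<sigma>. lin_ext (\<lambda>\<tau>. symbol (\<sigma> \<circ> \<tau>)) b) a),
     one = symbol id, zero = 0, add = (+), module.smult = scale\<rparr>"

definition regular_partitions :: "nat \<Rightarrow> nat list set" where
  "regular_partitions p =
    {\<mu>. sorted_wrt (\<ge>) \<mu> \<and> 0 \<notin> set \<mu> \<and> (p > 0 \<longrightarrow> (\<forall>k\<in>set \<mu>. count_list \<mu> k < p))}"

definition young_diagram :: "nat list \<Rightarrow> (nat \<times> nat) set" where
  "young_diagram \<mu> = {(i, j). i < length \<mu> \<and> j < \<mu> ! i}"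

definition tableau :: "nat list \<Rightarrow> (nat \<times> nat \<Rightarrow> nat) \<Rightarrow> bool" where
  "tableau \<mu> t \<longleftrightarrow> bij_betw t (young_diagram \<mu>) {..<sum_list \<mu>}"

text \<open>A tabloid (row equivalence class of tableaux) is encoded by its sequence of row sets.\<close>

type_synonym tabloid = "nat \<Rightarrow> nat set"

definition tabloid_of :: "nat list \<Rightarrow> (nat \<times> nat \<Rightarrow> nat) \<Rightarrow> tabloid" where
  "tabloid_of \<mu> t = (\<lambda>i. t ` {(i', j) \<in> young_diagram \<mu>. i' = i})"

definition tabloid_perm :: "(nat \<Rightarrow> nat) \<Rightarrow> tabloid \<Rightarrow> tabloid" where
  "tabloid_perm \<sigma> T = (\<lambda>i. \<sigma> ` T i)"

definition column_stabilizer :: "nat list \<Rightarrow> (nat \<times> nat \<Rightarrow> nat) \<Rightarrow> (nat \<Rightarrow> nat) set" where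
  "column_stabilizer \<mu> t =
    {\<sigma>. \<sigma> permutes {..<sum_list \<mu>} \<and>
      (\<forall>j. \<sigma> ` t ` {(i, j') \<in> young_diagram \<mu>. j' = j} = t ` {(i, j') \<in> young_diagram \<mu>. j' = j})}"

definition polytabloid :: "nat list \<Rightarrow> (nat \<times> nat \<Rightarrow> nat) \<Rightarrow> (tabloid \<Rightarrow>\<^sub>0 'k::field)" where
  "polytabloid \<mu> t =
    (\<Sum>\<sigma>\<in>column_stabilizer \<mu> t.
      scale (of_int (sign \<sigma>)) (symbol (tabloid_perm \<sigma> (tabloid_of \<mu> t))))"

text \<open>James' Specht module, inside the permutation module on tabloids.\<close>

definition specht_module ::
  "nat list \<Rightarrow> ('k::field, tabloid \<Rightarrow>\<^sub>0 'k, (nat \<Rightarrow> nat) \<Rightarrow>\<^sub>0 'k) amodule" where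
  "specht_module \<mu> =
    \<lparr>carrier = lin_span {polytabloid \<mu> t |t. tableau \<mu> t}, monoid.mult = undefined, one = undefined,
     zero = 0, add = (+), module.smult = scale,
     act = (\<lambda>a v. lin_ext (\<lambda>\<sigma>. lin_ext (\<lambda>T. symbol (tabloid_perm \<sigma> T)) v) a)\<rparr>"

text \<open>The projection of \<open>B\<^sup>0 \<cong> \<Oplus>\<^sub>m K\<SS>\<^sub>m\<close> onto its \<open>m\<close>-th factor.\<close>

definition sym_component :: "nat \<Rightarrow> 'k::field brauer_element \<Rightarrow> ((nat \<Rightarrow> nat) \<Rightarrow>\<^sub>0 'k)" where
  "sym_component m b =
    (\<Sum>\<sigma> | \<sigma> permutes {..<m}. scale (Poly_Mapping.lookup b (perm_diagram m \<sigma>)) (symbol \<sigma>))"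

text \<open>\<open>D(\<mu>)\<close>, inflated to \<open>B\<^sup>0\<close> along this projection.\<close>

definition D_module ::
  "nat list \<Rightarrow> ('k::field, (tabloid \<Rightarrow>\<^sub>0 'k) set, 'k brauer_element) amodule" where
  "D_module \<mu> =
    pullback (sym_component (sum_list \<mu>))
      (module_head (group_algebra (sum_list \<mu>)) (specht_module \<mu>))"

type_synonym 'k standard_carrier =
  "(('k brauer_element \<times> (tabloid \<Rightarrow>\<^sub>0 'k) set) \<Rightarrow>\<^sub>0 'k) set"

definition Delta_bar ::
  "'k::field \<Rightarrow> nat list \<Rightarrow> ('k, 'k standard_carrier, 'k brauer_element) amodule" where
  "Delta_bar \<delta>\<^sub>0 \<mu> = Delta \<delta>\<^sub>0 (D_module \<mu>)"

definition L_module ::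
  "'k::field \<Rightarrow> nat list \<Rightarrow> ('k, 'k standard_carrier set, 'k brauer_element) amodule" where
  "L_module \<delta>\<^sub>0 \<mu> = module_head (B_alg \<delta>\<^sub>0) (Delta_bar \<delta>\<^sub>0 \<mu>)"

end

theory Submission
  imports Defs
begin

text \<open>
  A module \<open>V\<close> with an algebra element \<open>e\<close> such that every nonzero \<open>e v\<close> generates \<open>V\<close> has a
  unique maximal submodule, namely the largest submodule killed by \<open>e\<close>. This
  applies to \<open>\<Delta>(D)\<close>, \<open>D\<close> a simple \<open>K\<SS>\<^sub>m\<close>-module, with \<open>e = 1\<^sub>m\<close>: the word space \<open>1\<^sub>m \<Delta>(D)\<close> is
  \<open>1 \<otimes> D\<close>, because a diagram with \<open>m\<close> top points and a cup factors through a shorter word. On a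
  simple \<open>B\<close>-module with shortest word \<open>m\<close> the product \<open>1\<^sub>m b\<close> acts on a vector of \<open>1\<^sub>m V\<close> through
  the image of \<open>b\<close> in \<open>K\<SS>\<^sub>m\<close>, so the annihilator of such a vector in \<open>B\<close>, and hence \<open>V\<close>, is
  determined by the \<open>K\<SS>\<^sub>m\<close>-module \<open>1\<^sub>m V\<close>.

  The same criterion applies to the Specht module with \<open>e\<close> the signed column sum \<open>\<kappa>\<close>, provided that
  \<open>\<kappa>\<close> does not annihilate it; this holds exactly for \<open>p\<close>-regular partitions. That every simple
  \<open>K\<SS>\<^sub>m\<close>-module occurs is shown directly: choose disjoint column sets greedily so that their signed
  sum \<open>\<kappa>\<close> acts nontrivially. Then \<open>\<kappa> a \<kappa>\<close> is a multiple of \<open>\<kappa>\<close> modulo elements that kill both the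
  given module and the Specht module, and comparing the multiples compares the annihilators of two
  generating vectors.
\<close>

section \<open>Linear algebra of finitely supported functions\<close>

text \<open>Two obstacles shape the argument. \<open>B\<close> has no unit and its simple modules
  come without a bound on their dimension, so they cannot be counted; each is recognised as a cyclic
  module, and cyclic modules are matched through the annihilators of generators. And in
  characteristic p the signed sum \<kappa> of a column group satisfies \<kappa>\<kappa> = |C|
  \<kappa> with a factor |C| that may vanish, so it yields no idempotent. What survives is a
  relation modulo an ideal: \<kappa> a \<kappa> is a multiple of \<kappa> as soon as, at every
  stage, the alternating sums over sets larger than the next column lie in the ideal. The greedy
  choice of columns is made to secure this. Whether \<kappa> kills the Specht module is decided by
  the form <e_t, e_s>: if s is t with reversed rows, it is a product of factorials, invertible in
  the regular case; in all other cases a rotation of p equal rows makes every value vanish.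
  Characteristic different from 2 enters twice: a vector equal to its negative is zero, and a
  rotation of odd order is an even permutation.\<close>

lemma lookup_scale [simp]: "Poly_Mapping.lookup (scale c p) x = c * Poly_Mapping.lookup p x"
  by (simp add: scale_def map.rep_eq when_def)

interpretation free: vector_space "scale :: 'k::field \<Rightarrow> ('x \<Rightarrow>\<^sub>0 'k) \<Rightarrow> _"
  by unfold_locales (auto intro!: poly_mapping_eqI simp: lookup_add algebra_simps)

lemma keys_scale: "Poly_Mapping.keys (scale c p) \<subseteq> Poly_Mapping.keys p"
  by (auto simp: in_keys_iff)

lemma lookup_symbol: "Poly_Mapping.lookup (symbol x) y = (if x = y then 1 else 0)"
  by (simp add: symbol_def lookup_single when_def)

lemma keys_symbol [simp]: "Poly_Mapping.keys (symbol x :: 'x \<Rightarrow>\<^sub>0 'k::field) = {x}"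
  by (simp add: symbol_def)

lemma lin_ext_superset:
  assumes "finite S" "Poly_Mapping.keys p \<subseteq> S"
  shows "lin_ext f p = (\<Sum>x\<in>S. scale (Poly_Mapping.lookup p x) (f x))"
  unfolding lin_ext_def using assms
  by (intro sum.mono_neutral_left) (auto simp: in_keys_iff)

lemma lin_ext_add: "lin_ext f (p + q) = lin_ext f p + lin_ext f q"
proof -
  let ?S = "Poly_Mapping.keys p \<union> Poly_Mapping.keys q"
  have "Poly_Mapping.keys (p + q) \<subseteq> ?S" by (rule keys_add)
  then show ?thesis
    by (simp add: lin_ext_superset[of ?S] lookup_add free.scale_left_distrib sum.distrib)
qed

lemma lin_ext_scale: "lin_ext f (scale c p) = scale c (lin_ext f p)"
  by (subst lin_ext_superset[of "Poly_Mapping.keys p"])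
    (auto simp: lin_ext_def free.scale_sum_right keys_scale)

lemma lin_ext_symbol [simp]: "lin_ext f (symbol x) = f x"
  by (simp add: lin_ext_def lookup_symbol)

lemma lin_ext_zero [simp]: "lin_ext f 0 = 0"
  by (simp add: lin_ext_def)

lemma lin_ext_uminus: "lin_ext f (- p) = - lin_ext f p"
  by (metis add_cancel_right_right add.right_inverse lin_ext_add lin_ext_zero minus_unique)

lemma lin_ext_diff: "lin_ext f (p - q) = lin_ext f p - lin_ext f q"
  by (metis diff_conv_add_uminus lin_ext_add lin_ext_uminus)

lemma lin_ext_fun_add: "lin_ext (\<lambda>x. f x + g x) p = lin_ext f p + lin_ext g p"
  by (simp add: lin_ext_def free.scale_right_distrib sum.distrib)

lemma lin_ext_fun_scale: "lin_ext (\<lambda>x. scale c (f x)) p = scale c (lin_ext f p)"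
  by (simp add: lin_ext_def free.scale_sum_right mult.commute)

lemma lin_ext_fun_zero [simp]: "lin_ext (\<lambda>x. 0) p = 0"
  by (simp add: lin_ext_def)

lemma poly_mapping_expand:
  "p = (\<Sum>x\<in>Poly_Mapping.keys p. scale (Poly_Mapping.lookup p x) (symbol x))"
  by (rule poly_mapping_eqI)
    (auto simp: lookup_sum lookup_symbol if_distrib[of "(*) _"] in_keys_iff
      sum.delta cong: if_cong)

lemma lin_ext_symbol_id [simp]: "lin_ext symbol p = p"
  using poly_mapping_expand[of p] by (simp add: lin_ext_def)

lemma free_induct [consumes 1, case_names zero add scale symbol]:
  assumes "Poly_Mapping.keys p \<subseteq> S"
    and "P 0" "\<And>p q. P p \<Longrightarrow> P q \<Longrightarrow> P (p + q)" "\<And>c p. P p \<Longrightarrow> P (scale c p)"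
    and "\<And>x. x \<in> S \<Longrightarrow> P (symbol x)"
  shows "P p"
proof -
  have "P (\<Sum>x\<in>T. scale (Poly_Mapping.lookup p x) (symbol x))" if "finite T" "T \<subseteq> S" for T
    using that by (induction T) (auto intro: assms)
  from this[of "Poly_Mapping.keys p"] assms(1) show ?thesis
    by (subst poly_mapping_expand) auto
qed

lemma lin_span_induct [consumes 1, case_names zero add scale base]:
  assumes "x \<in> lin_span S"
    and "P 0" "\<And>p q. P p \<Longrightarrow> P q \<Longrightarrow> P (p + q)" "\<And>c p. P p \<Longrightarrow> P (scale c p)"
    and "\<And>x. x \<in> S \<Longrightarrow> P x"
  shows "P x"
  using assms(1) unfolding lin_span_def
  by (rule free.span_induct[where P=P]) (auto simp: free.subspace_def intro: assms)

section \<open>Modules over algebras\<close>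

lemma scalar_ring_simps [simp]:
  "carrier scalar_ring = UNIV" "\<one>\<^bsub>scalar_ring\<^esub> = 1" "\<zero>\<^bsub>scalar_ring\<^esub> = 0"
  "x \<oplus>\<^bsub>scalar_ring\<^esub> y = x + y" "x \<otimes>\<^bsub>scalar_ring\<^esub> y = x * y"
  by (simp_all add: scalar_ring_def)

lemma cring_scalar_ring: "cring (scalar_ring :: 'k::field ring)"
proof -
  have "abelian_group (scalar_ring :: 'k ring)"
    by (rule abelian_groupI) (auto simp: algebra_simps intro: exI[of _ "- _"] add.left_inverse)
  moreover have "comm_monoid (scalar_ring :: 'k ring)"
    by (rule comm_monoidI) (auto simp: algebra_simps)
  ultimately show ?thesis
    by (rule cringI) (auto simp: algebra_simps)
qed

text \<open>The operations of an algebra enter only through the closure of its carrier.\<close>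

locale closed_algebra =
  fixes A :: "('k::field, 'a, 'm) module_scheme"
  assumes add_closed: "\<lbrakk>a \<in> carrier A; b \<in> carrier A\<rbrakk> \<Longrightarrow> a \<oplus>\<^bsub>A\<^esub> b \<in> carrier A"
    and smult_closed: "a \<in> carrier A \<Longrightarrow> c \<odot>\<^bsub>A\<^esub> a \<in> carrier A"
    and mult_closed: "\<lbrakk>a \<in> carrier A; b \<in> carrier A\<rbrakk> \<Longrightarrow> a \<otimes>\<^bsub>A\<^esub> b \<in> carrier A"

text \<open>Negation is scaling by -1, so the closure under inverses demanded by
  \<open>submodule\<close> follows from closure under scalars.\<close>

lemma submodule_scalar_ring_iff:
  assumes "Module.module scalar_ring V"
  shows "submodule W (scalar_ring :: 'k::field ring) V \<longleftrightarrow>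
    W \<subseteq> carrier V \<and> \<zero>\<^bsub>V\<^esub> \<in> W \<and> (\<forall>x\<in>W. \<forall>y\<in>W. x \<oplus>\<^bsub>V\<^esub> y \<in> W) \<and> (\<forall>c::'k. \<forall>x\<in>W. c \<odot>\<^bsub>V\<^esub> x \<in> W)"
    (is "_ \<longleftrightarrow> ?R")
proof
  interpret Module.module scalar_ring V by fact
  assume S: "submodule W scalar_ring V"
  then interpret submodule W scalar_ring V .
  show ?R using submoduleE[OF S] S one_closed by auto
next
  interpret Module.module scalar_ring V by fact
  assume R: ?R
  show "submodule W scalar_ring V"
  proof (rule submoduleI)
    fix a assume a: "a \<in> W"
    have "(-1::'k) \<odot>\<^bsub>V\<^esub> a = \<ominus>\<^bsub>V\<^esub> a"
    proof -
      have "(\<ominus>\<^bsub>scalar_ring\<^esub> (1::'k)) = -1"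
        by (rule R.minus_equality) auto
      then show ?thesis using smult_l_minus[of "1::'k" a] smult_one[of a] a R by auto
    qed
    then show "\<ominus>\<^bsub>V\<^esub> a \<in> W" using R a by metis
  qed (use R in auto)
qed

lemma neg_eq_smult:
  assumes "Module.module scalar_ring V" "x \<in> carrier V"
  shows "\<ominus>\<^bsub>V\<^esub> x = (-1 :: 'k::field) \<odot>\<^bsub>V\<^esub> x"
proof -
  interpret Module.module "scalar_ring :: 'k ring" V by fact
  have "(\<ominus>\<^bsub>scalar_ring\<^esub> (1::'k)) = -1"
    by (rule R.minus_equality) auto
  then show ?thesis using smult_l_minus[of "1::'k" x] smult_one[of x] assms by auto
qed

context amodule
begin

lemma smult_zero_left: "x \<in> carrier V \<Longrightarrow> 0 \<odot>\<^bsub>V\<^esub> x = \<zero>\<^bsub>V\<^esub>"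
  using smult_l_null by simp

lemma smult_zero_right: "c \<odot>\<^bsub>V\<^esub> \<zero>\<^bsub>V\<^esub> = \<zero>\<^bsub>V\<^esub>"
  using smult_r_null by simp

lemma smult_in: "x \<in> carrier V \<Longrightarrow> c \<odot>\<^bsub>V\<^esub> x \<in> carrier V"
  by simp

lemma act_zero_right: "a \<in> carrier A \<Longrightarrow> act V a \<zero>\<^bsub>V\<^esub> = \<zero>\<^bsub>V\<^esub>"
  using act_smult_right[of a "\<zero>\<^bsub>V\<^esub>" 0] act_closed[of a "\<zero>\<^bsub>V\<^esub>"]
  by (simp add: smult_zero_left smult_zero_right)

text \<open>The difference is written with the scalar -1 because the maps it is applied to are known
  only to respect sums and scalars.\<close>

lemma eq_iff_diff_zero:
  assumes "x \<in> carrier V" "y \<in> carrier V"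
  shows "x = y \<longleftrightarrow> x \<oplus>\<^bsub>V\<^esub> (-1) \<odot>\<^bsub>V\<^esub> y = \<zero>\<^bsub>V\<^esub>"
proof -
  have "x = y \<longleftrightarrow> x \<oplus>\<^bsub>V\<^esub> \<ominus>\<^bsub>V\<^esub> y = \<zero>\<^bsub>V\<^esub>"
    using assms by (metis a_inv_closed add.inv_inv minus_equality r_neg)
  then show ?thesis using neg_eq_smult[OF module_axioms assms(2)] by simp
qed

lemma asubmodule_iff:
  "asubmodule A V W \<longleftrightarrow>
    W \<subseteq> carrier V \<and> \<zero>\<^bsub>V\<^esub> \<in> W \<and> (\<forall>x\<in>W. \<forall>y\<in>W. x \<oplus>\<^bsub>V\<^esub> y \<in> W) \<and>
    (\<forall>c. \<forall>x\<in>W. c \<odot>\<^bsub>V\<^esub> x \<in> W) \<and> (\<forall>a\<in>carrier A. \<forall>x\<in>W. act V a x \<in> W)"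
  unfolding asubmodule_def by (subst submodule_scalar_ring_iff[OF module_axioms]) blast

end

section \<open>Quotients\<close>

locale module_quotient = M?: Module.module scalar_ring V
  for V :: "('k::field, 'v, 'a, 'n) amodule_scheme" +
  fixes W :: "'v set"
  assumes W: "submodule W (scalar_ring :: 'k ring) V"
begin

lemma abelian_subgroup_W: "abelian_subgroup W V"
  by (intro abelian_subgroupI3 additive_subgroupI submodule.axioms(1)[OF W] M.abelian_group_axioms)

interpretation S: abelian_subgroup W V by (rule abelian_subgroup_W)

lemmas W_props = W[unfolded submodule_scalar_ring_iff[OF module_axioms]]

lemma coset_eq_iff:
  assumes "x \<in> carrier V" "y \<in> carrier V"
  shows "W +>\<^bsub>V\<^esub> x = W +>\<^bsub>V\<^esub> y \<longleftrightarrow> x \<ominus>\<^bsub>V\<^esub> y \<in> W"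
  using assms
  by (metis S.a_rcos_module S.a_repr_independence' S.a_rcos_self a_minus_def)

lemma coset_eq_W_iff: "x \<in> carrier V \<Longrightarrow> W +>\<^bsub>V\<^esub> x = W \<longleftrightarrow> x \<in> W"
  by (metis S.a_rcos_const S.a_rcos_self)

lemma coset_add:
  "x \<in> carrier V \<Longrightarrow> y \<in> carrier V \<Longrightarrow>
    (W +>\<^bsub>V\<^esub> x) \<oplus>\<^bsub>quotient_amodule V W\<^esub> (W +>\<^bsub>V\<^esub> y) = W +>\<^bsub>V\<^esub> (x \<oplus>\<^bsub>V\<^esub> y)"
  by (simp add: quotient_amodule_def S.a_rcos_sum)

lemma carrier_quotient: "carrier (quotient_amodule V W) = (\<lambda>x. W +>\<^bsub>V\<^esub> x) ` carrier V"
  by (auto simp: quotient_amodule_def A_RCOSETS_def')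

lemma zero_quotient: "\<zero>\<^bsub>quotient_amodule V W\<^esub> = W"
  by (simp add: quotient_amodule_def)

text \<open>The operations of \<open>quotient_amodule\<close> are unions over all representatives of
  a coset. An additive map preserving \<open>W\<close> sends equivalent representatives to
  equivalent vectors, so the union is over copies of a single coset.\<close>

lemma UN_coset:
  assumes f: "\<And>x. x \<in> carrier V \<Longrightarrow> f x \<in> carrier V"
    and add: "\<And>x y. x \<in> carrier V \<Longrightarrow> y \<in> carrier V \<Longrightarrow> f (x \<oplus>\<^bsub>V\<^esub> y) = f x \<oplus>\<^bsub>V\<^esub> f y"
    and stable: "\<And>x. x \<in> W \<Longrightarrow> f x \<in> W" and v: "v \<in> carrier V"
  shows "(\<Union>x\<in>W +>\<^bsub>V\<^esub> v. W +>\<^bsub>V\<^esub> f x) = W +>\<^bsub>V\<^esub> f v"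
proof -
  have "W +>\<^bsub>V\<^esub> f x = W +>\<^bsub>V\<^esub> f v" if x: "x \<in> W +>\<^bsub>V\<^esub> v" for x
  proof -
    have xc: "x \<in> carrier V" using x v S.a_elemrcos_carrier by blast
    have w: "x \<ominus>\<^bsub>V\<^esub> v \<in> W" using x v xc S.a_rcos_module by (simp add: a_minus_def)
    then have wc: "x \<ominus>\<^bsub>V\<^esub> v \<in> carrier V" using xc v by simp
    have "x = (x \<ominus>\<^bsub>V\<^esub> v) \<oplus>\<^bsub>V\<^esub> v" using xc v by (simp add: a_minus_def M.M.a_assoc M.M.l_neg)
    then have "f x = f (x \<ominus>\<^bsub>V\<^esub> v) \<oplus>\<^bsub>V\<^esub> f v" using add[OF wc v] by simp
    then have "f x \<ominus>\<^bsub>V\<^esub> f v = f (x \<ominus>\<^bsub>V\<^esub> v)"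
      using f[OF wc] f[OF v] by (simp add: a_minus_def M.M.a_assoc M.M.r_neg)
    then show ?thesis using stable[OF w] f xc v by (simp add: coset_eq_iff)
  qed
  moreover have "v \<in> W +>\<^bsub>V\<^esub> v" using v by (rule S.a_rcos_self)
  ultimately show ?thesis by blast
qed

lemma coset_smult:
  assumes "v \<in> carrier V"
  shows "c \<odot>\<^bsub>quotient_amodule V W\<^esub> (W +>\<^bsub>V\<^esub> v) = W +>\<^bsub>V\<^esub> (c \<odot>\<^bsub>V\<^esub> v)"
  using UN_coset[of "\<lambda>x. c \<odot>\<^bsub>V\<^esub> x" v] W_props assms
  by (simp add: quotient_amodule_def smult_r_distr)

lemma coset_act:
  assumes "\<And>x. x \<in> carrier V \<Longrightarrow> act V a x \<in> carrier V"
    and "\<And>x y. x \<in> carrier V \<Longrightarrow> y \<in> carrier V \<Longrightarrow> act V a (x \<oplus>\<^bsub>V\<^esub> y) = act V a x \<oplus>\<^bsub>V\<^esub> act V a y"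
    and "\<And>x. x \<in> W \<Longrightarrow> act V a x \<in> W" and "v \<in> carrier V"
  shows "act (quotient_amodule V W) a (W +>\<^bsub>V\<^esub> v) = W +>\<^bsub>V\<^esub> (act V a v)"
  using UN_coset[of "act V a" v] assms by (simp add: quotient_amodule_def)

lemma module_quotient_module: "Module.module (scalar_ring :: 'k ring) (quotient_amodule V W)"
proof (rule moduleI)
  let ?Q = "quotient_amodule V W"
  note [simp] = coset_add coset_smult carrier_quotient zero_quotient
  have W0: "W = W +>\<^bsub>V\<^esub> \<zero>\<^bsub>V\<^esub>" using coset_eq_W_iff[of "\<zero>\<^bsub>V\<^esub>"] W_props by auto
  show "abelian_group ?Q"
  proof (rule abelian_groupI)
    show "\<zero>\<^bsub>?Q\<^esub> \<in> carrier ?Q" using W0 by auto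
    fix x assume x: "x \<in> carrier ?Q"
    then obtain v where v: "v \<in> carrier V" "x = W +>\<^bsub>V\<^esub> v" by auto
    have "(W +>\<^bsub>V\<^esub> \<zero>\<^bsub>V\<^esub>) \<oplus>\<^bsub>?Q\<^esub> x = x" using v by (simp del: zero_quotient)
    then show "\<zero>\<^bsub>?Q\<^esub> \<oplus>\<^bsub>?Q\<^esub> x = x" using W0 by simp
    have "(W +>\<^bsub>V\<^esub> (\<ominus>\<^bsub>V\<^esub> v)) \<oplus>\<^bsub>?Q\<^esub> x = W +>\<^bsub>V\<^esub> \<zero>\<^bsub>V\<^esub>" using v by (simp add: M.M.l_neg)
    then show "\<exists>y\<in>carrier ?Q. y \<oplus>\<^bsub>?Q\<^esub> x = \<zero>\<^bsub>?Q\<^esub>" using W0 v by auto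
  qed (auto simp: M.M.a_ac)
qed (auto simp: cring_scalar_ring smult_r_distr smult_l_distr[simplified] smult_assoc1[simplified]
     smult_one[simplified] coset_add coset_smult carrier_quotient)

text \<open>The laws in the algebra variable are required only modulo \<open>W\<close>. The tensor
  product needs this generality: the space of free symbols is not itself a module, since the symbols
  of \<open>a + b\<close>, \<open>a\<close> and \<open>b\<close> are unrelated before the relations
  are divided out.\<close>

lemma amodule_quotient:
  fixes A :: "('k, 'a, 'm) module_scheme"
  assumes closed: "closed_algebra A"
    and act_closed: "\<And>a x. a \<in> carrier A \<Longrightarrow> x \<in> carrier V \<Longrightarrow> act V a x \<in> carrier V"
    and act_add: "\<And>a x y. a \<in> carrier A \<Longrightarrow> x \<in> carrier V \<Longrightarrow> y \<in> carrier V \<Longrightarrow>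
        act V a (x \<oplus>\<^bsub>V\<^esub> y) = act V a x \<oplus>\<^bsub>V\<^esub> act V a y"
    and act_smult: "\<And>a c x. a \<in> carrier A \<Longrightarrow> x \<in> carrier V \<Longrightarrow> act V a (c \<odot>\<^bsub>V\<^esub> x) = c \<odot>\<^bsub>V\<^esub> act V a x"
    and stable: "\<And>a x. a \<in> carrier A \<Longrightarrow> x \<in> W \<Longrightarrow> act V a x \<in> W"
    and left_add: "\<And>a b x. a \<in> carrier A \<Longrightarrow> b \<in> carrier A \<Longrightarrow> x \<in> carrier V \<Longrightarrow>
        act V (a \<oplus>\<^bsub>A\<^esub> b) x \<ominus>\<^bsub>V\<^esub> (act V a x \<oplus>\<^bsub>V\<^esub> act V b x) \<in> W"
    and left_smult: "\<And>a c x. a \<in> carrier A \<Longrightarrow> x \<in> carrier V \<Longrightarrow>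
        act V (c \<odot>\<^bsub>A\<^esub> a) x \<ominus>\<^bsub>V\<^esub> (c \<odot>\<^bsub>V\<^esub> act V a x) \<in> W"
    and left_mult: "\<And>a b x. a \<in> carrier A \<Longrightarrow> b \<in> carrier A \<Longrightarrow> x \<in> carrier V \<Longrightarrow>
        act V (a \<otimes>\<^bsub>A\<^esub> b) x \<ominus>\<^bsub>V\<^esub> act V a (act V b x) \<in> W"
  shows "amodule A (quotient_amodule V W)"
proof -
  interpret A: closed_algebra A by fact
  have act: "act (quotient_amodule V W) a (W +>\<^bsub>V\<^esub> v) = W +>\<^bsub>V\<^esub> (act V a v)"
    if "a \<in> carrier A" "v \<in> carrier V" for a v
    using that by (intro coset_act act_closed act_add stable)
  have eq: "W +>\<^bsub>V\<^esub> act V (a \<oplus>\<^bsub>A\<^esub> b) v = W +>\<^bsub>V\<^esub> (act V a v \<oplus>\<^bsub>V\<^esub> act V b v)"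
      "W +>\<^bsub>V\<^esub> act V (c \<odot>\<^bsub>A\<^esub> a) v = W +>\<^bsub>V\<^esub> (c \<odot>\<^bsub>V\<^esub> act V a v)"
      "W +>\<^bsub>V\<^esub> act V (a \<otimes>\<^bsub>A\<^esub> b) v = W +>\<^bsub>V\<^esub> act V a (act V b v)"
    if "a \<in> carrier A" "b \<in> carrier A" "v \<in> carrier V" for a b c v
    using that
    by (intro coset_eq_iff[THEN iffD2] left_add left_smult left_mult act_closed A.add_closed
        A.smult_closed A.mult_closed M.M.a_closed smult_closed; simp)+
  show ?thesis
    by (intro amodule.intro module_quotient_module amodule_axioms.intro)
      (clarsimp simp: carrier_quotient act coset_add coset_smult act_closed A.add_closed A.smult_closed
        A.mult_closed act_add act_smult eq)+
qed

end

context amodule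
begin

lemma module_quotientI: "asubmodule A V W \<Longrightarrow> module_quotient V W"
  by (auto simp: module_quotient_def module_quotient_axioms_def asubmodule_def module_axioms)

lemma quotient_act:
  assumes "asubmodule A V W" "a \<in> carrier A" "v \<in> carrier V"
  shows "act (quotient_amodule V W) a (W +>\<^bsub>V\<^esub> v) = W +>\<^bsub>V\<^esub> (act V a v)"
  using assms module_quotientI[OF assms(1)]
  by (intro module_quotient.coset_act) (auto simp: act_closed act_add_right asubmodule_iff)

lemma amodule_quotient:
  assumes "closed_algebra A" "asubmodule A V W"
  shows "amodule A (quotient_amodule V W)"
proof -
  interpret A: closed_algebra A by fact
  interpret Q: module_quotient V W by (rule module_quotientI) fact
  have "x \<ominus>\<^bsub>V\<^esub> x \<in> W" if "x \<in> carrier V" for x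
    using that Q.W_props by (simp add: a_minus_def r_neg)
  then show ?thesis
    using assms by (intro Q.amodule_quotient)
      (auto simp: act_closed act_add_left act_add_right act_smult_left act_smult_right act_mult
        asubmodule_iff)
qed

text \<open>Submodules of the quotient pull back to submodules of \<open>V\<close> containing
  \<open>W\<close>, and maximality leaves only two of these.\<close>

lemma simple_quotient:
  assumes A: "closed_algebra A" and max: "maximal_submodule A V W"
  shows "simple_amodule A (quotient_amodule V W)"
proof -
  have W: "asubmodule A V W" using max by (simp add: maximal_submodule_def)
  interpret Q: module_quotient V W by (rule module_quotientI) fact
  let ?Q = "quotient_amodule V W"
  have Qm: "amodule A ?Q" by (rule amodule_quotient[OF A W])
  interpret QM: amodule A ?Q by (rule Qm)
  have Wc: "W \<subseteq> carrier V" using W by (simp add: asubmodule_iff)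
  have "carrier ?Q \<noteq> {\<zero>\<^bsub>?Q\<^esub>}"
  proof
    assume eq: "carrier ?Q = {\<zero>\<^bsub>?Q\<^esub>}"
    have "x \<in> W" if "x \<in> carrier V" for x
      using eq that by (auto simp: Q.carrier_quotient Q.zero_quotient Q.coset_eq_W_iff[symmetric])
    then show False using max Wc by (auto simp: maximal_submodule_def)
  qed
  moreover have "U = {\<zero>\<^bsub>?Q\<^esub>} \<or> U = carrier ?Q" if U: "asubmodule A ?Q U" for U
  proof -
    let ?P = "{v \<in> carrier V. W +>\<^bsub>V\<^esub> v \<in> U}"
    have U': "U \<subseteq> carrier ?Q" "W \<in> U" using U by (auto simp: QM.asubmodule_iff Q.zero_quotient)
    have "asubmodule A V ?P"
    proof -
      have "\<zero>\<^bsub>V\<^esub> \<in> ?P"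
        using U'(2) Q.coset_eq_W_iff[of "\<zero>\<^bsub>V\<^esub>"] W by (auto simp: asubmodule_iff)
      moreover have "W +>\<^bsub>V\<^esub> (x \<oplus>\<^bsub>V\<^esub> y) \<in> U" if "x \<in> ?P" "y \<in> ?P" for x y
        using that U by (auto simp: QM.asubmodule_iff Q.coset_add[symmetric])
      moreover have "W +>\<^bsub>V\<^esub> (c \<odot>\<^bsub>V\<^esub> x) \<in> U" if "x \<in> ?P" for c x
        using that U by (auto simp: QM.asubmodule_iff Q.coset_smult[symmetric])
      moreover have "W +>\<^bsub>V\<^esub> act V a x \<in> U" if "x \<in> ?P" "a \<in> carrier A" for a x
        using that U by (auto simp: QM.asubmodule_iff quotient_act[OF W, symmetric])
      ultimately show ?thesis by (auto simp: asubmodule_iff act_closed)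
    qed
    moreover have "W \<subseteq> ?P"
    proof
      fix x assume x: "x \<in> W"
      then have "W +>\<^bsub>V\<^esub> x = W" using Wc Q.coset_eq_W_iff[of x] by blast
      then show "x \<in> ?P" using x Wc U'(2) by auto
    qed
    ultimately consider "?P = W" | "?P = carrier V"
      using max unfolding maximal_submodule_def by blast
    then show ?thesis
    proof cases
      case 1
      have "u = W" if "u \<in> U" for u
      proof -
        have "u \<in> (\<lambda>x. W +>\<^bsub>V\<^esub> x) ` carrier V"
          using subsetD[OF U'(1) that] unfolding Q.carrier_quotient .
        then obtain v where v: "v \<in> carrier V" "u = W +>\<^bsub>V\<^esub> v" by (rule imageE)
        then have "v \<in> ?P" using that by simp
        then have "v \<in> W" unfolding 1 .
        then show ?thesis using v Q.coset_eq_W_iff[of v] by simp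
      qed
      then have "U = {W}" using U'(2) by blast
      then show ?thesis by (simp add: Q.zero_quotient)
    next
      case 2
      have "u \<in> U" if "u \<in> carrier ?Q" for u
      proof -
        have "u \<in> (\<lambda>x. W +>\<^bsub>V\<^esub> x) ` carrier V" using that unfolding Q.carrier_quotient .
        then obtain v where v: "v \<in> carrier V" "u = W +>\<^bsub>V\<^esub> v" by (rule imageE)
        then have "v \<in> ?P" unfolding 2 by simp
        then show ?thesis using v by simp
      qed
      then show ?thesis using U'(1) by blast
    qed
  qed
  ultimately show ?thesis using Qm by (simp add: simple_amodule_def)
qed

end

section \<open>Modules with a unique maximal submodule\<close>

text \<open>The equation for \<open>v\<close> itself is listed besides those for \<open>c v\<close>
  because an algebra without unit need not reproduce \<open>v\<close> in its orbit.\<close>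

definition core ::
  "('k::field, 'a, 'm) module_scheme \<Rightarrow> ('k, 'v, 'a, 'n) amodule_scheme \<Rightarrow> 'a \<Rightarrow> 'v set" where
  "core A V e =
    {v \<in> carrier V. act V e v = \<zero>\<^bsub>V\<^esub> \<and> (\<forall>c\<in>carrier A. act V e (act V c v) = \<zero>\<^bsub>V\<^esub>)}"

locale local_module = amodule A V + closed_algebra A
  for A :: "('k::field, 'a, 'm) module_scheme"
  and V :: "('k, 'v, 'a, 'n) amodule_scheme" +
  fixes e
  assumes e: "e \<in> carrier A"
    and generate: "\<And>v W. v \<in> carrier V \<Longrightarrow> act V e v \<noteq> \<zero>\<^bsub>V\<^esub> \<Longrightarrow> asubmodule A V W \<Longrightarrow>
      act V e v \<in> W \<Longrightarrow> W = carrier V"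
    and nonzero: "\<exists>v\<in>carrier V. act V e v \<noteq> \<zero>\<^bsub>V\<^esub>"
begin

lemma asubmodule_core: "asubmodule A V (core A V e)"
proof -
  have "act V e (act V c (act V a v)) = \<zero>\<^bsub>V\<^esub>"
    if "v \<in> core A V e" "a \<in> carrier A" "c \<in> carrier A" for a c v
    using that by (auto simp: core_def act_mult[symmetric] mult_closed)
  then show ?thesis
    by (auto simp: asubmodule_iff core_def act_closed e act_zero_right act_add_right act_smult_right
        smult_zero_right)
qed

text \<open>If some \<open>v\<close> in \<open>W\<close> had \<open>e v\<close> nonzero, then
  \<open>e v\<close> would be a vector of \<open>W\<close> that generates everything.\<close>

lemma proper_subset_core:
  assumes W: "asubmodule A V W" and "W \<noteq> carrier V"
  shows "W \<subseteq> core A V e"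
proof -
  have "act V e v = \<zero>\<^bsub>V\<^esub>" if "v \<in> W" for v
    using generate[of v W] that W assms(2) e by (auto simp: asubmodule_iff)
  then show ?thesis using W by (auto simp: core_def asubmodule_iff)
qed

lemma core_proper: "core A V e \<noteq> carrier V"
  using nonzero by (auto simp: core_def)

lemma maximal_submodule_iff: "maximal_submodule A V W \<longleftrightarrow> W = core A V e"
proof
  assume "maximal_submodule A V W"
  then show "W = core A V e"
    unfolding maximal_submodule_def
    using asubmodule_core proper_subset_core[of W] core_proper by blast
next
  assume "W = core A V e"
  then show "maximal_submodule A V W"
    unfolding maximal_submodule_def
    using asubmodule_core proper_subset_core core_proper by blast
qed

lemma module_radical_eq: "module_radical A V = core A V e"
  by (auto simp: module_radical_def maximal_submodule_iff core_def)

lemma simple_head: "simple_amodule A (module_head A V)"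
  unfolding module_head_def module_radical_eq
  by (intro simple_quotient) (simp_all add: maximal_submodule_iff closed_algebra_axioms)

text \<open>The core is a proper submodule, so it cannot contain a generator.\<close>

lemma act_e_not_in_core: "v \<in> carrier V \<Longrightarrow> act V e v \<noteq> \<zero>\<^bsub>V\<^esub> \<Longrightarrow> act V e v \<notin> core A V e"
  using generate[of v "core A V e"] asubmodule_core core_proper by auto

end

section \<open>Cyclic modules and isomorphisms\<close>

lemma (in amodule) asubmodule_cyclic:
  assumes "closed_algebra A" "v \<in> carrier V" "a0 \<in> carrier A"
  shows "asubmodule A V ((\<lambda>a. act V a v) ` carrier A)"
proof -
  interpret closed_algebra A by fact
  \<comment> \<open>Only closure of the algebra carrier is assumed, so an element acting as zero is
    produced as \<open>0\<close> times an arbitrary \<open>a0\<close>.\<close>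
  have 0: "act V (0 \<odot>\<^bsub>A\<^esub> a0) v = \<zero>\<^bsub>V\<^esub>"
    using assms by (simp add: act_smult_left smult_zero_left act_closed)
  have "\<zero>\<^bsub>V\<^esub> \<in> (\<lambda>a. act V a v) ` carrier A"
    using assms by (intro image_eqI[of _ _ "0 \<odot>\<^bsub>A\<^esub> a0"] smult_closed 0[symmetric])
  then show ?thesis using assms(2)
    by (auto simp: asubmodule_iff act_closed act_add_left[symmetric] act_smult_left[symmetric]
        act_mult[symmetric] intro!: imageI add_closed smult_closed mult_closed)
qed

text \<open>Without a unit the cyclic submodule might be zero; the element \<open>a0\<close> with
  \<open>a0 v\<close> nonzero rules this out, and simplicity does the rest.\<close>

lemma simple_cyclic:
  assumes "simple_amodule A V" "closed_algebra A" "v \<in> carrier V" "a0 \<in> carrier A" "act V a0 v \<noteq> \<zero>\<^bsub>V\<^esub>"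
  shows "(\<lambda>a. act V a v) ` carrier A = carrier V"
proof -
  interpret amodule A V using assms(1) by (simp add: simple_amodule_def)
  show ?thesis
    using asubmodule_cyclic[OF assms(2-4)] assms(1,4,5) by (auto simp: simple_amodule_def)
qed

text \<open>Both modules are the algebra modulo the same left ideal, the common annihilator, and the
  isomorphism sends \<open>a v\<close> to \<open>a w\<close>. No dimension count is involved, so the
  criterion also serves modules of infinite dimension.\<close>

lemma amodule_iso_cyclic:
  assumes V: "amodule A V" and W: "amodule A W" and A: "closed_algebra A"
    and v: "v \<in> carrier V" "(\<lambda>a. act V a v) ` carrier A = carrier V"
    and w: "w \<in> carrier W" "(\<lambda>a. act W a w) ` carrier A = carrier W"
    and ann: "\<And>a. a \<in> carrier A \<Longrightarrow> act V a v = \<zero>\<^bsub>V\<^esub> \<longleftrightarrow> act W a w = \<zero>\<^bsub>W\<^esub>"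
  shows "amodule_iso A V W"
proof -
  interpret V: amodule A V by fact
  interpret W: amodule A W by fact
  interpret A: closed_algebra A by fact
  have V_eq: "act V a v = act V b v \<longleftrightarrow> act V (a \<oplus>\<^bsub>A\<^esub> (-1) \<odot>\<^bsub>A\<^esub> b) v = \<zero>\<^bsub>V\<^esub>"
    if "a \<in> carrier A" "b \<in> carrier A" for a b
    using that v
    by (subst V.eq_iff_diff_zero) (simp_all add: V.act_add_left V.act_smult_left A.smult_closed V.act_closed)
  have W_eq: "act W a w = act W b w \<longleftrightarrow> act W (a \<oplus>\<^bsub>A\<^esub> (-1) \<odot>\<^bsub>A\<^esub> b) w = \<zero>\<^bsub>W\<^esub>"
    if "a \<in> carrier A" "b \<in> carrier A" for a b
    using that w
    by (subst W.eq_iff_diff_zero) (simp_all add: W.act_add_left W.act_smult_left A.smult_closed W.act_closed)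
  have eq: "act V a v = act V b v \<longleftrightarrow> act W a w = act W b w"
    if "a \<in> carrier A" "b \<in> carrier A" for a b
    using that by (simp add: V_eq W_eq ann A.add_closed A.smult_closed)
  \<comment> \<open>An arbitrary \<open>a\<close> with \<open>a v = x\<close> is chosen; by
    \<open>eq\<close> the value does not depend on it.\<close>
  define f where "f x = act W (SOME a. a \<in> carrier A \<and> act V a v = x) w" for x
  have f: "f (act V a v) = act W a w" if "a \<in> carrier A" for a
  proof -
    let ?b = "SOME b. b \<in> carrier A \<and> act V b v = act V a v"
    have "?b \<in> carrier A \<and> act V ?b v = act V a v" by (rule someI[of _ a]) (simp add: that)
    then show ?thesis using eq[of ?b a] that by (simp add: f_def)
  qed
  show ?thesis unfolding amodule_iso_def
  proof (intro exI[of _ f] conjI)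
    have "inj_on f (carrier V)"
    proof (rule inj_onI)
      fix x y assume "x \<in> carrier V" "y \<in> carrier V" and xy: "f x = f y"
      then obtain a b where "x = act V a v" "y = act V b v" "a \<in> carrier A" "b \<in> carrier A"
        using v(2) by blast
      then show "x = y" using xy by (simp add: f eq)
    qed
    moreover have "f ` carrier V = carrier W"
      unfolding v(2)[symmetric] w(2)[symmetric] by (simp add: image_image f)
    ultimately show "bij_betw f (carrier V) (carrier W)" by (simp add: bij_betw_def)
    show "\<forall>x\<in>carrier V. \<forall>y\<in>carrier V. f (x \<oplus>\<^bsub>V\<^esub> y) = f x \<oplus>\<^bsub>W\<^esub> f y"
    proof (intro ballI)
      fix x y assume "x \<in> carrier V" "y \<in> carrier V"
      then obtain a b where "x = act V a v" "y = act V b v" "a \<in> carrier A" "b \<in> carrier A"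
        using v(2) by blast
      then show "f (x \<oplus>\<^bsub>V\<^esub> y) = f x \<oplus>\<^bsub>W\<^esub> f y"
        using v w by (simp add: f V.act_add_left[symmetric] W.act_add_left[symmetric] A.add_closed)
    qed
    show "\<forall>c. \<forall>x\<in>carrier V. f (c \<odot>\<^bsub>V\<^esub> x) = c \<odot>\<^bsub>W\<^esub> f x"
    proof (intro allI ballI)
      fix c x assume "x \<in> carrier V"
      then obtain a where "x = act V a v" "a \<in> carrier A" using v(2) by blast
      then show "f (c \<odot>\<^bsub>V\<^esub> x) = c \<odot>\<^bsub>W\<^esub> f x"
        using v w by (simp add: f V.act_smult_left[symmetric] W.act_smult_left[symmetric] A.smult_closed)
    qed
    show "\<forall>c\<in>carrier A. \<forall>x\<in>carrier V. f (act V c x) = act W c (f x)"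
    proof (intro ballI)
      fix c x assume c: "c \<in> carrier A" and "x \<in> carrier V"
      then obtain a where "x = act V a v" "a \<in> carrier A" using v(2) by blast
      then show "f (act V c x) = act W c (f x)"
        using v w c by (simp add: f V.act_mult[symmetric] W.act_mult[symmetric] A.mult_closed)
    qed
  qed
qed

lemma amodule_iso_sym:
  assumes "amodule A V" "amodule_iso A V W"
  shows "amodule_iso A W V"
proof -
  interpret amodule A V by fact
  obtain f where f: "bij_betw f (carrier V) (carrier W)"
    "\<And>v w. v \<in> carrier V \<Longrightarrow> w \<in> carrier V \<Longrightarrow> f (v \<oplus>\<^bsub>V\<^esub> w) = f v \<oplus>\<^bsub>W\<^esub> f w"
    "\<And>c v. v \<in> carrier V \<Longrightarrow> f (c \<odot>\<^bsub>V\<^esub> v) = c \<odot>\<^bsub>W\<^esub> f v"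
    "\<And>a v. a \<in> carrier A \<Longrightarrow> v \<in> carrier V \<Longrightarrow> f (act V a v) = act W a (f v)"
    using assms(2) unfolding amodule_iso_def by blast
  let ?g = "the_inv_into (carrier V) f"
  have inj: "inj_on f (carrier V)" and im: "f ` carrier V = carrier W"
    using f(1) by (auto simp: bij_betw_def)
  have gf: "?g (f v) = v" if "v \<in> carrier V" for v using inj that by (rule the_inv_into_f_f)
  have W: "\<exists>v\<in>carrier V. w = f v" if "w \<in> carrier W" for w using im that by blast
  have "bij_betw ?g (carrier W) (carrier V)" by (rule bij_betw_the_inv_into[OF f(1)])
  moreover have "?g (x \<oplus>\<^bsub>W\<^esub> y) = ?g x \<oplus>\<^bsub>V\<^esub> ?g y" if "x \<in> carrier W" "y \<in> carrier W" for x y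
    using W[OF that(1)] W[OF that(2)] by (auto simp: gf f(2)[symmetric])
  moreover have "?g (c \<odot>\<^bsub>W\<^esub> x) = c \<odot>\<^bsub>V\<^esub> ?g x" if "x \<in> carrier W" for c x
    using W[OF that(1)] by (auto simp: gf f(3)[symmetric])
  moreover have "?g (act W a x) = act V a (?g x)" if "a \<in> carrier A" "x \<in> carrier W" for a x
    using W[OF that(2)] that by (auto simp: gf f(4)[symmetric] act_closed)
  ultimately show ?thesis unfolding amodule_iso_def by blast
qed

lemma amodule_iso_trans:
  assumes "amodule_iso A U V" "amodule_iso A V W"
  shows "amodule_iso A U W"
proof -
  obtain f where f: "bij_betw f (carrier U) (carrier V)"
    "\<And>v w. v \<in> carrier U \<Longrightarrow> w \<in> carrier U \<Longrightarrow> f (v \<oplus>\<^bsub>U\<^esub> w) = f v \<oplus>\<^bsub>V\<^esub> f w"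
    "\<And>c v. v \<in> carrier U \<Longrightarrow> f (c \<odot>\<^bsub>U\<^esub> v) = c \<odot>\<^bsub>V\<^esub> f v"
    "\<And>a v. a \<in> carrier A \<Longrightarrow> v \<in> carrier U \<Longrightarrow> f (act U a v) = act V a (f v)"
    using assms(1) unfolding amodule_iso_def by blast
  obtain g where g: "bij_betw g (carrier V) (carrier W)"
    "\<And>v w. v \<in> carrier V \<Longrightarrow> w \<in> carrier V \<Longrightarrow> g (v \<oplus>\<^bsub>V\<^esub> w) = g v \<oplus>\<^bsub>W\<^esub> g w"
    "\<And>c v. v \<in> carrier V \<Longrightarrow> g (c \<odot>\<^bsub>V\<^esub> v) = c \<odot>\<^bsub>W\<^esub> g v"
    "\<And>a v. a \<in> carrier A \<Longrightarrow> v \<in> carrier V \<Longrightarrow> g (act V a v) = act W a (g v)"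
    using assms(2) unfolding amodule_iso_def by blast
  have fc: "f v \<in> carrier V" if "v \<in> carrier U" for v using f(1) that by (auto simp: bij_betw_def)
  show ?thesis unfolding amodule_iso_def
    by (intro exI[of _ "g \<circ> f"]) (auto simp: f g fc intro: bij_betw_trans[OF f(1) g(1)])
qed

lemma amodule_iso_zero:
  assumes "amodule A V" "amodule A W"
    and f: "\<And>c v. v \<in> carrier V \<Longrightarrow> f (c \<odot>\<^bsub>V\<^esub> v) = c \<odot>\<^bsub>W\<^esub> f v" "\<And>v. v \<in> carrier V \<Longrightarrow> f v \<in> carrier W"
  shows "f \<zero>\<^bsub>V\<^esub> = \<zero>\<^bsub>W\<^esub>"
proof -
  interpret V: amodule A V by fact
  interpret W: amodule A W by fact
  show ?thesis
    using f(1)[of "\<zero>\<^bsub>V\<^esub>" 0] f(2)[of "\<zero>\<^bsub>V\<^esub>"] by (simp add: V.smult_zero_right W.smult_zero_left)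
qed

section \<open>Linear extension into modules given by a carrier\<close>

definition lin_ext_to ::
  "('k::field, 'v, 'n) module_scheme \<Rightarrow> ('x \<Rightarrow> 'v) \<Rightarrow> ('x \<Rightarrow>\<^sub>0 'k) \<Rightarrow> 'v" where
  "lin_ext_to V f p = finsum V (\<lambda>x. Poly_Mapping.lookup p x \<odot>\<^bsub>V\<^esub> f x) (Poly_Mapping.keys p)"

context
  fixes V :: "('k::field, 'v, 'n) module_scheme" and f :: "'x \<Rightarrow> 'v" and S
  assumes V: "Module.module scalar_ring V" and f: "\<And>x. x \<in> S \<Longrightarrow> f x \<in> carrier V"
begin

interpretation Module.module scalar_ring V by (rule V)

lemma lin_ext_to_superset:
  assumes "finite T" "Poly_Mapping.keys p \<subseteq> T" "T \<subseteq> S"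
  shows "lin_ext_to V f p = finsum V (\<lambda>x. Poly_Mapping.lookup p x \<odot>\<^bsub>V\<^esub> f x) T"
  unfolding lin_ext_to_def
  using assms f smult_l_null
  by (intro add.finprod_mono_neutral_cong_left) (auto simp: in_keys_iff subset_iff)

lemma lin_ext_to_add:
  assumes "Poly_Mapping.keys p \<subseteq> S" "Poly_Mapping.keys q \<subseteq> S"
  shows "lin_ext_to V f (p + q) = lin_ext_to V f p \<oplus>\<^bsub>V\<^esub> lin_ext_to V f q"
proof -
  let ?T = "Poly_Mapping.keys p \<union> Poly_Mapping.keys q"
  have "Poly_Mapping.keys (p + q) \<subseteq> ?T" by (rule keys_add)
  moreover have "f x \<in> carrier V" if "x \<in> ?T" for x using that assms f by auto
  moreover from this have "finsum V (\<lambda>x. Poly_Mapping.lookup (p + q) x \<odot>\<^bsub>V\<^esub> f x) ?T =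
      finsum V (\<lambda>x. Poly_Mapping.lookup p x \<odot>\<^bsub>V\<^esub> f x \<oplus>\<^bsub>V\<^esub> Poly_Mapping.lookup q x \<odot>\<^bsub>V\<^esub> f x) ?T"
    using smult_l_distr by (intro finsum_cong') (auto simp: lookup_add)
  ultimately show ?thesis using assms
    by (simp add: lin_ext_to_superset[of ?T] finsum_addf Pi_def)
qed

lemma lin_ext_to_scale:
  assumes "Poly_Mapping.keys p \<subseteq> S"
  shows "lin_ext_to V f (scale c p) = c \<odot>\<^bsub>V\<^esub> lin_ext_to V f p"
proof -
  have "f x \<in> carrier V" if "x \<in> Poly_Mapping.keys p" for x using that assms f by auto
  moreover from this have
    "finsum V (\<lambda>x. Poly_Mapping.lookup (scale c p) x \<odot>\<^bsub>V\<^esub> f x) (Poly_Mapping.keys p) =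
      finsum V (\<lambda>x. c \<odot>\<^bsub>V\<^esub> (Poly_Mapping.lookup p x \<odot>\<^bsub>V\<^esub> f x)) (Poly_Mapping.keys p)"
    using smult_assoc1 by (intro finsum_cong') auto
  ultimately show ?thesis using assms
    by (simp add: lin_ext_to_superset[of "Poly_Mapping.keys p"] keys_scale finsum_smult_ldistr Pi_def)
qed

lemma lin_ext_to_symbol: "x \<in> S \<Longrightarrow> lin_ext_to V f (symbol x) = f x"
  using f smult_one[of "f x"] by (simp add: lin_ext_to_def lookup_symbol)

lemma lin_ext_to_closed: "Poly_Mapping.keys p \<subseteq> S \<Longrightarrow> lin_ext_to V f p \<in> carrier V"
  using f unfolding lin_ext_to_def by (intro finsum_closed) auto

end

section \<open>Gluing matchings\<close>

definition conn :: "'a set set \<Rightarrow> ('a \<times> 'a) set" where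
  "conn F = {(x, y). {x, y} \<in> F}\<^sup>*"

definition matching :: "'a set set \<Rightarrow> bool" where
  "matching F \<longleftrightarrow> finite F \<and> disjoint F \<and> (\<forall>e\<in>F. card e = 2)"

lemma conn_refl [simp]: "(x, x) \<in> conn F"
  by (simp add: conn_def)

lemma conn_edge: "{x, y} \<in> F \<Longrightarrow> (x, y) \<in> conn F"
  by (auto simp: conn_def)

lemma conn_trans: "(x, y) \<in> conn F \<Longrightarrow> (y, z) \<in> conn F \<Longrightarrow> (x, z) \<in> conn F"
  by (auto simp: conn_def)

lemma conn_sym: "(x, y) \<in> conn F \<Longrightarrow> (y, x) \<in> conn F"
proof -
  have "sym {(x, y). {x, y} \<in> F}" by (auto intro!: symI simp: insert_commute)
  then have "sym (conn F)" unfolding conn_def by (rule sym_rtrancl)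
  then show "(x, y) \<in> conn F \<Longrightarrow> (y, x) \<in> conn F" by (rule symD)
qed

lemma conn_mono: "F \<subseteq> G \<Longrightarrow> conn F \<subseteq> conn G"
  unfolding conn_def by (intro rtrancl_mono) auto

lemma conn_Un1: "(x, y) \<in> conn F \<Longrightarrow> (x, y) \<in> conn (F \<union> G)"
  using conn_mono[of F "F \<union> G"] by auto

lemma equiv_conn: "equiv UNIV (conn F)"
  by (intro equivI) (auto simp: refl_on_def sym_def trans_def intro: conn_sym conn_trans)

lemma conn_class_eq: "(x, y) \<in> conn F \<Longrightarrow> conn F `` {x} = conn F `` {y}"
  by (rule equiv_class_eq[OF equiv_conn])

lemma conn_induct [consumes 1, case_names refl step]:
  assumes "(x, y) \<in> conn F" "P x"
    and "\<And>y z. (x, y) \<in> conn F \<Longrightarrow> {y, z} \<in> F \<Longrightarrow> P y \<Longrightarrow> P z"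
  shows "P y"
  using assms(1) unfolding conn_def
  by (induction rule: rtrancl_induct) (use assms in \<open>auto simp: conn_def\<close>)

lemma conn_closed: "(x, y) \<in> conn F \<Longrightarrow> x \<noteq> y \<Longrightarrow> x \<in> \<Union>F \<and> y \<in> \<Union>F"
proof -
  have *: "y \<in> \<Union>F" if "(x, y) \<in> conn F" "x \<noteq> y" for x y
    using that(1,2) by (induction rule: conn_induct) auto
  assume "(x, y) \<in> conn F" "x \<noteq> y"
  then show ?thesis using *[of x y] *[of y x] conn_sym[of x y F] by blast
qed

lemma conn_class_subset: "x \<in> \<Union>F \<Longrightarrow> conn F `` {x} \<subseteq> \<Union>F"
  using conn_closed by fastforce

lemma conn_exit:
  assumes "(x, y) \<in> conn F" "x \<in> S" "y \<notin> S"
  obtains u v where "u \<in> S" "v \<notin> S" "{u, v} \<in> F" "(x, u) \<in> conn F"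
  using assms by (induction arbitrary: thesis rule: conn_induct) auto

text \<open>A connected graph has at most one vertex more than edges. Among the vertex sets around
  \<open>x\<close> that satisfy this bound a largest one is taken; an edge leaving it would add one
  vertex and at least one edge, so it is the whole component.\<close>

lemma card_conn_class_le:
  assumes F: "finite F" and fin: "finite (conn F `` {x})"
  shows "card (conn F `` {x}) \<le> 1 + card {e \<in> F. e \<subseteq> conn F `` {x}}"
proof -
  let ?C = "conn F `` {x}"
  let ?E = "\<lambda>S. {e \<in> F. e \<subseteq> S}"
  let ?\<S> = "{S. S \<subseteq> ?C \<and> x \<in> S \<and> card S \<le> 1 + card (?E S)}"
  have "finite ?\<S>" by (rule finite_subset[of _ "Pow ?C"]) (use fin in auto)
  moreover have "{x} \<in> ?\<S>" by auto
  ultimately have "finite (card ` ?\<S>)" "card ` ?\<S> \<noteq> {}" by blast+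
  from Max_in[OF this] Max_ge[OF this(1)] obtain S
    where S: "S \<in> ?\<S>" and max: "\<And>S'. S' \<in> ?\<S> \<Longrightarrow> card S' \<le> card S"
    by (metis (no_types, lifting) imageE imageI)
  have "S = ?C"
  proof (rule ccontr)
    assume "S \<noteq> ?C"
    then obtain y where y: "(x, y) \<in> conn F" "y \<notin> S" using S by auto
    then obtain u v where uv: "u \<in> S" "v \<notin> S" "{u, v} \<in> F" "(x, u) \<in> conn F"
      using S by (elim conn_exit[of x y F S]) auto
    have v: "v \<in> ?C" using conn_trans[OF uv(4) conn_edge[OF uv(3)]] by simp
    have finS: "finite S" using S fin by (auto intro: finite_subset)
    have "insert {u, v} (?E S) \<subseteq> ?E (insert v S)" using uv by auto
    then have "card (insert {u, v} (?E S)) \<le> card (?E (insert v S))"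
      by (rule card_mono[rotated]) (use F in auto)
    moreover have "{u, v} \<notin> ?E S" using uv by auto
    ultimately have "Suc (card (?E S)) \<le> card (?E (insert v S))" using F by simp
    then have "insert v S \<in> ?\<S>" using S v uv finS by auto
    from max[OF this] show False using uv finS by simp
  qed
  then show ?thesis using S by simp
qed

lemma matching_finite_Union: "matching F \<Longrightarrow> finite (\<Union>F)"
  unfolding matching_def using card_ge_0_finite by (metis finite_Union pos2)

lemma matching_edge: "matching F \<Longrightarrow> e \<in> F \<Longrightarrow> \<exists>x y. e = {x, y} \<and> x \<noteq> y"
  by (auto simp: matching_def card_2_iff)

lemma matching_edge_in:
  assumes "matching F" "x \<in> \<Union>F"
  obtains y where "{x, y} \<in> F" "x \<noteq> y"
proof -
  obtain e where e: "e \<in> F" "x \<in> e" using assms(2) by blast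
  then obtain a b where "e = {a, b}" "a \<noteq> b" using matching_edge[OF assms(1)] by blast
  then show ?thesis using e that[of a] that[of b] by (auto simp: insert_commute)
qed

lemma matching_eqD: "matching F \<Longrightarrow> e \<in> F \<Longrightarrow> e' \<in> F \<Longrightarrow> x \<in> e \<Longrightarrow> x \<in> e' \<Longrightarrow> e = e'"
  unfolding matching_def disjoint_def by auto

lemma matching_partner: "matching F \<Longrightarrow> {x, y} \<in> F \<Longrightarrow> {x, z} \<in> F \<Longrightarrow> y = z"
  using matching_eqD[of F "{x, y}" "{x, z}" x] by (auto simp: doubleton_eq_iff)

text \<open>Edges that meet \<open>C\<close> lie inside it, so the covered part of \<open>C\<close>
  is a disjoint union of pairs.\<close>

lemma matching_even:
  assumes "matching F" "\<And>e. e \<in> F \<Longrightarrow> e \<inter> C \<noteq> {} \<Longrightarrow> e \<subseteq> C"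
  shows "card (C \<inter> \<Union>F) = 2 * card {e \<in> F. e \<subseteq> C}"
proof -
  have "C \<inter> \<Union>F = \<Union>{e \<in> F. e \<subseteq> C}" using assms(2) by blast
  also have "card \<dots> = sum card {e \<in> F. e \<subseteq> C}"
    using assms(1) by (intro card_Union_disjoint)
      (auto simp: matching_def disjoint_def pairwise_def disjnt_def intro: card_ge_0_finite)
  also have "\<dots> = (\<Sum>e\<in>{e \<in> F. e \<subseteq> C}. 2)"
    using assms(1) by (intro sum.cong) (auto simp: matching_def)
  finally show ?thesis by simp
qed

text \<open>
  A component of the union of two matchings is a path or a cycle: by connectedness it has at
  most one vertex more than edges, so by the handshake lemma at most two end points.
\<close>

lemma card_ends:
  assumes G: "matching G" and H: "matching H" and x: "x \<in> \<Union>G \<union> \<Union>H"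
  shows "card (conn (G \<union> H) `` {x} - \<Union>G \<inter> \<Union>H) \<in> {0, 2}"
proof -
  let ?C = "conn (G \<union> H) `` {x}"
  have CU: "?C \<subseteq> \<Union>G \<union> \<Union>H" using conn_class_subset[of x "G \<union> H"] x by auto
  have fin: "finite ?C"
    using CU by (rule finite_subset) (simp add: G H matching_finite_Union)
  have closed: "e \<subseteq> ?C" if e: "e \<in> G \<union> H" "e \<inter> ?C \<noteq> {}" for e
  proof -
    obtain a b where ab: "e = {a, b}" using e(1) matching_edge[OF G] matching_edge[OF H] by blast
    then have "(a, b) \<in> conn (G \<union> H)" using e(1) by (intro conn_edge) simp
    then show ?thesis using ab e(2) by (auto intro: conn_trans conn_sym)
  qed
  have cG: "card (?C \<inter> \<Union>G) = 2 * card {e \<in> G. e \<subseteq> ?C}"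
    by (intro matching_even[OF G] closed) auto
  have cH: "card (?C \<inter> \<Union>H) = 2 * card {e \<in> H. e \<subseteq> ?C}"
    by (intro matching_even[OF H] closed) auto
  have "card ?C \<le> 1 + card {e \<in> G \<union> H. e \<subseteq> ?C}"
    using G H fin by (intro card_conn_class_le) (auto simp: matching_def)
  also have "{e \<in> G \<union> H. e \<subseteq> ?C} = {e \<in> G. e \<subseteq> ?C} \<union> {e \<in> H. e \<subseteq> ?C}" by auto
  also have "card \<dots> \<le> card {e \<in> G. e \<subseteq> ?C} + card {e \<in> H. e \<subseteq> ?C}" by (rule card_Un_le)
  finally have le: "2 * card ?C \<le> 2 + card (?C \<inter> \<Union>G) + card (?C \<inter> \<Union>H)"
    using cG cH by simp
  have "card (?C \<inter> \<Union>G) + card (?C \<inter> \<Union>H) =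
      card (?C \<inter> \<Union>G \<union> ?C \<inter> \<Union>H) + card (?C \<inter> \<Union>G \<inter> (?C \<inter> \<Union>H))"
    using fin by (intro card_Un_Int) auto
  also have "?C \<inter> \<Union>G \<union> ?C \<inter> \<Union>H = ?C" using CU by auto
  also have "?C \<inter> \<Union>G \<inter> (?C \<inter> \<Union>H) = ?C \<inter> (\<Union>G \<inter> \<Union>H)" by auto
  finally have sum: "card (?C \<inter> \<Union>G) + card (?C \<inter> \<Union>H) = card ?C + card (?C \<inter> (\<Union>G \<inter> \<Union>H))" .
  have "card ?C = card (?C \<inter> (\<Union>G \<inter> \<Union>H)) + card (?C - \<Union>G \<inter> \<Union>H)"
    using fin by (subst card_Diff_subset_Int) (auto simp: card_mono)
  then have split: "card (?C - \<Union>G \<inter> \<Union>H) + 2 * card (?C \<inter> (\<Union>G \<inter> \<Union>H)) =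
      2 * card {e \<in> G. e \<subseteq> ?C} + 2 * card {e \<in> H. e \<subseteq> ?C}"
    and "card (?C - \<Union>G \<inter> \<Union>H) \<le> 2"
    using le sum unfolding cG cH by linarith+
  moreover have "even (card (?C - \<Union>G \<inter> \<Union>H))"
    using arg_cong[OF split, of even] by simp
  ultimately show ?thesis by (auto simp: le_Suc_eq numeral_2_eq_2)
qed

text \<open>The middle points are those covered by both matchings. Deleting them turns a component
  that is a path into the pair of its ends and a cycle into the empty set, which is
  discarded.\<close>

definition glue :: "'a set set \<Rightarrow> 'a set set \<Rightarrow> 'a set set" where
  "glue G H = (\<lambda>C. C - \<Union>G \<inter> \<Union>H) ` ((\<Union>G \<union> \<Union>H) // conn (G \<union> H)) - {{}}"

definition cycles :: "'a set set \<Rightarrow> 'a set set \<Rightarrow> nat" where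
  "cycles G H = card {C \<in> (\<Union>G \<union> \<Union>H) // conn (G \<union> H). C \<subseteq> \<Union>G \<inter> \<Union>H}"

lemma glue_commute: "glue G H = glue H G"
  by (simp add: glue_def Un_commute Int_commute)

lemma cycles_commute: "cycles G H = cycles H G"
  by (simp add: cycles_def Un_commute Int_commute)

context
  fixes G H :: "'a set set"
  assumes G: "matching G" and H: "matching H"
begin

lemma finite_conn_class: "x \<in> \<Union>G \<union> \<Union>H \<Longrightarrow> finite (conn (G \<union> H) `` {x})"
  using conn_class_subset[of x "G \<union> H"] matching_finite_Union[OF G] matching_finite_Union[OF H]
  by (metis Union_Un_distrib finite_Un finite_subset)

text \<open>A component has no or two end points by \<open>card_ends\<close>, so two distinct
  connected outer points exhaust the ends of their component. Gluing is thereby described by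
  connectedness alone, the form in which triple stacks can be handled.\<close>

lemma glue_iff:
  "e \<in> glue G H \<longleftrightarrow> (\<exists>x y. e = {x, y} \<and> x \<noteq> y \<and> x \<in> \<Union>G \<union> \<Union>H - \<Union>G \<inter> \<Union>H \<and>
     y \<in> \<Union>G \<union> \<Union>H - \<Union>G \<inter> \<Union>H \<and> (x, y) \<in> conn (G \<union> H))"
proof
  assume "e \<in> glue G H"
  then obtain x where x: "x \<in> \<Union>G \<union> \<Union>H" "e = conn (G \<union> H) `` {x} - \<Union>G \<inter> \<Union>H" "e \<noteq> {}"
    by (auto simp: glue_def quotient_def)
  have sub: "conn (G \<union> H) `` {x} \<subseteq> \<Union>G \<union> \<Union>H" using conn_class_subset[of x "G \<union> H"] x by auto
  have "finite e" using x finite_conn_class by simp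
  with card_ends[OF G H x(1)] x have "card e = 2" by auto
  then obtain a b where ab: "e = {a, b}" "a \<noteq> b" by (auto simp: card_2_iff)
  then have *: "a \<in> conn (G \<union> H) `` {x} - \<Union>G \<inter> \<Union>H" "b \<in> conn (G \<union> H) `` {x} - \<Union>G \<inter> \<Union>H"
    using x(2) by blast+
  then have "(a, b) \<in> conn (G \<union> H)" using conn_trans[OF conn_sym, of x a _ b] by blast
  then show "\<exists>x y. e = {x, y} \<and> x \<noteq> y \<and> x \<in> \<Union>G \<union> \<Union>H - \<Union>G \<inter> \<Union>H \<and>
     y \<in> \<Union>G \<union> \<Union>H - \<Union>G \<inter> \<Union>H \<and> (x, y) \<in> conn (G \<union> H)"
    using ab * sub by (intro exI[of _ a] exI[of _ b] conjI) blast+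
next
  assume "\<exists>x y. e = {x, y} \<and> x \<noteq> y \<and> x \<in> \<Union>G \<union> \<Union>H - \<Union>G \<inter> \<Union>H \<and>
     y \<in> \<Union>G \<union> \<Union>H - \<Union>G \<inter> \<Union>H \<and> (x, y) \<in> conn (G \<union> H)"
  then obtain x y where xy: "e = {x, y}" "x \<noteq> y" "x \<in> \<Union>G \<union> \<Union>H - \<Union>G \<inter> \<Union>H"
     "y \<in> \<Union>G \<union> \<Union>H - \<Union>G \<inter> \<Union>H" "(x, y) \<in> conn (G \<union> H)" by blast
  let ?D = "conn (G \<union> H) `` {x} - \<Union>G \<inter> \<Union>H"
  have x: "x \<in> \<Union>G \<union> \<Union>H" using xy by blast
  have sub: "{x, y} \<subseteq> ?D" using xy by auto
  have fin: "finite ?D" using finite_conn_class[OF x] by simp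
  have "card ?D \<noteq> 0" using fin sub by auto
  then have "card ?D = 2" using card_ends[OF G H x] by auto
  then have "{x, y} = ?D" using sub fin xy(2) by (intro card_subset_eq) auto
  then show "e \<in> glue G H"
    unfolding glue_def xy(1) using x by (intro DiffI image_eqI[where x="conn (G \<union> H) `` {x}"] quotientI) auto
qed

lemma Union_glue: "\<Union>(glue G H) = \<Union>G \<union> \<Union>H - \<Union>G \<inter> \<Union>H"
proof
  show "\<Union>(glue G H) \<subseteq> \<Union>G \<union> \<Union>H - \<Union>G \<inter> \<Union>H" by (auto simp: glue_iff)
  show "\<Union>G \<union> \<Union>H - \<Union>G \<inter> \<Union>H \<subseteq> \<Union>(glue G H)"
  proof
    fix x assume x: "x \<in> \<Union>G \<union> \<Union>H - \<Union>G \<inter> \<Union>H"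
    then have D: "x \<in> conn (G \<union> H) `` {x} - \<Union>G \<inter> \<Union>H" by auto
    then have "conn (G \<union> H) `` {x} - \<Union>G \<inter> \<Union>H \<in> glue G H"
      using x unfolding glue_def by (intro DiffI imageI quotientI) blast+
    then show "x \<in> \<Union>(glue G H)" using D by blast
  qed
qed

lemma matching_glue: "matching (glue G H)"
  unfolding matching_def
proof (intro conjI ballI)
  show "finite (glue G H)"
    using finite_UnionD[of "glue G H"] matching_finite_Union[OF G] matching_finite_Union[OF H]
    by (auto simp: Union_glue)
  show "card e = 2" if "e \<in> glue G H" for e using that by (auto simp: glue_iff)
  show "disjoint (glue G H)"
  proof (rule disjointI)
    fix e e' assume e: "e \<in> glue G H" "e' \<in> glue G H" "e \<noteq> e'"
    then obtain x y where x: "e = conn (G \<union> H) `` {x} - \<Union>G \<inter> \<Union>H" 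
      "e' = conn (G \<union> H) `` {y} - \<Union>G \<inter> \<Union>H" by (auto simp: glue_def quotient_def)
    show "e \<inter> e' = {}"
    proof (rule ccontr)
      assume "e \<inter> e' \<noteq> {}"
      then obtain z where "(x, z) \<in> conn (G \<union> H)" "(y, z) \<in> conn (G \<union> H)" unfolding x by blast
      then have "conn (G \<union> H) `` {x} = conn (G \<union> H) `` {y}" by (metis conn_class_eq)
      then show False using e(3) x by simp
    qed
  qed
qed

end

section \<open>Associativity of gluing and of the loop count\<close>

text \<open>The edges of \<open>S\<close> do not touch the middle points, so a walk between outer
  points can replace each passage through the middle by a glued edge.\<close>

lemma conn_contract:
  assumes F: "matching F" and G: "matching G" and S: "\<Union>S \<inter> (\<Union>F \<inter> \<Union>G) = {}"
    and x: "x \<notin> \<Union>F \<inter> \<Union>G" and y: "y \<notin> \<Union>F \<inter> \<Union>G"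
  shows "(x, y) \<in> conn (F \<union> G \<union> S) \<longleftrightarrow> (x, y) \<in> conn (glue F G \<union> S)"
proof
  let ?C = "\<Union>F \<inter> \<Union>G"
  have jump: "(x, z') \<in> conn (glue F G \<union> S)"
    if "(x, z) \<in> conn (glue F G \<union> S)" "(z, z') \<in> conn (F \<union> G)" "z \<notin> ?C" "z' \<notin> ?C" for z z'
  proof (cases "z = z'")
    case False
    then have "{z, z'} \<in> glue F G"
      using that conn_closed[OF that(2)] by (subst glue_iff[OF F G]) auto
    then show ?thesis using that(1) by (meson UnI1 conn_edge conn_trans)
  qed (use that in simp)
  assume xy: "(x, y) \<in> conn (F \<union> G \<union> S)"
  \<comment> \<open>Invariant of the walk: \<open>z\<close> is an outer point already reached by
    glued edges and edges of \<open>S\<close>, and the current point is reached from it inside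
    \<open>F \<union> G\<close>.\<close>
  have "\<exists>z. z \<notin> ?C \<and> (x, z) \<in> conn (glue F G \<union> S) \<and> (z, y) \<in> conn (F \<union> G)"
    using xy
  proof (induction rule: conn_induct)
    case refl
    then show ?case using x by (intro exI[of _ x]) auto
  next
    case (step y y')
    then obtain z where z: "z \<notin> ?C" "(x, z) \<in> conn (glue F G \<union> S)" "(z, y) \<in> conn (F \<union> G)"
      by blast
    consider "{y, y'} \<in> F \<union> G" | "{y, y'} \<in> S" using step by blast
    then show ?case
    proof cases
      case 1
      then show ?thesis using z conn_edge conn_trans by metis
    next
      case 2
      then have "y \<notin> ?C" "y' \<notin> ?C" using S by auto
      then have "(x, y) \<in> conn (glue F G \<union> S)" using jump z by blast
      moreover have "(y, y') \<in> conn (glue F G \<union> S)" using 2 by (intro conn_edge) auto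
      ultimately show ?thesis using \<open>y' \<notin> ?C\<close> by (intro exI[of _ y']) (auto intro: conn_trans)
    qed
  qed
  then show "(x, y) \<in> conn (glue F G \<union> S)" using jump y by blast
next
  assume "(x, y) \<in> conn (glue F G \<union> S)"
  then show "(x, y) \<in> conn (F \<union> G \<union> S)"
  proof (induction rule: conn_induct)
    case (step y z)
    have "(y, z) \<in> conn (F \<union> G \<union> S)"
    proof (cases "{y, z} \<in> S")
      case True
      then show ?thesis by (intro conn_edge) auto
    next
      case False
      then have "{y, z} \<in> glue F G" using step by blast
      then have "(y, z) \<in> conn (F \<union> G)"
        unfolding glue_iff[OF F G] by (auto simp: doubleton_eq_iff intro: conn_sym)
      then show ?thesis by (rule conn_Un1)
    qed
    then show ?case using step conn_trans by metis
  qed simp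
qed

context
  fixes F G H :: "'a set set"
  assumes F: "matching F" and G: "matching G" and H: "matching H" and FH: "\<Union>F \<inter> \<Union>H = {}"
begin

text \<open>Disjointness of \<open>F\<close> and \<open>H\<close> means that the two outer layers of
  the triple stack share no row. The resulting description is symmetric in \<open>F\<close> and
  \<open>H\<close>, and associativity is read off from this symmetry.\<close>

lemma glue_glue_iff:
  "e \<in> glue (glue F G) H \<longleftrightarrow> (\<exists>x y. e = {x, y} \<and> x \<noteq> y \<and>
     x \<in> \<Union>F \<union> \<Union>G \<union> \<Union>H - (\<Union>F \<inter> \<Union>G \<union> \<Union>G \<inter> \<Union>H) \<and>
     y \<in> \<Union>F \<union> \<Union>G \<union> \<Union>H - (\<Union>F \<inter> \<Union>G \<union> \<Union>G \<inter> \<Union>H) \<and> (x, y) \<in> conn (F \<union> G \<union> H))"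
proof -
  have *: "\<Union>(glue F G) \<union> \<Union>H - \<Union>(glue F G) \<inter> \<Union>H =
      \<Union>F \<union> \<Union>G \<union> \<Union>H - (\<Union>F \<inter> \<Union>G \<union> \<Union>G \<inter> \<Union>H)"
    using FH unfolding Union_glue[OF F G] by blast
  have "(x, y) \<in> conn (glue F G \<union> H) \<longleftrightarrow> (x, y) \<in> conn (F \<union> G \<union> H)"
    if "x \<notin> \<Union>F \<inter> \<Union>G" "y \<notin> \<Union>F \<inter> \<Union>G" for x y
    using FH by (intro conn_contract[OF F G, symmetric] that) auto
  then show ?thesis unfolding glue_iff[OF matching_glue[OF F G] H] * by blast
qed

text \<open>The closed loops of the triple stack are sorted by whether they reach the interface
  \<open>?B\<close> of \<open>G\<close> and \<open>H\<close>. Those that do not are loops of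
  \<open>F\<close> and \<open>G\<close>; the others become loops of \<open>glue F G\<close> and
  \<open>H\<close> once the points of \<open>?C\<close> are removed.\<close>

lemma cycles_glue:
  "cycles F G + cycles (glue F G) H =
    card {K \<in> (\<Union>F \<union> \<Union>G \<union> \<Union>H) // conn (F \<union> G \<union> H). K \<subseteq> \<Union>F \<inter> \<Union>G \<union> \<Union>G \<inter> \<Union>H}"
proof -
  let ?C = "\<Union>F \<inter> \<Union>G" and ?B = "\<Union>G \<inter> \<Union>H" and ?V = "\<Union>F \<union> \<Union>G \<union> \<Union>H"
  let ?T = "conn (F \<union> G \<union> H)" and ?FG = "conn (F \<union> G)" and ?D = "conn (glue F G \<union> H)"
  let ?K = "{K \<in> ?V // ?T. K \<subseteq> ?C \<union> ?B}"
  let ?K1 = "{K \<in> (\<Union>F \<union> \<Union>G) // ?FG. K \<subseteq> ?C}"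
  let ?K2 = "{K \<in> ?K. K \<inter> ?B \<noteq> {}}"
  let ?K3 = "{K \<in> (\<Union>(glue F G) \<union> \<Union>H) // ?D. K \<subseteq> \<Union>(glue F G) \<inter> \<Union>H}"
  have fin: "finite ?V" using F G H by (simp add: matching_finite_Union)
  have finK: "finite ?K"
  proof (rule finite_subset)
    show "?K \<subseteq> (\<lambda>x. ?T `` {x}) ` ?V" by (auto simp: quotient_def)
  qed (use fin in simp)
  \<comment> \<open>A component of \<open>F \<union> G\<close> inside \<open>?C\<close> meets no
    edge of \<open>H\<close>, so adding \<open>H\<close> does not enlarge it.\<close>
  have same: "?T `` {x} = ?FG `` {x}" if "?FG `` {x} \<subseteq> ?C" for x
  proof -
    have "(x, y) \<in> ?FG" if "(x, y) \<in> ?T" for y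
      using that
    proof (induction rule: conn_induct)
      case (step y z)
      then have "y \<in> ?C" using \<open>?FG `` {x} \<subseteq> ?C\<close> by auto
      then have "{y, z} \<notin> H" using FH by auto
      then show ?case using step by (meson UnE conn_edge conn_trans)
    qed simp
    then show ?thesis using conn_Un1 by fast
  qed
  have K1: "?K1 = {K \<in> ?K. K \<subseteq> ?C}"
  proof (intro equalityI subsetI)
    fix K assume K: "K \<in> ?K1"
    then obtain x where x: "x \<in> \<Union>F \<union> \<Union>G" "K = ?FG `` {x}" by (blast elim: quotientE)
    then have "K = ?T `` {x}" using same K by blast
    then have "K \<in> ?V // ?T" using x by (auto intro: quotientI)
    then show "K \<in> {K \<in> ?K. K \<subseteq> ?C}" using K by blast
  next
    fix K assume "K \<in> {K \<in> ?K. K \<subseteq> ?C}"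
    then obtain x where x: "K = ?T `` {x}" "K \<subseteq> ?C" by (blast elim: quotientE)
    then have "?FG `` {x} \<subseteq> ?C" using conn_Un1 by fast
    then have "K = ?FG `` {x}" using x(1) same by simp
    moreover have "x \<in> K" using x(1) conn_refl[of x "F \<union> G \<union> H"] by blast
    then have "x \<in> ?C" using x(2) by blast
    ultimately have "K \<in> (\<Union>F \<union> \<Union>G) // ?FG" by (auto intro: quotientI)
    then show "K \<in> ?K1" using x by blast
  qed
  have K: "?K = ?K1 \<union> ?K2" unfolding K1 by auto
  have disj: "?K1 \<inter> ?K2 = {}" using FH by blast
  have V3: "\<Union>(glue F G) \<union> \<Union>H = ?V - ?C" "\<Union>(glue F G) \<inter> \<Union>H = ?B"
    using FH unfolding Union_glue[OF F G] by blast+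
  have TD: "?T `` {x} - ?C = ?D `` {x}" if x: "x \<in> ?V - ?C" for x
  proof -
    have "?D `` {x} \<subseteq> ?V - ?C"
      using conn_class_subset[of x "glue F G \<union> H"] x V3(1) by auto
    moreover have "(x, y) \<in> ?T \<longleftrightarrow> (x, y) \<in> ?D" if "y \<notin> ?C" for y
      using x that FH by (intro conn_contract[OF F G]) auto
    ultimately show ?thesis by blast
  qed
  \<comment> \<open>Removing \<open>?C\<close> loses no information: each loop in \<open>?K2\<close>
    keeps a point of \<open>?B\<close>, and that point determines its component.\<close>
  have "bij_betw (\<lambda>K. K - ?C) ?K2 ?K3"
    unfolding bij_betw_def
  proof
    show "inj_on (\<lambda>K. K - ?C) ?K2"
    proof (rule inj_onI)
      fix K L assume KL: "K \<in> ?K2" "L \<in> ?K2" "K - ?C = L - ?C"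
      then obtain z where z: "z \<in> K" "z \<in> ?B" by auto
      then have "z \<in> L" using KL(3) FH by blast
      moreover obtain x y where xy: "K = ?T `` {x}" "L = ?T `` {y}"
        using KL(1,2) by (blast elim: quotientE)
      ultimately show "K = L" using z by (metis Image_singleton_iff conn_class_eq)
    qed
    show "(\<lambda>K. K - ?C) ` ?K2 = ?K3"
    proof (intro equalityI subsetI)
      fix L assume "L \<in> (\<lambda>K. K - ?C) ` ?K2"
      then obtain K x z where K: "L = K - ?C" "K = ?T `` {x}" "K \<subseteq> ?C \<union> ?B" "z \<in> K" "z \<in> ?B"
        by (blast elim: quotientE)
      then have "K = ?T `` {z}" by (metis Image_singleton_iff conn_class_eq)
      moreover have z: "z \<in> ?V - ?C" using K FH by blast
      ultimately have "L = ?D `` {z}" using K TD by simp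
      then have "L \<in> (?V - ?C) // ?D" using z by (auto intro: quotientI)
      then show "L \<in> ?K3" using K(1,3) unfolding V3 by blast
    next
      fix L assume "L \<in> ?K3"
      then have "L \<in> (?V - ?C) // ?D" and LB: "L \<subseteq> ?B" unfolding V3 by simp_all
      then obtain x where x: "x \<in> ?V - ?C" "L = ?D `` {x}" by (elim quotientE)
      then have L: "L = ?T `` {x} - ?C" using TD by simp
      have "x \<in> L" using x(2) by simp
      then have "x \<in> ?B" using LB by blast
      moreover have "?T `` {x} \<in> ?V // ?T" using x by (blast intro: quotientI)
      moreover have "?T `` {x} \<subseteq> ?C \<union> ?B" using LB L by blast
      moreover have "x \<in> ?T `` {x}" by simp
      ultimately have "?T `` {x} \<in> ?K2" by blast
      then show "L \<in> (\<lambda>K. K - ?C) ` ?K2" using L by blast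
    qed
  qed
  then have "card ?K2 = card ?K3" by (rule bij_betw_same_card)
  moreover have "finite ?K1" "finite ?K2"
    using finite_subset[OF _ finK, of ?K1] finite_subset[OF _ finK, of ?K2] K by blast+
  then have "card (?K1 \<union> ?K2) = card ?K1 + card ?K2" using disj by (rule card_Un_disjoint)
  moreover note arg_cong[OF K, of card]
  ultimately show ?thesis unfolding cycles_def by linarith
qed

end

text \<open>Reversing the order of the three layers exchanges the two sides up to commutativity of
  gluing, and the descriptions of the triple stack do not see the reversal.\<close>

lemma
  assumes "matching F" "matching G" "matching H" "\<Union>F \<inter> \<Union>H = {}"
  shows glue_assoc: "glue (glue F G) H = glue F (glue G H)"
    and cycles_assoc: "cycles F G + cycles (glue F G) H = cycles G H + cycles F (glue G H)"
proof -
  have HF: "\<Union>H \<inter> \<Union>F = {}" using assms(4) by blast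
  have c: "\<Union>H \<union> \<Union>G \<union> \<Union>F = \<Union>F \<union> \<Union>G \<union> \<Union>H" "H \<union> G \<union> F = F \<union> G \<union> H"
    "\<Union>H \<inter> \<Union>G \<union> \<Union>G \<inter> \<Union>F = \<Union>F \<inter> \<Union>G \<union> \<Union>G \<inter> \<Union>H" by auto
  show "glue (glue F G) H = glue F (glue G H)"
    unfolding glue_commute[of G H] glue_commute[of F "glue H G"]
    by (simp only: set_eq_iff glue_glue_iff[OF assms] glue_glue_iff[OF assms(3,2,1) HF] c simp_thms)
  show "cycles F G + cycles (glue F G) H = cycles G H + cycles F (glue G H)"
    using cycles_glue[OF assms] cycles_glue[OF assms(3,2,1) HF, unfolded c]
    unfolding cycles_commute[of H G] glue_commute[of H G] cycles_commute[of "glue G H" F] by linarith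
qed

section \<open>Relabelling points along an injection\<close>

lemma matching_image:
  assumes "matching F" "inj_on f (\<Union>F)"
  shows "matching (image f ` F)"
  unfolding matching_def
proof (intro conjI ballI)
  show "finite (image f ` F)" using assms by (simp add: matching_def)
  show "card e = 2" if e: "e \<in> image f ` F" for e
  proof -
    obtain e' where "e' \<in> F" "e = f ` e'" using e by blast
    moreover from this have "inj_on f e'" using assms(2) by (meson Union_upper inj_on_subset)
    ultimately show ?thesis using assms(1) by (simp add: card_image matching_def)
  qed
  show "disjoint (image f ` F)"
  proof (rule disjointI)
    fix d e assume "d \<in> image f ` F" "e \<in> image f ` F" "d \<noteq> e"
    then obtain d' e' where de: "d' \<in> F" "e' \<in> F" "d = f ` d'" "e = f ` e'" "d' \<noteq> e'" by blast
    then have "d' \<inter> e' = {}" using assms(1) by (auto simp: matching_def disjoint_def)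
    moreover have "d \<inter> e = f ` (d' \<inter> e')"
      using de inj_on_image_Int[OF assms(2), of d' e'] by (auto)
    ultimately show "d \<inter> e = {}" by simp
  qed
qed

lemma conn_image_iff:
  assumes "inj f"
  shows "(f x, f y) \<in> conn (image f ` F) \<longleftrightarrow> (x, y) \<in> conn F"
proof
  assume "(f x, f y) \<in> conn (image f ` F)"
  then have "\<exists>z. f y = f z \<and> (x, z) \<in> conn F"
  proof (induction rule: conn_induct)
    case refl
    then show ?case by (intro exI[of _ x]) simp
  next
    case (step u v)
    then obtain z where z: "u = f z" "(x, z) \<in> conn F" by blast
    obtain e where e: "e \<in> F" "{u, v} = f ` e" using step by blast
    then have "v \<in> f ` e" by auto
    then obtain z' where z': "v = f z'" "z' \<in> e" by blast
    have "f ` e = f ` {z, z'}" using e z z' by simp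
    then have "e = {z, z'}" using inj_image_eq_iff[OF assms] by metis
    then show ?case using z z' e(1) conn_edge conn_trans by metis
  qed
  then show "(x, y) \<in> conn F" using assms by (auto dest: injD)
next
  assume "(x, y) \<in> conn F"
  then show "(f x, f y) \<in> conn (image f ` F)"
  proof (induction rule: conn_induct)
    case (step y z)
    have "{f y, f z} \<in> image f ` F" using step(2) by (intro image_eqI[of _ _ "{y, z}"]) auto
    then show ?case using step conn_edge conn_trans by metis
  qed simp
qed

lemma conn_image_class:
  assumes "inj f"
  shows "conn (image f ` F) `` {f x} = f ` (conn F `` {x})"
proof -
  have "\<exists>z. y = f z" if "(f x, y) \<in> conn (image f ` F)" for y
    using that by (induction rule: conn_induct) auto
  then show ?thesis using conn_image_iff[OF assms] by fastforce
qed

lemma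
  assumes f: "inj f"
  shows glue_image: "glue (image f ` G) (image f ` H) = image f ` glue G H"
    and cycles_image: "cycles (image f ` G) (image f ` H) = cycles G H"
proof -
  have U: "\<Union>(image f ` G) = f ` \<Union>G" for G by blast
  have I: "f ` \<Union>G \<inter> f ` \<Union>H = f ` (\<Union>G \<inter> \<Union>H)" by (rule image_Int[OF f, symmetric])
  have q: "(f ` \<Union>G \<union> f ` \<Union>H) // conn (image f ` (G \<union> H)) = image f ` ((\<Union>G \<union> \<Union>H) // conn (G \<union> H))"
    unfolding image_Un[symmetric] quotient_def by (auto simp: conn_image_class[OF f])
  show "glue (image f ` G) (image f ` H) = image f ` glue G H"
    unfolding glue_def U I image_Un[symmetric, of "image f"] q
    by (auto simp: image_image image_set_diff[OF f, symmetric])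
  have "{C \<in> image f ` ((\<Union>G \<union> \<Union>H) // conn (G \<union> H)). C \<subseteq> f ` (\<Union>G \<inter> \<Union>H)} =
      image f ` {C \<in> (\<Union>G \<union> \<Union>H) // conn (G \<union> H). C \<subseteq> \<Union>G \<inter> \<Union>H}"
    by (simp only: inj_image_subset_iff[OF f, symmetric]) blast
  then have "bij_betw (image f) {C \<in> (\<Union>G \<union> \<Union>H) // conn (G \<union> H). C \<subseteq> \<Union>G \<inter> \<Union>H}
    {C \<in> (f ` \<Union>G \<union> f ` \<Union>H) // conn (image f ` (G \<union> H)). C \<subseteq> f ` (\<Union>G \<inter> \<Union>H)}"
    unfolding bij_betw_def q by (simp add: inj_on_def inj_image_eq_iff[OF f])
  then show "cycles (image f ` G) (image f ` H) = cycles G H"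
    unfolding cycles_def U I image_Un[symmetric, of "image f"] by (rule bij_betw_same_card[symmetric])
qed

section \<open>Brauer diagrams\<close>

definition points :: "diagram \<Rightarrow> point set" where
  "points g = Bot ` {..<n_bot g} \<union> Top ` {..<n_top g}"

lemma points_simps [simp]:
  "Bot i \<in> points g \<longleftrightarrow> i < n_bot g" "Top i \<in> points g \<longleftrightarrow> i < n_top g" "Mid i \<notin> points g"
  by (auto simp: points_def)

lemma finite_points [simp]: "finite (points g)"
  by (simp add: points_def)

lemma brauer_diagram_iff: "brauer_diagram g \<longleftrightarrow> matching (strands g) \<and> \<Union>(strands g) = points g"
proof -
  have "finite (strands g)" if "\<Union>(strands g) = points g"
    using that finite_UnionD[of "strands g"] by simp
  then show ?thesis
    by (auto simp: brauer_diagram_def partition_on_def matching_def points_def)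
qed

lemma strand_cases:
  assumes "brauer_diagram g" "x \<in> points g"
  obtains y where "{x, y} \<in> strands g" "x \<noteq> y" "y \<in> points g"
proof -
  have "x \<in> \<Union>(strands g)" using assms by (simp add: brauer_diagram_iff)
  moreover have "matching (strands g)" using assms(1) by (simp add: brauer_diagram_iff)
  ultimately obtain y where y: "{x, y} \<in> strands g" "x \<noteq> y" using matching_edge_in by metis
  then have "y \<in> \<Union>(strands g)" by blast
  then show ?thesis using that y assms by (auto simp: brauer_diagram_iff)
qed

lemma strand_points: "brauer_diagram g \<Longrightarrow> {x, y} \<in> strands g \<Longrightarrow> x \<in> points g \<and> y \<in> points g \<and> x \<noteq> y"
  unfolding brauer_diagram_iff using matching_edge[of "strands g" "{x, y}"]
  by (auto simp: doubleton_eq_iff)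

lemma inj_on_bot_to_mid: "inj_on bot_to_mid (points g)"
  by (auto simp: inj_on_def points_def)

lemma inj_on_top_to_mid: "inj_on top_to_mid (points g)"
  by (auto simp: inj_on_def points_def)

text \<open>
  The points of the stack of two diagrams, and those of a stack of three, are addressed by row
  and column; \<open>place r q s\<close> puts the three rows of a \<open>point\<close> into rows \<open>r\<close>, \<open>q\<close>, \<open>s\<close>.
\<close>

primrec place :: "nat \<Rightarrow> nat \<Rightarrow> nat \<Rightarrow> point \<Rightarrow> nat \<times> nat" where
  "place r q s (Bot i) = (r, i)"
| "place r q s (Mid i) = (q, i)"
| "place r q s (Top i) = (s, i)"

text \<open>The middle argument of \<open>place\<close> is a dummy here, since a Brauer diagram has
  no points \<open>Mid\<close>.\<close>

definition rows :: "nat \<Rightarrow> nat \<Rightarrow> diagram \<Rightarrow> (nat \<times> nat) set set" where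
  "rows r s g = image (place r r s) ` strands g"

lemma inj_place: "r \<noteq> q \<Longrightarrow> q \<noteq> s \<Longrightarrow> r \<noteq> s \<Longrightarrow> inj (place r q s)"
proof (rule injI)
  fix x y assume "r \<noteq> q" "q \<noteq> s" "r \<noteq> s" "place r q s x = place r q s y"
  then show "x = y" by (cases x; cases y) auto
qed

lemma
  assumes g: "brauer_diagram g" and rs: "r \<noteq> s"
  shows matching_rows: "matching (rows r s g)"
    and Union_rows: "\<Union>(rows r s g) = {r} \<times> {..<n_bot g} \<union> {s} \<times> {..<n_top g}"
proof -
  have "inj_on (place r r s) (points g)" using rs by (auto simp: inj_on_def points_def)
  then show "matching (rows r s g)"
    using g unfolding rows_def brauer_diagram_iff by (intro matching_image) auto
  have "\<Union>(rows r s g) = place r r s ` points g"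
    using g unfolding rows_def brauer_diagram_iff by (metis image_Union)
  then show "\<Union>(rows r s g) = {r} \<times> {..<n_bot g} \<union> {s} \<times> {..<n_top g}"
    by (auto simp: points_def image_Un image_image)
qed

lemma rows_eqD:
  assumes "brauer_diagram g" "brauer_diagram h" "r \<noteq> s" "rows r s g = rows r s h"
  shows "strands g = strands h"
proof -
  \<comment> \<open>\<open>Suc (r + s)\<close> is merely a row other than \<open>r\<close> and
    \<open>s\<close>; it makes the map injective on all points, and on the points of a diagram
    nothing changes.\<close>
  let ?f = "place r (Suc (r + s)) s"
  have f: "inj ?f" using assms(3) by (intro inj_place) auto
  have "place r r s ` e = ?f ` e" if "e \<in> strands k" "brauer_diagram k" for e k
  proof (rule image_cong)
    fix x assume "x \<in> e"
    then have "x \<in> points k" using that by (auto simp: brauer_diagram_iff)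
    then show "place r r s x = ?f x" by (auto simp: points_def)
  qed simp
  then have "image ?f ` strands g = image ?f ` strands h"
    using assms by (simp add: rows_def cong: image_cong_simp)
  then show ?thesis
    using inj_image_eq_iff[of "image ?f"] f by (simp add: inj_on_def inj_image_eq_iff)
qed

context
  fixes g h :: diagram
  assumes g: "brauer_diagram g" and h: "brauer_diagram h" and gh: "n_top h = n_bot g"
begin

abbreviation (input) "upper \<equiv> image bot_to_mid ` strands g"
abbreviation (input) "lower \<equiv> image top_to_mid ` strands h"

lemma matching_upper: "matching upper" and matching_lower: "matching lower"
  using g h unfolding brauer_diagram_iff
  by (auto intro!: matching_image simp: inj_on_bot_to_mid inj_on_top_to_mid)

lemma Union_upper: "\<Union>upper = Mid ` {..<n_bot g} \<union> Top ` {..<n_top g}"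
proof -
  have "\<Union>upper = bot_to_mid ` points g" using g unfolding brauer_diagram_iff by (metis image_Union)
  then show ?thesis by (auto simp: points_def image_Un image_image)
qed

lemma Union_lower: "\<Union>lower = Bot ` {..<n_bot h} \<union> Mid ` {..<n_top h}"
proof -
  have "\<Union>lower = top_to_mid ` points h" using h unfolding brauer_diagram_iff by (metis image_Union)
  then show ?thesis by (auto simp: points_def image_Un image_image)
qed

lemma stack_vertices:
  "Bot ` {..<n_bot h} \<union> Mid ` {..<n_top h} \<union> Top ` {..<n_top g} = \<Union>upper \<union> \<Union>lower"
  "\<Union>upper \<inter> \<Union>lower = Mid ` {..<n_bot g}"
  unfolding Union_upper Union_lower using gh by auto

lemma stack_components_eq: "stack_components g h = (\<Union>upper \<union> \<Union>lower) // conn (upper \<union> lower)"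
  unfolding stack_components_def stack_vertices conn_def ..

lemma stack_component_Mid:
  assumes "C \<in> stack_components g h"
  shows "C \<inter> range Mid = C \<inter> Mid ` {..<n_bot g}"
proof -
  obtain x where x: "x \<in> \<Union>upper \<union> \<Union>lower" "C = conn (upper \<union> lower) `` {x}"
    using assms unfolding stack_components_eq by (elim quotientE)
  then have "C \<subseteq> \<Union>upper \<union> \<Union>lower" using conn_class_subset[of x "upper \<union> lower"] by simp
  then show ?thesis unfolding stack_vertices(1)[symmetric] using gh by auto
qed

text \<open>The points covered by both layers are exactly the middle points of the stack, so
  removing \<open>range Mid\<close> from a component is the removal that occurs in
  \<open>glue\<close>.\<close>

lemma strands_stack: "strands (stack g h) = glue upper lower"
proof -
  have "C - range Mid = C - Mid ` {..<n_bot g}" if "C \<in> stack_components g h" for C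
    using stack_component_Mid[OF that] by blast
  then have "(\<lambda>C. C - range Mid) ` stack_components g h = (\<lambda>C. C - Mid ` {..<n_bot g}) ` stack_components g h"
    by (intro image_cong) auto
  then show ?thesis unfolding glue_def stack_vertices(2) stack_components_eq[symmetric] stack_def by simp
qed

lemma loops_eq: "loops g h = cycles upper lower"
proof -
  have "C \<subseteq> range Mid \<longleftrightarrow> C \<subseteq> Mid ` {..<n_bot g}" if "C \<in> stack_components g h" for C
    using stack_component_Mid[OF that] by blast
  then have "{C \<in> stack_components g h. C \<subseteq> range Mid} = {C \<in> stack_components g h. C \<subseteq> Mid ` {..<n_bot g}}"
    by blast
  then show ?thesis unfolding cycles_def stack_vertices(2) stack_components_eq[symmetric] loops_def by simp
qed

lemma stack_simps [simp]: "n_bot (stack g h) = n_bot h" "n_top (stack g h) = n_top g"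
  by (simp_all add: stack_def)

lemma points_stack: "points (stack g h) = \<Union>upper \<union> \<Union>lower - \<Union>upper \<inter> \<Union>lower"
  unfolding Union_upper Union_lower points_def using gh by auto

lemma brauer_stack: "brauer_diagram (stack g h)"
  unfolding brauer_diagram_iff strands_stack points_stack
  using matching_glue[OF matching_upper matching_lower] Union_glue[OF matching_upper matching_lower]
  by simp

lemma strands_stackI:
  assumes "x \<in> points (stack g h)" "y \<in> points (stack g h)" "x \<noteq> y" "(x, y) \<in> conn (upper \<union> lower)"
  shows "{x, y} \<in> strands (stack g h)"
  unfolding strands_stack glue_iff[OF matching_upper matching_lower] points_stack[symmetric]
  using assms by blast

text \<open>Only one inclusion has to be checked: the strands partition the points, so a family of
  strands that covers all points is complete.\<close>

lemma strands_stack_eqI: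
  assumes "\<And>e. e \<in> R \<Longrightarrow> \<exists>x y. e = {x, y} \<and> x \<in> points (stack g h) \<and> y \<in> points (stack g h) \<and> x \<noteq> y \<and>
      (x, y) \<in> conn (upper \<union> lower)"
    and "points (stack g h) \<subseteq> \<Union>R"
  shows "strands (stack g h) = R"
proof
  show R: "R \<subseteq> strands (stack g h)" using assms(1) strands_stackI by blast
  show "strands (stack g h) \<subseteq> R"
  proof
    fix e assume e: "e \<in> strands (stack g h)"
    have m: "matching (strands (stack g h))" "\<Union>(strands (stack g h)) = points (stack g h)"
      using brauer_stack by (simp_all add: brauer_diagram_iff)
    obtain x where x: "x \<in> e" using matching_edge[OF m(1) e] by blast
    then obtain e' where "e' \<in> R" "x \<in> e'" using assms(2) e m(2) by blast
    then show "e \<in> R" using matching_eqD[OF m(1) e _ x] R by blast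
  qed
qed

lemma loops_zeroI:
  assumes "\<And>i. i < n_bot g \<Longrightarrow> \<exists>y. (Mid i, y) \<in> conn (upper \<union> lower) \<and> y \<notin> range Mid"
  shows "loops g h = 0"
proof -
  have "\<not> C \<subseteq> range Mid" if CS: "C \<in> stack_components g h" for C
  proof
    assume C: "C \<subseteq> range Mid"
    obtain x where x: "C = conn (upper \<union> lower) `` {x}"
      using CS unfolding stack_components_eq by (elim quotientE)
    then have "x \<in> C" by simp
    then have "x \<in> Mid ` {..<n_bot g}" using stack_component_Mid[OF CS] C by blast
    then obtain y where "(x, y) \<in> conn (upper \<union> lower)" "y \<notin> range Mid" using assms by blast
    then show False using C x by blast
  qed
  then have "{C \<in> stack_components g h. C \<subseteq> range Mid} = {}" by blast
  then show ?thesis unfolding loops_def by (simp only: card.empty)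
qed

lemma
  assumes "r \<noteq> q" "q \<noteq> s" "r \<noteq> s"
  shows rows_stack: "rows r s (stack g h) = glue (rows q s g) (rows r q h)"
    and loops_rows: "loops g h = cycles (rows q s g) (rows r q h)"
proof -
  let ?f = "place r q s"
  have f: "inj ?f" using assms by (rule inj_place)
  have "?f (bot_to_mid x) = place q q s x" if "x \<in> points g" for x using that by (auto simp: points_def)
  then have "?f ` bot_to_mid ` e = place q q s ` e" if "e \<in> strands g" for e
    using that g unfolding image_image by (intro image_cong) (auto simp: brauer_diagram_iff)
  then have up: "image ?f ` upper = rows q s g" unfolding rows_def image_image[of "image ?f"] by (rule image_cong[OF refl]) simp
  have "?f (top_to_mid x) = place r r q x" if "x \<in> points h" for x using that by (auto simp: points_def)
  then have "?f ` top_to_mid ` e = place r r q ` e" if "e \<in> strands h" for e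
    using that h unfolding image_image by (intro image_cong) (auto simp: brauer_diagram_iff)
  then have low: "image ?f ` lower = rows r q h" unfolding rows_def image_image[of "image ?f"] by (rule image_cong[OF refl]) simp
  have "?f x = place r r s x" if "x \<in> points (stack g h)" for x using that by (auto simp: points_def)
  then have "?f ` e = place r r s ` e" if "e \<in> strands (stack g h)" for e
    using that brauer_stack by (intro image_cong) (auto simp: brauer_diagram_iff)
  then have "image ?f ` strands (stack g h) = rows r s (stack g h)"
    unfolding rows_def by (rule image_cong[OF refl])
  then show "rows r s (stack g h) = glue (rows q s g) (rows r q h)"
    unfolding strands_stack up[symmetric] low[symmetric] glue_image[OF f] by simp
  show "loops g h = cycles (rows q s g) (rows r q h)"
    unfolding loops_eq up[symmetric] low[symmetric] cycles_image[OF f] ..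
qed

end

text \<open>The rows of the triple stack are numbered 0 to 3 from bottom to top, which turns both
  bracketings into gluings of the same three matchings. The identity for \<open>loops\<close> is
  what makes the powers of the loop parameter agree.\<close>

lemma
  assumes f: "brauer_diagram f" and g: "brauer_diagram g" and h: "brauer_diagram h"
    and fg: "n_top g = n_bot f" and gh: "n_top h = n_bot g"
  shows stack_assoc: "stack (stack f g) h = stack f (stack g h)"
    and loops_assoc: "loops f g + loops (stack f g) h = loops g h + loops f (stack g h)"
proof -
  let ?F = "rows 2 3 f" and ?G = "rows 1 2 g" and ?H = "rows 0 1 h"
  have FGH: "matching ?F" "matching ?G" "matching ?H" using matching_rows f g h by simp_all
  have disj: "\<Union>?F \<inter> \<Union>?H = {}" by (subst Union_rows[OF f], simp, subst Union_rows[OF h]) auto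
  have bfg: "brauer_diagram (stack f g)" and bgh: "brauer_diagram (stack g h)"
    using brauer_stack[OF f g fg] brauer_stack[OF g h gh] .
  have c1: "n_top h = n_bot (stack f g)" and c2: "n_top (stack g h) = n_bot f"
    using fg gh by (simp_all add: stack_def)
  have l: "rows 0 3 (stack (stack f g) h) = glue (glue ?F ?G) ?H"
    by (subst rows_stack[OF bfg h c1, where q=1]) (simp_all add: rows_stack[OF f g fg, where q=2])
  have r: "rows 0 3 (stack f (stack g h)) = glue ?F (glue ?G ?H)"
    by (subst rows_stack[OF f bgh c2, where q=2]) (simp_all add: rows_stack[OF g h gh, where q=1])
  have "strands (stack (stack f g) h) = strands (stack f (stack g h))"
    using brauer_stack[OF bfg h c1] brauer_stack[OF f bgh c2]
  proof (rule rows_eqD[where r=0 and s=3])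
    show "rows 0 3 (stack (stack f g) h) = rows 0 3 (stack f (stack g h))"
      unfolding l r by (rule glue_assoc[OF FGH disj])
  qed simp
  then show "stack (stack f g) h = stack f (stack g h)" by (simp add: stack_def)
  have "loops (stack f g) h = cycles (glue ?F ?G) ?H"
    by (subst loops_rows[OF bfg h c1, of 0 1 3]) (simp_all add: rows_stack[OF f g fg, where q=2])
  moreover have "loops f (stack g h) = cycles ?F (glue ?G ?H)"
    by (subst loops_rows[OF f bgh c2, of 0 2 3]) (simp_all add: rows_stack[OF g h gh, where q=1])
  moreover have "loops f g = cycles ?F ?G" by (rule loops_rows[OF f g fg]) simp_all
  moreover have "loops g h = cycles ?G ?H" by (rule loops_rows[OF g h gh]) simp_all
  ultimately show "loops f g + loops (stack f g) h = loops g h + loops f (stack g h)"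
    using cycles_assoc[OF FGH disj] by linarith
qed

subsection \<open>Diagrams without cups or caps\<close>

definition lift :: "(nat \<Rightarrow> nat) \<Rightarrow> point \<Rightarrow> point" where
  "lift f x = (case x of Bot i \<Rightarrow> Bot (f i) | _ \<Rightarrow> x)"

lemma lift_simps [simp]: "lift f (Bot i) = Bot (f i)" "lift f (Mid i) = Mid i" "lift f (Top i) = Top i"
  by (simp_all add: lift_def)

text \<open>Here \<open>f i\<close> is the bottom end of the strand at top point \<open>i\<close> of
  \<open>h\<close>. Every middle point is led straight down, so the composite is \<open>g\<close>
  with a relabelled bottom row together with the caps of \<open>h\<close>, and no loop can
  close.\<close>

lemma stack_without_cups:
  assumes g: "brauer_diagram g" and h: "brauer_diagram h" and gh: "n_top h = n_bot g"
    and f: "\<And>i. i < n_top h \<Longrightarrow> {Bot (f i), Top i} \<in> strands h"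
  shows "strands (stack g h) = image (lift f) ` strands g \<union> caps h" "loops g h = 0"
proof -
  note [simp] = stack_simps[OF g h gh]
  let ?E = "image bot_to_mid ` strands g \<union> image top_to_mid ` strands h"
  have mh: "matching (strands h)" using h by (simp add: brauer_diagram_iff)
  have fM: "(Bot (f i), Mid i) \<in> conn ?E" if "i < n_top h" for i
  proof (rule conn_edge)
    have "top_to_mid ` {Bot (f i), Top i} \<in> image top_to_mid ` strands h" using f[OF that] by (rule imageI)
    then show "{Bot (f i), Mid i} \<in> ?E" by simp
  qed
  have finj: "i = j" if "i < n_top h" "j < n_top h" "f i = f j" for i j
    using matching_partner[OF mh f[OF that(1)], of "Top j"] f[OF that(2)] that(3) by simp
  have fb: "f i < n_bot h" if "i < n_top h" for i using strand_points[OF h f[OF that]] by simp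
  have lift_conn: "(lift f x, bot_to_mid x) \<in> conn ?E" if "x \<in> points g" for x
    using that fM gh by (cases x) auto
  have lift_pt: "lift f x \<in> points (stack g h)" if "x \<in> points g" for x
    using that fb gh by (cases x) auto
  have lift_inj: "lift f x \<noteq> lift f y" if "x \<in> points g" "y \<in> points g" "x \<noteq> y" for x y
    using that finj gh by (cases x; cases y) auto
  show "strands (stack g h) = image (lift f) ` strands g \<union> caps h"
  proof (rule strands_stack_eqI[OF g h gh])
    fix e assume "e \<in> image (lift f) ` strands g \<union> caps h"
    then consider e' where "e' \<in> strands g" "e = lift f ` e'" | "e \<in> strands h" "e \<subseteq> range Bot"
      by (auto simp: caps_def)
    then show "\<exists>x y. e = {x, y} \<and> x \<in> points (stack g h) \<and> y \<in> points (stack g h) \<and> x \<noteq> y \<and>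
      (x, y) \<in> conn ?E"
    proof cases
      case 1
      then obtain x y where xy: "e' = {x, y}" "x \<noteq> y"
        using g matching_edge[of "strands g" e'] by (auto simp: brauer_diagram_iff)
      then have pts: "x \<in> points g" "y \<in> points g" using strand_points[OF g] 1 by blast+
      have "bot_to_mid ` {x, y} \<in> ?E" using 1(1) xy by blast
      then have "(bot_to_mid x, bot_to_mid y) \<in> conn ?E" by (intro conn_edge) simp
      then have "(lift f x, lift f y) \<in> conn ?E"
        using lift_conn[OF pts(1)] conn_sym[OF lift_conn[OF pts(2)]] conn_trans by metis
      then show ?thesis
        using xy 1(2) lift_pt pts lift_inj[OF pts] by (intro exI[of _ "lift f x"] exI[of _ "lift f y"]) auto
    next
      case 2
      then obtain x y where xy: "e = {x, y}" "x \<noteq> y" using matching_edge[OF mh] by blast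
      then obtain i j where ij: "x = Bot i" "y = Bot j" using 2 by blast
      have "x \<in> points h" "y \<in> points h" using strand_points[OF h] 2 xy by blast+
      then have "x \<in> points (stack g h)" "y \<in> points (stack g h)" using ij by auto
      moreover have "top_to_mid ` e \<in> ?E" using 2(1) by blast
      then have "(x, y) \<in> conn ?E" using xy ij by (intro conn_edge) simp
      ultimately show ?thesis using xy by blast
    qed
  next
    show "points (stack g h) \<subseteq> \<Union>(image (lift f) ` strands g \<union> caps h)"
    proof
      fix x assume x: "x \<in> points (stack g h)"
      show "x \<in> \<Union>(image (lift f) ` strands g \<union> caps h)"
      proof (cases x)
        case (Bot i)
        then have "x \<in> points h" using x by simp
        then obtain y where y: "{x, y} \<in> strands h" "y \<in> points h" using strand_cases[OF h] by metis
        show ?thesis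
        proof (cases y)
          case (Bot j)
          then have "{x, y} \<in> caps h" using y \<open>x = Bot i\<close> by (auto simp: caps_def)
          then show ?thesis by blast
        next
          case (Top j)
          then have j: "j < n_top h" using y by simp
          then have "{y, x} \<in> strands h" "{y, Bot (f j)} \<in> strands h"
            using f[OF j] y(1) Top by (simp_all add: insert_commute)
          then have "x = Bot (f j)" by (rule matching_partner[OF mh])
          moreover obtain z where "{Bot j, z} \<in> strands g"
            using strand_cases[OF g, of "Bot j"] j gh by auto
          then have "lift f ` {Bot j, z} \<in> image (lift f) ` strands g" by (rule imageI)
          ultimately have "lift f ` {Bot j, z} \<in> image (lift f) ` strands g" "x \<in> lift f ` {Bot j, z}"
            by auto
          then show ?thesis by blast
        qed (use y in auto)
      next
        case (Top i)
        then obtain z where "{Top i, z} \<in> strands g"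
          using strand_cases[OF g, of "Top i"] x by auto
        then have "lift f ` {Top i, z} \<in> image (lift f) ` strands g" by (rule imageI)
        moreover have "x \<in> lift f ` {Top i, z}" using Top by simp
        ultimately have "lift f ` {Top i, z} \<in> image (lift f) ` strands g" "x \<in> lift f ` {Top i, z}"
          by blast+
        then show ?thesis by blast
      qed (use x in auto)
    qed
  qed
  show "loops g h = 0"
  proof (rule loops_zeroI[OF g h gh])
    fix i assume "i < n_bot g"
    then have "(Mid i, Bot (f i)) \<in> conn ?E" using fM[of i] gh conn_sym by metis
    then show "\<exists>y. (Mid i, y) \<in> conn ?E \<and> y \<notin> range Mid" by blast
  qed
qed

lemma perm_diagram_simps [simp]: "n_bot (perm_diagram m s) = m" "n_top (perm_diagram m s) = m"
  by (simp_all add: perm_diagram_def)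

lemma brauer_perm_diagram:
  assumes "s permutes {..<m}"
  shows "brauer_diagram (perm_diagram m s)"
proof -
  have inj: "s i = s j \<longleftrightarrow> i = j" for i j using permutes_inj[OF assms] by (auto dest: injD)
  have "Top ` {..<m} = Top ` s ` {..<m}" using permutes_image[OF assms] by simp
  then have "\<Union>(strands (perm_diagram m s)) = points (perm_diagram m s)"
    unfolding perm_diagram_def points_def by auto
  then show ?thesis
    unfolding brauer_diagram_iff matching_def perm_diagram_def
    by (auto simp: disjoint_def inj)
qed

lemma caps_perm [simp]: "caps (perm_diagram m s) = {}" and cups_perm [simp]: "cups (perm_diagram m s) = {}"
  by (auto simp: caps_def cups_def perm_diagram_def)

lemma perm_diagram_inj:
  assumes "s permutes {..<m}" "t permutes {..<m}" "perm_diagram m s = perm_diagram m t"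
  shows "s = t"
proof
  fix i
  show "s i = t i"
  proof (cases "i < m")
    case True
    then have "{Bot i, Top (s i)} \<in> strands (perm_diagram m t)"
      using assms(3)[symmetric] by (simp add: perm_diagram_def)
    then obtain j where "{Bot i, Top (s i)} = {Bot j, Top (t j)}"
      unfolding perm_diagram_def diagram.simps by (rule imageE)
    then show ?thesis by (auto simp: doubleton_eq_iff)
  next
    case False
    then show ?thesis using assms by (simp add: permutes_def)
  qed
qed

lemma stack_id_left:
  assumes h: "brauer_diagram h"
  shows "stack (perm_diagram (n_top h) id) h = h" "loops (perm_diagram (n_top h) id) h = 0"
proof -
  let ?g = "perm_diagram (n_top h) id"
  have g: "brauer_diagram ?g" by (intro brauer_perm_diagram permutes_id)
  have gh: "n_top h = n_bot ?g" by simp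
  note [simp] = stack_simps[OF g h gh]
  let ?E = "image bot_to_mid ` strands ?g \<union> image top_to_mid ` strands h"
  have M: "(Top i, Mid i) \<in> conn ?E" if "i < n_top h" for i
  proof (rule conn_edge)
    have "bot_to_mid ` {Bot i, Top i} \<in> image bot_to_mid ` strands ?g"
      using that by (intro imageI) (auto simp: perm_diagram_def)
    then show "{Top i, Mid i} \<in> ?E" by (simp add: insert_commute)
  qed
  have conn: "(x, top_to_mid x) \<in> conn ?E" if "x \<in> points h" for x
    using that M by (cases x) auto
  have pts: "points (stack ?g h) = points h" by (simp add: points_def)
  have "strands (stack ?g h) = strands h"
  proof (rule strands_stack_eqI[OF g h gh], unfold pts)
    fix e assume e: "e \<in> strands h"
    then obtain x y where xy: "e = {x, y}" "x \<noteq> y"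
      using h matching_edge[of "strands h" e] by (auto simp: brauer_diagram_iff)
    then have p: "x \<in> points h" "y \<in> points h" using strand_points[OF h] e by blast+
    have "top_to_mid ` {x, y} \<in> ?E" using e xy by blast
    then have "(top_to_mid x, top_to_mid y) \<in> conn ?E" by (intro conn_edge) simp
    then have "(x, y) \<in> conn ?E"
      using conn[OF p(1)] conn_sym[OF conn[OF p(2)]] conn_trans by metis
    then show "\<exists>x y. e = {x, y} \<and> x \<in> points h \<and> y \<in> points h \<and> x \<noteq> y \<and> (x, y) \<in> conn ?E"
      using xy p by blast
  qed (use h in \<open>simp add: brauer_diagram_iff\<close>)
  then show "stack ?g h = h" by (simp add: stack_def)
  show "loops ?g h = 0"
  proof (rule loops_zeroI[OF g h gh])
    fix i assume "i < n_bot ?g"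
    then have "(Mid i, Top i) \<in> conn ?E" using M[of i] conn_sym by simp
    then show "\<exists>y. (Mid i, y) \<in> conn ?E \<and> y \<notin> range Mid" by blast
  qed
qed

lemma without_cupsE:
  assumes h: "brauer_diagram h" and "cups h = {}"
  obtains f where "\<And>i. i < n_top h \<Longrightarrow> {Bot (f i), Top i} \<in> strands h" "inj_on f {..<n_top h}"
    "f ` {..<n_top h} \<subseteq> {..<n_bot h}"
proof -
  have "\<exists>j. {Bot j, Top i} \<in> strands h" if "i < n_top h" for i
  proof -
    have "Top i \<in> points h" using that by simp
    then obtain y where y: "{Top i, y} \<in> strands h" "y \<in> points h" using strand_cases[OF h] by metis
    show ?thesis
    proof (cases y)
      case (Top j)
      then have "{Top i, y} \<in> cups h" using y by (auto simp: cups_def)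
      then show ?thesis using assms by simp
    qed (use y in \<open>auto simp: insert_commute\<close>)
  qed
  then obtain f where f: "\<And>i. i < n_top h \<Longrightarrow> {Bot (f i), Top i} \<in> strands h" by metis
  have "inj_on f {..<n_top h}"
  proof (rule inj_onI)
    fix i j assume "i \<in> {..<n_top h}" "j \<in> {..<n_top h}" "f i = f j"
    then have "Top i = Top j"
      using matching_partner[of "strands h" "Bot (f i)" "Top i" "Top j"] f[of i] f[of j] h
      by (auto simp: brauer_diagram_iff)
    then show "i = j" by simp
  qed
  moreover have "f ` {..<n_top h} \<subseteq> {..<n_bot h}" using strand_points[OF h f] by auto
  ultimately show ?thesis using that f by blast
qed

lemma without_capsE:
  assumes h: "brauer_diagram h" and "caps h = {}"
  obtains f where "\<And>i. i < n_bot h \<Longrightarrow> {Bot i, Top (f i)} \<in> strands h" "inj_on f {..<n_bot h}"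
    "f ` {..<n_bot h} \<subseteq> {..<n_top h}"
proof -
  have "\<exists>j. {Bot i, Top j} \<in> strands h" if "i < n_bot h" for i
  proof -
    have "Bot i \<in> points h" using that by simp
    then obtain y where y: "{Bot i, y} \<in> strands h" "y \<in> points h" using strand_cases[OF h] by metis
    show ?thesis
    proof (cases y)
      case (Bot j)
      then have "{Bot i, y} \<in> caps h" using y by (auto simp: caps_def)
      then show ?thesis using assms by simp
    qed (use y in auto)
  qed
  then obtain f where f: "\<And>i. i < n_bot h \<Longrightarrow> {Bot i, Top (f i)} \<in> strands h" by metis
  have "inj_on f {..<n_bot h}"
  proof (rule inj_onI)
    fix i j assume "i \<in> {..<n_bot h}" "j \<in> {..<n_bot h}" "f i = f j"
    then have "Bot i = Bot j"
      using matching_partner[of "strands h" "Top (f i)" "Bot i" "Bot j"] f[of i] f[of j] h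
      by (auto simp: brauer_diagram_iff insert_commute)
    then show "i = j" by simp
  qed
  moreover have "f ` {..<n_bot h} \<subseteq> {..<n_top h}" using strand_points[OF h f] by auto
  ultimately show ?thesis using that f by blast
qed

lemma without_cups_le: "brauer_diagram h \<Longrightarrow> cups h = {} \<Longrightarrow> n_top h \<le> n_bot h"
  by (metis without_cupsE card_inj_on_le card_lessThan finite_lessThan)

lemma without_caps_le: "brauer_diagram h \<Longrightarrow> caps h = {} \<Longrightarrow> n_bot h \<le> n_top h"
  by (metis without_capsE card_inj_on_le card_lessThan finite_lessThan)

text \<open>Without caps the bottom points are joined to distinct top points, and an injection
  between rows of equal length is onto, which leaves no room for cups.\<close>

lemma perm_diagramE:
  assumes h: "brauer_diagram h" and "caps h = {}" and n: "n_top h = n_bot h"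
  obtains s where "s permutes {..<n_bot h}" "h = perm_diagram (n_bot h) s"
proof -
  obtain f where f: "\<And>i. i < n_bot h \<Longrightarrow> {Bot i, Top (f i)} \<in> strands h" "inj_on f {..<n_bot h}"
    "f ` {..<n_bot h} \<subseteq> {..<n_bot h}" using without_capsE[OF assms(1,2)] n by metis
  define s where "s i = (if i < n_bot h then f i else i)" for i
  have "bij_betw f {..<n_bot h} {..<n_bot h}"
    using f(2,3) by (simp add: bij_betw_def endo_inj_surj)
  then have "bij_betw s {..<n_bot h} {..<n_bot h}"
    by (subst bij_betw_cong[of _ _ f]) (auto simp: s_def)
  then have s: "s permutes {..<n_bot h}"
    by (intro bij_imp_permutes) (auto simp: s_def)
  have sub: "strands (perm_diagram (n_bot h) s) \<subseteq> strands h"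
    using f(1) by (auto simp: perm_diagram_def s_def)
  have "strands h \<subseteq> strands (perm_diagram (n_bot h) s)"
  proof
    fix e assume e: "e \<in> strands h"
    have m: "matching (strands h)" "\<Union>(strands h) = points h" using h by (simp_all add: brauer_diagram_iff)
    obtain x where x: "x \<in> e" using matching_edge[OF m(1) e] by blast
    have "x \<in> points h" using x e m(2) by blast
    also have "points h = points (perm_diagram (n_bot h) s)" using n by (simp add: points_def)
    also have "\<dots> = \<Union>(strands (perm_diagram (n_bot h) s))"
      using brauer_perm_diagram[OF s] by (simp add: brauer_diagram_iff)
    finally obtain e' where "e' \<in> strands (perm_diagram (n_bot h) s)" "x \<in> e'" by blast
    then show "e \<in> strands (perm_diagram (n_bot h) s)" using matching_eqD[OF m(1) e _ x] sub by blast
  qed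
  then have "strands h = strands (perm_diagram (n_bot h) s)" using sub by blast
  then have "h = perm_diagram (n_bot h) s" using n by (simp add: perm_diagram_def)
  then show ?thesis using s that by blast
qed

text \<open>A strand joins bottom \<open>i\<close> to top \<open>s i\<close>, so top point
  \<open>i\<close> is reached from the preimage of \<open>i\<close> under \<open>s\<close>; hence
  the inverse.\<close>

lemma stack_perm_diagram:
  assumes g: "brauer_diagram g" and s: "s permutes {..<n_bot g}"
  shows "strands (stack g (perm_diagram (n_bot g) s)) = image (lift (Hilbert_Choice.inv s)) ` strands g"
    "loops g (perm_diagram (n_bot g) s) = 0"
proof -
  have "{Bot (Hilbert_Choice.inv s i), Top i} \<in> strands (perm_diagram (n_bot g) s)" if "i < n_bot g" for i
    using that permutes_in_image[OF permutes_inv[OF s], of i] permutes_inverses[OF s]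
    by (auto simp: perm_diagram_def intro!: image_eqI[of _ _ "Hilbert_Choice.inv s i"])
  then show "strands (stack g (perm_diagram (n_bot g) s)) = image (lift (Hilbert_Choice.inv s)) ` strands g"
    "loops g (perm_diagram (n_bot g) s) = 0"
    using stack_without_cups[OF g brauer_perm_diagram[OF s], of "Hilbert_Choice.inv s"] by simp_all
qed

lemma stack_perm_perm:
  assumes "s permutes {..<m}" "t permutes {..<m}"
  shows "stack (perm_diagram m s) (perm_diagram m t) = perm_diagram m (s \<circ> t)"
    "loops (perm_diagram m s) (perm_diagram m t) = 0"
proof -
  let ?g = "perm_diagram m s"
  have g: "brauer_diagram ?g" by (rule brauer_perm_diagram[OF assms(1)])
  have t: "t permutes {..<n_bot ?g}" using assms by simp
  have "strands (stack ?g (perm_diagram m t)) = (\<lambda>i. {Bot (Hilbert_Choice.inv t i), Top (s i)}) ` {..<m}"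
    using stack_perm_diagram(1)[OF g t] by (simp add: perm_diagram_def image_image)
  also have "\<dots> = (\<lambda>i. {Bot (Hilbert_Choice.inv t i), Top (s i)}) ` t ` {..<m}" using permutes_image[OF assms(2)] by simp
  also have "\<dots> = (\<lambda>i. {Bot i, Top (s (t i))}) ` {..<m}"
    by (simp add: image_image permutes_inverses[OF assms(2)])
  finally show "stack ?g (perm_diagram m t) = perm_diagram m (s \<circ> t)"
    by (simp add: stack_def perm_diagram_def)
  show "loops ?g (perm_diagram m t) = 0" using stack_perm_diagram(2)[OF g t] by simp
qed

lemma stack_id_right:
  assumes "brauer_diagram g"
  shows "stack g (perm_diagram (n_bot g) id) = g" "loops g (perm_diagram (n_bot g) id) = 0"
proof -
  have "lift id = id" by (rule ext) (simp add: lift_def split: point.split)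
  then have "strands (stack g (perm_diagram (n_bot g) id)) = strands g"
    using stack_perm_diagram(1)[OF assms permutes_id] by simp
  then show "stack g (perm_diagram (n_bot g) id) = g" by (simp add: stack_def)
qed (rule stack_perm_diagram(2)[OF assms permutes_id])

lemma caps_stack:
  assumes "brauer_diagram g" "brauer_diagram h" "n_top h = n_bot g" "cups h = {}"
  shows "caps h \<subseteq> caps (stack g h)"
proof -
  obtain f where "\<And>i. i < n_top h \<Longrightarrow> {Bot (f i), Top i} \<in> strands h"
    using without_cupsE[OF assms(2,4)] by metis
  from stack_without_cups(1)[OF assms(1-3) this] show ?thesis by (auto simp: caps_def)
qed

text \<open>One cap is split off at the bottom: \<open>l\<close> consists of that cap and vertical
  strands from the remaining bottom points, and \<open>u\<close> is the rest of \<open>g\<close> on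
  two points fewer. No loop arises, so the factorization holds whatever the value of the loop
  parameter, zero included.\<close>

lemma factor_cap:
  assumes g: "brauer_diagram g" and cap: "caps g \<noteq> {}"
  obtains u l where "brauer_diagram u" "brauer_diagram l" "n_top l = n_bot u" "n_bot l = n_bot g"
    "n_top u = n_top g" "n_top l < n_bot g" "cups l = {}" "caps l \<noteq> {}" "stack u l = g" "loops u l = 0"
proof -
  have m: "matching (strands g)" "\<Union>(strands g) = points g" using g by (simp_all add: brauer_diagram_iff)
  obtain c where c: "c \<in> strands g" "c \<subseteq> range Bot" using cap by (auto simp: caps_def)
  then obtain x y where xy: "c = {x, y}" "x \<noteq> y" using matching_edge[OF m(1)] by blast
  with c(2) obtain i j where c_eq: "c = {Bot i, Bot j}" and ij: "i \<noteq> j" by auto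
  have ijm: "i < n_bot g" "j < n_bot g" using strand_points[OF g, of "Bot i" "Bot j"] c c_eq by auto
  \<comment> \<open>Two bottom points are used up by the cap.\<close>
  define k where "k = n_bot g - 2"
  have "card ({..<n_bot g} - {i, j}) = k" using ij ijm by (simp add: card_Diff_subset k_def)
  then obtain f where f: "bij_betw f {..<k} ({..<n_bot g} - {i, j})"
    by (metis card_lessThan finite_Diff finite_lessThan finite_same_card_bij)
  then have finj: "inj_on f {..<k}" and fim: "f ` {..<k} = {..<n_bot g} - {i, j}"
    by (auto simp: bij_betw_def)
  define l where "l = \<lparr>n_bot = n_bot g, n_top = k, strands = insert c ((\<lambda>a. {Bot (f a), Top a}) ` {..<k})\<rparr>"
  define P where "P = Bot ` {..<k} \<union> Top ` {..<n_top g}"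
  have linj: "inj_on (lift f) P" using finj by (auto simp: inj_on_def P_def)
  have "lift f ` P = Bot ` f ` {..<k} \<union> Top ` {..<n_top g}" by (simp add: P_def image_Un image_image)
  then have lim: "lift f ` P = points g - c" unfolding fim c_eq points_def by auto
  \<comment> \<open>\<open>h\<close> undoes the relabelling \<open>lift f\<close>, whose image is
    everything but the two ends of the cap.\<close>
  define h where "h = the_inv_into P (lift f)"
  define u where "u = \<lparr>n_bot = k, n_top = n_top g, strands = image h ` (strands g - {c})\<rparr>"
  have rest: "matching (strands g - {c})" "\<Union>(strands g - {c}) = points g - c"
  proof -
    show "matching (strands g - {c})" using m(1) by (auto simp: matching_def disjoint_def)
    have "e \<inter> c = {}" if "e \<in> strands g - {c}" for e
      using that c(1) m(1) by (auto simp: matching_def disjoint_def)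
    then have "\<Union>(strands g - {c}) \<inter> c = {}" by blast
    moreover have "points g = \<Union>(strands g - {c}) \<union> c" unfolding m(2)[symmetric] using c(1) by blast
    ultimately show "\<Union>(strands g - {c}) = points g - c" by blast
  qed
  have hinj: "inj_on h (points g - c)" unfolding h_def lim[symmetric] by (rule inj_on_the_inv_into[OF linj])
  have him: "h ` (points g - c) = P" unfolding h_def lim[symmetric] by (rule the_inv_into_onto[OF linj])
  have "matching (strands u)" unfolding u_def using rest hinj by (simp add: matching_image)
  moreover have "\<Union>(strands u) = points u"
  proof -
    have "\<Union>(strands u) = h ` \<Union>(strands g - {c})" unfolding u_def by (simp add: image_Union)
    also have "\<dots> = P" unfolding rest(2) him ..
    finally show ?thesis by (simp add: points_def P_def u_def)
  qed
  ultimately have u: "brauer_diagram u" by (simp add: brauer_diagram_iff)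
  have "\<Union>(strands l) = points l"
  proof -
    have "\<Union>(strands l) = {Bot i, Bot j} \<union> Bot ` f ` {..<k} \<union> Top ` {..<k}" by (auto simp: l_def c_eq)
    also have "\<dots> = points l" unfolding fim using ijm by (auto simp: points_def l_def)
    finally show ?thesis .
  qed
  moreover have "matching (strands l)"
  proof -
    have "i \<notin> f ` {..<k}" "j \<notin> f ` {..<k}" unfolding fim by auto
    then show ?thesis
      using ij finj by (auto simp: matching_def disjoint_def l_def c_eq inj_on_eq_iff)
  qed
  ultimately have l: "brauer_diagram l" by (simp add: brauer_diagram_iff)
  have lu: "n_top l = n_bot u" by (simp add: l_def u_def)
  have caps_l: "caps l = {c}" using c(2) by (auto simp: caps_def l_def)
  have "{Bot (f a), Top a} \<in> strands l" if "a < n_top l" for a using that by (simp add: l_def)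
  note st = stack_without_cups[OF u l lu this]
  have hl: "lift f (h x) = x" if "x \<in> points g - c" for x
    using that f_the_inv_into_f[OF linj] unfolding lim[symmetric] h_def by blast
  have "image (lift f) ` strands u = strands g - {c}"
  proof -
    have "lift f ` h ` e = e" if "e \<in> strands g - {c}" for e
    proof -
      have "e \<subseteq> points g - c" using that rest(2) by blast
      then have "lift f ` h ` e = (\<lambda>x. x) ` e" unfolding image_image using hl by (intro image_cong) auto
      then show ?thesis by simp
    qed
    then have "(\<lambda>e. lift f ` h ` e) ` (strands g - {c}) = (\<lambda>e. e) ` (strands g - {c})"
      by (intro image_cong[OF refl])
    then show ?thesis by (simp add: u_def image_image[of "image (lift f)" "image h"])
  qed
  then have "strands (stack u l) = strands g" using st(1) caps_l c(1) by auto
  then have "stack u l = g" using st(1) by (simp add: stack_def l_def u_def)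
  moreover have "cups l = {}" by (auto simp: cups_def l_def c_eq)
  moreover have "k < n_bot g" using ijm ij by (auto simp: k_def)
  ultimately show ?thesis
    using that[of u l] u l lu caps_l st(2) by (simp add: l_def u_def)
qed

section \<open>The algebra \<open>B\<close>\<close>

text \<open>The common shape of the products of \<open>B\<close> and of the group algebra and of the
  action on tabloids, so that each inherits its laws from basis elements.\<close>

definition bilinear_ext ::
  "('x \<Rightarrow> 'y \<Rightarrow> ('z \<Rightarrow>\<^sub>0 'k::field)) \<Rightarrow> ('x \<Rightarrow>\<^sub>0 'k) \<Rightarrow> ('y \<Rightarrow>\<^sub>0 'k) \<Rightarrow> ('z \<Rightarrow>\<^sub>0 'k)" where
  "bilinear_ext m a b = lin_ext (\<lambda>x. lin_ext (m x) b) a"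

lemma bilinear_ext_symbol: "bilinear_ext m (symbol x) (symbol y) = m x y"
  by (simp add: bilinear_ext_def)

lemma bilinear_ext_zero [simp]: "bilinear_ext m 0 b = 0" "bilinear_ext m a 0 = 0"
  by (simp_all add: bilinear_ext_def)

lemma bilinear_ext_add:
  "bilinear_ext m (a + a') b = bilinear_ext m a b + bilinear_ext m a' b"
  "bilinear_ext m a (b + b') = bilinear_ext m a b + bilinear_ext m a b'"
  by (simp_all add: bilinear_ext_def lin_ext_add lin_ext_fun_add)

lemma bilinear_ext_scale:
  "bilinear_ext m (scale c a) b = scale c (bilinear_ext m a b)"
  "bilinear_ext m a (scale c b) = scale c (bilinear_ext m a b)"
  by (simp_all add: bilinear_ext_def lin_ext_scale lin_ext_fun_scale)

lemma bilinear_ext_sum: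
  "bilinear_ext m (sum f S) b = (\<Sum>s\<in>S. bilinear_ext m (f s) b)"
  "bilinear_ext m a (sum g S) = (\<Sum>s\<in>S. bilinear_ext m a (g s))"
  by (induction S rule: infinite_finite_induct) (simp_all add: bilinear_ext_add)

text \<open>Four different basis operations are allowed, so that one statement gives both
  associativity of a product and compatibility of an action with it.\<close>

lemma bilinear_ext_assoc:
  assumes "Poly_Mapping.keys a \<subseteq> A" "Poly_Mapping.keys b \<subseteq> B" "Poly_Mapping.keys c \<subseteq> C"
    and "\<And>x y z. x \<in> A \<Longrightarrow> y \<in> B \<Longrightarrow> z \<in> C \<Longrightarrow>
      bilinear_ext m1 (m2 x y) (symbol z) = bilinear_ext m3 (symbol x) (m4 y z)"
  shows "bilinear_ext m1 (bilinear_ext m2 a b) c = bilinear_ext m3 a (bilinear_ext m4 b c)"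
  using assms(1)
proof (induction rule: free_induct)
  case (symbol x)
  note x = symbol
  show ?case using assms(2)
  proof (induction rule: free_induct)
    case (symbol y)
    note y = symbol
    show ?case using assms(3)
      by (induction rule: free_induct) (simp_all add: bilinear_ext_add bilinear_ext_scale bilinear_ext_symbol assms(4) x y)
  qed (simp_all add: bilinear_ext_add bilinear_ext_scale)
qed (simp_all add: bilinear_ext_add bilinear_ext_scale)

lemma keys_lin_ext_subset:
  assumes "\<And>x. x \<in> Poly_Mapping.keys p \<Longrightarrow> Poly_Mapping.keys (f x) \<subseteq> S"
  shows "Poly_Mapping.keys (lin_ext f p) \<subseteq> S"
proof
  fix y assume "y \<in> Poly_Mapping.keys (lin_ext f p)"
  then have "(\<Sum>x\<in>Poly_Mapping.keys p. Poly_Mapping.lookup p x * Poly_Mapping.lookup (f x) y) \<noteq> 0"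
    by (simp add: in_keys_iff lin_ext_def lookup_sum)
  then obtain x where "x \<in> Poly_Mapping.keys p" "Poly_Mapping.lookup (f x) y \<noteq> 0"
    by (metis (no_types, lifting) mult_zero_right sum.neutral)
  then show "y \<in> S" using assms[of x] by (auto simp: in_keys_iff subset_iff)
qed

lemma keys_bilinear_ext_subset:
  assumes "\<And>x y. x \<in> Poly_Mapping.keys a \<Longrightarrow> y \<in> Poly_Mapping.keys b \<Longrightarrow> Poly_Mapping.keys (m x y) \<subseteq> S"
  shows "Poly_Mapping.keys (bilinear_ext m a b) \<subseteq> S"
  unfolding bilinear_ext_def by (intro keys_lin_ext_subset assms)

lemma keys_add_subset: "Poly_Mapping.keys p \<subseteq> S \<Longrightarrow> Poly_Mapping.keys q \<subseteq> S \<Longrightarrow> Poly_Mapping.keys (p + q) \<subseteq> S"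
  using keys_add[of p q] by blast

lemma keys_scale_subset: "Poly_Mapping.keys p \<subseteq> S \<Longrightarrow> Poly_Mapping.keys (scale c p) \<subseteq> S"
  using keys_scale[of c p] by blast

abbreviation bmult :: "'k::field \<Rightarrow> 'k brauer_element \<Rightarrow> 'k brauer_element \<Rightarrow> 'k brauer_element" where
  "bmult \<delta> \<equiv> bilinear_ext (diagram_mult \<delta>)"

lemma diagram_span_simps [simp]:
  "a \<oplus>\<^bsub>diagram_span \<delta> P\<^esub> b = a + b" "c \<odot>\<^bsub>diagram_span \<delta> P\<^esub> a = scale c a"
  "a \<otimes>\<^bsub>diagram_span \<delta> P\<^esub> b = bmult \<delta> a b"
  by (simp_all add: diagram_span_def bilinear_ext_def)

lemma carrier_diagram_span:
  "carrier (diagram_span \<delta> P) = {b. Poly_Mapping.keys b \<subseteq> {g. brauer_diagram g \<and> P g}}"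
  by (auto simp: diagram_span_def)

lemma B_alg_simps [simp]:
  "a \<oplus>\<^bsub>B_alg \<delta>\<^esub> b = a + b" "c \<odot>\<^bsub>B_alg \<delta>\<^esub> a = scale c a" "a \<otimes>\<^bsub>B_alg \<delta>\<^esub> b = bmult \<delta> a b"
  by (simp_all add: B_alg_def)

lemma B_sharp_simps [simp]:
  "a \<oplus>\<^bsub>B_sharp \<delta>\<^esub> b = a + b" "c \<odot>\<^bsub>B_sharp \<delta>\<^esub> a = scale c a" "a \<otimes>\<^bsub>B_sharp \<delta>\<^esub> b = bmult \<delta> a b"
  by (simp_all add: B_sharp_def)

lemma B_zero_simps [simp]:
  "a \<oplus>\<^bsub>B_zero \<delta>\<^esub> b = a + b" "c \<odot>\<^bsub>B_zero \<delta>\<^esub> a = scale c a" "a \<otimes>\<^bsub>B_zero \<delta>\<^esub> b = bmult \<delta> a b"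
  by (simp_all add: B_zero_def)

lemma in_B_alg: "b \<in> carrier (B_alg \<delta>) \<longleftrightarrow> Poly_Mapping.keys b \<subseteq> Collect brauer_diagram"
  by (simp add: B_alg_def carrier_diagram_span)

lemma in_B_sharp:
  "b \<in> carrier (B_sharp \<delta>) \<longleftrightarrow> Poly_Mapping.keys b \<subseteq> {g. brauer_diagram g \<and> cups g = {}}"
  by (simp add: B_sharp_def carrier_diagram_span)

lemma in_B_zero:
  "b \<in> carrier (B_zero \<delta>) \<longleftrightarrow> Poly_Mapping.keys b \<subseteq> {g. brauer_diagram g \<and> cups g = {} \<and> caps g = {}}"
  by (simp add: B_zero_def carrier_diagram_span)

lemma B_sharp_in_B: "b \<in> carrier (B_sharp \<delta>) \<Longrightarrow> b \<in> carrier (B_alg \<delta>)"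
  unfolding in_B_alg in_B_sharp by blast

lemma B_zero_in_B_sharp: "b \<in> carrier (B_zero \<delta>) \<Longrightarrow> b \<in> carrier (B_sharp \<delta>)"
  unfolding in_B_zero in_B_sharp by blast

lemma keys_diagram_mult:
  "brauer_diagram g \<Longrightarrow> brauer_diagram h \<Longrightarrow> Poly_Mapping.keys (diagram_mult \<delta> g h) \<subseteq> Collect brauer_diagram"
  by (auto simp: diagram_mult_def brauer_stack dest!: subsetD[OF keys_scale])

lemma closed_algebra_B: "closed_algebra (B_alg \<delta>)"
proof
  fix a b assume ab: "a \<in> carrier (B_alg \<delta>)" "b \<in> carrier (B_alg \<delta>)"
  show "a \<otimes>\<^bsub>B_alg \<delta>\<^esub> b \<in> carrier (B_alg \<delta>)"
    using ab unfolding in_B_alg B_alg_simps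
    by (intro keys_bilinear_ext_subset keys_diagram_mult) auto
qed (simp_all only: in_B_alg B_alg_simps keys_add_subset keys_scale_subset)

interpretation B: closed_algebra "B_alg \<delta>" for \<delta> by (rule closed_algebra_B)

lemma bmult_in_B: "a \<in> carrier (B_alg \<delta>) \<Longrightarrow> b \<in> carrier (B_alg \<delta>) \<Longrightarrow> bmult \<delta> a b \<in> carrier (B_alg \<delta>)"
  using B.mult_closed by simp

lemma bmult_assoc:
  assumes "a \<in> carrier (B_alg \<delta>)" "b \<in> carrier (B_alg \<delta>)" "c \<in> carrier (B_alg \<delta>)"
  shows "bmult \<delta> (bmult \<delta> a b) c = bmult \<delta> a (bmult \<delta> b c)"
proof (rule bilinear_ext_assoc[OF assms[unfolded in_B_alg]])
  fix f g h assume "f \<in> Collect brauer_diagram" "g \<in> Collect brauer_diagram" "h \<in> Collect brauer_diagram"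
  then have b: "brauer_diagram f" "brauer_diagram g" "brauer_diagram h" by auto
  show "bmult \<delta> (diagram_mult \<delta> f g) (symbol h) = bmult \<delta> (symbol f) (diagram_mult \<delta> g h)"
  proof (cases "n_top g = n_bot f \<and> n_top h = n_bot g")
    case True
    then show ?thesis
      using stack_assoc[OF b] loops_assoc[OF b]
      by (simp add: bilinear_ext_symbol diagram_mult_def bilinear_ext_scale stack_def power_add[symmetric] add.commute)
  next
    case False
    then show ?thesis by (auto simp: bilinear_ext_symbol diagram_mult_def bilinear_ext_scale stack_def)
  qed
qed

lemma symbol_in_B [simp]: "symbol g \<in> carrier (B_alg \<delta>) \<longleftrightarrow> brauer_diagram g"
  by (simp add: in_B_alg)

lemma zero_in_B [simp]: "0 \<in> carrier (B_alg \<delta>)"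
  by (simp add: in_B_alg)

lemma B_id_in_B [simp]: "B_id k \<in> carrier (B_alg \<delta>)"
  unfolding B_id_def symbol_in_B by (intro brauer_perm_diagram permutes_id)

lemma B_id_in_B_zero [simp]: "B_id k \<in> carrier (B_zero \<delta>)"
  unfolding B_id_def in_B_zero using brauer_perm_diagram[OF permutes_id[of "{..<k}"]] by simp

lemma bmult_B_id:
  assumes "brauer_diagram g"
  shows "bmult \<delta> (symbol g) (B_id k) = (if n_bot g = k then symbol g else 0)"
    and "bmult \<delta> (B_id k) (symbol g) = (if n_top g = k then symbol g else 0)"
  using stack_id_right[OF assms] stack_id_left[OF assms]
  by (auto simp: bilinear_ext_symbol B_id_def diagram_mult_def)

lemma bmult_B_id_B_id: "bmult \<delta> (B_id k) (B_id l) = (if k = l then B_id k else (0 :: 'k::field brauer_element))"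
  using bmult_B_id(1)[OF brauer_perm_diagram[OF permutes_id[of "{..<k}"]], of \<delta> l]
  by (simp add: B_id_def)

section \<open>The group algebra of a symmetric group and its place in \<open>B\<close>\<close>

definition perm_mult :: "(nat \<Rightarrow> nat) \<Rightarrow> (nat \<Rightarrow> nat) \<Rightarrow> ((nat \<Rightarrow> nat) \<Rightarrow>\<^sub>0 'k::field)" where
  "perm_mult \<sigma> \<tau> = symbol (\<sigma> \<circ> \<tau>)"

abbreviation gmult ::
  "((nat \<Rightarrow> nat) \<Rightarrow>\<^sub>0 'k::field) \<Rightarrow> ((nat \<Rightarrow> nat) \<Rightarrow>\<^sub>0 'k) \<Rightarrow> ((nat \<Rightarrow> nat) \<Rightarrow>\<^sub>0 'k)" where
  "gmult \<equiv> bilinear_ext perm_mult"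

lemma gmult_symbol [simp]: "gmult (symbol \<sigma>) (symbol \<tau>) = symbol (\<sigma> \<circ> \<tau>)"
  by (simp add: bilinear_ext_symbol perm_mult_def)

lemma group_algebra_simps [simp]:
  "a \<oplus>\<^bsub>group_algebra m\<^esub> b = a + b" "c \<odot>\<^bsub>group_algebra m\<^esub> a = scale c a"
  "a \<otimes>\<^bsub>group_algebra m\<^esub> b = gmult a b"
  by (simp_all add: group_algebra_def bilinear_ext_def perm_mult_def [abs_def])

lemma in_group_algebra: "a \<in> carrier (group_algebra m) \<longleftrightarrow> Poly_Mapping.keys a \<subseteq> {\<sigma>. \<sigma> permutes {..<m}}"
  by (auto simp: group_algebra_def)

lemma symbol_in_group_algebra [simp]: "symbol \<sigma> \<in> carrier (group_algebra m) \<longleftrightarrow> \<sigma> permutes {..<m}"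
  by (simp add: in_group_algebra)

lemma zero_in_group_algebra [simp]: "0 \<in> carrier (group_algebra m)"
  by (simp add: in_group_algebra)

lemma closed_algebra_group_algebra: "closed_algebra (group_algebra m)"
proof
  fix a b :: "(nat \<Rightarrow> nat) \<Rightarrow>\<^sub>0 'a"
  assume ab: "a \<in> carrier (group_algebra m)" "b \<in> carrier (group_algebra m)"
  show "a \<otimes>\<^bsub>group_algebra m\<^esub> b \<in> carrier (group_algebra m)"
    using ab unfolding in_group_algebra group_algebra_simps
    by (intro keys_bilinear_ext_subset) (auto simp: perm_mult_def intro: permutes_compose)
qed (simp_all only: in_group_algebra group_algebra_simps keys_add_subset keys_scale_subset)

lemma gmult_assoc: "gmult (gmult a b) c = gmult a (gmult b c)"
  by (rule bilinear_ext_assoc[of _ UNIV _ UNIV _ UNIV]) (simp_all add: perm_mult_def comp_assoc)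

lemma gmult_id [simp]: "gmult (symbol id) a = a" "gmult a (symbol id) = a"
proof -
  have "perm_mult id = (symbol :: _ \<Rightarrow> _ \<Rightarrow>\<^sub>0 'a)" by (rule ext) (simp add: perm_mult_def)
  then show "gmult (symbol id) a = a" by (simp add: bilinear_ext_def)
  show "gmult a (symbol id) = a" by (simp add: bilinear_ext_def perm_mult_def)
qed

lemma sym_component_add: "sym_component m (a + b) = sym_component m a + sym_component m b"
  by (simp add: sym_component_def lookup_add free.scale_left_distrib sum.distrib)

lemma sym_component_scale: "sym_component m (scale c a) = scale c (sym_component m a)"
  by (simp add: sym_component_def free.scale_sum_right)

lemma sym_component_zero [simp]: "sym_component m 0 = 0"
  by (simp add: sym_component_def)

lemma sym_component_perm:
  assumes "\<sigma> permutes {..<m}"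
  shows "sym_component m (symbol (perm_diagram m \<sigma>)) = symbol \<sigma>"
proof -
  have "perm_diagram m \<sigma> = perm_diagram m \<tau> \<longleftrightarrow> \<tau> = \<sigma>" if "\<tau> permutes {..<m}" for \<tau>
    using perm_diagram_inj[OF assms that] by blast
  then have "sym_component m (symbol (perm_diagram m \<sigma>)) =
      (\<Sum>\<tau> | \<tau> permutes {..<m}. if \<tau> = \<sigma> then symbol \<sigma> else 0)"
    unfolding sym_component_def by (intro sum.cong) (auto simp: lookup_symbol)
  then show ?thesis using assms by (simp add: finite_permutations)
qed

lemma sym_component_not_perm:
  assumes "\<And>\<sigma>. \<sigma> permutes {..<m} \<Longrightarrow> g \<noteq> perm_diagram m \<sigma>"
  shows "sym_component m (symbol g) = 0"
  unfolding sym_component_def using assms by (intro sum.neutral) (auto simp: lookup_symbol)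

lemma sym_component_in: "sym_component m b \<in> carrier (group_algebra m)"
  unfolding sym_component_def
proof -
  interpret closed_algebra "group_algebra m" by (rule closed_algebra_group_algebra)
  have "(\<Sum>\<sigma>\<in>S. scale (Poly_Mapping.lookup b (perm_diagram m \<sigma>)) (symbol \<sigma>)) \<in> carrier (group_algebra m)"
    if "finite S" "S \<subseteq> {\<sigma>. \<sigma> permutes {..<m}}" for S
    using that
  proof (induction S)
    case (insert x S)
    then show ?case
      using add_closed[OF smult_closed[of "symbol x"]] by simp
  qed simp
  then show "(\<Sum>\<sigma> | \<sigma> permutes {..<m}. scale (Poly_Mapping.lookup b (perm_diagram m \<sigma>)) (symbol \<sigma>))
      \<in> carrier (group_algebra m)" by (simp add: finite_permutations)
qed

lemma sym_component_B_id: "sym_component m (B_id k) = (if k = m then symbol id else 0)"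
proof (cases "k = m")
  case True
  then show ?thesis by (simp add: B_id_def sym_component_perm permutes_id)
next
  case False
  then have "perm_diagram k id \<noteq> perm_diagram m \<sigma>" for \<sigma> by (simp add: perm_diagram_def)
  then show ?thesis using False by (simp add: B_id_def sym_component_not_perm)
qed

text \<open>Diagrams with caps have no symmetric component, so inflating to \<open>B_zero\<close>
  and then along \<open>kill_caps\<close> amounts to a single pullback.\<close>

lemma sym_component_kill_caps: "sym_component m (kill_caps b) = sym_component m b"
proof -
  have "Poly_Mapping.keys b \<subseteq> UNIV" by simp
  then show ?thesis
  proof (induction rule: free_induct)
    case (symbol g)
    show ?case
    proof (cases "caps g = {}")
      case False
      then have "g \<noteq> perm_diagram m \<sigma>" for \<sigma> by auto
      then show ?thesis using False by (simp add: kill_caps_def sym_component_not_perm)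
    qed (simp add: kill_caps_def)
  qed (simp_all add: kill_caps_def sym_component_add sym_component_scale lin_ext_add lin_ext_scale)
qed

text \<open>For arbitrary right factors this fails, since cups and caps can straighten to a
  permutation. A diagram without cups either has a cap, which survives in the product, or is a
  permutation diagram, which only relabels the bottom row of the left factor.\<close>

lemma sym_component_bmult:
  assumes a: "a \<in> carrier (B_alg \<delta>)" and s: "s \<in> carrier (B_sharp \<delta>)"
  shows "sym_component m (bmult \<delta> a s) = gmult (sym_component m a) (sym_component m s)"
proof -
  have *: "sym_component m (diagram_mult \<delta> g h) = gmult (sym_component m (symbol g)) (sym_component m (symbol h))"
    if g: "brauer_diagram g" and h: "brauer_diagram h" and cups: "cups h = {}" for g h
  proof (cases "n_top h = n_bot g")
    case False
    then have "(\<forall>\<sigma>. g \<noteq> perm_diagram m \<sigma>) \<or> (\<forall>\<sigma>. h \<noteq> perm_diagram m \<sigma>)" by auto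
    then show ?thesis using False by (auto simp: diagram_mult_def sym_component_not_perm)
  next
    case gh: True
    show ?thesis
    proof (cases "caps h = {}")
      case False
      then have "h \<noteq> perm_diagram m \<sigma>" "stack g h \<noteq> perm_diagram m \<sigma>" for \<sigma>
        using caps_stack[OF g h gh cups] by auto
      then show ?thesis using gh
        by (simp add: diagram_mult_def sym_component_not_perm sym_component_scale)
    next
      case True
      \<comment> \<open>Without cups the top row is no longer than the bottom row, without caps no
        shorter.\<close>
      have n: "n_top h = n_bot h"
        using without_cups_le[OF h cups] without_caps_le[OF h True] by simp
      obtain \<tau> where \<tau>: "\<tau> permutes {..<n_bot h}" "h = perm_diagram (n_bot h) \<tau>"
        by (rule perm_diagramE[OF h True n])
      show ?thesis
      proof (cases "\<exists>\<sigma>. \<sigma> permutes {..<m} \<and> g = perm_diagram m \<sigma>")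
        case True
        then obtain \<sigma> where \<sigma>: "\<sigma> permutes {..<m}" "g = perm_diagram m \<sigma>" by blast
        then have "n_bot h = m" using gh n by simp
        then have \<tau>': "\<tau> permutes {..<m}" "h = perm_diagram m \<tau>" using \<tau> by simp_all
        have "\<sigma> \<circ> \<tau> permutes {..<m}" using \<sigma>(1) \<tau>'(1) by (rule permutes_compose[rotated])
        then show ?thesis unfolding \<sigma>(2) \<tau>'(2)
          using stack_perm_perm[OF \<sigma>(1) \<tau>'(1)] \<sigma> \<tau>'
          by (simp add: diagram_mult_def sym_component_perm)
      next
        case False
        \<comment> \<open>If the product were a permutation diagram, \<open>g\<close> would be
          square; not being a permutation diagram it has a cap, and relabelling its bottom row
          leaves a cap in the product.\<close>
        have "stack g h \<noteq> perm_diagram m \<rho>" if \<rho>: "\<rho> permutes {..<m}" for \<rho>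
        proof
          assume eq: "stack g h = perm_diagram m \<rho>"
          then have m: "n_bot h = m" "n_top g = m" by (auto simp: stack_def perm_diagram_def)
          then have gm: "n_bot g = m" "n_top g = n_bot g" using gh n by auto
          have "caps g \<noteq> {}"
          proof
            assume "caps g = {}"
            then obtain \<sigma> where "\<sigma> permutes {..<n_bot g}" "g = perm_diagram (n_bot g) \<sigma>"
              using perm_diagramE[OF g _ gm(2)] by metis
            then show False using False gm(1) by auto
          qed
          then obtain e where e: "e \<in> strands g" "e \<subseteq> range Bot" by (auto simp: caps_def)
          have "h = perm_diagram (n_bot g) \<tau>" "\<tau> permutes {..<n_bot g}" using \<tau> m gm by simp_all
          then have "lift (Hilbert_Choice.inv \<tau>) ` e \<in> strands (stack g h)"
            using stack_perm_diagram(1)[OF g, of \<tau>] e(1) by simp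
          moreover have "lift (Hilbert_Choice.inv \<tau>) ` e \<subseteq> range Bot" using e(2) by auto
          ultimately have "caps (stack g h) \<noteq> {}" by (auto simp: caps_def)
          then show False using eq by simp
        qed
        then show ?thesis using False gh
          by (auto simp: diagram_mult_def sym_component_not_perm sym_component_scale)
      qed
    qed
  qed
  from a[unfolded in_B_alg] show ?thesis
  proof (induction rule: free_induct)
    case (symbol g)
    from s[unfolded in_B_sharp] show ?case
      by (induction rule: free_induct)
        (use symbol * in \<open>simp_all add: bilinear_ext_symbol bilinear_ext_add bilinear_ext_scale sym_component_add sym_component_scale\<close>)
  qed (simp_all add: bilinear_ext_add bilinear_ext_scale sym_component_add sym_component_scale)
qed

text \<open>A right inverse of \<open>sym_component m\<close> on the group algebra. The identity
  permutation goes to the idempotent \<open>B_id m\<close>.\<close>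

definition perm_embedding :: "nat \<Rightarrow> ((nat \<Rightarrow> nat) \<Rightarrow>\<^sub>0 'k::field) \<Rightarrow> 'k brauer_element" where
  "perm_embedding m = lin_ext (\<lambda>\<sigma>. symbol (perm_diagram m \<sigma>))"

lemma perm_embedding_simps [simp]:
  "perm_embedding m (symbol \<sigma>) = symbol (perm_diagram m \<sigma>)"
  "perm_embedding m (a + b) = perm_embedding m a + perm_embedding m b"
  "perm_embedding m (scale c a) = scale c (perm_embedding m a)"
  "perm_embedding m 0 = 0"
  by (simp_all add: perm_embedding_def lin_ext_add lin_ext_scale)

lemma perm_embedding_in:
  assumes "a \<in> carrier (group_algebra m)"
  shows "perm_embedding m a \<in> carrier (B_zero \<delta>)"
  using assms unfolding in_group_algebra in_B_zero perm_embedding_def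
  by (intro keys_lin_ext_subset) (auto simp: brauer_perm_diagram)

lemma perm_embedding_in_B: "a \<in> carrier (group_algebra m) \<Longrightarrow> perm_embedding m a \<in> carrier (B_alg \<delta>)"
  by (intro B_sharp_in_B B_zero_in_B_sharp perm_embedding_in)

lemma perm_embedding_mult:
  assumes "a \<in> carrier (group_algebra m)" "b \<in> carrier (group_algebra m)"
  shows "perm_embedding m (gmult a b) = bmult \<delta> (perm_embedding m a) (perm_embedding m b)"
  using assms(1)[unfolded in_group_algebra]
proof (induction rule: free_induct)
  case (symbol \<sigma>)
  show ?case using assms(2)[unfolded in_group_algebra]
    by (induction rule: free_induct)
      (use symbol in \<open>simp_all add: bilinear_ext_add bilinear_ext_scale diagram_mult_def stack_perm_perm bilinear_ext_symbol perm_mult_def\<close>)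
qed (simp_all add: bilinear_ext_add bilinear_ext_scale)

lemma sym_component_perm_embedding:
  assumes "a \<in> carrier (group_algebra m)"
  shows "sym_component m (perm_embedding m a) = a"
  using assms[unfolded in_group_algebra]
  by (induction rule: free_induct) (simp_all add: sym_component_add sym_component_scale sym_component_perm)

lemma bmult_perm_embedding_id:
  assumes "a \<in> carrier (group_algebra m)"
  shows "bmult \<delta> (perm_embedding m a) (B_id m) = perm_embedding m a"
    and "bmult \<delta> (B_id m) (perm_embedding m a) = perm_embedding m a"
  using assms[unfolded in_group_algebra]
  by (induction rule: free_induct)
    (simp_all add: bilinear_ext_add bilinear_ext_scale bmult_B_id brauer_perm_diagram)

section \<open>Modules over \<open>B\<close>\<close>

locale brauer_module = amodule "B_alg \<delta>" V
  for \<delta> :: "'k::field" and V :: "('k, 'v, 'k brauer_element, 'n) amodule_scheme"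
begin

abbreviation (input) B where "B \<equiv> carrier (B_alg \<delta>)"

lemma act_add: "a \<in> B \<Longrightarrow> b \<in> B \<Longrightarrow> v \<in> carrier V \<Longrightarrow> act V (a + b) v = act V a v \<oplus>\<^bsub>V\<^esub> act V b v"
  using act_add_left by simp

lemma act_scale: "a \<in> B \<Longrightarrow> v \<in> carrier V \<Longrightarrow> act V (scale c a) v = c \<odot>\<^bsub>V\<^esub> act V a v"
  using act_smult_left by simp

lemma act_bmult: "a \<in> B \<Longrightarrow> b \<in> B \<Longrightarrow> v \<in> carrier V \<Longrightarrow> act V (bmult \<delta> a b) v = act V a (act V b v)"
  using act_mult by simp

lemma act_zero_left: "v \<in> carrier V \<Longrightarrow> act V 0 v = \<zero>\<^bsub>V\<^esub>"
  using act_scale[of 0 v 0] act_closed[of 0 v] by (simp add: smult_zero_left)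

lemma scale_in_B: "a \<in> B \<Longrightarrow> scale c a \<in> B"
  using B.smult_closed[of a \<delta>] by simp

lemma add_in_B: "a \<in> B \<Longrightarrow> b \<in> B \<Longrightarrow> a + b \<in> B"
  using B.add_closed[of a \<delta>] by simp

lemma B_induct [consumes 1, case_names zero add scale diagram]:
  assumes "b \<in> B" "P 0" "\<And>a b. a \<in> B \<Longrightarrow> b \<in> B \<Longrightarrow> P a \<Longrightarrow> P b \<Longrightarrow> P (a + b)"
    "\<And>c a. a \<in> B \<Longrightarrow> P a \<Longrightarrow> P (scale c a)" "\<And>g. brauer_diagram g \<Longrightarrow> P (symbol g)"
  shows "P b"
proof -
  have "b \<in> B \<and> P b"
    using assms(1)[unfolded in_B_alg]
    by (induction rule: free_induct) (use assms(2-5) in \<open>simp_all add: add_in_B scale_in_B\<close>)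
  then show ?thesis by simp
qed

lemma act_B_id_B_id:
  "v \<in> carrier V \<Longrightarrow> act V (B_id k) (act V (B_id l) v) = (if k = l then act V (B_id k) v else \<zero>\<^bsub>V\<^esub>)"
  by (subst act_bmult[symmetric]) (simp_all add: bmult_B_id_B_id act_zero_left)

text \<open>\<open>B_id k\<close> acts as an idempotent, so its image consists of its fixed
  vectors.\<close>

lemma word_space_iff: "v \<in> word_space V k \<longleftrightarrow> v \<in> carrier V \<and> act V (B_id k) v = v"
  by (auto simp: word_space_def act_closed act_B_id_B_id intro: image_eqI[of v _ v])

lemma word_space_trivial_iff:
  "word_space V k = {\<zero>\<^bsub>V\<^esub>} \<longleftrightarrow> (\<forall>v\<in>carrier V. act V (B_id k) v = \<zero>\<^bsub>V\<^esub>)"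
proof -
  have "\<zero>\<^bsub>V\<^esub> \<in> carrier V" by simp
  then show ?thesis unfolding word_space_def using act_zero_right[of "B_id k"]
    by (auto simp: image_def intro!: exI[of _ "\<zero>\<^bsub>V\<^esub>"])
qed

lemma act_finsum:
  assumes "finite S" "a \<in> B" "w \<in> S \<rightarrow> carrier V"
  shows "act V a (finsum V w S) = finsum V (\<lambda>s. act V a (w s)) S"
  using assms(1,3)
  by (induction S) (simp_all add: act_zero_right assms(2) finsum_closed act_add_right act_closed Pi_def)

lemma act_sum:
  assumes "finite S" "\<And>s. s \<in> S \<Longrightarrow> f s \<in> B" "v \<in> carrier V"
  shows "act V (sum f S) v = finsum V (\<lambda>s. act V (f s) v) S"
proof -
  have "sum f S \<in> B \<and> act V (sum f S) v = finsum V (\<lambda>s. act V (f s) v) S"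
    using assms(1,2)
    by (induction S) (simp_all add: act_zero_left assms(3) act_add add_in_B act_closed Pi_def)
  then show ?thesis ..
qed

text \<open>Objects of the category of the paper, in a form that passes to quotients.\<close>

definition locally_unital :: bool where
  "locally_unital \<longleftrightarrow> (\<forall>v\<in>carrier V. \<exists>M. finite M \<and> act V (sum B_id M) v = v)"

lemma sum_B_id_in_B: "finite M \<Longrightarrow> sum B_id M \<in> B"
  by (induction M rule: finite_induct) (simp_all add: add_in_B)

text \<open>Applying \<open>B_id k\<close> to a decomposition isolates its summand of index
  \<open>k\<close>, so the components of \<open>v\<close> must be the vectors \<open>B_id k\<close>
  times \<open>v\<close>; local unitality says that finitely many of these add up to
  \<open>v\<close>.\<close>

lemma B_moduleI:
  assumes "locally_unital"
  shows "\<forall>v\<in>carrier V. \<exists>!w. (\<forall>m. w m \<in> word_space V m) \<and> finite {m. w m \<noteq> \<zero>\<^bsub>V\<^esub>} \<and>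
      v = finsum V w {m. w m \<noteq> \<zero>\<^bsub>V\<^esub>}"
proof (intro ballI ex1I conjI allI)
  fix v assume v: "v \<in> carrier V"
  let ?w = "\<lambda>m. act V (B_id m) v"
  obtain M where M: "finite M" "act V (sum B_id M) v = v"
    using assms v by (auto simp: locally_unital_def)
  show "?w m \<in> word_space V m" for m using v by (simp add: word_space_def)
  have v_eq: "v = finsum V ?w M" using act_sum[OF M(1) _ v, of B_id] M(2) by simp
  have sub: "{m. ?w m \<noteq> \<zero>\<^bsub>V\<^esub>} \<subseteq> M"
  proof
    fix m assume m: "m \<in> {m. ?w m \<noteq> \<zero>\<^bsub>V\<^esub>}"
    show "m \<in> M"
    proof (rule ccontr)
      assume "m \<notin> M"
      have "?w m = act V (B_id m) (finsum V ?w M)" using v_eq by simp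
      also have "\<dots> = finsum V (\<lambda>k. act V (B_id m) (?w k)) M"
        using M(1) v by (intro act_finsum) (auto simp: act_closed)
      also have "\<dots> = finsum V (\<lambda>k. \<zero>\<^bsub>V\<^esub>) M"
        using \<open>m \<notin> M\<close> v by (intro finsum_cong') (auto simp: act_B_id_B_id)
      finally show False using m by simp
    qed
  qed
  show "finite {m. ?w m \<noteq> \<zero>\<^bsub>V\<^esub>}" using sub M(1) by (rule finite_subset)
  have "finsum V ?w {m. ?w m \<noteq> \<zero>\<^bsub>V\<^esub>} = finsum V ?w M"
    using sub M(1) v by (intro add.finprod_mono_neutral_cong_left) (auto simp: act_closed)
  then show "v = finsum V ?w {m. ?w m \<noteq> \<zero>\<^bsub>V\<^esub>}" using v_eq by simp
  fix w assume w: "(\<forall>m. w m \<in> word_space V m) \<and> finite {m. w m \<noteq> \<zero>\<^bsub>V\<^esub>} \<and>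
      v = finsum V w {m. w m \<noteq> \<zero>\<^bsub>V\<^esub>}"
  let ?S = "{m. w m \<noteq> \<zero>\<^bsub>V\<^esub>}"
  have wc: "w m \<in> carrier V" "act V (B_id m) (w m) = w m" for m using w by (auto simp: word_space_iff)
  have wk: "act V (B_id k) (w m) = (if m = k then w k else \<zero>\<^bsub>V\<^esub>)" for k m
    using act_B_id_B_id[OF wc(1), of k m m] wc by auto
  show "w = ?w"
  proof
    fix k
    have "?w k = act V (B_id k) (finsum V w ?S)" using w by simp
    also have "\<dots> = finsum V (\<lambda>m. act V (B_id k) (w m)) ?S"
      using w wc by (intro act_finsum) auto
    also have "\<dots> = finsum V (\<lambda>m. if k = m then w m else \<zero>\<^bsub>V\<^esub>) ?S"
      using wc by (intro finsum_cong') (auto simp: wk)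
    also have "\<dots> = w k"
    proof (cases "k \<in> ?S")
      case True
      then show ?thesis using w wc by (intro finsum_singleton) auto
    next
      case False
      then have "finsum V (\<lambda>m. if k = m then w m else \<zero>\<^bsub>V\<^esub>) ?S = finsum V (\<lambda>m. \<zero>\<^bsub>V\<^esub>) ?S"
        by (intro finsum_cong') auto
      then show ?thesis using False by simp
    qed
    finally show "w k = ?w k" ..
  qed
qed

text \<open>The quantifier over all larger index sets lets the sets found for two summands be united
  in the induction.\<close>

lemma B_id_left_unit: "b \<in> B \<Longrightarrow> \<exists>M. finite M \<and> (\<forall>M'. finite M' \<longrightarrow> M \<subseteq> M' \<longrightarrow> bmult \<delta> (sum B_id M') b = b)"
proof (induction rule: B_induct)
  case zero
  show ?case by (intro exI[of _ "{}"]) simp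
next
  case (add a b)
  then obtain M M' where "finite M" "finite M'"
    "\<And>N. finite N \<Longrightarrow> M \<subseteq> N \<Longrightarrow> bmult \<delta> (sum B_id N) a = a"
    "\<And>N. finite N \<Longrightarrow> M' \<subseteq> N \<Longrightarrow> bmult \<delta> (sum B_id N) b = b" by blast
  then show ?case by (intro exI[of _ "M \<union> M'"]) (simp add: bilinear_ext_add)
next
  case (scale c a)
  then show ?case by (auto simp: bilinear_ext_scale)
next
  case (diagram g)
  have "bmult \<delta> (sum B_id M) (symbol g) = symbol g" if "finite M" "{n_top g} \<subseteq> M" for M
    using that diagram by (simp add: bilinear_ext_sum bmult_B_id)
  then show ?case by (intro exI[of _ "{n_top g}"]) simp
qed

lemma act_left_unit:
  assumes "b \<in> B" "v \<in> carrier V"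
  obtains M where "finite M" "act V (sum B_id M) (act V b v) = act V b v"
proof -
  obtain M where M: "finite M" "bmult \<delta> (sum B_id M) b = b" using B_id_left_unit[OF assms(1)] by blast
  then show ?thesis
    using that[of M] act_bmult[OF sum_B_id_in_B[OF M(1)] assms] by simp
qed

text \<open>A square diagram that is not a permutation diagram has a cap and hence factors through a
  shorter word, where \<open>V\<close> vanishes by \<open>low\<close>. Diagrams with rows of another
  length are killed by \<open>B_id m\<close> on one side or the other.\<close>

lemma act_perm_embedding:
  assumes low: "\<And>k. k < m \<Longrightarrow> word_space V k = {\<zero>\<^bsub>V\<^esub>}"
    and v: "v \<in> word_space V m" and b: "b \<in> B"
  shows "act V (B_id m) (act V b v) = act V (perm_embedding m (sym_component m b)) v"
proof -
  note vV = v[unfolded word_space_iff]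
  have emb: "perm_embedding m (sym_component m a) \<in> B" for a :: "'k brauer_element"
    by (intro perm_embedding_in_B sym_component_in)
  from b show ?thesis
  proof (induction rule: B_induct)
    case zero
    then show ?case using vV by (simp add: act_zero_left act_zero_right)
  next
    case (add a b)
    then show ?case using vV emb
      by (simp add: act_add act_add_right act_closed sym_component_add)
  next
    case (scale c a)
    then show ?case using vV emb by (simp add: act_scale act_smult_right act_closed sym_component_scale)
  next
    case (diagram g)
    have g: "symbol g \<in> B" using diagram by simp
    have expand: "act V (B_id m) (act V (symbol g) v) = act V (bmult \<delta> (bmult \<delta> (B_id m) (symbol g)) (B_id m)) v"
      using vV g by (simp add: act_bmult bmult_in_B act_closed)
    show ?case
    proof (cases "\<exists>\<sigma>. \<sigma> permutes {..<m} \<and> g = perm_diagram m \<sigma>")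
      case True
      then obtain \<sigma> where s: "\<sigma> permutes {..<m}" "g = perm_diagram m \<sigma>" by blast
      then show ?thesis using expand diagram by (simp add: bmult_B_id sym_component_perm)
    next
      case False
      then have "sym_component m (symbol g) = (0 :: (nat \<Rightarrow> nat) \<Rightarrow>\<^sub>0 'k)" by (intro sym_component_not_perm) blast
      then have rhs: "act V (perm_embedding m (sym_component m (symbol g))) v = \<zero>\<^bsub>V\<^esub>"
        using vV by (simp add: act_zero_left)
      show ?thesis
      proof (cases "n_bot g = m \<and> n_top g = m")
        case True
        have "caps g \<noteq> {}"
          using perm_diagramE[OF diagram] True False by metis
        then obtain u l where ul: "brauer_diagram u" "brauer_diagram l" "n_top l = n_bot u"
          "n_top l < n_bot g" "stack u l = g" "loops u l = 0" by (rule factor_cap[OF diagram])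
        have "bmult \<delta> (symbol u) (symbol l) = symbol g"
          using ul by (simp add: bilinear_ext_symbol diagram_mult_def)
        then have "act V (symbol g) v = act V (symbol u) (act V (symbol l) v)"
          using ul vV act_bmult[of "symbol u" "symbol l" v] by simp
        also have "act V (symbol l) v = act V (B_id (n_top l)) (act V (symbol l) v)"
          using ul vV act_bmult[of "B_id (n_top l)" "symbol l" v] by (simp add: bmult_B_id)
        also have "\<dots> = \<zero>\<^bsub>V\<^esub>"
          using low[of "n_top l"] ul True vV by (auto simp: word_space_trivial_iff act_closed)
        finally show ?thesis using rhs ul by (simp add: act_zero_right)
      next
        case False
        then show ?thesis using rhs expand diagram vV by (auto simp: bmult_B_id act_zero_left)
      qed
    qed
  qed
qed

end

lemma brauer_moduleI: "amodule (B_alg \<delta>) V \<Longrightarrow> brauer_module \<delta> V"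
  by (simp add: brauer_module_def)

section \<open>Standard modules\<close>

lemma free_symbols_simps [simp]:
  "\<zero>\<^bsub>free_symbols A V\<^esub> = 0" "x \<oplus>\<^bsub>free_symbols A V\<^esub> y = x + y" "c \<odot>\<^bsub>free_symbols A V\<^esub> x = scale c x"
  "act (free_symbols A V) a = lin_ext (\<lambda>(b, v). symbol (a \<otimes>\<^bsub>A\<^esub> b, v))"
  "carrier (free_symbols A V) = {p. Poly_Mapping.keys p \<subseteq> carrier A \<times> carrier V}"
  by (simp_all add: free_symbols_def)

lemma module_free_symbols: "Module.module scalar_ring (free_symbols A V)"
proof (rule moduleI)
  let ?S = "carrier A \<times> carrier V"
  show "abelian_group (free_symbols A V)"
  proof (rule abelian_groupI)
    fix x assume "x \<in> carrier (free_symbols A V)"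
    then have "scale (-1) x \<in> carrier (free_symbols A V)" using keys_scale_subset[of x ?S "-1"] by simp
    moreover have "scale (-1) x + x = 0" by simp
    ultimately show "\<exists>y\<in>carrier (free_symbols A V). y \<oplus>\<^bsub>free_symbols A V\<^esub> x = \<zero>\<^bsub>free_symbols A V\<^esub>"
      unfolding free_symbols_simps(1,2) by blast
  qed (auto simp: algebra_simps dest!: subsetD[OF keys_add])
qed (auto simp: cring_scalar_ring free.scale_left_distrib free.scale_right_distrib
    dest!: subsetD[OF keys_scale])

lemma minus_free_symbols:
  assumes "x \<in> carrier (free_symbols A V)" "y \<in> carrier (free_symbols A V)"
  shows "x \<ominus>\<^bsub>free_symbols A V\<^esub> y = x - y"
  unfolding a_minus_def neg_eq_smult[OF module_free_symbols assms(2)] by simp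

lemma lin_span_closed:
  "0 \<in> lin_span S" "x \<in> lin_span S \<Longrightarrow> y \<in> lin_span S \<Longrightarrow> x + y \<in> lin_span S"
  "x \<in> lin_span S \<Longrightarrow> scale c x \<in> lin_span S" "x \<in> S \<Longrightarrow> x \<in> lin_span S"
  "x \<in> lin_span S \<Longrightarrow> y \<in> lin_span S \<Longrightarrow> x - y \<in> lin_span S"
  unfolding lin_span_def
  by (auto intro: free.span_zero free.span_add free.span_scale free.span_base free.span_diff)

text \<open>\<open>amodule\<close> imposes no unit law, so it is assumed separately.
  \<open>X\<close> below is the module over \<open>B_zero\<close> and \<open>X'\<close> its
  inflation to \<open>B_sharp\<close>, the input of the tensor product.\<close>

locale inflation = H: amodule "group_algebra m" H
  for m :: nat and H :: "('k::field, 'w, (nat \<Rightarrow> nat) \<Rightarrow>\<^sub>0 'k) amodule" +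
  fixes \<delta> :: 'k
  assumes unital: "x \<in> carrier H \<Longrightarrow> act H (symbol id) x = x"
begin

abbreviation (input) X where "X \<equiv> pullback (sym_component m) H"
abbreviation (input) X' where "X' \<equiv> pullback kill_caps X"
abbreviation (input) F where "F \<equiv> free_symbols (B_alg \<delta>) X'"
abbreviation (input) Rel where "Rel \<equiv> tensor_relations (B_alg \<delta>) (B_sharp \<delta>) X'"
abbreviation (input) T where "T \<equiv> Delta \<delta> X"

lemma X'_simps: "carrier X' = carrier H" "zero X' = zero H" "add X' = add H" "module.smult X' = module.smult H"
  "act X' b = act H (sym_component m b)"
  by (auto simp: pullback_def sym_component_kill_caps)

lemma sym_act_closed: "x \<in> carrier H \<Longrightarrow> act H (sym_component m b) x \<in> carrier H"
  by (intro H.act_closed sym_component_in)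

lemma Rel_cases:
  assumes "r \<in> Rel"
  obtains (add_left) b b' v where "r = symbol (b + b', v) - symbol (b, v) - symbol (b', v)"
      "b \<in> carrier (B_alg \<delta>)" "b' \<in> carrier (B_alg \<delta>)" "v \<in> carrier H"
  | (add_right) b v v' where "r = symbol (b, v \<oplus>\<^bsub>H\<^esub> v') - symbol (b, v) - symbol (b, v')"
      "b \<in> carrier (B_alg \<delta>)" "v \<in> carrier H" "v' \<in> carrier H"
  | (scale_left) c b v where "r = symbol (scale c b, v) - scale c (symbol (b, v))"
      "b \<in> carrier (B_alg \<delta>)" "v \<in> carrier H"
  | (scale_right) c b v where "r = symbol (b, c \<odot>\<^bsub>H\<^esub> v) - scale c (symbol (b, v))"
      "b \<in> carrier (B_alg \<delta>)" "v \<in> carrier H"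
  | (balanced) b s v where "r = symbol (bmult \<delta> b s, v) - symbol (b, act H (sym_component m s) v)"
      "b \<in> carrier (B_alg \<delta>)" "s \<in> carrier (B_sharp \<delta>)" "v \<in> carrier H"
  using assms unfolding tensor_relations_def X'_simps B_alg_simps by blast

lemma RelI:
  "b \<in> carrier (B_alg \<delta>) \<Longrightarrow> b' \<in> carrier (B_alg \<delta>) \<Longrightarrow> v \<in> carrier H \<Longrightarrow>
    symbol (b + b', v) - symbol (b, v) - symbol (b', v) \<in> Rel"
  "b \<in> carrier (B_alg \<delta>) \<Longrightarrow> v \<in> carrier H \<Longrightarrow> v' \<in> carrier H \<Longrightarrow>
    symbol (b, v \<oplus>\<^bsub>H\<^esub> v') - symbol (b, v) - symbol (b, v') \<in> Rel"
  "b \<in> carrier (B_alg \<delta>) \<Longrightarrow> v \<in> carrier H \<Longrightarrow> symbol (scale c b, v) - scale c (symbol (b, v)) \<in> Rel"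
  "b \<in> carrier (B_alg \<delta>) \<Longrightarrow> v \<in> carrier H \<Longrightarrow> symbol (b, c \<odot>\<^bsub>H\<^esub> v) - scale c (symbol (b, v)) \<in> Rel"
  "b \<in> carrier (B_alg \<delta>) \<Longrightarrow> s \<in> carrier (B_sharp \<delta>) \<Longrightarrow> v \<in> carrier H \<Longrightarrow>
    symbol (bmult \<delta> b s, v) - symbol (b, act H (sym_component m s) v) \<in> Rel"
  unfolding tensor_relations_def X'_simps B_alg_simps by blast+

lemma F_carrier: "p \<in> carrier F \<longleftrightarrow> Poly_Mapping.keys p \<subseteq> carrier (B_alg \<delta>) \<times> carrier H"
  by (simp add: X'_simps)

lemma F_closed:
  "p \<in> carrier F \<Longrightarrow> q \<in> carrier F \<Longrightarrow> p + q \<in> carrier F"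
  "p \<in> carrier F \<Longrightarrow> scale c p \<in> carrier F"
  "p \<in> carrier F \<Longrightarrow> q \<in> carrier F \<Longrightarrow> p - q \<in> carrier F"
  "0 \<in> carrier F"
  "symbol (b, v) \<in> carrier F \<longleftrightarrow> b \<in> carrier (B_alg \<delta>) \<and> v \<in> carrier H"
proof -
  show a: "p + q \<in> carrier F" if "p \<in> carrier F" "q \<in> carrier F" for p q
    using that unfolding F_carrier by (rule keys_add_subset)
  show s: "scale c p \<in> carrier F" if "p \<in> carrier F" for c p
    using that unfolding F_carrier by (rule keys_scale_subset)
  show "p - q \<in> carrier F" if "p \<in> carrier F" "q \<in> carrier F"
    using a[OF that(1) s[OF that(2), of "-1"]] by simp
qed (simp_all add: X'_simps)

lemma Rel_subset: "Rel \<subseteq> carrier F"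
proof
  fix r assume "r \<in> Rel"
  then show "r \<in> carrier F"
    by (cases rule: Rel_cases)
      (auto intro!: F_closed(1-3) simp: F_closed(5) B_sharp_in_B bmult_in_B sym_act_closed simp del: free_symbols_simps
        simp: B.add_closed[of _ \<delta>, simplified] B.smult_closed[of _ \<delta>, simplified])
qed

lemma N_subset: "lin_span Rel \<subseteq> carrier F"
proof
  fix x assume "x \<in> lin_span Rel"
  then show "x \<in> carrier F"
    by (induction rule: lin_span_induct) (use Rel_subset F_closed in blast)+
qed

lemma submodule_N: "submodule (lin_span Rel) scalar_ring F"
  unfolding submodule_scalar_ring_iff[OF module_free_symbols] free_symbols_simps(1-3)
  using N_subset lin_span_closed[where S=Rel] by blast

sublocale Q: module_quotient F "lin_span Rel"
  by (simp add: module_quotient_def module_quotient_axioms_def submodule_N module_free_symbols)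

lemma act_F_symbol: "act F a (symbol (b, v)) = symbol (bmult \<delta> a b, v)"
  by simp

lemma act_F_linear:
  "act F a (p + q) = act F a p + act F a q" "act F a (scale c p) = scale c (act F a p)"
  "act F a (p - q) = act F a p - act F a q" "act F a 0 = 0"
  unfolding free_symbols_simps by (simp_all only: lin_ext_add lin_ext_scale lin_ext_diff lin_ext_zero)

lemma F_induct [consumes 1, case_names zero add scale symbol]:
  assumes "p \<in> carrier F" "P 0" "\<And>p q. P p \<Longrightarrow> P q \<Longrightarrow> P (p + q)" "\<And>c p. P p \<Longrightarrow> P (scale c p)"
    "\<And>b v. b \<in> carrier (B_alg \<delta>) \<Longrightarrow> v \<in> carrier H \<Longrightarrow> P (symbol (b, v))"
  shows "P p"
  using assms(1)[unfolded F_carrier]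
  by (induction rule: free_induct) (use assms(2-5) in auto)

lemma act_F_closed:
  assumes "a \<in> carrier (B_alg \<delta>)" "p \<in> carrier F"
  shows "act F a p \<in> carrier F"
  using assms(2)
proof (induction rule: F_induct)
  case (symbol b v)
  then show ?case unfolding act_F_symbol F_closed using assms(1) by (simp add: bmult_in_B)
qed (unfold act_F_linear, (rule F_closed | assumption)+)

lemma act_N_closed:
  assumes a: "a \<in> carrier (B_alg \<delta>)" and "x \<in> lin_span Rel"
  shows "act F a x \<in> lin_span Rel"
  using assms(2)
proof (induction rule: lin_span_induct)
  case (base x)
  have "act F a x \<in> Rel"
    using base
  proof (cases rule: Rel_cases)
    case (add_left b b' v)
    then show ?thesis using RelI(1)[of "bmult \<delta> a b" "bmult \<delta> a b'" v] a
      by (simp only: act_F_linear act_F_symbol bilinear_ext_add bmult_in_B)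
  next
    case (add_right b v v')
    then show ?thesis using RelI(2)[of "bmult \<delta> a b" v v'] a
      by (simp only: act_F_linear act_F_symbol bmult_in_B)
  next
    case (scale_left c b v)
    then show ?thesis using RelI(3)[of "bmult \<delta> a b" v c] a
      by (simp only: act_F_linear act_F_symbol bilinear_ext_scale bmult_in_B)
  next
    case (scale_right c b v)
    then show ?thesis using RelI(4)[of "bmult \<delta> a b" v c] a
      by (simp only: act_F_linear act_F_symbol bmult_in_B)
  next
    case (balanced b s v)
    then show ?thesis using RelI(5)[of "bmult \<delta> a b" s v] a
      by (simp only: act_F_linear act_F_symbol bmult_in_B bmult_assoc B_sharp_in_B)
  qed
  then show ?case by (rule lin_span_closed)
next
  case zero
  show ?case unfolding act_F_linear by (rule lin_span_closed)
next
  case (add p q)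
  then show ?case unfolding act_F_linear by (rule lin_span_closed(2))
next
  case (scale c p)
  then show ?case unfolding act_F_linear by (rule lin_span_closed(3))
qed

lemma amodule_T: "amodule (B_alg \<delta>) T"
proof -
  note mem = lin_span_closed[where S=Rel]
  \<comment> \<open>The action on free symbols is linear in the symbol but not in the algebra
    element; the defect is a combination of relations.\<close>
  have left_add: "act F (a + b) p - (act F a p + act F b p) \<in> lin_span Rel"
    if "a \<in> carrier (B_alg \<delta>)" "b \<in> carrier (B_alg \<delta>)" "p \<in> carrier F" for a b p
    using that(3)
  proof (induction rule: F_induct)
    case (add p q)
    have "act F (a + b) (p + q) - (act F a (p + q) + act F b (p + q)) =
        (act F (a + b) p - (act F a p + act F b p)) + (act F (a + b) q - (act F a q + act F b q))"
      unfolding act_F_linear by simp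
    then show ?case using add mem(2) by metis
  next
    case (scale c p)
    have "act F (a + b) (scale c p) - (act F a (scale c p) + act F b (scale c p)) =
        scale c (act F (a + b) p - (act F a p + act F b p))"
      unfolding act_F_linear by (simp add: free.scale_right_diff_distrib free.scale_right_distrib)
    then show ?case using scale mem(3) by metis
  next
    case (symbol d v)
    then have "symbol (bmult \<delta> a d + bmult \<delta> b d, v) - symbol (bmult \<delta> a d, v) - symbol (bmult \<delta> b d, v) \<in> Rel"
      using that by (intro RelI bmult_in_B)
    then show ?case unfolding act_F_symbol bilinear_ext_add using mem(4) by (simp add: algebra_simps)
  qed (simp add: act_F_linear mem)
  have left_smult: "act F (scale c a) p - scale c (act F a p) \<in> lin_span Rel"
    if "a \<in> carrier (B_alg \<delta>)" "p \<in> carrier F" for a c p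
    using that(2)
  proof (induction rule: F_induct)
    case (add p q)
    have "act F (scale c a) (p + q) - scale c (act F a (p + q)) =
        (act F (scale c a) p - scale c (act F a p)) + (act F (scale c a) q - scale c (act F a q))"
      unfolding act_F_linear by (simp add: free.scale_right_distrib)
    then show ?case using add mem(2) by metis
  next
    case (scale d p)
    have "act F (scale c a) (scale d p) - scale c (act F a (scale d p)) =
        scale d (act F (scale c a) p - scale c (act F a p))"
      unfolding act_F_linear by (simp add: free.scale_right_diff_distrib mult.commute)
    then show ?case using scale mem(3) by metis
  next
    case (symbol d v)
    then have "symbol (scale c (bmult \<delta> a d), v) - scale c (symbol (bmult \<delta> a d, v)) \<in> Rel"
      using that by (intro RelI bmult_in_B)
    then show ?case unfolding act_F_symbol bilinear_ext_scale by (rule mem(4))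
  qed (simp add: act_F_linear mem)
  \<comment> \<open>Compatibility with the product, by contrast, holds exactly, because the product
    of \<open>B\<close> is associative.\<close>
  have left_mult: "act F (bmult \<delta> a b) p - act F a (act F b p) \<in> lin_span Rel"
    if "a \<in> carrier (B_alg \<delta>)" "b \<in> carrier (B_alg \<delta>)" "p \<in> carrier F" for a b p
  proof -
    have "act F (bmult \<delta> a b) p = act F a (act F b p)"
      using that(3)
    proof (induction rule: F_induct)
      case (symbol d v)
      then show ?case unfolding act_F_symbol using that by (simp add: bmult_assoc)
    qed (simp_all only: act_F_linear)
    then show ?thesis using mem(1) by simp
  qed
  have "amodule (B_alg \<delta>) (quotient_amodule F (lin_span Rel))"
  proof (rule Q.amodule_quotient[OF closed_algebra_B])
    fix a b x assume abx: "a \<in> carrier (B_alg \<delta>)" "b \<in> carrier (B_alg \<delta>)" "x \<in> carrier F"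
    then have ab: "a + b \<in> carrier (B_alg \<delta>)" "bmult \<delta> a b \<in> carrier (B_alg \<delta>)"
      using B.add_closed[of a \<delta> b] bmult_in_B by simp_all
    show "act F (a \<oplus>\<^bsub>B_alg \<delta>\<^esub> b) x \<ominus>\<^bsub>F\<^esub> (act F a x \<oplus>\<^bsub>F\<^esub> act F b x) \<in> lin_span Rel"
      using left_add[OF abx] unfolding B_alg_simps free_symbols_simps(2)
      by (subst minus_free_symbols) (intro act_F_closed F_closed ab abx | assumption)+
    show "act F (a \<otimes>\<^bsub>B_alg \<delta>\<^esub> b) x \<ominus>\<^bsub>F\<^esub> act F a (act F b x) \<in> lin_span Rel"
      using left_mult[OF abx] unfolding B_alg_simps free_symbols_simps(2)
      by (subst minus_free_symbols) (intro act_F_closed F_closed ab abx | assumption)+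
  next
    fix a c x assume ax: "a \<in> carrier (B_alg \<delta>)" "x \<in> carrier F"
    then have ca: "scale c a \<in> carrier (B_alg \<delta>)" using B.smult_closed[of a \<delta>] by simp
    show "act F (c \<odot>\<^bsub>B_alg \<delta>\<^esub> a) x \<ominus>\<^bsub>F\<^esub> c \<odot>\<^bsub>F\<^esub> act F a x \<in> lin_span Rel"
      using left_smult[OF ax] unfolding B_alg_simps free_symbols_simps(3)
      by (subst minus_free_symbols) (intro act_F_closed F_closed ca ax | assumption)+
  qed (simp_all only: act_F_closed act_N_closed free_symbols_simps(2,3) act_F_linear)
  then show ?thesis by (simp add: Delta_def tensor_module_def)
qed

sublocale T: brauer_module \<delta> T
  by (rule brauer_moduleI[OF amodule_T])

definition tens :: "'k brauer_element \<Rightarrow> 'w \<Rightarrow> (('k brauer_element \<times> 'w) \<Rightarrow>\<^sub>0 'k) set" where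
  "tens b v = lin_span Rel +>\<^bsub>F\<^esub> symbol (b, v)"

lemma T_eq: "T = quotient_amodule F (lin_span Rel)"
  by (simp add: Delta_def tensor_module_def)

lemma tens_closed: "b \<in> carrier (B_alg \<delta>) \<Longrightarrow> v \<in> carrier H \<Longrightarrow> tens b v \<in> carrier T"
  unfolding T_eq Q.carrier_quotient tens_def by (intro imageI) (simp only: F_closed)

lemma coset_eqI:
  assumes "x \<in> carrier F" "y \<in> carrier F" "x - y \<in> Rel"
  shows "lin_span Rel +>\<^bsub>F\<^esub> x = lin_span Rel +>\<^bsub>F\<^esub> y"
  using assms by (simp only: Q.coset_eq_iff minus_free_symbols lin_span_closed(4))

lemma tens_add_left:
  assumes "b \<in> carrier (B_alg \<delta>)" "b' \<in> carrier (B_alg \<delta>)" "v \<in> carrier H"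
  shows "tens (b + b') v = tens b v \<oplus>\<^bsub>T\<^esub> tens b' v"
proof -
  have "tens b v \<oplus>\<^bsub>T\<^esub> tens b' v = lin_span Rel +>\<^bsub>F\<^esub> (symbol (b, v) + symbol (b', v))"
    unfolding tens_def T_eq using assms by (subst Q.coset_add) (simp_all only: F_closed free_symbols_simps(2))
  moreover have "b + b' \<in> carrier (B_alg \<delta>)" using assms B.add_closed[of b \<delta> b'] by simp
  ultimately show ?thesis
    unfolding tens_def using RelI(1)[OF assms] assms
    by (simp only:) (intro coset_eqI; simp only: F_closed diff_diff_add)
qed

lemma tens_add_right:
  assumes "b \<in> carrier (B_alg \<delta>)" "v \<in> carrier H" "v' \<in> carrier H"
  shows "tens b (v \<oplus>\<^bsub>H\<^esub> v') = tens b v \<oplus>\<^bsub>T\<^esub> tens b v'"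
proof -
  have "tens b v \<oplus>\<^bsub>T\<^esub> tens b v' = lin_span Rel +>\<^bsub>F\<^esub> (symbol (b, v) + symbol (b, v'))"
    unfolding tens_def T_eq using assms by (subst Q.coset_add) (simp_all only: F_closed free_symbols_simps(2))
  then show ?thesis
    unfolding tens_def using RelI(2)[OF assms] assms H.a_closed
    by (simp only:) (intro coset_eqI; simp only: F_closed diff_diff_add)
qed

lemma tens_scale_left:
  assumes "b \<in> carrier (B_alg \<delta>)" "v \<in> carrier H"
  shows "tens (scale c b) v = c \<odot>\<^bsub>T\<^esub> tens b v"
proof -
  have "c \<odot>\<^bsub>T\<^esub> tens b v = lin_span Rel +>\<^bsub>F\<^esub> scale c (symbol (b, v))"
    unfolding tens_def T_eq using assms by (subst Q.coset_smult) (simp_all only: F_closed free_symbols_simps(3))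
  moreover have "scale c b \<in> carrier (B_alg \<delta>)" using assms B.smult_closed[of b \<delta>] by simp
  ultimately show ?thesis
    unfolding tens_def using RelI(3)[OF assms] assms
    by (simp only:) (intro coset_eqI; simp only: F_closed)
qed

lemma tens_scale_right:
  assumes "b \<in> carrier (B_alg \<delta>)" "v \<in> carrier H"
  shows "tens b (c \<odot>\<^bsub>H\<^esub> v) = c \<odot>\<^bsub>T\<^esub> tens b v"
proof -
  have "c \<odot>\<^bsub>T\<^esub> tens b v = lin_span Rel +>\<^bsub>F\<^esub> scale c (symbol (b, v))"
    unfolding tens_def T_eq using assms by (subst Q.coset_smult) (simp_all only: F_closed free_symbols_simps(3))
  then show ?thesis
    unfolding tens_def using RelI(4)[OF assms] assms H.smult_in[of v c]
    by (simp only:) (intro coset_eqI; simp only: F_closed)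
qed

lemma tens_balanced:
  assumes "b \<in> carrier (B_alg \<delta>)" "s \<in> carrier (B_sharp \<delta>)" "v \<in> carrier H"
  shows "tens (bmult \<delta> b s) v = tens b (act H (sym_component m s) v)"
  unfolding tens_def
  using RelI(5)[OF assms] assms sym_act_closed[OF assms(3)] bmult_in_B[OF assms(1) B_sharp_in_B[OF assms(2)]]
  by (intro coset_eqI; simp only: F_closed)

lemma act_tens:
  assumes "a \<in> carrier (B_alg \<delta>)" "b \<in> carrier (B_alg \<delta>)" "v \<in> carrier H"
  shows "act T a (tens b v) = tens (bmult \<delta> a b) v"
proof -
  have "act (quotient_amodule F (lin_span Rel)) a (lin_span Rel +>\<^bsub>F\<^esub> symbol (b, v)) =
      lin_span Rel +>\<^bsub>F\<^esub> act F a (symbol (b, v))"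
    using assms
    by (intro Q.coset_act) (simp_all only: F_closed(5) act_F_closed act_N_closed act_F_linear free_symbols_simps(2))
  then show ?thesis unfolding T_eq tens_def act_F_symbol .
qed

lemma tens_zero_left: "v \<in> carrier H \<Longrightarrow> tens 0 v = \<zero>\<^bsub>T\<^esub>"
  using tens_scale_left[of 0 v 0] tens_closed[of 0 v] T.smult_zero_left by simp

lemma tens_zero_right: "b \<in> carrier (B_alg \<delta>) \<Longrightarrow> tens b \<zero>\<^bsub>H\<^esub> = \<zero>\<^bsub>T\<^esub>"
  using tens_scale_right[of b "\<zero>\<^bsub>H\<^esub>" 0] tens_closed[of b "\<zero>\<^bsub>H\<^esub>"] H.smult_zero_left[of "\<zero>\<^bsub>H\<^esub>"] T.smult_zero_left
  by simp

text \<open>Pure tensors with a single diagram suffice because \<open>tens\<close> is linear in its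
  first argument.\<close>

lemma T_induct [consumes 1, case_names zero add scale tens]:
  assumes "v \<in> carrier T" "P \<zero>\<^bsub>T\<^esub>"
    and "\<And>v w. v \<in> carrier T \<Longrightarrow> w \<in> carrier T \<Longrightarrow> P v \<Longrightarrow> P w \<Longrightarrow> P (v \<oplus>\<^bsub>T\<^esub> w)"
    and "\<And>c v. v \<in> carrier T \<Longrightarrow> P v \<Longrightarrow> P (c \<odot>\<^bsub>T\<^esub> v)"
    and "\<And>g x. brauer_diagram g \<Longrightarrow> x \<in> carrier H \<Longrightarrow> P (tens (symbol g) x)"
  shows "P v"
proof -
  have tens: "P (tens b x)" if "b \<in> carrier (B_alg \<delta>)" "x \<in> carrier H" for b x
    using that(1)
  proof (induction rule: T.B_induct)
    case (add a b)
    then show ?case using that assms(3) tens_closed by (simp add: tens_add_left)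
  next
    case (scale c a)
    then show ?case using that assms(4) tens_closed by (simp add: tens_scale_left)
  qed (use that assms(2,5) in \<open>simp_all add: tens_zero_left\<close>)
  obtain p where p: "p \<in> carrier F" "v = lin_span Rel +>\<^bsub>F\<^esub> p"
    using assms(1) unfolding T_eq Q.carrier_quotient by blast
  have cT: "lin_span Rel +>\<^bsub>F\<^esub> q \<in> carrier T" if "q \<in> carrier F" for q
    using that unfolding T_eq Q.carrier_quotient by (rule imageI)
  have "p \<in> carrier F \<and> P (lin_span Rel +>\<^bsub>F\<^esub> p)" using p(1)
  proof (induction rule: F_induct)
    case zero
    have "lin_span Rel +>\<^bsub>F\<^esub> 0 = \<zero>\<^bsub>T\<^esub>"
      unfolding T_eq Q.zero_quotient using Q.coset_eq_W_iff[OF F_closed(4)] lin_span_closed(1) by blast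
    then show ?case using assms(2) F_closed(4) by simp
  next
    case (add p q)
    have "lin_span Rel +>\<^bsub>F\<^esub> (p + q) = (lin_span Rel +>\<^bsub>F\<^esub> p) \<oplus>\<^bsub>T\<^esub> (lin_span Rel +>\<^bsub>F\<^esub> q)"
      unfolding T_eq using add by (subst Q.coset_add) (simp_all only: free_symbols_simps(2))
    then show ?case using add assms(3)[OF cT cT] F_closed(1) by simp
  next
    case (scale c p)
    have "lin_span Rel +>\<^bsub>F\<^esub> scale c p = c \<odot>\<^bsub>T\<^esub> (lin_span Rel +>\<^bsub>F\<^esub> p)"
      unfolding T_eq using scale by (subst Q.coset_smult) (simp_all only: free_symbols_simps(3))
    then show ?case using scale assms(4)[OF cT] F_closed(2) by simp
  next
    case (symbol b x)
    then show ?case using tens[of b x] F_closed(5)[of b x] unfolding tens_def by blast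
  qed
  then show ?thesis using p by simp
qed

text \<open>An element of \<open>B_sharp\<close> that acts as zero on \<open>H\<close> is moved
  across the tensor sign: the idempotent of a word of the wrong length, or the lower factor of a
  diagram with a cap.\<close>

lemma tens_diagram_zero:
  assumes g: "brauer_diagram g" and x: "x \<in> carrier H" and "n_bot g \<noteq> m \<or> caps g \<noteq> {}"
  shows "tens (symbol g) x = \<zero>\<^bsub>T\<^esub>"
proof (cases "caps g = {}")
  case True
  then have "n_bot g \<noteq> m" using assms by simp
  have "tens (symbol g) x = tens (bmult \<delta> (symbol g) (B_id (n_bot g))) x"
    using g by (simp add: bmult_B_id)
  also have "\<dots> = tens (symbol g) (act H (sym_component m (B_id (n_bot g))) x)"
    using g x by (intro tens_balanced B_zero_in_B_sharp) auto
  also have "act H (sym_component m (B_id (n_bot g))) x = act H (0 \<odot>\<^bsub>group_algebra m\<^esub> symbol id) x"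
    using \<open>n_bot g \<noteq> m\<close> by (simp add: sym_component_B_id)
  also have "\<dots> = \<zero>\<^bsub>H\<^esub>"
    using x by (subst H.act_smult_left) (auto simp: permutes_id H.smult_zero_left H.act_closed)
  finally show ?thesis using g by (simp add: tens_zero_right)
next
  case False
  then obtain u l where ul: "brauer_diagram u" "brauer_diagram l" "n_top l = n_bot u"
    "cups l = {}" "caps l \<noteq> {}" "stack u l = g" "loops u l = 0" by (rule factor_cap[OF g])
  have "l \<noteq> perm_diagram m \<sigma>" for \<sigma> using ul by auto
  then have l: "sym_component m (symbol l) = (0 :: (nat \<Rightarrow> nat) \<Rightarrow>\<^sub>0 'k)" by (intro sym_component_not_perm)
  have "tens (symbol g) x = tens (bmult \<delta> (symbol u) (symbol l)) x"
    using ul by (simp add: bilinear_ext_symbol diagram_mult_def)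
  also have "\<dots> = tens (symbol u) (act H (sym_component m (symbol l)) x)"
    using ul x by (intro tens_balanced) (auto simp: in_B_sharp)
  also have "act H (sym_component m (symbol l)) x = act H (0 \<odot>\<^bsub>group_algebra m\<^esub> symbol id) x"
    by (simp add: l)
  also have "\<dots> = \<zero>\<^bsub>H\<^esub>"
    using x by (subst H.act_smult_left) (auto simp: permutes_id H.smult_zero_left H.act_closed)
  finally show ?thesis using ul by (simp add: tens_zero_right)
qed

lemma tens_B_zero:
  assumes "b \<in> carrier (B_zero \<delta>)" "x \<in> carrier H"
  shows "act T b (tens (B_id m) x) = tens (B_id m) (act H (sym_component m b) x)"
proof -
  have bs: "b \<in> carrier (B_sharp \<delta>)" "b \<in> carrier (B_alg \<delta>)"
    using assms(1) B_zero_in_B_sharp B_sharp_in_B by blast+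
  \<comment> \<open>A diagram without cups and caps has equally many points above and below, so
    \<open>B_id m\<close> selects the same diagrams from either side.\<close>
  have "bmult \<delta> b (B_id m) = bmult \<delta> (B_id m) b"
    using assms(1)[unfolded in_B_zero]
  proof (induction rule: free_induct)
    case (symbol g)
    then have "n_bot g = n_top g" using without_cups_le[of g] without_caps_le[of g] by simp
    then show ?case using symbol by (simp add: bmult_B_id)
  qed (simp_all add: bilinear_ext_add bilinear_ext_scale)
  then show ?thesis using bs assms by (simp add: act_tens tens_balanced)
qed

lemma act_B_id_tens:
  assumes g: "brauer_diagram g" and x: "x \<in> carrier H"
  shows "act T (B_id k) (tens (symbol g) x) = (if n_top g = k then tens (symbol g) x else \<zero>\<^bsub>T\<^esub>)"
  using assms by (simp add: act_tens bmult_B_id tens_zero_left)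

text \<open>A nonzero tensor comes from a diagram with \<open>m\<close> bottom points and no caps,
  and such a diagram has at least \<open>m\<close> top points.\<close>

lemma act_B_id_low:
  assumes "v \<in> carrier T" "k < m"
  shows "act T (B_id k) v = \<zero>\<^bsub>T\<^esub>"
  using assms(1)
proof (induction rule: T_induct)
  case (tens g x)
  then show ?case
    using tens_diagram_zero[of g x] without_caps_le[of g] \<open>k < m\<close>
    by (cases "caps g = {} \<and> n_bot g = m") (auto simp: act_B_id_tens T.act_zero_right)
qed (simp_all add: T.act_add_right T.act_smult_right T.smult_zero_right T.act_zero_right)

lemma act_B_id_T:
  assumes "v \<in> carrier T"
  shows "\<exists>x\<in>carrier H. act T (B_id m) v = tens (B_id m) x"
  using assms
proof (induction rule: T_induct)
  case zero
  show ?case by (intro bexI[of _ "\<zero>\<^bsub>H\<^esub>"]) (simp_all add: tens_zero_right T.act_zero_right)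
next
  case (add v w)
  then obtain x y where "x \<in> carrier H" "y \<in> carrier H"
    "act T (B_id m) v = tens (B_id m) x" "act T (B_id m) w = tens (B_id m) y" by blast
  then show ?case using add
    by (intro bexI[of _ "x \<oplus>\<^bsub>H\<^esub> y"]) (simp_all add: tens_add_right T.act_add_right)
next
  case (scale c v)
  then obtain x where "x \<in> carrier H" "act T (B_id m) v = tens (B_id m) x" by blast
  then show ?case using scale H.smult_in[of x c]
    by (intro bexI[of _ "c \<odot>\<^bsub>H\<^esub> x"]) (simp_all add: tens_scale_right T.act_smult_right)
next
  case (tens g x)
  show ?case
  proof (cases "n_bot g = m \<and> caps g = {} \<and> n_top g = m")
    case True
    \<comment> \<open>The surviving diagrams are permutation diagrams; these lie in
      \<open>B_sharp\<close> and can be moved across to \<open>H\<close>.\<close>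
    then obtain \<sigma> where "g = perm_diagram (n_bot g) \<sigma>" using perm_diagramE[OF tens(1)] by metis
    then have "cups g = {}" using cups_perm by metis
    then have gs: "symbol g \<in> carrier (B_sharp \<delta>)" using tens(1) by (simp add: in_B_sharp)
    have "act T (B_id m) (tens (symbol g) x) = tens (bmult \<delta> (B_id m) (symbol g)) x"
      using tens by (simp add: act_tens)
    also have "\<dots> = tens (B_id m) (act H (sym_component m (symbol g)) x)"
      using tens gs by (intro tens_balanced) auto
    finally show ?thesis using tens sym_act_closed by blast
  next
    case False
    then have "act T (B_id m) (tens (symbol g) x) = \<zero>\<^bsub>T\<^esub>"
      using tens tens_diagram_zero[of g x]
      by (cases "caps g = {} \<and> n_bot g = m") (auto simp: act_B_id_tens T.act_zero_right)
    then show ?thesis by (intro bexI[of _ "\<zero>\<^bsub>H\<^esub>"]) (simp_all add: tens_zero_right)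
  qed
qed

lemma locally_unital_T: "T.locally_unital"
proof -
  \<comment> \<open>As for left units in \<open>B\<close>, it is the statement for all larger index
    sets that survives addition of vectors.\<close>
  have ex: "\<exists>M. finite M \<and> (\<forall>M'. finite M' \<longrightarrow> M \<subseteq> M' \<longrightarrow> act T (sum B_id M') v = v)"
    if "v \<in> carrier T" for v
    using that
  proof (induction rule: T_induct)
    case zero
    show ?case using T.sum_B_id_in_B by (intro exI[of _ "{}"]) (simp add: T.act_zero_right)
  next
    case (add v w)
    from add(3) obtain M
      where M: "finite M" "\<forall>N. finite N \<longrightarrow> M \<subseteq> N \<longrightarrow> act T (sum B_id N) v = v" by blast
    from add(4) obtain M'
      where M': "finite M'" "\<forall>N. finite N \<longrightarrow> M' \<subseteq> N \<longrightarrow> act T (sum B_id N) w = w" by blast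
    have "act T (sum B_id N) (v \<oplus>\<^bsub>T\<^esub> w) = v \<oplus>\<^bsub>T\<^esub> w" if N: "finite N" "M \<union> M' \<subseteq> N" for N
    proof -
      have "act T (sum B_id N) v = v" "act T (sum B_id N) w = w" using M(2) M'(2) N by blast+
      then show ?thesis using T.act_add_right[OF T.sum_B_id_in_B[OF N(1)] add(1,2)] by simp
    qed
    then show ?case using M(1) M'(1) by (intro exI[of _ "M \<union> M'"]) blast
  next
    case (scale c v)
    from scale(2) obtain M
      where M: "finite M" "\<forall>N. finite N \<longrightarrow> M \<subseteq> N \<longrightarrow> act T (sum B_id N) v = v" by blast
    have "act T (sum B_id N) (c \<odot>\<^bsub>T\<^esub> v) = c \<odot>\<^bsub>T\<^esub> v" if N: "finite N" "M \<subseteq> N" for N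
    proof -
      have "act T (sum B_id N) v = v" using M(2) N by blast
      then show ?thesis using T.act_smult_right[OF T.sum_B_id_in_B[OF N(1)] scale(1)] by simp
    qed
    then show ?case using M(1) by blast
  next
    case (tens g x)
    obtain M where M: "finite M"
        "\<forall>N. finite N \<longrightarrow> M \<subseteq> N \<longrightarrow> bmult \<delta> (sum B_id N) (symbol g) = symbol g"
      using T.B_id_left_unit[of "symbol g"] tens(1) by auto
    have "act T (sum B_id N) (tens (symbol g) x) = tens (symbol g) x" if N: "finite N" "M \<subseteq> N" for N
    proof -
      have "bmult \<delta> (sum B_id N) (symbol g) = symbol g" using M(2) N by blast
      then show ?thesis using act_tens[OF T.sum_B_id_in_B[OF N(1)] _ tens(2), of "symbol g"] tens(1) by simp
    qed
    then show ?case using M(1) by blast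
  qed
  have "\<exists>M. finite M \<and> act T (sum B_id M) v = v" if v: "v \<in> carrier T" for v
  proof -
    obtain M where M: "finite M" "\<forall>M'. finite M' \<longrightarrow> M \<subseteq> M' \<longrightarrow> act T (sum B_id M') v = v"
      using ex[OF v] by (elim exE conjE)
    from M(2)[rule_format, OF M(1) order_refl] M(1) show ?thesis by (intro exI conjI)
  qed
  then show ?thesis unfolding T.locally_unital_def by (intro ballI)
qed

text \<open>A linear map back to \<open>H\<close> shows that the relations do not collapse the
  tensor product. The map \<open>?\<Phi>\<close> sends the symbol \<open>(b, v)\<close> to
  \<open>sym_component m b\<close> applied to \<open>v\<close>. It respects the balanced relations
  because \<open>sym_component\<close> is multiplicative when the right factor has no cups, and it
  recovers \<open>x\<close> from \<open>tens (B_id m) x\<close>.\<close>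

lemma tens_B_id_eq_zero:
  assumes x: "x \<in> carrier H" and zero: "tens (B_id m) x = \<zero>\<^bsub>T\<^esub>"
  shows "x = \<zero>\<^bsub>H\<^esub>"
proof -
  let ?f = "\<lambda>(b, v). act H (sym_component m b) v" and ?S = "carrier (B_alg \<delta>) \<times> carrier H"
  let ?\<Phi> = "lin_ext_to H ?f"
  have f: "?f y \<in> carrier H" if "y \<in> ?S" for y using that sym_act_closed by auto
  have \<Phi>_add: "?\<Phi> (p + q) = ?\<Phi> p \<oplus>\<^bsub>H\<^esub> ?\<Phi> q" if "p \<in> carrier F" "q \<in> carrier F" for p q
    using lin_ext_to_add[OF H.module_axioms, of ?S ?f p q] f that unfolding F_carrier by blast
  have \<Phi>_scale: "?\<Phi> (scale c p) = c \<odot>\<^bsub>H\<^esub> ?\<Phi> p" if "p \<in> carrier F" for c p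
    using lin_ext_to_scale[OF H.module_axioms, of ?S ?f p] f that unfolding F_carrier by blast
  have \<Phi>_symbol: "?\<Phi> (symbol (b, v)) = act H (sym_component m b) v"
    if "b \<in> carrier (B_alg \<delta>)" "v \<in> carrier H" for b v
    using lin_ext_to_symbol[OF H.module_axioms, of ?S ?f "(b, v)"] f that by auto
  have \<Phi>_closed: "?\<Phi> p \<in> carrier H" if "p \<in> carrier F" for p
    using lin_ext_to_closed[OF H.module_axioms, of ?S ?f p] f that unfolding F_carrier by blast
  have \<Phi>_diff: "?\<Phi> (p - q) = \<zero>\<^bsub>H\<^esub>" if "p \<in> carrier F" "q \<in> carrier F" "?\<Phi> p = ?\<Phi> q" for p q
  proof -
    have "?\<Phi> (p - q) = ?\<Phi> (p + scale (-1) q)" by simp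
    also have "\<dots> = ?\<Phi> p \<oplus>\<^bsub>H\<^esub> (-1) \<odot>\<^bsub>H\<^esub> ?\<Phi> q"
      using that F_closed(2)[of q "-1"] by (simp only: \<Phi>_add \<Phi>_scale)
    also have "\<dots> = \<zero>\<^bsub>H\<^esub>" using that H.eq_iff_diff_zero[OF \<Phi>_closed \<Phi>_closed] by blast
    finally show ?thesis .
  qed
  have sa: "act H (sym_component m (b + b')) v = act H (sym_component m b) v \<oplus>\<^bsub>H\<^esub> act H (sym_component m b') v"
    if "v \<in> carrier H" for b b' v
    using that H.act_add_left[OF sym_component_in sym_component_in, of v] by (simp add: sym_component_add)
  have ss: "act H (sym_component m (scale c b)) v = c \<odot>\<^bsub>H\<^esub> act H (sym_component m b) v"
    if "v \<in> carrier H" for b c v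
    using that H.act_smult_left[OF sym_component_in, of v] by (simp add: sym_component_scale)
  have Rel0: "?\<Phi> r = \<zero>\<^bsub>H\<^esub>" if "r \<in> Rel" for r
    using that
  proof (cases rule: Rel_cases)
    case (add_left b b' v)
    then have "b + b' \<in> carrier (B_alg \<delta>)" using B.add_closed[of b \<delta> b'] by simp
    with add_left show ?thesis unfolding add_left(1) diff_diff_add
      by (intro \<Phi>_diff) (simp_all only: F_closed \<Phi>_add \<Phi>_symbol sa)
  next
    case (add_right b v v')
    then have "v \<oplus>\<^bsub>H\<^esub> v' \<in> carrier H" by simp
    with add_right show ?thesis unfolding add_right(1) diff_diff_add
      by (intro \<Phi>_diff) (simp_all only: F_closed \<Phi>_add \<Phi>_symbol H.act_add_right sym_component_in)
  next
    case (scale_left c b v)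
    then have "scale c b \<in> carrier (B_alg \<delta>)" using B.smult_closed[of b \<delta>] by simp
    with scale_left show ?thesis unfolding scale_left(1)
      by (intro \<Phi>_diff) (simp_all only: F_closed \<Phi>_scale \<Phi>_symbol ss)
  next
    case (scale_right c b v)
    then have "c \<odot>\<^bsub>H\<^esub> v \<in> carrier H" using H.smult_in by blast
    with scale_right show ?thesis unfolding scale_right(1)
      by (intro \<Phi>_diff) (simp_all only: F_closed \<Phi>_scale \<Phi>_symbol H.act_smult_right sym_component_in)
  next
    case (balanced b s v)
    have "act H (sym_component m (bmult \<delta> b s)) v = act H (sym_component m b) (act H (sym_component m s) v)"
      using balanced H.act_mult[OF sym_component_in sym_component_in, of v] by (simp add: sym_component_bmult)
    with balanced sym_act_closed show ?thesis unfolding balanced(1)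
      by (intro \<Phi>_diff) (simp_all only: F_closed \<Phi>_symbol bmult_in_B B_sharp_in_B)
  qed
  have N0: "p \<in> carrier F \<and> ?\<Phi> p = \<zero>\<^bsub>H\<^esub>" if "p \<in> lin_span Rel" for p
    using that
  proof (induction rule: lin_span_induct)
    case zero
    have "?\<Phi> (0 - 0) = \<zero>\<^bsub>H\<^esub>" using F_closed(4) by (intro \<Phi>_diff) auto
    then show ?case using F_closed(4) by simp
  next
    case (add p q)
    then show ?case using F_closed(1) \<Phi>_add by simp
  next
    case (scale c p)
    then show ?case using F_closed(2) \<Phi>_scale H.smult_zero_right by simp
  next
    case (base r)
    then show ?case using Rel0 Rel_subset by blast
  qed
  have "symbol (B_id m, x) \<in> carrier F" using x by (simp only: F_closed B_id_in_B)
  then have "symbol (B_id m, x) \<in> lin_span Rel"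
    using zero Q.coset_eq_W_iff unfolding tens_def T_eq Q.zero_quotient by blast
  then have "?\<Phi> (symbol (B_id m, x)) = \<zero>\<^bsub>H\<^esub>" using N0 by blast
  then have "act H (sym_component m (B_id m)) x = \<zero>\<^bsub>H\<^esub>" by (simp only: \<Phi>_symbol[OF B_id_in_B x])
  then show ?thesis using unital[OF x] by (simp add: sym_component_B_id)
qed

end

lemma pullback_simps:
  "carrier (pullback f V) = carrier V" "zero (pullback f V) = zero V" "add (pullback f V) = add V"
  "module.smult (pullback f V) = module.smult V" "act (pullback f V) b = act V (f b)"
  by (simp_all add: pullback_def)

lemma module_cong:
  assumes "Module.module R V"
    and [simp]: "carrier W = carrier V" "zero W = zero V" "add W = add V" "module.smult W = module.smult V"
  shows "Module.module R W"
proof -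
  interpret Module.module R V by fact
  show ?thesis
  proof (rule moduleI)
    show "abelian_group W"
    proof (rule abelian_groupI)
      fix x assume "x \<in> carrier W"
      then show "\<exists>y\<in>carrier W. y \<oplus>\<^bsub>W\<^esub> x = \<zero>\<^bsub>W\<^esub>" by (intro bexI[of _ "\<ominus>\<^bsub>V\<^esub> x"]) (simp_all add: M.l_neg)
    qed (simp_all add: M.a_ac)
  qed (simp_all add: R.cring_axioms smult_l_distr smult_r_distr smult_assoc1)
qed

section \<open>Heads of the standard modules of simple modules\<close>

locale simple_inflation = inflation m H \<delta>
  for m and H :: "('k::field, 'w, (nat \<Rightarrow> nat) \<Rightarrow>\<^sub>0 'k) amodule" and \<delta> +
  assumes simple: "simple_amodule (group_algebra m) H"
begin

text \<open>The \<open>y\<close> whose tensor \<open>tens (B_id m) y\<close> lies in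
  \<open>W\<close> form a submodule of \<open>H\<close>, because permutation diagrams act on these
  tensors as permutations act on \<open>H\<close>; simplicity of \<open>H\<close> leaves all or
  nothing.\<close>

lemma subset_of_submodule:
  assumes W: "asubmodule (B_alg \<delta>) T W" and x: "x \<in> carrier H" "x \<noteq> \<zero>\<^bsub>H\<^esub>" "tens (B_id m) x \<in> W"
    and y: "y \<in> carrier H"
  shows "tens (B_id m) y \<in> W"
proof -
  let ?U = "{y \<in> carrier H. tens (B_id m) y \<in> W}"
  note W' = W[unfolded T.asubmodule_iff]
  have "tens (B_id m) (act H a y) \<in> W" if "a \<in> carrier (group_algebra m)" "y \<in> ?U" for a y
  proof -
    have "act T (perm_embedding m a) (tens (B_id m) y) = tens (B_id m) (act H a y)"
      using that tens_B_zero[OF perm_embedding_in] by (simp add: sym_component_perm_embedding)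
    moreover have "act T (perm_embedding m a) (tens (B_id m) y) \<in> W"
      using that W' perm_embedding_in_B by blast
    ultimately show ?thesis by simp
  qed
  moreover have "tens (B_id m) \<zero>\<^bsub>H\<^esub> \<in> W" using W' by (simp add: tens_zero_right)
  ultimately have "asubmodule (group_algebra m) H ?U"
    using W' by (auto simp: H.asubmodule_iff H.act_closed tens_add_right tens_scale_right H.smult_in)
  then have "?U = {\<zero>\<^bsub>H\<^esub>} \<or> ?U = carrier H" using simple by (simp add: simple_amodule_def)
  then show ?thesis using x y by blast
qed

sublocale T: local_module "B_alg \<delta>" T "B_id m"
proof
  show "B_id m \<in> carrier (B_alg \<delta>)" by simp
  obtain x where x: "x \<in> carrier H" "x \<noteq> \<zero>\<^bsub>H\<^esub>"
    using simple H.M.zero_closed unfolding simple_amodule_def by blast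
  have 1: "act T (B_id m) (tens (B_id m) x) = tens (B_id m) x" if "x \<in> carrier H" for x
    using that by (simp add: act_tens bmult_B_id_B_id)
  then have "act T (B_id m) (tens (B_id m) x) \<noteq> \<zero>\<^bsub>T\<^esub>" using x tens_B_id_eq_zero by metis
  then show "\<exists>v\<in>carrier T. act T (B_id m) v \<noteq> \<zero>\<^bsub>T\<^esub>" using x tens_closed[OF B_id_in_B] by blast
  fix v W assume v: "v \<in> carrier T" "act T (B_id m) v \<noteq> \<zero>\<^bsub>T\<^esub>"
    and W: "asubmodule (B_alg \<delta>) T W" "act T (B_id m) v \<in> W"
  obtain x where x: "x \<in> carrier H" "act T (B_id m) v = tens (B_id m) x" using act_B_id_T[OF v(1)] by blast
  have x0: "x \<noteq> \<zero>\<^bsub>H\<^esub>" using v(2) tens_zero_right[OF B_id_in_B] x(2) by metis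
  note W' = W(1)[unfolded T.asubmodule_iff]
  have "u \<in> W" if "u \<in> carrier T" for u
    using that
  proof (induction rule: T_induct)
    case (tens g y)
    show ?case
    proof (cases "n_bot g = m")
      case True
      have "tens (symbol g) y = act T (symbol g) (tens (B_id m) y)"
        using tens True by (simp add: act_tens bmult_B_id)
      then show ?thesis
        using subset_of_submodule[OF W(1) x(1) x0 _ tens(2)] x(2) W(2) W' tens(1) symbol_in_B by metis
    next
      case False
      then show ?thesis using tens_diagram_zero tens W' by simp
    qed
  qed (use W' in auto)
  then show "W = carrier T" using W' by blast
qed

abbreviation (input) L where "L \<equiv> module_head (B_alg \<delta>) T"
abbreviation (input) R where "R \<equiv> core (B_alg \<delta>) T (B_id m)"

lemma L_eq: "L = quotient_amodule T R"
  by (simp add: module_head_def T.module_radical_eq)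

lemma simple_L: "simple_amodule (B_alg \<delta>) L"
  by (rule T.simple_head)

sublocale L: brauer_module \<delta> L
  using simple_L by (intro brauer_moduleI) (simp add: simple_amodule_def)

sublocale QR: module_quotient T R
  by (rule T.module_quotientI[OF T.asubmodule_core])

lemma L_act: "a \<in> carrier (B_alg \<delta>) \<Longrightarrow> v \<in> carrier T \<Longrightarrow> act L a (R +>\<^bsub>T\<^esub> v) = R +>\<^bsub>T\<^esub> act T a v"
  unfolding L_eq by (rule T.quotient_act[OF T.asubmodule_core])

lemma L_carrier: "carrier L = (\<lambda>v. R +>\<^bsub>T\<^esub> v) ` carrier T"
  unfolding L_eq by (rule QR.carrier_quotient)

lemma B_module_L: "B_module \<delta> L"
proof -
  have "L.locally_unital"
    unfolding L.locally_unital_def L_carrier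
    using locally_unital_T T.sum_B_id_in_B by (fastforce simp: T.locally_unital_def L_act)
  then show ?thesis
    using L.B_moduleI L.amodule_axioms by (simp add: B_module_def)
qed

lemma word_space_L_low:
  assumes "k < m"
  shows "word_space L k = {\<zero>\<^bsub>L\<^esub>}"
  unfolding L.word_space_trivial_iff
proof
  fix v assume "v \<in> carrier L"
  then obtain u where u: "u \<in> carrier T" "v = R +>\<^bsub>T\<^esub> u" unfolding L_carrier by (rule imageE)
  have "act L (B_id k) v = R +>\<^bsub>T\<^esub> \<zero>\<^bsub>T\<^esub>"
    unfolding u(2) using u(1) assms by (subst L_act) (simp_all add: act_B_id_low)
  also have "\<dots> = \<zero>\<^bsub>L\<^esub>"
    unfolding L_eq QR.zero_quotient
    using QR.coset_eq_W_iff[of "\<zero>\<^bsub>T\<^esub>"] T.asubmodule_core unfolding T.asubmodule_iff by blast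
  finally show "act L (B_id k) v = \<zero>\<^bsub>L\<^esub>" .
qed

text \<open>These vectors turn out to form the shortest word space of the head, and
  \<open>top_vector\<close> itself is the isomorphism onto it.\<close>

definition top_vector :: "'w \<Rightarrow> (('k brauer_element \<times> 'w) \<Rightarrow>\<^sub>0 'k) set set" where
  "top_vector x = R +>\<^bsub>T\<^esub> tens (B_id m) x"

lemma top_vector_closed: "x \<in> carrier H \<Longrightarrow> top_vector x \<in> carrier L"
  unfolding top_vector_def L_carrier by (intro imageI tens_closed B_id_in_B)

lemma top_vector_add:
  "x \<in> carrier H \<Longrightarrow> y \<in> carrier H \<Longrightarrow> top_vector (x \<oplus>\<^bsub>H\<^esub> y) = top_vector x \<oplus>\<^bsub>L\<^esub> top_vector y"
  unfolding top_vector_def L_eq by (simp add: QR.coset_add tens_closed tens_add_right)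

lemma top_vector_smult:
  "x \<in> carrier H \<Longrightarrow> top_vector (c \<odot>\<^bsub>H\<^esub> x) = c \<odot>\<^bsub>L\<^esub> top_vector x"
  unfolding top_vector_def L_eq by (simp add: QR.coset_smult tens_closed tens_scale_right)

lemma top_vector_act:
  "b \<in> carrier (B_zero \<delta>) \<Longrightarrow> x \<in> carrier H \<Longrightarrow>
    act L b (top_vector x) = top_vector (act H (sym_component m b) x)"
  unfolding top_vector_def
  by (simp add: L_act B_zero_in_B_sharp B_sharp_in_B tens_closed tens_B_zero)

text \<open>A vector of the core is killed by \<open>B_id m\<close>, which fixes
  \<open>tens (B_id m) x\<close>; hence nothing of \<open>H\<close> is lost on passing to the
  head.\<close>

lemma top_vector_eq_zero:
  assumes "x \<in> carrier H" "top_vector x = \<zero>\<^bsub>L\<^esub>"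
  shows "x = \<zero>\<^bsub>H\<^esub>"
proof -
  have "tens (B_id m) x \<in> R"
    using assms QR.coset_eq_W_iff[OF tens_closed[OF B_id_in_B assms(1)]]
    unfolding top_vector_def L_eq QR.zero_quotient by simp
  then have "act T (B_id m) (tens (B_id m) x) = \<zero>\<^bsub>T\<^esub>" by (simp add: core_def)
  then show ?thesis using assms(1) tens_B_id_eq_zero by (simp add: act_tens bmult_B_id_B_id)
qed

lemma word_space_L: "word_space L m = top_vector ` carrier H"
proof
  show "word_space L m \<subseteq> top_vector ` carrier H"
  proof
    fix v assume "v \<in> word_space L m"
    then obtain u where "u \<in> carrier T" "v = R +>\<^bsub>T\<^esub> act T (B_id m) u"
      unfolding word_space_def L_carrier by (auto simp: L_act)
    then show "v \<in> top_vector ` carrier H" using act_B_id_T[of u] by (auto simp: top_vector_def)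
  qed
  show "top_vector ` carrier H \<subseteq> word_space L m"
    unfolding L.word_space_iff
    using top_vector_closed top_vector_act[OF B_id_in_B_zero] unital
    by (auto simp: L.word_space_iff sym_component_B_id)
qed

lemma shortest_word_space_L: "shortest_word_space L = L\<lparr>carrier := top_vector ` carrier H\<rparr>"
proof -
  obtain x where x: "x \<in> carrier H" "x \<noteq> \<zero>\<^bsub>H\<^esub>"
    using simple H.M.zero_closed unfolding simple_amodule_def by blast
  then have "top_vector x \<noteq> \<zero>\<^bsub>L\<^esub>" using top_vector_eq_zero by metis
  moreover have "top_vector x \<in> word_space L m" unfolding word_space_L using x(1) by (rule imageI)
  ultimately have "word_space L m \<noteq> {\<zero>\<^bsub>L\<^esub>}" by auto
  then have "(LEAST k. word_space L k \<noteq> {\<zero>\<^bsub>L\<^esub>}) = m"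
    by (intro Least_equality) (use word_space_L_low not_le in blast)+
  then show ?thesis by (simp add: shortest_word_space_def word_space_L)
qed

lemma amodule_X: "amodule (B_zero \<delta>) X"
proof -
  have X: "carrier X = carrier H" "zero X = zero H" "add X = add H" "module.smult X = module.smult H"
    "act X b = act H (sym_component m b)" for b
    by (auto simp: pullback_def)
  have "Module.module scalar_ring X"
    using H.module_axioms X(1-4) by (rule module_cong)
  then show ?thesis
    by (intro amodule.intro amodule_axioms.intro)
      (use H.act_add_left[OF sym_component_in sym_component_in] H.act_mult[OF sym_component_in sym_component_in]
          H.act_smult_left[OF sym_component_in] in
        \<open>auto simp: X sym_act_closed H.act_add_right H.act_smult_right sym_component_in
          sym_component_add sym_component_scale sym_component_bmult[OF B_sharp_in_B[OF B_zero_in_B_sharp] B_zero_in_B_sharp]\<close>)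
qed

lemma iso_shortest_word_space: "amodule_iso (B_zero \<delta>) X (shortest_word_space L)"
proof -
  have "inj_on top_vector (carrier H)"
  proof (rule inj_onI)
    fix x y assume xy: "x \<in> carrier H" "y \<in> carrier H" "top_vector x = top_vector y"
    have "top_vector (x \<oplus>\<^bsub>H\<^esub> (-1) \<odot>\<^bsub>H\<^esub> y) = top_vector y \<oplus>\<^bsub>L\<^esub> (-1) \<odot>\<^bsub>L\<^esub> top_vector y"
      using xy by (simp add: top_vector_add top_vector_smult H.smult_in)
    also have "\<dots> = \<zero>\<^bsub>L\<^esub>" using L.eq_iff_diff_zero[OF top_vector_closed[OF xy(2)] top_vector_closed[OF xy(2)]] by blast
    finally have "x \<oplus>\<^bsub>H\<^esub> (-1) \<odot>\<^bsub>H\<^esub> y = \<zero>\<^bsub>H\<^esub>" using xy by (intro top_vector_eq_zero) (simp_all add: H.smult_in)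
    then show "x = y" using H.eq_iff_diff_zero[OF xy(1,2)] by blast
  qed
  then show ?thesis
    unfolding amodule_iso_def shortest_word_space_L
    by (intro exI[of _ top_vector])
      (auto simp: pullback_simps bij_betw_def top_vector_add top_vector_smult top_vector_act)
qed

lemma shortest_word_space_iso: "amodule_iso (B_zero \<delta>) (shortest_word_space L) X"
  by (rule amodule_iso_sym[OF amodule_X iso_shortest_word_space])

end

section \<open>Signed sums of permutations\<close>

definition signed :: "(nat \<Rightarrow> nat) \<Rightarrow> ((nat \<Rightarrow> nat) \<Rightarrow>\<^sub>0 'k::field)" where
  "signed \<sigma> = scale (of_int (sign \<sigma>)) (symbol \<sigma>)"

definition signed_sum :: "(nat \<Rightarrow> nat) set \<Rightarrow> ((nat \<Rightarrow> nat) \<Rightarrow>\<^sub>0 'k::field)" where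
  "signed_sum X = sum signed X"

abbreviation alt_sum :: "nat set \<Rightarrow> ((nat \<Rightarrow> nat) \<Rightarrow>\<^sub>0 'k::field)" where
  "alt_sum P \<equiv> signed_sum {\<sigma>. \<sigma> permutes P}"

lemma sign_cases: "sign \<sigma> = 1 \<or> sign \<sigma> = -1"
  by (simp add: sign_def)

lemma of_int_sign_square [simp]: "of_int (sign \<sigma>) * of_int (sign \<sigma>) = (1 :: 'k::field)"
  using sign_cases[of \<sigma>] by auto

lemma of_int_sign_nonzero [simp]: "of_int (sign \<sigma>) \<noteq> (0 :: 'k::field)"
  using sign_cases[of \<sigma>] by auto

lemma permutes_permutation: "\<sigma> permutes \<Omega> \<Longrightarrow> finite \<Omega> \<Longrightarrow> permutation \<sigma>"
  using permutation_permutes by blast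

lemma sign_comp: "permutation \<sigma> \<Longrightarrow> permutation \<tau> \<Longrightarrow> sign (\<sigma> \<circ> \<tau>) = sign \<sigma> * sign \<tau>"
  by (rule sign_compose)

lemma gmult_signed:
  assumes "permutation \<sigma>" "permutation \<tau>"
  shows "gmult (symbol \<sigma>) (signed \<tau>) = scale (of_int (sign \<sigma>)) (signed (\<sigma> \<circ> \<tau>))"
    and "gmult (signed \<tau>) (symbol \<sigma>) = scale (of_int (sign \<sigma>)) (signed (\<tau> \<circ> \<sigma>))"
  using assms by (simp_all add: signed_def bilinear_ext_scale sign_comp mult.assoc[symmetric] mult.commute)

lemma gmult_signed_sum:
  assumes X: "\<And>x. x \<in> X \<Longrightarrow> permutation x" and s: "permutation \<sigma>"
  shows "gmult (symbol \<sigma>) (signed_sum X) = scale (of_int (sign \<sigma>)) (signed_sum ((\<lambda>x. \<sigma> \<circ> x) ` X))"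
    and "gmult (signed_sum X) (symbol \<sigma>) = scale (of_int (sign \<sigma>)) (signed_sum ((\<lambda>x. x \<circ> \<sigma>) ` X))"
proof -
  have b: "bij \<sigma>" by (rule permutation_bijective[OF s])
  have i1: "inj_on (\<lambda>x. \<sigma> \<circ> x) X"
    using b by (auto intro!: inj_onI dest: bij_is_inj simp: fun.inj_map_strong comp_def fun_eq_iff inj_eq)
  have i2: "inj_on (\<lambda>x. x \<circ> \<sigma>) X"
  proof (rule inj_onI)
    fix x y assume "x \<circ> \<sigma> = y \<circ> \<sigma>"
    then have "x (\<sigma> a) = y (\<sigma> a)" for a by (metis comp_apply)
    then show "x = y" using b by (metis bij_pointE ext)
  qed
  show "gmult (symbol \<sigma>) (signed_sum X) = scale (of_int (sign \<sigma>)) (signed_sum ((\<lambda>x. \<sigma> \<circ> x) ` X))"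
    unfolding signed_sum_def bilinear_ext_sum sum.reindex[OF i1] free.scale_sum_right
    by (intro sum.cong) (simp_all add: gmult_signed X s)
  show "gmult (signed_sum X) (symbol \<sigma>) = scale (of_int (sign \<sigma>)) (signed_sum ((\<lambda>x. x \<circ> \<sigma>) ` X))"
    unfolding signed_sum_def bilinear_ext_sum sum.reindex[OF i2] free.scale_sum_right
    by (intro sum.cong) (simp_all add: gmult_signed X s)
qed

lemma signed_sum_subset:
  assumes "finite X" "Y \<subseteq> X"
  shows "signed_sum X = signed_sum Y + signed_sum (X - Y)"
  unfolding signed_sum_def using sum.subset_diff[OF assms(2,1), of signed] by (simp add: add.commute)

lemma keys_signed: "Poly_Mapping.keys (signed \<sigma> :: _ \<Rightarrow>\<^sub>0 'k::field) = {\<sigma>}"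
  by (auto simp: signed_def in_keys_iff lookup_symbol split: if_splits)

lemma keys_signed_sum: "Poly_Mapping.keys (signed_sum X :: _ \<Rightarrow>\<^sub>0 'k::field) \<subseteq> X"
proof (induction X rule: infinite_finite_induct)
  case (insert x F)
  then have "signed_sum (insert x F) = (signed x + signed_sum F :: _ \<Rightarrow>\<^sub>0 'k)" by (simp add: signed_sum_def)
  then show ?case
    using insert by (auto simp: keys_signed dest!: subsetD[OF keys_add])
qed (simp_all add: signed_sum_def)

text \<open>The complements in \<open>P\<close> of \<open>A\<close> and of its image have equal size
  and are matched arbitrarily.\<close>

lemma permutes_extend:
  assumes "finite P" "A \<subseteq> P" "inj_on f A" "f ` A \<subseteq> P"
  obtains a where "a permutes P" "\<And>y. y \<in> A \<Longrightarrow> a y = f y"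
proof -
  have "card (P - A) = card (P - f ` A)"
    using assms by (simp add: card_Diff_subset finite_subset card_image)
  then obtain h where h: "bij_betw h (P - A) (P - f ` A)"
    using assms(1) by (metis finite_Diff finite_same_card_bij)
  define a where "a x = (if x \<in> A then f x else if x \<in> P then h x else x)" for x
  have "bij_betw a A (f ` A)" using assms(3) by (auto simp: bij_betw_def a_def inj_on_def)
  moreover have "bij_betw a (P - A) (P - f ` A)"
    using h by (subst bij_betw_cong[of _ _ h]) (auto simp: a_def)
  ultimately have "bij_betw a (A \<union> (P - A)) (f ` A \<union> (P - f ` A))"
    by (rule bij_betw_combine) auto
  then have "bij_betw a P P" using assms(2,4) by (simp add: Un_absorb1 Un_Diff_cancel)
  moreover have "a x = x" if "x \<notin> P" for x using that assms(2) by (auto simp: a_def)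
  ultimately have "a permutes P" by (rule bij_imp_permutes)
  then show ?thesis using that by (auto simp: a_def)
qed

lemma permutes_mono: "A \<subseteq> B \<Longrightarrow> {\<sigma>. \<sigma> permutes A} \<subseteq> {\<sigma>. \<sigma> permutes B}"
  by (auto intro: permutes_subset)

lemma permutes_restrict: "b permutes \<Omega> \<Longrightarrow> (\<And>y. y \<notin> P \<Longrightarrow> b y = y) \<Longrightarrow> b permutes P"
  by (erule permutes_superset) simp

lemma permutes_commute:
  assumes "p permutes P" "h permutes R" "P \<inter> R = {}"
  shows "h \<circ> p = p \<circ> h"
proof
  fix x
  have px: "p x \<in> P \<longleftrightarrow> x \<in> P" and hx: "h x \<in> R \<longleftrightarrow> x \<in> R"
    using assms permutes_in_image by metis+
  consider "x \<in> P" | "x \<in> R" | "x \<notin> P \<and> x \<notin> R" by blast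
  then show "(h \<circ> p) x = (p \<circ> h) x"
  proof cases
    case 1
    then have "x \<notin> R" "p x \<notin> R" using assms(3) px by auto
    then show ?thesis using assms(2) by (simp add: permutes_not_in)
  next
    case 2
    then have "x \<notin> P" "h x \<notin> P" using assms(3) hx by auto
    then show ?thesis using assms(1) by (simp add: permutes_not_in)
  next
    case 3
    then show ?thesis using assms(1,2) by (simp add: permutes_not_in)
  qed
qed

lemma gmult_alt_sum_commute:
  assumes "h permutes R" "P \<inter> R = {}"
  shows "gmult (symbol h) (alt_sum P) = gmult (alt_sum P) (symbol h)"
proof -
  have "gmult (symbol h) (signed \<sigma>) = gmult (signed \<sigma>) (symbol h)" if "\<sigma> permutes P" for \<sigma>
    using permutes_commute[OF that assms] by (simp add: signed_def bilinear_ext_scale)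
  then show ?thesis unfolding signed_sum_def bilinear_ext_sum by (intro sum.cong) auto
qed

text \<open>The set need not lie in the group algebra of \<Omega>; thus preimages of an ideal under
  left multiplication, which arise in the recursion over blocks, also qualify.\<close>

definition perm_ideal :: "nat set \<Rightarrow> ((nat \<Rightarrow> nat) \<Rightarrow>\<^sub>0 'k::field) set \<Rightarrow> bool" where
  "perm_ideal \<Omega> I \<longleftrightarrow> free.subspace I \<and>
    (\<forall>\<sigma> x. \<sigma> permutes \<Omega> \<longrightarrow> x \<in> I \<longrightarrow> gmult (symbol \<sigma>) x \<in> I \<and> gmult x (symbol \<sigma>) \<in> I)"

lemma perm_ideal_mult:
  assumes I: "perm_ideal \<Omega> I" and a: "Poly_Mapping.keys a \<subseteq> {\<sigma>. \<sigma> permutes \<Omega>}" and x: "x \<in> I"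
  shows "gmult a x \<in> I" "gmult x a \<in> I"
proof -
  have sub: "free.subspace I" using I by (simp add: perm_ideal_def)
  have "gmult a x \<in> I \<and> gmult x a \<in> I" using a
  proof (induction rule: free_induct)
    case (symbol \<sigma>)
    then show ?case using I x by (simp add: perm_ideal_def)
  qed (use sub in \<open>simp_all add: bilinear_ext_add bilinear_ext_scale free.subspace_0 free.subspace_add free.subspace_scale\<close>)
  then show "gmult a x \<in> I" "gmult x a \<in> I" by simp_all
qed

lemma keys_alt_sum: "P \<subseteq> \<Omega> \<Longrightarrow> Poly_Mapping.keys (alt_sum P :: _ \<Rightarrow>\<^sub>0 'k::field) \<subseteq> {\<sigma>. \<sigma> permutes \<Omega>}"
  using keys_signed_sum[of "{\<sigma>. \<sigma> permutes P}", where 'k='k] permutes_subset by blast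

section \<open>Double cosets of the symmetric group on a block\<close>

definition double_coset :: "nat set \<Rightarrow> (nat \<Rightarrow> nat) \<Rightarrow> (nat \<Rightarrow> nat) set" where
  "double_coset P g = (\<lambda>(a, b). a \<circ> g \<circ> b) ` ({a. a permutes P} \<times> {b. b permutes P})"

lemma double_coset_self: "g \<in> double_coset P g"
  unfolding double_coset_def by (rule image_eqI[of _ _ "(id, id)"]) (simp_all add: permutes_id)

lemma double_coset_subset:
  assumes "x \<in> double_coset P g"
  shows "double_coset P x \<subseteq> double_coset P g"
proof
  fix y assume "y \<in> double_coset P x"
  then obtain a b a' b' where "a permutes P" "b permutes P" "a' permutes P" "b' permutes P"
    "x = a \<circ> g \<circ> b" "y = a' \<circ> x \<circ> b'" using assms by (auto simp: double_coset_def)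
  then show "y \<in> double_coset P g"
    unfolding double_coset_def
    by (intro image_eqI[of _ _ "(a' \<circ> a, b \<circ> b')"]) (auto simp: comp_assoc intro: permutes_compose)
qed

lemma double_coset_sym:
  assumes "x \<in> double_coset P g"
  shows "g \<in> double_coset P x"
proof -
  obtain a b where ab: "a permutes P" "b permutes P" "x = a \<circ> g \<circ> b"
    using assms by (auto simp: double_coset_def)
  have "g = Hilbert_Choice.inv a \<circ> x \<circ> Hilbert_Choice.inv b"
    using ab permutes_inverses[OF ab(1)] permutes_inverses[OF ab(2)] by (auto simp: fun_eq_iff)
  then show ?thesis unfolding double_coset_def
    using ab by (intro image_eqI[of _ _ "(Hilbert_Choice.inv a, Hilbert_Choice.inv b)"]) (auto intro: permutes_inv)
qed

text \<open>A set that contains the double coset of each of its elements is a disjoint union of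
  double cosets, and signed sums add up over disjoint unions.\<close>

lemma signed_sum_stable:
  assumes J: "free.subspace J" and fin: "finite X"
    and stable: "\<And>x. x \<in> X \<Longrightarrow> double_coset P x \<subseteq> X"
    and D: "\<And>x. x \<in> X \<Longrightarrow> signed_sum (double_coset P x) \<in> J"
  shows "signed_sum X \<in> J"
  using fin stable D
proof (induction X rule: finite_psubset_induct)
  case (psubset X)
  show ?case
  proof (cases "X = {}")
    case True
    then show ?thesis using J by (simp add: signed_sum_def free.subspace_0)
  next
    case False
    then obtain x where x: "x \<in> X" by blast
    let ?Y = "X - double_coset P x"
    have Y: "?Y \<subset> X" using x double_coset_self by blast
    have st: "double_coset P y \<subseteq> ?Y" if y: "y \<in> ?Y" for y
    proof
      fix z assume z: "z \<in> double_coset P y"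
      have "z \<notin> double_coset P x"
      proof
        assume "z \<in> double_coset P x"
        then have "y \<in> double_coset P x"
          using double_coset_subset double_coset_sym[OF z] by blast
        then show False using y by blast
      qed
      then show "z \<in> ?Y" using z y psubset.prems(1) by blast
    qed
    have "signed_sum ?Y \<in> J"
    proof (rule psubset.IH[OF Y])
      show "double_coset P y \<subseteq> ?Y" if "y \<in> ?Y" for y using that by (rule st)
      show "signed_sum (double_coset P y) \<in> J" if "y \<in> ?Y" for y
        using psubset.prems(2) that by blast
    qed
    then show ?thesis
      unfolding signed_sum_subset[OF psubset.hyps psubset.prems(1)[OF x]]
      by (intro free.subspace_add[OF J] psubset.prems(2) x)
  qed
qed

text \<open>Translation shows that every element of the double coset is
  \<open>a \<circ> g \<circ> b\<close> for equally many pairs, and the sign depends on the element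
  only. The common number \<open>N\<close> may vanish in the field, so the double coset sum cannot
  in general be recovered from the product.\<close>

lemma alt_sum_mult_alt_sum:
  assumes P: "finite P" and g: "permutation g"
  shows "\<exists>c::'k::field. gmult (gmult (alt_sum P) (symbol g)) (alt_sum P) = scale c (signed_sum (double_coset P g))"
proof -
  let ?S = "{a. a permutes P}" and ?f = "\<lambda>(a, b). a \<circ> g \<circ> b"
  let ?Q = "?S \<times> ?S"
  have fin: "finite ?Q" using P by (simp add: finite_permutations)
  have perm: "permutation a" if "a permutes P" for a using that P permutes_permutation by blast
  define N where "N = card {q \<in> ?Q. ?f q = g}"
  have fiber: "card {q \<in> ?Q. ?f q = x} = N" if x: "x \<in> double_coset P g" for x
  proof -
    obtain a0 b0 where ab: "a0 permutes P" "b0 permutes P" "x = a0 \<circ> g \<circ> b0"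
      using x by (auto simp: double_coset_def)
    note inv = permutes_inverses[OF ab(1)] permutes_inverses[OF ab(2)]
    have "bij_betw (\<lambda>(a, b). (a0 \<circ> a, b \<circ> b0)) {q \<in> ?Q. ?f q = g} {q \<in> ?Q. ?f q = x}"
    proof (rule bij_betw_byWitness[where f' = "\<lambda>(a, b). (Hilbert_Choice.inv a0 \<circ> a, b \<circ> Hilbert_Choice.inv b0)"])
      show "(\<lambda>(a, b). (a0 \<circ> a, b \<circ> b0)) ` {q \<in> ?Q. ?f q = g} \<subseteq> {q \<in> ?Q. ?f q = x}"
        using ab by (auto intro: permutes_compose simp: fun_eq_iff)
      show "(\<lambda>(a, b). (Hilbert_Choice.inv a0 \<circ> a, b \<circ> Hilbert_Choice.inv b0)) ` {q \<in> ?Q. ?f q = x} \<subseteq> {q \<in> ?Q. ?f q = g}"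
        using ab inv by (auto intro: permutes_compose permutes_inv simp: fun_eq_iff)
    qed (use inv in \<open>auto simp: fun_eq_iff\<close>)
    then show ?thesis unfolding N_def by (rule bij_betw_same_card[symmetric])
  qed
  have "gmult (gmult (signed a) (symbol g)) (signed b) = scale (of_int (sign g)) (signed (a \<circ> g \<circ> b))"
    if "a permutes P" "b permutes P" for a b
    using perm[OF that(1)] perm[OF that(2)] g
    by (simp add: signed_def bilinear_ext_scale sign_comp permutation_compose mult_ac)
  then have "gmult (gmult (alt_sum P) (symbol g)) (alt_sum P) =
      (\<Sum>a\<in>?S. \<Sum>b\<in>?S. scale (of_int (sign g)) (signed (a \<circ> g \<circ> b)) :: _ \<Rightarrow>\<^sub>0 'k)"
    unfolding signed_sum_def bilinear_ext_sum
    by (subst sum.swap) (intro sum.cong refl; simp)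
  also have "\<dots> = (\<Sum>q\<in>?Q. scale (of_int (sign g)) (signed (?f q)))"
    by (simp add: sum.cartesian_product split_def)
  also have "\<dots> = (\<Sum>x\<in>?f ` ?Q. \<Sum>q\<in>{q \<in> ?Q. ?f q = x}. scale (of_int (sign g)) (signed (?f q)))"
    by (rule sum.image_gen[OF fin])
  also have "\<dots> = (\<Sum>x\<in>double_coset P g. scale (of_nat N * of_int (sign g)) (signed x))"
    unfolding double_coset_def[symmetric]
  proof (rule sum.cong[OF refl])
    fix x assume x: "x \<in> double_coset P g"
    have "(\<Sum>q\<in>{q \<in> ?Q. ?f q = x}. scale (of_int (sign g)) (signed (?f q))) =
        (\<Sum>q\<in>{q \<in> ?Q. ?f q = x}. scale (of_int (sign g)) (signed x))"
      by (intro sum.cong) auto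
    also have "\<dots> = scale (of_nat N) (scale (of_int (sign g)) (signed x))"
      unfolding free.sum_constant_scale fiber[OF x] ..
    finally show "(\<Sum>q\<in>{q \<in> ?Q. ?f q = x}. scale (of_int (sign g)) (signed (?f q))) =
      (scale (of_nat N * of_int (sign g)) (signed x) :: (nat \<Rightarrow> nat) \<Rightarrow>\<^sub>0 'k)" by simp
  qed
  finally show ?thesis unfolding signed_sum_def free.scale_sum_right[symmetric] by blast
qed

text \<open>
  The whole coset \<open>S\<^sub>Z g\<close> with \<open>Z = P \<union> g P\<close> has signed sum in the ideal; it is a union of
  double cosets, and all of them except that of \<open>g\<close> move fewer points out of \<open>P\<close>.
  Using double coset sums instead of the products \<open>\<kappa> g \<kappa>\<close> avoids dividing by integers.
\<close>

lemma signed_sum_double_coset: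
  fixes I :: "((nat \<Rightarrow> nat) \<Rightarrow>\<^sub>0 'k::field) set"
  assumes \<Omega>: "finite \<Omega>" and P: "P \<subseteq> \<Omega>" and I: "perm_ideal \<Omega> I"
    and big: "\<And>Z. Z \<subseteq> \<Omega> \<Longrightarrow> card P < card Z \<Longrightarrow> alt_sum Z \<in> I"
    and J: "free.subspace J" "I \<subseteq> J" "\<And>h. h permutes (\<Omega> - P) \<Longrightarrow> gmult (symbol h) (alt_sum P) \<in> J"
    and g: "g permutes \<Omega>"
  shows "signed_sum (double_coset P g) \<in> J"
  using g
proof (induction "card (g ` P - P)" arbitrary: g rule: less_induct)
  case less
  note g = less.prems
  have finP: "finite P" using P \<Omega> by (rule finite_subset)
  have gperm: "permutation g" using g \<Omega> permutes_permutation by blast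
  have injg: "inj g" by (rule permutes_inj[OF g])
  have cardg: "card (g ` P) = card P" using injg by (simp add: card_image inj_on_subset)
  show ?case
  proof (cases "g ` P \<subseteq> P")
    case True
    then have gP: "g ` P = P" using cardg finP by (simp add: card_subset_eq)
    obtain a where a: "a permutes P" "\<And>y. y \<in> P \<Longrightarrow> a y = g y"
      using permutes_extend[OF finP order_refl, of g] injg gP by (metis inj_on_subset order_refl subset_UNIV)
    \<comment> \<open>When \<open>g\<close> preserves \<open>P\<close>, its part on \<open>P\<close>
      is absorbed into a permutation of \<open>P\<close>; what remains fixes \<open>P\<close>
      pointwise, and the double coset is a single coset of the permutations of
      \<open>P\<close>.\<close>
    define h where "h = g \<circ> Hilbert_Choice.inv a"
    have hO: "h permutes \<Omega>" unfolding h_def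
      using permutes_compose[OF permutes_subset[OF permutes_inv[OF a(1)] P] g] .
    have hP: "h x = x" if "x \<in> P" for x
    proof -
      have "Hilbert_Choice.inv a x \<in> P" using that permutes_in_image[OF permutes_inv[OF a(1)]] by blast
      then have "h x = a (Hilbert_Choice.inv a x)" by (simp add: h_def a(2))
      then show ?thesis using permutes_inverses(1)[OF a(1)] by simp
    qed
    have h: "h permutes (\<Omega> - P)"
    proof (rule permutes_restrict[OF hO])
      fix y assume "y \<notin> \<Omega> - P"
      then show "h y = y" using hP permutes_not_in[OF hO, of y] by (cases "y \<in> P") simp_all
    qed
    have g_eq: "g = h \<circ> a" using permutes_inverses(2)[OF a(1)] by (auto simp: h_def fun_eq_iff)
    have "double_coset P g = (\<lambda>x. h \<circ> x) ` {x. x permutes P}"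
    proof
      show "double_coset P g \<subseteq> (\<lambda>x. h \<circ> x) ` {x. x permutes P}"
      proof
        fix y assume "y \<in> double_coset P g"
        then obtain c d where cd: "c permutes P" "d permutes P" "y = c \<circ> g \<circ> d" by (auto simp: double_coset_def)
        have "c \<circ> h = h \<circ> c" using permutes_commute[OF cd(1) h] by auto
        then have "y = h \<circ> (c \<circ> a \<circ> d)" unfolding cd(3) g_eq by (metis comp_assoc)
        moreover have "c \<circ> a \<circ> d permutes P" using cd a permutes_compose by blast
        ultimately show "y \<in> (\<lambda>x. h \<circ> x) ` {x. x permutes P}" by blast
      qed
      show "(\<lambda>x. h \<circ> x) ` {x. x permutes P} \<subseteq> double_coset P g"
      proof
        fix y assume "y \<in> (\<lambda>x. h \<circ> x) ` {x. x permutes P}"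
        then obtain x where x: "x permutes P" "y = h \<circ> x" by blast
        have "y = id \<circ> g \<circ> (Hilbert_Choice.inv a \<circ> x)"
          unfolding x(2) g_eq using permutes_inverses(1)[OF a(1)] by (auto simp: fun_eq_iff)
        moreover have "Hilbert_Choice.inv a \<circ> x permutes P"
          using x a permutes_compose permutes_inv by blast
        ultimately show "y \<in> double_coset P g"
          unfolding double_coset_def using permutes_id by (intro image_eqI[of _ _ "(id, Hilbert_Choice.inv a \<circ> x)"]) auto
      qed
    qed
    moreover have "gmult (symbol h) (alt_sum P) =
        (scale (of_int (sign h)) (signed_sum ((\<lambda>x. h \<circ> x) ` {x. x permutes P})) :: _ \<Rightarrow>\<^sub>0 'k)"
      using finP h \<Omega> permutes_permutation by (intro gmult_signed_sum) blast+
    ultimately have "(signed_sum (double_coset P g) :: _ \<Rightarrow>\<^sub>0 'k) =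
        scale (of_int (sign h)) (gmult (symbol h) (alt_sum P))" by simp
    then show ?thesis using J(1) J(3)[OF h] by (simp add: free.subspace_scale)
  next
    case False
    let ?Z = "P \<union> g ` P"
    have ZO: "?Z \<subseteq> \<Omega>" using P permutes_image[OF g] by auto
    have finZ: "finite ?Z" using finP by simp
    have "P \<subset> ?Z" using False by blast
    then have "card P < card ?Z" using finZ by (rule psubset_card_mono[rotated])
    then have ZI: "alt_sum ?Z \<in> I" using ZO by (intro big)
    let ?Y = "(\<lambda>s. s \<circ> g) ` {s. s permutes ?Z}"
    have finY: "finite ?Y" using finZ by (intro finite_imageI finite_permutations)
    have "gmult (alt_sum ?Z) (symbol g) = (scale (of_int (sign g)) (signed_sum ?Y) :: _ \<Rightarrow>\<^sub>0 'k)"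
      using finZ permutes_permutation gperm by (intro gmult_signed_sum) blast+
    moreover have "gmult (alt_sum ?Z) (symbol g) \<in> I" using I ZI g by (simp add: perm_ideal_def)
    ultimately have "scale (of_int (sign g)) (scale (of_int (sign g)) (signed_sum ?Y)) \<in> I"
      using I by (metis free.subspace_scale perm_ideal_def)
    then have YJ: "signed_sum ?Y \<in> J" using J(2) by auto
    \<comment> \<open>A permutation of \<open>P\<close> to the right of \<open>g\<close> becomes a
      permutation of the image of \<open>P\<close> to its left; this is why \<open>?Z\<close>
      contains that image.\<close>
    have conj: "g \<circ> b \<circ> Hilbert_Choice.inv g permutes ?Z" if "b permutes P" for b
    proof -
      have "g \<circ> b \<circ> Hilbert_Choice.inv g permutes \<Omega>"
        using permutes_compose[OF permutes_inv[OF g] permutes_compose[OF permutes_subset[OF that P] g]]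
        by (simp add: comp_assoc)
      moreover have "(g \<circ> b \<circ> Hilbert_Choice.inv g) y = y" if "y \<notin> g ` P" for y
      proof -
        have "Hilbert_Choice.inv g y \<notin> P" using that permutes_inverses(1)[OF g] by (metis imageI)
        then show ?thesis using permutes_not_in[OF \<open>b permutes P\<close>] permutes_inverses(1)[OF g] by simp
      qed
      ultimately show ?thesis by (rule permutes_restrict) simp
    qed
    have stable: "double_coset P x \<subseteq> ?Y" if x: "x \<in> ?Y" for x
    proof
      fix y assume "y \<in> double_coset P x"
      then obtain a b s where ab: "a permutes P" "b permutes P" "s permutes ?Z" "y = a \<circ> (s \<circ> g) \<circ> b"
        using x by (auto simp: double_coset_def)
      have "y = (a \<circ> s \<circ> (g \<circ> b \<circ> Hilbert_Choice.inv g)) \<circ> g"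
        unfolding ab(4) using permutes_inverses(2)[OF g] by (auto simp: fun_eq_iff)
      moreover have "a permutes ?Z" using ab(1) by (rule permutes_subset) simp
      then have "a \<circ> s \<circ> (g \<circ> b \<circ> Hilbert_Choice.inv g) permutes ?Z"
        using ab(3) conj[OF ab(2)] permutes_compose by blast
      ultimately show "y \<in> ?Y" by blast
    qed
    have gY: "g \<in> ?Y" using permutes_id by (intro image_eqI[of _ _ id]) auto
    let ?X = "?Y - double_coset P g"
    have smaller: "card (x ` P - P) < card (g ` P - P)" "x permutes \<Omega>" if x: "x \<in> ?X" for x
    proof -
      obtain s where s: "s permutes ?Z" "x = s \<circ> g" using x by blast
      have sO: "s permutes \<Omega>" using s(1) ZO by (rule permutes_subset)
      show xO: "x permutes \<Omega>" unfolding s(2) using permutes_compose[OF g sO] .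
      have xs: "x ` P = s ` g ` P" unfolding s(2) by (simp add: image_comp)
      have xZ: "x ` P \<subseteq> ?Z" unfolding xs using permutes_image[OF s(1)] by blast
      \<comment> \<open>If \<open>x\<close> moved the same points out of \<open>P\<close> as
        \<open>g\<close>, then \<open>s\<close> would map the points of \<open>P\<close> outside the
        image of \<open>P\<close> under \<open>g\<close> into \<open>P\<close> and agree there with
        a permutation \<open>a\<close> of \<open>P\<close>. The permutation \<open>b\<close> with
        \<open>x = a \<circ> g \<circ> b\<close> then fixes everything outside \<open>P\<close>,
        which puts \<open>x\<close> into the double coset of \<open>g\<close>.\<close>
      have "x ` P - P \<noteq> g ` P - P"
      proof
        assume eq: "x ` P - P = g ` P - P"
        have "s y \<in> P" if y: "y \<in> P - g ` P" for y
        proof -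
          have "s y \<in> ?Z" using permutes_in_image[OF s(1)] y by blast
          moreover have "s y \<notin> x ` P" unfolding xs using y permutes_inj[OF s(1)] by (auto dest: injD)
          ultimately show ?thesis using eq by blast
        qed
        then obtain a where a: "a permutes P" "\<And>y. y \<in> P - g ` P \<Longrightarrow> a y = s y"
          using permutes_extend[OF finP, of "P - g ` P" s] permutes_inj[OF s(1)]
          by (metis Diff_subset image_subsetI inj_on_subset subset_UNIV)
        define b where "b = Hilbert_Choice.inv g \<circ> (Hilbert_Choice.inv a \<circ> (s \<circ> g))"
        have ia: "Hilbert_Choice.inv a permutes P" by (rule permutes_inv[OF a(1)])
        have "b permutes \<Omega>" unfolding b_def
          by (intro permutes_compose[of _ \<Omega>] g sO permutes_inv[OF g] permutes_subset[OF ia P])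
        moreover have "b y = y" if y: "y \<notin> P" for y
        proof -
          have w: "g y \<notin> g ` P" using y injg by (auto dest: injD)
          have "Hilbert_Choice.inv a (s (g y)) = g y"
          proof (cases "g y \<in> P")
            case True
            then have "a (g y) = s (g y)" using w a(2) by blast
            then show ?thesis using permutes_inverses(2)[OF a(1)] by metis
          next
            case False
            then have "s (g y) = g y" using w permutes_not_in[OF s(1)] by blast
            then show ?thesis using False permutes_not_in[OF ia] by simp
          qed
          then show ?thesis by (simp add: b_def permutes_inverses(2)[OF g])
        qed
        ultimately have b: "b permutes P" by (rule permutes_restrict)
        have "x = a \<circ> g \<circ> b"
          unfolding b_def s(2) using permutes_inverses(1)[OF g] permutes_inverses(1)[OF a(1)]
          by (auto simp: fun_eq_iff)
        then have "x \<in> double_coset P g"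
          unfolding double_coset_def using a(1) b by (intro image_eqI[of _ _ "(a, b)"]) auto
        then show False using x by blast
      qed
      then have "x ` P - P \<subset> g ` P - P" using xZ by blast
      then show "card (x ` P - P) < card (g ` P - P)" using finP by (intro psubset_card_mono) auto
    qed
    have Xstable: "double_coset P x \<subseteq> ?X" if x: "x \<in> ?X" for x
    proof
      fix z assume z: "z \<in> double_coset P x"
      have "z \<notin> double_coset P g"
        using x double_coset_subset[of z P g] double_coset_sym[OF z] by blast
      then show "z \<in> ?X" using stable x z by blast
    qed
    have "signed_sum ?X \<in> J"
    proof (rule signed_sum_stable[OF J(1)])
      show "finite ?X" using finY by simp
      show "double_coset P x \<subseteq> ?X" if "x \<in> ?X" for x using that by (rule Xstable)
      show "signed_sum (double_coset P x) \<in> J" if "x \<in> ?X" for x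
        using less.hyps[OF smaller(1)[OF that] smaller(2)[OF that]] .
    qed
    moreover have "signed_sum ?Y = signed_sum (double_coset P g) + (signed_sum ?X :: _ \<Rightarrow>\<^sub>0 'k)"
      by (rule signed_sum_subset[OF finY stable[OF gY]])
    ultimately have "signed_sum (double_coset P g) + signed_sum ?X - signed_sum ?X \<in> J"
      using YJ J(1) by (metis free.subspace_diff)
    then show ?thesis by simp
  qed
qed

text \<open>
  A list of disjoint blocks stands for the columns of a tableau. The blocks are \<open>greedy\<close> modulo
  an ideal if no larger block could have been chosen at any stage.
\<close>

primrec disjoint_blocks :: "nat set list \<Rightarrow> bool" where
  "disjoint_blocks [] \<longleftrightarrow> True"
| "disjoint_blocks (P # Ps) \<longleftrightarrow> finite P \<and> P \<inter> \<Union>(set Ps) = {} \<and> disjoint_blocks Ps"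

primrec block_sum :: "nat set list \<Rightarrow> ((nat \<Rightarrow> nat) \<Rightarrow>\<^sub>0 'k::field)" where
  "block_sum [] = symbol id"
| "block_sum (P # Ps) = gmult (alt_sum P) (block_sum Ps)"

primrec greedy :: "((nat \<Rightarrow> nat) \<Rightarrow>\<^sub>0 'k::field) set \<Rightarrow> nat set list \<Rightarrow> bool" where
  "greedy I [] \<longleftrightarrow> True"
| "greedy I (P # Ps) \<longleftrightarrow> (\<forall>Z \<subseteq> P \<union> \<Union>(set Ps). card P < card Z \<longrightarrow> alt_sum Z \<in> I) \<and>
     greedy {x. gmult (alt_sum P) x \<in> I} Ps"

text \<open>Permutations of \<open>R\<close> commute with the alternating sum over the disjoint
  block \<open>P\<close>, which gives stability on the left; on the right associativity
  suffices.\<close>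

lemma perm_ideal_after:
  assumes I: "perm_ideal \<Omega> I" and "R \<subseteq> \<Omega>" "P \<inter> R = {}"
  shows "perm_ideal R {x. gmult (alt_sum P) x \<in> I}"
proof -
  have sub: "free.subspace I" using I by (simp add: perm_ideal_def)
  have "free.subspace {x. gmult (alt_sum P) x \<in> I}"
    using sub by (auto simp: free.subspace_def bilinear_ext_add bilinear_ext_scale)
  moreover have "gmult (alt_sum P) (gmult (symbol \<sigma>) x) \<in> I" "gmult (alt_sum P) (gmult x (symbol \<sigma>)) \<in> I"
    if "\<sigma> permutes R" "gmult (alt_sum P) x \<in> I" for \<sigma> x
  proof -
    have \<sigma>: "\<sigma> permutes \<Omega>" using that(1) assms(2) by (rule permutes_subset)
    have "gmult (alt_sum P) (gmult (symbol \<sigma>) x) = gmult (symbol \<sigma>) (gmult (alt_sum P) x)"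
      using gmult_alt_sum_commute[OF that(1) assms(3)] by (metis gmult_assoc)
    then show "gmult (alt_sum P) (gmult (symbol \<sigma>) x) \<in> I" using I \<sigma> that(2) by (simp add: perm_ideal_def)
    show "gmult (alt_sum P) (gmult x (symbol \<sigma>)) \<in> I"
      using I \<sigma> that(2) by (simp add: perm_ideal_def gmult_assoc[symmetric])
  qed
  ultimately show ?thesis by (simp add: perm_ideal_def)
qed

lemma keys_gmult:
  assumes "Poly_Mapping.keys a \<subseteq> {\<sigma>. \<sigma> permutes \<Omega>}" "Poly_Mapping.keys b \<subseteq> {\<sigma>. \<sigma> permutes \<Omega>}"
  shows "Poly_Mapping.keys (gmult a b) \<subseteq> {\<sigma>. \<sigma> permutes \<Omega>}"
  using assms by (intro keys_bilinear_ext_subset) (auto simp: perm_mult_def intro: permutes_compose)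

lemma keys_block_sum: "Poly_Mapping.keys (block_sum Ps :: _ \<Rightarrow>\<^sub>0 'k::field) \<subseteq> {\<sigma>. \<sigma> permutes \<Union>(set Ps)}"
proof (induction Ps)
  case (Cons P Ps)
  then have "Poly_Mapping.keys (block_sum Ps :: _ \<Rightarrow>\<^sub>0 'k) \<subseteq> {\<sigma>. \<sigma> permutes \<Union>(set (P # Ps))}"
    by (rule subset_trans[OF _ permutes_mono]) auto
  then show ?case unfolding block_sum.simps by (intro keys_gmult keys_alt_sum) auto
qed (simp add: permutes_id)

lemma alt_sum_commute:
  assumes "Poly_Mapping.keys a \<subseteq> {\<sigma>. \<sigma> permutes R}" "P \<inter> R = {}"
  shows "gmult a (alt_sum P) = gmult (alt_sum P) a"
  using assms(1)
  by (induction rule: free_induct)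
    (simp_all add: bilinear_ext_add bilinear_ext_scale gmult_alt_sum_commute[OF _ assms(2)])

text \<open>Induction over the columns. For the first block only the double coset sum of
  \<open>g\<close> matters, and \<open>signed_sum_double_coset\<close> reduces it to permutations
  \<open>h\<close> fixing that block. These commute past its alternating sum and are handled by the
  remaining columns, with the ideal replaced by its preimage under that sum.\<close>

lemma block_sum_sandwich:
  fixes I :: "((nat \<Rightarrow> nat) \<Rightarrow>\<^sub>0 'k::field) set"
  assumes "disjoint_blocks Ps" "perm_ideal (\<Union>(set Ps)) I" "greedy I Ps" "g permutes \<Union>(set Ps)"
  shows "\<exists>c. gmult (gmult (block_sum Ps) (symbol g)) (block_sum Ps) - scale c (block_sum Ps) \<in> I"
  using assms
proof (induction Ps arbitrary: I g)
  case Nil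
  then have "g = id" by simp
  then show ?case using Nil by (intro exI[of _ 1]) (simp add: perm_ideal_def free.subspace_0)
next
  case (Cons P Ps)
  let ?R = "\<Union>(set Ps)" and ?\<Omega> = "\<Union>(set (P # Ps))"
  let ?k = "block_sum Ps :: (nat \<Rightarrow> nat) \<Rightarrow>\<^sub>0 'k" and ?K = "block_sum (P # Ps) :: (nat \<Rightarrow> nat) \<Rightarrow>\<^sub>0 'k"
  let ?A = "alt_sum P :: (nat \<Rightarrow> nat) \<Rightarrow>\<^sub>0 'k"
  have PR: "P \<inter> ?R = {}" "finite P" and blocks: "disjoint_blocks Ps" using Cons.prems(1) by auto
  have fin: "finite ?\<Omega>"
  proof -
    have "finite (\<Union>(set Qs))" if "disjoint_blocks Qs" for Qs
      using that by (induction Qs) auto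
    then show ?thesis using Cons.prems(1) by blast
  qed
  have sub: "free.subspace I" using Cons.prems(2) by (simp add: perm_ideal_def)
  have kR: "Poly_Mapping.keys ?k \<subseteq> {\<sigma>. \<sigma> permutes ?R}" by (rule keys_block_sum)
  then have kO: "Poly_Mapping.keys ?k \<subseteq> {\<sigma>. \<sigma> permutes ?\<Omega>}"
    by (rule subset_trans[OF _ permutes_mono]) auto
  have comm: "gmult ?k ?A = gmult ?A ?k" using alt_sum_commute[OF kR PR(1)] .
  \<comment> \<open>\<open>J\<close> collects what becomes a multiple of the full block sum modulo
    \<open>I\<close> when enclosed between the remaining blocks; it is made to fit the hypotheses of
    \<open>signed_sum_double_coset\<close>.\<close>
  define J where "J = {x. \<exists>c. gmult (gmult ?k x) ?k - scale c ?K \<in> I}"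
  have J: "free.subspace J"
    unfolding free.subspace_def
  proof (intro conjI ballI allI)
    show "0 \<in> J" unfolding J_def using sub by (auto intro!: exI[of _ 0] simp: free.subspace_0)
  next
    fix x y assume "x \<in> J" "y \<in> J"
    then obtain c d where "gmult (gmult ?k x) ?k - scale c ?K \<in> I" "gmult (gmult ?k y) ?k - scale d ?K \<in> I"
      unfolding J_def by blast
    then have "(gmult (gmult ?k x) ?k - scale c ?K) + (gmult (gmult ?k y) ?k - scale d ?K) \<in> I"
      using sub by (rule free.subspace_add[rotated])
    also have "(gmult (gmult ?k x) ?k - scale c ?K) + (gmult (gmult ?k y) ?k - scale d ?K) =
        gmult (gmult ?k (x + y)) ?k - scale (c + d) ?K"
      by (simp only: bilinear_ext_add free.scale_left_distrib) simp
    finally show "x + y \<in> J" unfolding J_def by blast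
  next
    fix c x assume "x \<in> J"
    then obtain d where "gmult (gmult ?k x) ?k - scale d ?K \<in> I" unfolding J_def by blast
    then have "scale c (gmult (gmult ?k x) ?k - scale d ?K) \<in> I"
      using sub by (rule free.subspace_scale[rotated])
    also have "scale c (gmult (gmult ?k x) ?k - scale d ?K) = gmult (gmult ?k (scale c x)) ?k - scale (c * d) ?K"
      by (simp only: bilinear_ext_scale free.scale_right_diff_distrib free.scale_scale)
    finally show "scale c x \<in> J" unfolding J_def by blast
  qed
  have IJ: "I \<subseteq> J"
  proof
    fix x assume "x \<in> I"
    then have "gmult (gmult ?k x) ?k \<in> I" using perm_ideal_mult[OF Cons.prems(2) kO] by blast
    then show "x \<in> J" unfolding J_def by (auto intro!: exI[of _ 0])
  qed
  have hJ: "gmult (symbol h) ?A \<in> J" if h: "h permutes (?\<Omega> - P)" for h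
  proof -
    have hR: "h permutes ?R" using h PR(1) by (simp add: Un_Diff Int_commute Diff_triv)
    have "perm_ideal ?R {x. gmult ?A x \<in> I}" using perm_ideal_after[OF Cons.prems(2), of ?R P] PR(1) by auto
    moreover have "greedy {x. gmult ?A x \<in> I} Ps" using Cons.prems(3) by simp
    ultimately obtain c where "gmult (gmult ?k (symbol h)) ?k - scale c ?k \<in> {x. gmult ?A x \<in> I}"
      using Cons.IH[OF blocks _ _ hR] by blast
    then have "gmult ?A (gmult (gmult ?k (symbol h)) ?k - scale c ?k) \<in> I" by simp
    also have "gmult ?A (gmult (gmult ?k (symbol h)) ?k - scale c ?k) =
        gmult ?A (gmult (gmult ?k (symbol h)) ?k) - scale c ?K"
      using bilinear_ext_add(2)[of perm_mult ?A "gmult (gmult ?k (symbol h)) ?k - scale c ?k" "scale c ?k"]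
      by (simp add: bilinear_ext_scale algebra_simps)
    also have "gmult ?A (gmult (gmult ?k (symbol h)) ?k) = gmult (gmult ?k (gmult (symbol h) ?A)) ?k"
      using comm gmult_alt_sum_commute[OF hR PR(1)] by (metis gmult_assoc)
    finally show ?thesis unfolding J_def by blast
  qed
  have "signed_sum (double_coset P g) \<in> J"
    using Cons.prems(2,3,4) J IJ hJ fin
    by (intro signed_sum_double_coset[of ?\<Omega> P I J g]) auto
  moreover obtain c where c: "gmult (gmult ?A (symbol g)) ?A = scale c (signed_sum (double_coset P g))"
    using alt_sum_mult_alt_sum[OF PR(2) permutes_permutation[OF Cons.prems(4) fin]] by blast
  ultimately have "gmult (gmult ?A (symbol g)) ?A \<in> J" using J free.subspace_scale by metis
  then obtain d where "gmult (gmult ?k (gmult (gmult ?A (symbol g)) ?A)) ?k - scale d ?K \<in> I"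
    unfolding J_def by blast
  moreover have "gmult (gmult ?k (gmult (gmult ?A (symbol g)) ?A)) ?k = gmult (gmult ?K (symbol g)) ?K"
    using comm unfolding block_sum.simps by (metis gmult_assoc)
  ultimately show ?case by metis
qed

lemma alt_sum_singleton: "alt_sum {x} = symbol id"
proof -
  have "{\<sigma>. \<sigma> permutes {x}} = {id}" by (auto simp: permutes_id)
  then show ?thesis by (simp add: signed_sum_def signed_def)
qed

text \<open>At each stage a block of maximal size whose alternating sum is not in the ideal is split
  off. The last clause, a bound on all block sizes in terms of the ideal, is carried through the
  induction to show that later blocks are no larger than earlier ones.\<close>

lemma greedy_exists:
  assumes "finite \<Omega>" "perm_ideal \<Omega> I" "symbol id \<notin> I"
  shows "\<exists>Ps. disjoint_blocks Ps \<and> \<Union>(set Ps) = \<Omega> \<and> {} \<notin> set Ps \<and> greedy I Ps \<and> block_sum Ps \<notin> I \<and>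
    sorted_wrt (\<lambda>P Q. card Q \<le> card P) Ps \<and>
    (\<forall>c. (\<forall>Z \<subseteq> \<Omega>. c < card Z \<longrightarrow> alt_sum Z \<in> I) \<longrightarrow> (\<forall>P\<in>set Ps. card P \<le> c))"
  using assms
proof (induction \<Omega> arbitrary: I rule: finite_psubset_induct)
  case (psubset \<Omega>)
  show ?case
  proof (cases "\<Omega> = {}")
    case True
    then show ?thesis using psubset.prems(2)
      by (intro exI[of _ "[]"] conjI)
        (simp_all only: block_sum.simps disjoint_blocks.simps greedy.simps sorted_wrt.simps list.set
          Union_empty empty_iff ball_empty simp_thms)
  next
    case False
    let ?G = "{P. P \<subseteq> \<Omega> \<and> alt_sum P \<notin> I}"
    obtain x where x: "x \<in> \<Omega>" using False by blast
    \<comment> \<open>The alternating sum over one point is the identity, so a nonempty block can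
      always be found.\<close>
    have "{x} \<in> ?G" using x psubset.prems(2) unfolding alt_sum_singleton[of x, symmetric] by blast
    have finG: "finite ?G" using psubset.hyps by simp
    have "Max (card ` ?G) \<in> card ` ?G" using finG \<open>{x} \<in> ?G\<close> by (intro Max_in) blast+
    then obtain P where P: "P \<in> ?G" "card P = Max (card ` ?G)" by (metis (no_types, lifting) imageE)
    have max: "card Q \<le> card P" if "Q \<in> ?G" for Q
      unfolding P(2) using finG that by (intro Max_ge) blast+
    have PO: "P \<subseteq> \<Omega>" and PI: "alt_sum P \<notin> I" using P(1) by blast+
    have finP: "finite P" using PO psubset.hyps by (rule finite_subset)
    have "card P \<ge> 1" using max[OF \<open>{x} \<in> ?G\<close>] by simp
    then have Pne: "P \<noteq> {}" by auto
    let ?I = "{x. gmult (alt_sum P) x \<in> I}"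
    have sub: "\<Omega> - P \<subset> \<Omega>" using Pne PO by blast
    have pI: "perm_ideal (\<Omega> - P) ?I" using perm_ideal_after[OF psubset.prems(1), of "\<Omega> - P" P] by blast
    have idI: "symbol id \<notin> ?I" using PI by simp
    obtain Ps where Ps: "disjoint_blocks Ps" "\<Union>(set Ps) = \<Omega> - P" "{} \<notin> set Ps" "greedy ?I Ps"
      "block_sum Ps \<notin> ?I" "sorted_wrt (\<lambda>P Q. card Q \<le> card P) Ps"
      "\<forall>c. (\<forall>Z \<subseteq> \<Omega> - P. c < card Z \<longrightarrow> alt_sum Z \<in> ?I) \<longrightarrow> (\<forall>P\<in>set Ps. card P \<le> c)"
      using psubset.IH[OF sub pI idI] by (elim exE conjE)
    have big: "alt_sum Z \<in> I" if "Z \<subseteq> \<Omega>" "card P < card Z" for Z using max[of Z] that by fastforce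
    \<comment> \<open>A set too large for \<open>I\<close> is too large for the preimage ideal as
      well, so the inductive bound applies with \<open>card P\<close>.\<close>
    have small: "\<forall>Z \<subseteq> \<Omega> - P. card P < card Z \<longrightarrow> alt_sum Z \<in> ?I"
      using big perm_ideal_mult(1)[OF psubset.prems(1) keys_alt_sum[OF PO]] by blast
    have le: "\<forall>Q\<in>set Ps. card Q \<le> card P" by (rule mp[OF spec[OF Ps(7)] small])
    have U: "P \<union> \<Union>(set Ps) = \<Omega>" using Ps(2) PO by blast
    have Pc: "card P \<le> c" if "\<forall>Z \<subseteq> \<Omega>. c < card Z \<longrightarrow> alt_sum Z \<in> I" for c
      using that PO PI by (meson not_le)
    have bound: "(\<forall>Z \<subseteq> \<Omega>. c < card Z \<longrightarrow> alt_sum Z \<in> I) \<longrightarrow> (\<forall>Q\<in>set (P # Ps). card Q \<le> c)" for c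
    proof (intro impI ballI)
      fix Q assume "\<forall>Z \<subseteq> \<Omega>. c < card Z \<longrightarrow> alt_sum Z \<in> I" and Q: "Q \<in> set (P # Ps)"
      then have "card P \<le> c" by (intro Pc)
      moreover have "card Q \<le> card P" using Q le by auto
      ultimately show "card Q \<le> c" by linarith
    qed
    have "disjoint_blocks (P # Ps)" using finP Ps(1,2) by auto
    moreover have "greedy I (P # Ps)" using big Ps(4) U by simp
    moreover have "block_sum (P # Ps) \<notin> I" using Ps(5) by simp
    moreover have "sorted_wrt (\<lambda>P Q. card Q \<le> card P) (P # Ps)" using Ps(6) le by simp
    moreover have "{} \<notin> set (P # Ps)" "\<Union>(set (P # Ps)) = \<Omega>" using Ps(3) Pne U by auto
    ultimately show ?thesis using bound by (intro exI[of _ "P # Ps"] conjI allI)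
  qed
qed

lemma greedy_Int: "greedy I Ps \<Longrightarrow> greedy I' Ps \<Longrightarrow> greedy (I \<inter> I') Ps"
proof (induction Ps arbitrary: I I')
  case (Cons P Ps)
  have "{x. gmult (alt_sum P) x \<in> I \<inter> I'} = {x. gmult (alt_sum P) x \<in> I} \<inter> {x. gmult (alt_sum P) x \<in> I'}" by blast
  then show ?case using Cons.IH[of "{x. gmult (alt_sum P) x \<in> I}" "{x. gmult (alt_sum P) x \<in> I'}"] Cons.prems by simp
qed simp

text \<open>The nested preimage ideals unwind: belonging to the ideal left after the blocks
  \<open>As\<close> means belonging to \<open>I\<close> after left multiplication by their block
  sum.\<close>

lemma greedyI:
  assumes "\<And>As P Bs Z. Ps = As @ P # Bs \<Longrightarrow> Z \<subseteq> P \<union> \<Union>(set Bs) \<Longrightarrow> card P < card Z \<Longrightarrow>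
    block_sum (As @ [Z]) \<in> I"
  shows "greedy I Ps"
  using assms
proof (induction Ps arbitrary: I)
  case (Cons P Ps)
  have "alt_sum Z \<in> I" if "Z \<subseteq> P \<union> \<Union>(set Ps)" "card P < card Z" for Z
    using Cons.prems[of "[]" P Ps Z] that by simp
  moreover have "greedy {x. gmult (alt_sum P) x \<in> I} Ps"
  proof (rule Cons.IH)
    fix As Q Bs Z assume "Ps = As @ Q # Bs" "Z \<subseteq> Q \<union> \<Union>(set Bs)" "card Q < card Z"
    then show "block_sum (As @ [Z]) \<in> {x. gmult (alt_sum P) x \<in> I}"
      using Cons.prems[of "P # As" Q Bs Z] by simp
  qed
  ultimately show ?case by simp
qed simp

section \<open>Young subgroups\<close>

text \<open>For disjoint blocks this is the Young subgroup, the direct product of the symmetric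
  groups on the blocks.\<close>

definition block_stabilizer :: "nat set list \<Rightarrow> (nat \<Rightarrow> nat) set" where
  "block_stabilizer Ps = {\<sigma>. \<sigma> permutes \<Union>(set Ps) \<and> (\<forall>P\<in>set Ps. \<sigma> ` P = P)}"

lemma block_stabilizer_Cons:
  assumes "disjoint_blocks (P # Ps)"
  shows "bij_betw (\<lambda>(p, q). p \<circ> q) ({p. p permutes P} \<times> block_stabilizer Ps) (block_stabilizer (P # Ps))"
proof -
  let ?R = "\<Union>(set Ps)"
  have PR: "P \<inter> ?R = {}" using assms by simp
  have inj: "inj_on (\<lambda>(p, q). p \<circ> q) ({p. p permutes P} \<times> block_stabilizer Ps)"
  proof (rule inj_onI, clarify)
    fix p q p' q' assume p: "p permutes P" "p' permutes P" and q: "q \<in> block_stabilizer Ps" "q' \<in> block_stabilizer Ps"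
      and eq: "p \<circ> q = p' \<circ> q'"
    have q': "q permutes ?R" "q' permutes ?R" using q by (auto simp: block_stabilizer_def)
    have "p x = p' x" for x
    proof (cases "x \<in> P")
      case True
      then have "x \<notin> ?R" using PR by blast
      then have "q x = x" "q' x = x" using q' by (auto simp: permutes_not_in)
      then show ?thesis using fun_cong[OF eq, of x] by simp
    qed (use p in \<open>simp add: permutes_not_in\<close>)
    then have pp: "p = p'" by blast
    moreover have "q = q'"
    proof
      fix x
      have "p (q x) = p (q' x)" using fun_cong[OF eq, of x] pp by simp
      then show "q x = q' x" using permutes_inj[OF p(1)] by (simp add: inj_eq)
    qed
    ultimately show "p = p' \<and> q = q'" by blast
  qed
  have "(\<lambda>(p, q). p \<circ> q) ` ({p. p permutes P} \<times> block_stabilizer Ps) = block_stabilizer (P # Ps)"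
  proof (intro equalityI subsetI)
    fix \<sigma> assume "\<sigma> \<in> (\<lambda>(p, q). p \<circ> q) ` ({p. p permutes P} \<times> block_stabilizer Ps)"
    then obtain p q where pq: "p permutes P" "q permutes ?R" "\<And>Q. Q \<in> set Ps \<Longrightarrow> q ` Q = Q" "\<sigma> = p \<circ> q"
      by (auto simp: block_stabilizer_def)
    have "\<sigma> permutes \<Union>(set (P # Ps))" unfolding pq(4)
      using permutes_subset[OF pq(1)] permutes_subset[OF pq(2)] by (intro permutes_compose) auto
    moreover have "\<sigma> ` P = P"
    proof -
      have "q x = x" if "x \<in> P" for x using that PR permutes_not_in[OF pq(2)] by blast
      then have "q ` P = P" by simp
      then show ?thesis unfolding pq(4) image_comp[symmetric] using permutes_image[OF pq(1)] by simp
    qed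
    moreover have "\<sigma> ` Q = Q" if Q: "Q \<in> set Ps" for Q
    proof -
      have "p x = x" if "x \<in> Q" for x using that Q PR permutes_not_in[OF pq(1)] by blast
      then have "p ` Q = Q" by simp
      then show ?thesis unfolding pq(4) image_comp[symmetric] using pq(3)[OF Q] by simp
    qed
    ultimately show "\<sigma> \<in> block_stabilizer (P # Ps)" by (simp add: block_stabilizer_def)
  next
    fix \<sigma> assume "\<sigma> \<in> block_stabilizer (P # Ps)"
    then have \<sigma>: "\<sigma> permutes (P \<union> ?R)" "\<sigma> ` P = P" "\<And>Q. Q \<in> set Ps \<Longrightarrow> \<sigma> ` Q = Q"
      by (auto simp: block_stabilizer_def)
    have \<sigma>R: "\<sigma> ` ?R = ?R" using \<sigma>(3) by blast
    define p where "p x = (if x \<in> P then \<sigma> x else x)" for x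
    define q where "q x = (if x \<in> ?R then \<sigma> x else x)" for x
    have b: "bij_betw \<sigma> P P" "bij_betw \<sigma> ?R ?R"
      using \<sigma>(2) \<sigma>R permutes_inj[OF \<sigma>(1)] by (auto simp: bij_betw_def intro: inj_on_subset)
    have "bij_betw p P P" using b(1) by (subst bij_betw_cong[of _ _ \<sigma>]) (auto simp: p_def)
    then have p: "p permutes P" by (rule bij_imp_permutes) (simp add: p_def)
    have "bij_betw q ?R ?R" using b(2) by (subst bij_betw_cong[of _ _ \<sigma>]) (auto simp: q_def)
    then have q: "q permutes ?R" by (rule bij_imp_permutes) (simp add: q_def)
    have "q ` Q = Q" if "Q \<in> set Ps" for Q
    proof -
      have "q ` Q = \<sigma> ` Q" using that by (intro image_cong) (auto simp: q_def)
      then show ?thesis using \<sigma>(3) that by simp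
    qed
    then have qs: "q \<in> block_stabilizer Ps" using q by (simp add: block_stabilizer_def)
    have "\<sigma> = p \<circ> q"
    proof
      fix x
      consider "x \<in> P" | "x \<in> ?R" | "x \<notin> P \<union> ?R" by blast
      then show "\<sigma> x = (p \<circ> q) x"
      proof cases
        case 1
        then have "x \<notin> ?R" using PR by blast
        then show ?thesis using 1 by (simp add: p_def q_def)
      next
        case 2
        then have "\<sigma> x \<in> ?R" using \<sigma>R by blast
        then have "\<sigma> x \<notin> P" using PR by blast
        then show ?thesis using 2 by (simp add: p_def q_def)
      next
        case 3
        then show ?thesis using permutes_not_in[OF \<sigma>(1) 3] by (simp add: p_def q_def)
      qed
    qed
    then show "\<sigma> \<in> (\<lambda>(p, q). p \<circ> q) ` ({p. p permutes P} \<times> block_stabilizer Ps)"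
      using p qs by (intro image_eqI[of _ _ "(p, q)"]) auto
  qed
  then show ?thesis using inj by (simp add: bij_betw_def)
qed

lemma finite_disjoint_blocks: "disjoint_blocks Ps \<Longrightarrow> finite (\<Union>(set Ps))"
  by (induction Ps) auto

text \<open>Expanding the product of alternating sums runs through the Young subgroup once, by its
  product decomposition, and signs are multiplicative.\<close>

lemma block_sum_eq:
  "disjoint_blocks Ps \<Longrightarrow> block_sum Ps = (signed_sum (block_stabilizer Ps) :: _ \<Rightarrow>\<^sub>0 'k::field)"
proof (induction Ps)
  case Nil
  have "block_stabilizer [] = {id}" by (auto simp: block_stabilizer_def)
  then show ?case by (simp add: signed_sum_def signed_def)
next
  case (Cons P Ps)
  have fin: "finite P" "finite (\<Union>(set Ps))" using Cons.prems finite_disjoint_blocks by auto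
  have "block_sum (P # Ps) = (\<Sum>p\<in>{p. p permutes P}. \<Sum>q\<in>block_stabilizer Ps. gmult (signed p) (signed q :: _ \<Rightarrow>\<^sub>0 'k))"
  proof -
    have "block_sum Ps = (signed_sum (block_stabilizer Ps) :: _ \<Rightarrow>\<^sub>0 'k)" using Cons by simp
    then show ?thesis
      by (simp only: block_sum.simps signed_sum_def bilinear_ext_sum) (rule sum.swap)
  qed
  also have "\<dots> = (\<Sum>(p, q)\<in>{p. p permutes P} \<times> block_stabilizer Ps. gmult (signed p) (signed q))"
    by (rule sum.cartesian_product)
  also have "\<dots> = (\<Sum>z\<in>{p. p permutes P} \<times> block_stabilizer Ps. signed ((\<lambda>(p, q). p \<circ> q) z))"
  proof (rule sum.cong[OF refl], clarify)
    fix p q assume "p permutes P" "q \<in> block_stabilizer Ps"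
    then have "permutation p" "permutation q"
      using fin permutes_permutation by (auto simp: block_stabilizer_def)
    then show "gmult (signed p) (signed q) = (signed (p \<circ> q) :: _ \<Rightarrow>\<^sub>0 'k)"
      by (simp add: signed_def bilinear_ext_scale sign_comp mult.commute)
  qed
  also have "\<dots> = signed_sum (block_stabilizer (P # Ps))"
    unfolding signed_sum_def by (rule sum.reindex_bij_betw[OF block_stabilizer_Cons[OF Cons.prems]])
  finally show ?case .
qed

lemma card_block_stabilizer:
  "disjoint_blocks Ps \<Longrightarrow> card (block_stabilizer Ps) = (\<Prod>P\<leftarrow>Ps. fact (card P))"
proof (induction Ps)
  case Nil
  have "block_stabilizer [] = {id}" by (auto simp: block_stabilizer_def)
  then show ?case by simp
next
  case (Cons P Ps)
  have "card (block_stabilizer (P # Ps)) = card ({p. p permutes P} \<times> block_stabilizer Ps)"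
    using bij_betw_same_card[OF block_stabilizer_Cons[OF Cons.prems]] by simp
  then show ?case using Cons by (simp add: card_cartesian_product card_permutations)
qed

section \<open>Tabloids and Specht modules\<close>

definition perm_tabloid :: "(nat \<Rightarrow> nat) \<Rightarrow> tabloid \<Rightarrow> (tabloid \<Rightarrow>\<^sub>0 'k::field)" where
  "perm_tabloid \<sigma> T = symbol (tabloid_perm \<sigma> T)"

abbreviation tact :: "((nat \<Rightarrow> nat) \<Rightarrow>\<^sub>0 'k::field) \<Rightarrow> (tabloid \<Rightarrow>\<^sub>0 'k) \<Rightarrow> (tabloid \<Rightarrow>\<^sub>0 'k)" where
  "tact \<equiv> bilinear_ext perm_tabloid"

lemma tact_symbol: "tact (symbol \<sigma>) (symbol T) = symbol (tabloid_perm \<sigma> T)"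
  by (simp add: bilinear_ext_symbol perm_tabloid_def)

lemma tabloid_perm_comp: "tabloid_perm (\<sigma> \<circ> \<tau>) T = tabloid_perm \<sigma> (tabloid_perm \<tau> T)"
  by (simp add: tabloid_perm_def image_comp)

lemma tabloid_perm_id [simp]: "tabloid_perm id T = T"
  by (simp add: tabloid_perm_def)

lemma tact_gmult: "tact (gmult a b) v = tact a (tact b v)"
  by (rule bilinear_ext_assoc[of _ UNIV _ UNIV _ UNIV])
    (simp_all add: perm_mult_def perm_tabloid_def tabloid_perm_comp bilinear_ext_symbol)

lemma tact_id [simp]: "tact (symbol id) v = v"
proof -
  have "perm_tabloid id = (symbol :: _ \<Rightarrow> _ \<Rightarrow>\<^sub>0 'a)" by (rule ext) (simp add: perm_tabloid_def)
  then show ?thesis by (simp add: bilinear_ext_def)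
qed

lemma specht_simps [simp]:
  "\<zero>\<^bsub>specht_module \<mu>\<^esub> = 0" "x \<oplus>\<^bsub>specht_module \<mu>\<^esub> y = x + y" "c \<odot>\<^bsub>specht_module \<mu>\<^esub> x = scale c x"
  "act (specht_module \<mu>) a v = tact a v"
  "carrier (specht_module \<mu>) = lin_span {polytabloid \<mu> t |t. tableau \<mu> t}"
  by (simp_all add: specht_module_def bilinear_ext_def perm_tabloid_def[abs_def])

text \<open>Multiplying the signed sum by \<tau> on the right changes its sign, whereas \<tau> fixes
  the tabloid; so the vector equals its negative, and 2 is invertible.\<close>

lemma tact_signed_sum_eq_zero:
  fixes X :: "(nat \<Rightarrow> nat) set"
  assumes two: "(2::'k::field) \<noteq> 0" and X: "\<And>x. x \<in> X \<Longrightarrow> permutation x"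
    and \<tau>: "x \<noteq> y" "\<tau> = Transposition.transpose x y" "(\<lambda>s. s \<circ> \<tau>) ` X = X" "tabloid_perm \<tau> T = T"
  shows "tact (signed_sum X) (symbol T) = (0 :: tabloid \<Rightarrow>\<^sub>0 'k)"
proof -
  let ?v = "tact (signed_sum X) (symbol T) :: tabloid \<Rightarrow>\<^sub>0 'k"
  have p: "permutation \<tau>" unfolding \<tau>(2) by (rule permutation_swap_id)
  have s: "sign \<tau> = -1" using \<tau>(1,2) by (simp add: sign_swap_id)
  have "gmult (signed_sum X) (symbol \<tau>) = (scale (of_int (sign \<tau>)) (signed_sum X) :: _ \<Rightarrow>\<^sub>0 'k)"
    using gmult_signed_sum(2)[of X \<tau>] X p \<tau>(3) by simp
  then have "tact (signed_sum X) (tact (symbol \<tau>) (symbol T)) = - ?v"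
    unfolding tact_gmult[symmetric] by (simp add: s bilinear_ext_scale(1)[of _ "-1", simplified])
  then have "?v = - ?v" by (simp only: tact_symbol \<tau>(4))
  then have "Poly_Mapping.lookup ?v z = - Poly_Mapping.lookup ?v z" for z by (metis lookup_uminus)
  then have "2 * Poly_Mapping.lookup ?v z = 0" for z by (metis add.right_inverse mult_2)
  then have "Poly_Mapping.lookup ?v z = 0" for z using two by simp
  then show ?thesis by (intro poly_mapping_eqI) simp
qed

text \<open>Remove the maximum: in a set of \<open>k + 1\<close> natural numbers it is at least
  \<open>k\<close>.\<close>

lemma sum_nat_set_ge:
  fixes A :: "nat set"
  assumes "finite A"
  shows "\<Sum>{..<card A} \<le> \<Sum>A \<and> (\<Sum>A = \<Sum>{..<card A} \<longrightarrow> A = {..<card A})"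
  using assms
proof (induction "card A" arbitrary: A)
  case 0
  then show ?case by simp
next
  case (Suc k)
  let ?m = "Max A"
  have A: "A \<noteq> {}" "finite A" using Suc by auto
  have m: "?m \<in> A" using A by simp
  have c: "k = card (A - {?m})" using Suc m A by simp
  have "A \<subseteq> {..?m}" using A by auto
  then have "card A \<le> card {..?m}" by (intro card_mono) auto
  then have mk: "k \<le> ?m" using Suc by simp
  have IH: "\<Sum>{..<k} \<le> \<Sum>(A - {?m})" "\<Sum>(A - {?m}) = \<Sum>{..<k} \<Longrightarrow> A - {?m} = {..<k}"
    using Suc.hyps(1)[OF c] A c by simp_all
  have s: "\<Sum>A = ?m + \<Sum>(A - {?m})" using sum.remove[OF A(2) m, of "\<lambda>x. x"] .
  have s': "\<Sum>{..<card A} = k + \<Sum>{..<k}" using Suc by (simp flip: Suc.hyps(2))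
  have "A = {..<card A}" if "\<Sum>A = \<Sum>{..<card A}"
  proof -
    have "?m = k" "\<Sum>(A - {?m}) = \<Sum>{..<k}" using that s s' mk IH(1) by linarith+
    then have "A - {?m} = {..<k}" "A = insert k (A - {?m})" using IH(2) m by auto
    then show ?thesis using Suc by (simp add: lessThan_Suc flip: Suc.hyps(2))
  qed
  then show ?case using s s' mk IH(1) by linarith
qed

text \<open>The parameter \<open>K\<close> carries only the coefficient field, so that the constants
  of the locale have a definite scalar type.\<close>

locale young =
  fixes \<mu> :: "nat list" and K :: "'k::field itself"
  assumes sorted: "sorted_wrt (\<ge>) \<mu>" and nonzero: "0 \<notin> set \<mu>" and two: "(2::'k) \<noteq> 0"
begin

abbreviation (input) n where "n \<equiv> sum_list \<mu>"
abbreviation (input) Y where "Y \<equiv> young_diagram \<mu>"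

lemma in_Y: "(i, j) \<in> Y \<longleftrightarrow> i < length \<mu> \<and> j < \<mu> ! i"
  by (simp add: young_diagram_def)

lemma Y_Sigma: "Y = (SIGMA i:{..<length \<mu>}. {..<\<mu> ! i})"
  by (auto simp: young_diagram_def)

lemma finite_Y [simp]: "finite Y"
  by (simp add: Y_Sigma)

lemma card_Y: "card Y = n"
  by (simp add: Y_Sigma sum_list_sum_nth atLeast0LessThan)

lemma Y_down:
  assumes "(i, j) \<in> Y" "i' \<le> i"
  shows "(i', j) \<in> Y"
proof (cases "i' = i")
  case False
  then have "\<mu> ! i \<le> \<mu> ! i'"
    using sorted assms by (auto simp: in_Y sorted_wrt_iff_nth_less)
  then show ?thesis using assms False by (auto simp: in_Y)
qed (use assms in simp)

definition height :: "nat \<Rightarrow> nat" where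
  "height j = card {i. (i, j) \<in> Y}"

lemma in_Y_height: "(i, j) \<in> Y \<longleftrightarrow> i < height j"
proof -
  have fin: "finite {i. (i, j) \<in> Y}"
    by (rule finite_subset[of _ "{..<length \<mu>}"]) (auto simp: in_Y)
  have down: "{i. (i, j) \<in> Y} = {..<card {i. (i, j) \<in> Y}}"
  proof (cases "{i. (i, j) \<in> Y} = {}")
    case False
    let ?m = "Max {i. (i, j) \<in> Y}"
    have "?m \<in> {i. (i, j) \<in> Y}" using fin False by (rule Max_in)
    then have "i \<in> {i. (i, j) \<in> Y} \<longleftrightarrow> i \<in> {..?m}" for i
      using Max_ge[OF fin, of i] Y_down[of ?m j i] by blast
    then have "{i. (i, j) \<in> Y} = {..?m}" by blast
    then show ?thesis by (metis card_atMost lessThan_Suc_atMost)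
  qed simp
  then show ?thesis unfolding height_def by blast
qed

text \<open>Only entries \<open>x < n\<close> have a position; elsewhere the value is unspecified,
  hence the side conditions below.\<close>

definition row :: "(nat \<times> nat \<Rightarrow> nat) \<Rightarrow> nat \<Rightarrow> nat" where
  "row t x = fst (the_inv_into Y t x)"

definition col :: "(nat \<times> nat \<Rightarrow> nat) \<Rightarrow> nat \<Rightarrow> nat" where
  "col t x = snd (the_inv_into Y t x)"

definition tabloids :: "tabloid set" where
  "tabloids = {tabloid_of \<mu> t |t. tableau \<mu> t}"

definition kappa :: "(nat \<times> nat \<Rightarrow> nat) \<Rightarrow> ((nat \<Rightarrow> nat) \<Rightarrow>\<^sub>0 'k)" where
  "kappa t = signed_sum (column_stabilizer \<mu> t)"

definition e :: "(nat \<times> nat \<Rightarrow> nat) \<Rightarrow> (tabloid \<Rightarrow>\<^sub>0 'k)" where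
  "e t = polytabloid \<mu> t"

lemma e_eq: "e t = tact (kappa t) (symbol (tabloid_of \<mu> t))"
  by (simp add: e_def polytabloid_def kappa_def signed_sum_def signed_def bilinear_ext_sum
      bilinear_ext_scale tact_symbol)

abbreviation (input) S :: "('k, tabloid \<Rightarrow>\<^sub>0 'k, (nat \<Rightarrow> nat) \<Rightarrow>\<^sub>0 'k) amodule" where
  "S \<equiv> specht_module \<mu>"

lemma S_carrier: "carrier S = lin_span {e t |t. tableau \<mu> t}"
  by (simp add: e_def)

context
  fixes t assumes t: "tableau \<mu> t"
begin

lemma cell: "x < n \<Longrightarrow> (row t x, col t x) \<in> Y" "x < n \<Longrightarrow> t (row t x, col t x) = x"
  using t the_inv_into_into[of t Y x Y] f_the_inv_into_f[of t Y x]
  by (auto simp: tableau_def bij_betw_def row_def col_def)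

lemma row_col_t: "(i, j) \<in> Y \<Longrightarrow> t (i, j) < n \<and> row t (t (i, j)) = i \<and> col t (t (i, j)) = j"
  using t the_inv_into_f_f[of t Y "(i, j)"] by (auto simp: tableau_def bij_betw_def row_def col_def)

lemma row_col_inj: "x < n \<Longrightarrow> y < n \<Longrightarrow> row t x = row t y \<Longrightarrow> col t x = col t y \<Longrightarrow> x = y"
  using cell(2) by metis

lemma tabloid_of_eq: "tabloid_of \<mu> t i = {x. x < n \<and> row t x = i}"
proof -
  have "x \<in> t ` {(i', j). (i', j) \<in> Y \<and> i' = i}" if x: "x < n" "row t x = i" for x
    using cell[OF x(1)] x(2) by (intro image_eqI[of _ _ "(i, col t x)"]) simp_all
  then show ?thesis unfolding tabloid_of_def using row_col_t by auto
qed

lemma column_eq: "t ` {(i, j'). (i, j') \<in> Y \<and> j' = j} = {x. x < n \<and> col t x = j}"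
proof -
  have "x \<in> t ` {(i, j'). (i, j') \<in> Y \<and> j' = j}" if x: "x < n" "col t x = j" for x
    using cell[OF x(1)] x(2) by (intro image_eqI[of _ _ "(row t x, j)"]) simp_all
  then show ?thesis using row_col_t by auto
qed

lemma column_stabilizer_iff:
  "\<sigma> \<in> column_stabilizer \<mu> t \<longleftrightarrow> \<sigma> permutes {..<n} \<and> (\<forall>x<n. col t (\<sigma> x) = col t x)"
proof (cases "\<sigma> permutes {..<n}")
  case True
  have lt: "\<sigma> x < n \<longleftrightarrow> x < n" for x using permutes_in_image[OF True, of x] by simp
  have "\<sigma> ` {x. x < n \<and> col t x = j} = {x. x < n \<and> col t x = j}"
    if "\<forall>x<n. col t (\<sigma> x) = col t x" for j
    using that lt permutes_inj[OF True] by (intro endo_inj_surj) (auto intro: inj_on_subset)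
  moreover have "col t (\<sigma> x) = col t x"
    if "\<forall>j. \<sigma> ` {x. x < n \<and> col t x = j} = {x. x < n \<and> col t x = j}" "x < n" for x
  proof -
    have "\<sigma> x \<in> \<sigma> ` {y. y < n \<and> col t y = col t x}" using that(2) by blast
    then show ?thesis using that(1) by auto
  qed
  moreover have "{(i, j') \<in> Y. j' = j} = {(i, j'). (i, j') \<in> Y \<and> j' = j}" for j by auto
  ultimately show ?thesis using True unfolding column_stabilizer_def by (auto simp: column_eq)
qed (simp add: column_stabilizer_def)

lemma finite_column_stabilizer [simp]: "finite (column_stabilizer \<mu> t)"
  by (rule finite_subset[OF _ finite_permutations[of "{..<n}"]]) (auto simp: column_stabilizer_iff)

lemma column_stabilizer_comp:
  assumes "\<sigma> \<in> column_stabilizer \<mu> t" "\<tau> \<in> column_stabilizer \<mu> t"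
  shows "\<sigma> \<circ> \<tau> \<in> column_stabilizer \<mu> t"
proof -
  have "\<tau> x < n" if "x < n" for x using assms(2) that permutes_in_image[of \<tau> "{..<n}" x]
    by (simp add: column_stabilizer_iff)
  then show ?thesis using assms by (auto simp: column_stabilizer_iff intro: permutes_compose)
qed

lemma column_stabilizer_inv:
  assumes "\<sigma> \<in> column_stabilizer \<mu> t"
  shows "Hilbert_Choice.inv \<sigma> \<in> column_stabilizer \<mu> t"
proof -
  have p: "\<sigma> permutes {..<n}" using assms by (simp add: column_stabilizer_iff)
  have "col t (Hilbert_Choice.inv \<sigma> x) = col t x" if "x < n" for x
  proof -
    have "Hilbert_Choice.inv \<sigma> x < n" using that permutes_in_image[OF permutes_inv[OF p], of x] by simp
    then have "col t (\<sigma> (Hilbert_Choice.inv \<sigma> x)) = col t (Hilbert_Choice.inv \<sigma> x)"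
      using assms by (simp add: column_stabilizer_iff)
    then show ?thesis by (simp add: permutes_inverses(1)[OF p])
  qed
  then show ?thesis using permutes_inv[OF p] by (simp add: column_stabilizer_iff)
qed

lemma column_stabilizer_permutation: "\<sigma> \<in> column_stabilizer \<mu> t \<Longrightarrow> permutation \<sigma>"
  using permutes_permutation[of \<sigma> "{..<n}"] by (simp add: column_stabilizer_iff)

lemma image_comp_column_stabilizer:
  assumes "\<sigma> \<in> column_stabilizer \<mu> t"
  shows "(\<lambda>s. s \<circ> \<sigma>) ` column_stabilizer \<mu> t = column_stabilizer \<mu> t"
proof (intro equalityI subsetI)
  fix s assume s: "s \<in> column_stabilizer \<mu> t"
  have p: "\<sigma> permutes {..<n}" using assms by (simp add: column_stabilizer_iff)
  have "s = (s \<circ> Hilbert_Choice.inv \<sigma>) \<circ> \<sigma>" using permutes_inverses(2)[OF p] by (auto simp: fun_eq_iff)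
  then show "s \<in> (\<lambda>s. s \<circ> \<sigma>) ` column_stabilizer \<mu> t"
    using column_stabilizer_comp[OF s column_stabilizer_inv[OF assms]] by blast
qed (use assms column_stabilizer_comp in blast)

lemma kappa_mult:
  assumes "\<sigma> \<in> column_stabilizer \<mu> t"
  shows "gmult (kappa t) (symbol \<sigma>) = scale (of_int (sign \<sigma>)) (kappa t)"
  using gmult_signed_sum(2)[of "column_stabilizer \<mu> t" \<sigma>] column_stabilizer_permutation assms
  by (simp add: kappa_def image_comp_column_stabilizer)

lemma kappa_in: "kappa t \<in> carrier (group_algebra n)"
  unfolding in_group_algebra kappa_def
  by (rule subset_trans[OF keys_signed_sum]) (auto simp: column_stabilizer_iff)

lemma transpose_in_column_stabilizer:
  assumes "x < n" "y < n" "col t x = col t y"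
  shows "Transposition.transpose x y \<in> column_stabilizer \<mu> t"
  using assms permutes_swap_id[of x "{..<n}" y]
  by (auto simp: column_stabilizer_iff Transposition.transpose_def)

lemma tabloid_perm_of:
  assumes "\<sigma> permutes {..<n}"
  shows "tabloid_perm \<sigma> (tabloid_of \<mu> t) i = {x. x < n \<and> row t (Hilbert_Choice.inv \<sigma> x) = i}"
proof -
  have lt: "\<sigma> x < n \<longleftrightarrow> x < n" for x using permutes_in_image[OF assms, of x] by simp
  have "x = \<sigma> (Hilbert_Choice.inv \<sigma> x)" "Hilbert_Choice.inv \<sigma> (\<sigma> x) = x" for x
    using permutes_inverses[OF assms] by simp_all
  then show ?thesis
    unfolding tabloid_perm_def tabloid_of_eq using lt by (auto intro!: image_eqI) metis
qed

text \<open>An entry is determined by its row and its column, so a column permutation is determined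
  by the rows into which it sends the entries. In group terms, row and column stabilizer meet
  trivially.\<close>

lemma stabilizer_tabloid_inj:
  assumes "\<sigma> \<in> column_stabilizer \<mu> t" "\<tau> \<in> column_stabilizer \<mu> t"
    "tabloid_perm \<sigma> (tabloid_of \<mu> t) = tabloid_perm \<tau> (tabloid_of \<mu> t)"
  shows "\<sigma> = \<tau>"
proof -
  have p: "\<sigma> permutes {..<n}" "\<tau> permutes {..<n}" using assms by (simp_all add: column_stabilizer_iff)
  have "Hilbert_Choice.inv \<sigma> x = Hilbert_Choice.inv \<tau> x" for x
  proof (cases "x < n")
    case True
    have "x \<in> tabloid_perm \<sigma> (tabloid_of \<mu> t) (row t (Hilbert_Choice.inv \<sigma> x))"
      using True by (simp add: tabloid_perm_of[OF p(1)])
    then have "row t (Hilbert_Choice.inv \<tau> x) = row t (Hilbert_Choice.inv \<sigma> x)"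
      unfolding assms(3) tabloid_perm_of[OF p(2)] by simp
    moreover have "col t (Hilbert_Choice.inv \<tau> x) = col t (Hilbert_Choice.inv \<sigma> x)"
      using True column_stabilizer_inv[OF assms(1)] column_stabilizer_inv[OF assms(2)]
      by (simp add: column_stabilizer_iff)
    moreover have "Hilbert_Choice.inv \<sigma> x < n" "Hilbert_Choice.inv \<tau> x < n"
      using True permutes_in_image[OF permutes_inv[OF p(1)], of x] permutes_in_image[OF permutes_inv[OF p(2)], of x]
      by simp_all
    ultimately show ?thesis using row_col_inj by metis
  next
    case False
    then show ?thesis using permutes_not_in[OF permutes_inv[OF p(1)]] permutes_not_in[OF permutes_inv[OF p(2)]] by simp
  qed
  then have "Hilbert_Choice.inv \<sigma> = Hilbert_Choice.inv \<tau>" by blast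
  then show ?thesis using permutes_inv_inv p by metis
qed

lemma lookup_e:
  "Poly_Mapping.lookup (e t) T =
    (\<Sum>\<sigma>\<in>column_stabilizer \<mu> t. of_int (sign \<sigma>) * (if tabloid_perm \<sigma> (tabloid_of \<mu> t) = T then 1 else 0))"
  by (simp add: e_def polytabloid_def lookup_sum lookup_symbol)

lemma lookup_e_stabilizer:
  assumes "\<sigma> \<in> column_stabilizer \<mu> t"
  shows "Poly_Mapping.lookup (e t) (tabloid_perm \<sigma> (tabloid_of \<mu> t)) = of_int (sign \<sigma>)"
proof -
  have "Poly_Mapping.lookup (e t) (tabloid_perm \<sigma> (tabloid_of \<mu> t)) =
      (\<Sum>\<tau>\<in>column_stabilizer \<mu> t. if \<tau> = \<sigma> then of_int (sign \<sigma>) else 0)"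
    unfolding lookup_e using stabilizer_tabloid_inj[OF _ assms] by (intro sum.cong) auto
  then show ?thesis using assms by simp
qed

lemma lookup_e_eq_zero:
  "(\<And>\<sigma>. \<sigma> \<in> column_stabilizer \<mu> t \<Longrightarrow> tabloid_perm \<sigma> (tabloid_of \<mu> t) \<noteq> T) \<Longrightarrow> Poly_Mapping.lookup (e t) T = 0"
  unfolding lookup_e by (intro sum.neutral) simp

lemma e_nonzero: "e t \<noteq> 0"
proof -
  have "id \<in> column_stabilizer \<mu> t" by (simp add: column_stabilizer_iff permutes_id)
  from lookup_e_stabilizer[OF this] show ?thesis by auto
qed

text \<open>
  If the entries of every column of \<open>t\<close> lie in distinct rows of another tableau, then the row
  indices occurring in a column of height \<open>h\<close> sum to at least \<open>0 + \<dots> + (h - 1)\<close>, with equality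
  only if they are \<open>0, \<dots>, h - 1\<close>.
\<close>

lemma
  assumes r: "\<And>x y. x < n \<Longrightarrow> y < n \<Longrightarrow> x \<noteq> y \<Longrightarrow> col t x = col t y \<Longrightarrow> r x \<noteq> r y"
  shows row_potential_le: "(\<Sum>x<n. row t x) \<le> (\<Sum>x<n. r x)"
    and row_potential_eq: "(\<Sum>x<n. r x) = (\<Sum>x<n. row t x) \<Longrightarrow> r ` {x. x < n \<and> col t x = j} = {..<height j}"
proof -
  let ?C = "\<lambda>j. {x. x < n \<and> col t x = j}" and ?J = "col t ` {..<n}"
  have split: "(\<Sum>x<n. f x) = (\<Sum>j\<in>?J. \<Sum>x\<in>?C j. f x)" for f :: "nat \<Rightarrow> nat"
    using sum.image_gen[of "{..<n}" f "col t"] by simp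
  have inj: "inj_on r (?C j)" for j by (rule inj_onI) (metis (mono_tags, lifting) mem_Collect_eq r)
  have injr: "inj_on (row t) (?C j)" for j using row_col_inj by (auto simp: inj_on_def)
  have "row t ` ?C j = {i. (i, j) \<in> Y}" for j
  proof (intro equalityI subsetI)
    fix i assume "i \<in> {i. (i, j) \<in> Y}"
    then show "i \<in> row t ` ?C j" using row_col_t[of i j] by (intro image_eqI[of _ _ "t (i, j)"]) auto
  qed (use cell(1) in auto)
  then have rowC: "row t ` ?C j = {..<height j}" for j using in_Y_height by auto
  have cardC: "card (?C j) = height j" for j using card_image[OF injr[of j]] rowC[of j] by simp
  have sumrow: "(\<Sum>x\<in>?C j. row t x) = \<Sum>{..<height j}" for j
    using sum.reindex[OF injr[of j], of "\<lambda>x. x"] rowC[of j] by simp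
  have sumr: "(\<Sum>x\<in>?C j. r x) = \<Sum>(r ` ?C j)" for j
    using sum.reindex[OF inj[of j], of "\<lambda>x. x"] by simp
  have cardr: "card (r ` ?C j) = height j" for j using card_image[OF inj[of j]] cardC by simp
  have ge: "(\<Sum>x\<in>?C j. row t x) \<le> (\<Sum>x\<in>?C j. r x)" for j
    unfolding sumrow sumr using sum_nat_set_ge[of "r ` ?C j"] cardr by simp
  then show "(\<Sum>x<n. row t x) \<le> (\<Sum>x<n. r x)" unfolding split by (rule sum_mono)
  assume eq: "(\<Sum>x<n. r x) = (\<Sum>x<n. row t x)"
  show "r ` ?C j = {..<height j}"
  proof (cases "j \<in> ?J")
    case True
    have "(\<Sum>x\<in>?C j. row t x) = (\<Sum>x\<in>?C j. r x)"
      using sum_mono_inv[of "\<lambda>j. \<Sum>x\<in>?C j. row t x" ?J "\<lambda>j. \<Sum>x\<in>?C j. r x"] eq[unfolded split] ge True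
      by simp
    then have "\<Sum>(r ` ?C j) = \<Sum>{..<card (r ` ?C j)}" unfolding sumrow sumr cardr by simp
    then have "r ` ?C j = {..<card (r ` ?C j)}"
      using sum_nat_set_ge[of "r ` ?C j"] by simp
    then show ?thesis unfolding cardr .
  next
    case False
    then have E: "?C j = {}" by auto
    then have "height j = 0" using cardC[of j] by (metis card.empty)
    then show ?thesis unfolding E by simp
  qed
qed

lemma row_card: "card {x. x < n \<and> row t x = i} = card {j. (i, j) \<in> Y}"
proof -
  have inj: "inj_on (col t) {x. x < n \<and> row t x = i}" using row_col_inj by (auto simp: inj_on_def)
  have img: "col t ` {x. x < n \<and> row t x = i} = {j. (i, j) \<in> Y}"
  proof (intro equalityI subsetI)
    fix j assume "j \<in> {j. (i, j) \<in> Y}"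
    then show "j \<in> col t ` {x. x < n \<and> row t x = i}"
      using row_col_t[of i j] by (intro image_eqI[of _ _ "t (i, j)"]) auto
  qed (use cell(1) in auto)
  show ?thesis using card_image[OF inj] unfolding img by (rule sym)
qed

text \<open>In the case of equality a column of height \<open>h\<close> takes the values
  \<open>0\<close> to \<open>h - 1\<close> once each, so \<open>i\<close> occurs once in every
  column that reaches row \<open>i\<close>. The function \<open>r\<close> may come from a tableau of
  another shape, which is how two shapes are compared.\<close>

lemma row_card_potential:
  assumes r: "\<And>x y. x < n \<Longrightarrow> y < n \<Longrightarrow> x \<noteq> y \<Longrightarrow> col t x = col t y \<Longrightarrow> r x \<noteq> r y"
    and eq: "(\<Sum>x<n. r x) = (\<Sum>x<n. row t x)"
  shows "card {x. x < n \<and> r x = i} = card {j. (i, j) \<in> Y}"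
proof -
  have im: "r ` {x. x < n \<and> col t x = j} = {..<height j}" for j
    by (rule row_potential_eq[OF _ eq]) (rule r)
  have inj: "inj_on (col t) {x. x < n \<and> r x = i}" by (rule inj_onI) (metis (mono_tags, lifting) mem_Collect_eq r)
  have img: "col t ` {x. x < n \<and> r x = i} = {j. (i, j) \<in> Y}"
  proof (intro equalityI subsetI)
    fix j assume "j \<in> {j. (i, j) \<in> Y}"
    then have "i \<in> r ` {x. x < n \<and> col t x = j}" unfolding im using in_Y_height by simp
    then show "j \<in> col t ` {x. x < n \<and> r x = i}" by auto
  next
    fix j assume "j \<in> col t ` {x. x < n \<and> r x = i}"
    then have "i \<in> r ` {x. x < n \<and> col t x = j}" by auto
    then show "j \<in> {j. (i, j) \<in> Y}" unfolding im using in_Y_height by simp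
  qed
  show ?thesis using card_image[OF inj] unfolding img by (rule sym)
qed

text \<open>In each column of \<open>t\<close> the rows of \<open>s\<close> that occur are exactly
  \<open>0\<close> to the height minus one, so the column can be rearranged until its entries stand
  in the rows they have in \<open>s\<close>.\<close>

lemma collision_free_stabilizer:
  assumes s: "tableau \<mu> s"
    and r: "\<And>x y. x < n \<Longrightarrow> y < n \<Longrightarrow> x \<noteq> y \<Longrightarrow> col t x = col t y \<Longrightarrow> row s x \<noteq> row s y"
    and eq: "(\<Sum>x<n. row s x) = (\<Sum>x<n. row t x)"
  shows "\<exists>\<pi>\<in>column_stabilizer \<mu> t. tabloid_of \<mu> s = tabloid_perm \<pi> (tabloid_of \<mu> t)"
proof -
  have im: "row s ` {x. x < n \<and> col t x = j} = {..<height j}" for j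
    by (rule row_potential_eq[OF _ eq]) (rule r)
  have "\<exists>y. y < n \<and> col t y = col t x \<and> row s y = row t x" if "x < n" for x
  proof -
    have "row t x \<in> {..<height (col t x)}" using cell(1)[OF that] in_Y_height by simp
    then have "row t x \<in> row s ` {y. y < n \<and> col t y = col t x}" using im[of "col t x"] by blast
    then show ?thesis by auto
  qed
  then obtain p where p: "\<And>x. x < n \<Longrightarrow> p x < n \<and> col t (p x) = col t x \<and> row s (p x) = row t x" by metis
  define \<pi> where "\<pi> x = (if x < n then p x else x)" for x
  have "inj_on \<pi> {..<n}"
  proof (rule inj_onI)
    fix x y assume xy: "x \<in> {..<n}" "y \<in> {..<n}" "\<pi> x = \<pi> y"
    then have "p x = p y" by (simp add: \<pi>_def)
    then have "col t x = col t y" "row t x = row t y" using p[of x] p[of y] xy by simp_all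
    then show "x = y" using row_col_inj xy by simp
  qed
  moreover have "\<pi> ` {..<n} \<subseteq> {..<n}" using p by (auto simp: \<pi>_def)
  ultimately have "bij_betw \<pi> {..<n} {..<n}" by (simp add: bij_betw_def endo_inj_surj)
  then have \<pi>: "\<pi> permutes {..<n}" by (rule bij_imp_permutes) (simp add: \<pi>_def)
  then have C: "\<pi> \<in> column_stabilizer \<mu> t" using p by (simp add: column_stabilizer_iff \<pi>_def)
  have "tabloid_of \<mu> s i = tabloid_perm \<pi> (tabloid_of \<mu> t) i" for i
  proof -
    have "row s x = row t (Hilbert_Choice.inv \<pi> x)" if "x < n" for x
    proof -
      let ?y = "Hilbert_Choice.inv \<pi> x"
      have "?y < n" using that permutes_in_image[OF permutes_inv[OF \<pi>], of x] by simp
      then have "row s (\<pi> ?y) = row t ?y" using p[of ?y] by (simp add: \<pi>_def)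
      then show ?thesis by (simp add: permutes_inverses(1)[OF \<pi>])
    qed
    moreover have "tabloid_of \<mu> s i = {x. x < n \<and> row s x = i}"
    proof -
      interpret young \<mu> K by (rule young_axioms)
      have "\<exists>j. (i, j) \<in> Y \<and> x = s (i, j)" if "x < n" "row s x = i" for x
        using s that f_the_inv_into_f[of s Y x] the_inv_into_into[of s Y x Y]
        by (auto simp: tableau_def bij_betw_def row_def intro!: exI[of _ "snd (the_inv_into Y s x)"])
      moreover have "s (i, j) < n \<and> row s (s (i, j)) = i" if "(i, j) \<in> Y" for j
        using s that the_inv_into_f_f[of s Y "(i, j)"] by (auto simp: tableau_def bij_betw_def row_def)
      ultimately show ?thesis unfolding tabloid_of_def by auto
    qed
    ultimately show ?thesis unfolding tabloid_perm_of[OF \<pi>] by auto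
  qed
  then show ?thesis using C by blast
qed

end

lemma tabloid_perm_transpose:
  assumes s: "tableau \<mu> s" and "x < n" "y < n" "row s x = row s y"
  shows "tabloid_perm (Transposition.transpose x y) (tabloid_of \<mu> s) = tabloid_of \<mu> s"
proof
  fix i
  let ?T = "Transposition.transpose x y"
  have "?T z < n \<and> row s (?T z) = i \<longleftrightarrow> z < n \<and> row s z = i" for z
    using assms by (auto simp: Transposition.transpose_def)
  moreover have "?T ` A = {z. ?T z \<in> A}" for A
  proof (intro equalityI subsetI)
    fix z assume "z \<in> {z. ?T z \<in> A}"
    then show "z \<in> ?T ` A" by (intro image_eqI[of _ _ "?T z"]) simp_all
  next
    fix z assume "z \<in> ?T ` A"
    then obtain a where "a \<in> A" "z = ?T a" by blast
    then show "z \<in> {z. ?T z \<in> A}" by simp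
  qed
  ultimately show "tabloid_perm ?T (tabloid_of \<mu> s) i = tabloid_of \<mu> s i"
    unfolding tabloid_perm_def tabloid_of_eq[OF s] by simp
qed

text \<open>Either the tabloid of \<open>s\<close> is a column rearrangement of that of
  \<open>t\<close>, and \<open>kappa t\<close> absorbs the rearrangement up to sign, or two entries
  of one column of \<open>t\<close> share a row of \<open>s\<close>, and their transposition forces
  zero. Tableaux of the same shape have the same sum of row indices, so there is no third
  case.\<close>

lemma kappa_tabloid:
  assumes t: "tableau \<mu> t" and s: "tableau \<mu> s"
  shows "tact (kappa t) (symbol (tabloid_of \<mu> s)) =
    scale (Poly_Mapping.lookup (e t) (tabloid_of \<mu> s)) (e t)"
proof (cases "\<exists>\<pi>\<in>column_stabilizer \<mu> t. tabloid_of \<mu> s = tabloid_perm \<pi> (tabloid_of \<mu> t)")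
  case True
  then obtain \<pi> where \<pi>: "\<pi> \<in> column_stabilizer \<mu> t" "tabloid_of \<mu> s = tabloid_perm \<pi> (tabloid_of \<mu> t)" by blast
  have "tact (kappa t) (symbol (tabloid_of \<mu> s)) = tact (gmult (kappa t) (symbol \<pi>)) (symbol (tabloid_of \<mu> t))"
    unfolding \<pi>(2) by (simp add: tact_gmult tact_symbol)
  then show ?thesis
    using \<pi> t by (simp add: kappa_mult bilinear_ext_scale e_eq[symmetric] lookup_e_stabilizer)
next
  case False
  have pot: "(\<Sum>x<n. row u x) = (\<Sum>z\<in>Y. fst z)" if "tableau \<mu> u" for u
  proof -
    have "(\<Sum>x<n. row u x) = (\<Sum>z\<in>Y. row u (u z))"
      using sum.reindex_bij_betw[of u Y "{..<n}" "row u"] that by (simp add: tableau_def)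
    also have "\<dots> = (\<Sum>z\<in>Y. fst z)"
      using row_col_t[OF that] by (intro sum.cong) auto
    finally show ?thesis .
  qed
  have "\<not> (\<forall>x y. x < n \<longrightarrow> y < n \<longrightarrow> x \<noteq> y \<longrightarrow> col t x = col t y \<longrightarrow> row s x \<noteq> row s y)"
    using collision_free_stabilizer[OF t s] pot[OF t] pot[OF s] False by auto
  then obtain x y where xy: "x < n" "y < n" "x \<noteq> y" "col t x = col t y" "row s x = row s y" by blast
  have "tact (signed_sum (column_stabilizer \<mu> t)) (symbol (tabloid_of \<mu> s)) = (0 :: tabloid \<Rightarrow>\<^sub>0 'k)"
  proof (rule tact_signed_sum_eq_zero[OF two _ xy(3) refl])
    show "permutation \<sigma>" if "\<sigma> \<in> column_stabilizer \<mu> t" for \<sigma> using column_stabilizer_permutation[OF t that] .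
    show "(\<lambda>s. s \<circ> Transposition.transpose x y) ` column_stabilizer \<mu> t = column_stabilizer \<mu> t"
      using xy by (intro image_comp_column_stabilizer[OF t] transpose_in_column_stabilizer[OF t])
    show "tabloid_perm (Transposition.transpose x y) (tabloid_of \<mu> s) = tabloid_of \<mu> s"
      using xy by (intro tabloid_perm_transpose[OF s])
  qed
  moreover have "Poly_Mapping.lookup (e t) (tabloid_of \<mu> s) = 0"
    using False by (intro lookup_e_eq_zero[OF t]) metis
  ultimately show ?thesis by (simp add: kappa_def)
qed

lemma tabloid_of_comp: "tabloid_of \<mu> (\<sigma> \<circ> t) = tabloid_perm \<sigma> (tabloid_of \<mu> t)"
  by (simp add: tabloid_of_def tabloid_perm_def image_comp)

lemma tableau_comp: "tableau \<mu> t \<Longrightarrow> \<sigma> permutes {..<n} \<Longrightarrow> tableau \<mu> (\<sigma> \<circ> t)"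
  using permutes_imp_bij[of \<sigma> "{..<n}"] by (auto simp: tableau_def intro: bij_betw_trans)

text \<open>Conjugation by \<sigma> carries the column stabilizer of \<open>t\<close> to that of
  \<open>\<sigma> \<circ> t\<close> and preserves signs.\<close>

lemma act_e:
  assumes t: "tableau \<mu> t" and \<sigma>: "\<sigma> permutes {..<n}"
  shows "tact (symbol \<sigma>) (e t) = e (\<sigma> \<circ> t)"
proof -
  let ?C = "column_stabilizer \<mu> t" and ?c = "\<lambda>\<pi>. \<sigma> \<circ> \<pi> \<circ> Hilbert_Choice.inv \<sigma>"
  note inv = permutes_inverses[OF \<sigma>]
  have perm: "permutation \<sigma>" "permutation (Hilbert_Choice.inv \<sigma>)"
    using \<sigma> permutes_inv[OF \<sigma>] permutes_permutation[of _ "{..<n}"] by auto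
  have sg: "sign (?c \<pi>) = sign \<pi>" if "\<pi> \<in> ?C" for \<pi>
    using column_stabilizer_permutation[OF t that] perm sign_cases[of \<sigma>]
    by (simp add: sign_comp permutation_compose sign_inverse) 
  have C: "column_stabilizer \<mu> (\<sigma> \<circ> t) = ?c ` ?C"
  proof (intro equalityI subsetI)
    fix \<rho> assume "\<rho> \<in> column_stabilizer \<mu> (\<sigma> \<circ> t)"
    then have \<rho>: "\<rho> permutes {..<n}"
      "\<And>j. \<rho> ` \<sigma> ` t ` {(i, j') \<in> Y. j' = j} = \<sigma> ` t ` {(i, j') \<in> Y. j' = j}"
      by (auto simp: column_stabilizer_def image_comp comp_assoc)
    let ?p = "Hilbert_Choice.inv \<sigma> \<circ> \<rho> \<circ> \<sigma>"
    have "?p ` A = Hilbert_Choice.inv \<sigma> ` \<rho> ` \<sigma> ` A" for A by (simp add: image_comp comp_assoc)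
    moreover have "Hilbert_Choice.inv \<sigma> ` \<sigma> ` A = A" for A by (simp add: image_image inv)
    ultimately have "?p ` t ` {(i, j') \<in> Y. j' = j} = t ` {(i, j') \<in> Y. j' = j}" for j
      using \<rho>(2) by simp
    moreover have "?p permutes {..<n}"
      using permutes_compose[OF \<sigma> permutes_compose[OF \<rho>(1) permutes_inv[OF \<sigma>]]] by (simp add: comp_assoc)
    ultimately have "?p \<in> ?C" by (simp add: column_stabilizer_def)
    moreover have "\<rho> = ?c ?p" using inv by (auto simp: fun_eq_iff)
    ultimately show "\<rho> \<in> ?c ` ?C" by blast
  next
    fix \<rho> assume "\<rho> \<in> ?c ` ?C"
    then obtain \<pi> where \<pi>: "\<pi> \<in> ?C" "\<rho> = ?c \<pi>" by blast
    then have p: "\<pi> permutes {..<n}" "\<And>j. \<pi> ` t ` {(i, j') \<in> Y. j' = j} = t ` {(i, j') \<in> Y. j' = j}"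
      by (auto simp: column_stabilizer_def)
    have "?c \<pi> ` \<sigma> ` A = \<sigma> ` \<pi> ` A" for A by (simp add: image_image inv)
    then have "\<rho> ` (\<sigma> \<circ> t) ` {(i, j') \<in> Y. j' = j} = (\<sigma> \<circ> t) ` {(i, j') \<in> Y. j' = j}" for j
      unfolding \<pi>(2) image_comp[symmetric] by (metis p(2))
    moreover have "\<rho> permutes {..<n}" unfolding \<pi>(2)
      using permutes_compose[OF permutes_inv[OF \<sigma>] permutes_compose[OF p(1) \<sigma>]] .
    ultimately show "\<rho> \<in> column_stabilizer \<mu> (\<sigma> \<circ> t)" by (simp add: column_stabilizer_def)
  qed
  have inj: "inj_on ?c ?C"
  proof (rule inj_onI)
    fix \<pi> \<pi>' assume "?c \<pi> = ?c \<pi>'"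
    then have "Hilbert_Choice.inv \<sigma> (?c \<pi> (\<sigma> x)) = Hilbert_Choice.inv \<sigma> (?c \<pi>' (\<sigma> x))" for x by simp
    then show "\<pi> = \<pi>'" by (auto simp: inv fun_eq_iff)
  qed
  have "?c \<pi> \<circ> \<sigma> = \<sigma> \<circ> \<pi>" for \<pi> using inv by (auto simp: fun_eq_iff)
  then have tp: "tabloid_perm (?c \<pi>) (tabloid_perm \<sigma> T) = tabloid_perm \<sigma> (tabloid_perm \<pi> T)" for \<pi> T
    by (metis tabloid_perm_comp)
  show ?thesis
    unfolding e_def polytabloid_def C sum.reindex[OF inj] tabloid_of_comp bilinear_ext_sum
    by (intro sum.cong) (simp_all add: bilinear_ext_scale tact_symbol sg tp)
qed

lemma e_orbit:
  assumes t: "tableau \<mu> t" and s: "tableau \<mu> s"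
  obtains \<sigma> where "\<sigma> permutes {..<n}" "e s = tact (symbol \<sigma>) (e t)"
proof -
  define \<sigma> where "\<sigma> x = (if x < n then s (the_inv_into Y t x) else x)" for x
  have bt: "bij_betw t Y {..<n}" and bs: "bij_betw s Y {..<n}" using t s by (simp_all add: tableau_def)
  have "bij_betw (s \<circ> the_inv_into Y t) {..<n} {..<n}"
    using bij_betw_the_inv_into[OF bt] bs by (rule bij_betw_trans)
  then have "bij_betw \<sigma> {..<n} {..<n}" by (subst bij_betw_cong[of _ _ "s \<circ> the_inv_into Y t"]) (auto simp: \<sigma>_def)
  then have \<sigma>: "\<sigma> permutes {..<n}" by (rule bij_imp_permutes) (simp add: \<sigma>_def)
  \<comment> \<open>Equality with \<open>s\<close> is available only on the cells. Outside the Young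
    diagram the functions are arbitrary, which neither the tabloid nor the column stabilizer
    sees.\<close>
  have agree: "(\<sigma> \<circ> t) z = s z" if "z \<in> Y" for z
    using that bt the_inv_into_f_f[of t Y z] by (auto simp: \<sigma>_def bij_betw_def)
  have img: "(\<sigma> \<circ> t) ` A = s ` A" if "A \<subseteq> Y" for A using that agree by (intro image_cong) auto
  have "tabloid_of \<mu> (\<sigma> \<circ> t) = tabloid_of \<mu> s"
    unfolding tabloid_of_def by (rule ext, rule img) auto
  moreover have "(\<sigma> \<circ> t) ` {(i, j') \<in> Y. j' = j} = s ` {(i, j') \<in> Y. j' = j}" for j by (rule img) auto
  then have "column_stabilizer \<mu> (\<sigma> \<circ> t) = column_stabilizer \<mu> s"
    unfolding column_stabilizer_def by (simp only:)
  ultimately have "e (\<sigma> \<circ> t) = e s" by (simp add: e_def polytabloid_def)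
  then show ?thesis using that \<sigma> act_e[OF t \<sigma>] by metis
qed

end

section \<open>Colour classes, factorials and cyclic sums\<close>

lemma disjoint_blocks_map:
  assumes "distinct xs" "\<And>x. x \<in> set xs \<Longrightarrow> finite (f x)"
    and "\<And>x y. x \<in> set xs \<Longrightarrow> y \<in> set xs \<Longrightarrow> x \<noteq> y \<Longrightarrow> f x \<inter> f y = {}"
  shows "disjoint_blocks (map f xs)"
  using assms
proof (induction xs)
  case (Cons a xs)
  have "f a \<inter> f y = {}" if "y \<in> set xs" for y
    using Cons.prems(1) that by (intro Cons.prems(3)) auto
  then have "f a \<inter> \<Union>(set (map f xs)) = {}" by auto
  then show ?case using Cons by simp
qed simp

text \<open>A permutation that keeps colours maps each finite colour class injectively into itself,
  hence onto itself.\<close>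

lemma colour_stabilizer_eq:
  assumes "distinct cs" "f ` {..<n} \<subseteq> set cs"
  shows "{\<sigma>. \<sigma> permutes {..<n} \<and> (\<forall>x<n. f (\<sigma> x) = f x)} =
    block_stabilizer (map (\<lambda>c. {x. x < n \<and> f x = c}) cs)"
proof -
  let ?B = "\<lambda>c. {x. x < n \<and> f x = c}"
  have U: "\<Union>(set (map ?B cs)) = {..<n}" using assms(2) by auto
  have "(\<forall>x<n. f (\<sigma> x) = f x) \<longleftrightarrow> (\<forall>c\<in>set cs. \<sigma> ` ?B c = ?B c)" if \<sigma>: "\<sigma> permutes {..<n}" for \<sigma>
  proof
    have lt: "\<sigma> x < n \<longleftrightarrow> x < n" for x using permutes_in_image[OF \<sigma>, of x] by simp
    assume a: "\<forall>x<n. f (\<sigma> x) = f x"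
    have "\<sigma> ` ?B c = ?B c" for c
    proof (rule endo_inj_surj)
      show "finite (?B c)" by simp
      show "\<sigma> ` ?B c \<subseteq> ?B c" using a lt by auto
      show "inj_on \<sigma> (?B c)" using permutes_inj[OF \<sigma>] by (rule inj_on_subset) simp
    qed
    then show "\<forall>c\<in>set cs. \<sigma> ` ?B c = ?B c" by blast
  next
    assume a: "\<forall>c\<in>set cs. \<sigma> ` ?B c = ?B c"
    show "\<forall>x<n. f (\<sigma> x) = f x"
    proof (intro allI impI)
      fix x assume x: "x < n"
      then have "f x \<in> set cs" using assms(2) by auto
      then have "\<sigma> ` ?B (f x) = ?B (f x)" using a by blast
      moreover have "\<sigma> x \<in> \<sigma> ` ?B (f x)" using x by blast
      ultimately show "f (\<sigma> x) = f x" by blast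
    qed
  qed
  then show ?thesis unfolding block_stabilizer_def U
    by (intro Collect_cong conj_cong refl) (simp only: list.set_map ball_simps)
qed

lemma of_nat_fact_nonzero:
  assumes "CHAR('k::field) > 0 \<Longrightarrow> m < CHAR('k)"
  shows "of_nat (fact m) \<noteq> (0 :: 'k)"
proof
  assume "of_nat (fact m) = (0 :: 'k)"
  then have d: "CHAR('k) dvd fact m" by (simp add: of_nat_eq_0_iff_char_dvd)
  show False
  proof (cases "CHAR('k) = 0")
    case True
    then show ?thesis using d by simp
  next
    case False
    then have "prime CHAR('k)" by (simp add: prime_CHAR_semidom)
    then have "CHAR('k) \<le> m" using d by (simp add: prime_dvd_fact_iff)
    then show ?thesis using assms False by simp
  qed
qed

text \<open>
  The elements are split into \<open>p\<close> phases, permuted cyclically by \<open>z\<close>; all phases contribute equally.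
\<close>

lemma sum_cyclic_eq_zero:
  fixes f :: "'x \<Rightarrow> 'k::field"
  assumes "finite X" "0 < p" "of_nat p = (0::'k)" and z: "bij_betw z X X"
    and f: "\<And>x. x \<in> X \<Longrightarrow> f (z x) = f x"
    and phase: "\<And>x. x \<in> X \<Longrightarrow> phase x < p" "\<And>x. x \<in> X \<Longrightarrow> phase x = Suc (phase (z x)) mod p"
  shows "sum f X = 0"
proof -
  let ?X = "\<lambda>q. {x \<in> X. phase x = q}"
  have step: "sum f (?X q) = sum f (?X (Suc q mod p))" if q: "q < p" for q
  proof -
    have inj: "inj_on z (?X (Suc q mod p))" using z by (auto simp: bij_betw_def intro: inj_on_subset)
    have "z ` ?X (Suc q mod p) = ?X q"
    proof (intro equalityI subsetI)
      fix y assume "y \<in> z ` ?X (Suc q mod p)"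
      then obtain x where x: "x \<in> X" "phase x = Suc q mod p" "y = z x" by blast
      have y: "y \<in> X" using z x by (auto simp: bij_betw_def)
      have "Suc (phase y) mod p = Suc q mod p" using phase(2)[OF x(1)] x by simp
      then have "phase y = q" using phase(1)[OF y] q by (auto simp: mod_Suc split: if_splits)
      then show "y \<in> ?X q" using y by simp
    next
      fix y assume y: "y \<in> ?X q"
      then obtain x where x: "x \<in> X" "y = z x" using z by (auto simp: bij_betw_def)
      then have "phase x = Suc q mod p" using phase(2)[OF x(1)] y by simp
      then show "y \<in> z ` ?X (Suc q mod p)" using x by blast
    qed
    then have "sum f (?X q) = sum (f \<circ> z) (?X (Suc q mod p))" using sum.reindex[OF inj, of f] by simp
    also have "\<dots> = sum f (?X (Suc q mod p))" using f by (intro sum.cong) auto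
    finally show ?thesis .
  qed
  have const: "sum f (?X q) = sum f (?X 0)" if "q < p" for q
    using that
  proof (induction q)
    case (Suc q)
    then show ?case using step[of q] by simp
  qed simp
  have "X = (\<Union>q\<in>{..<p}. ?X q)" using phase(1) by blast
  then have "sum f X = sum f (\<Union>q\<in>{..<p}. ?X q)" by simp
  also have "\<dots> = (\<Sum>q<p. sum f (?X q))" using assms(1) by (intro sum.UNION_disjoint) auto
  also have "\<dots> = (\<Sum>q<p. sum f (?X 0))" by (rule sum.cong[OF refl], rule const) simp
  also have "\<dots> = 0" using assms(3) by simp
  finally show ?thesis .
qed

section \<open>The Specht module and its bilinear form\<close>

context young
begin

lemma specht_closed: "0 \<in> carrier S" "x \<in> carrier S \<Longrightarrow> y \<in> carrier S \<Longrightarrow> x + y \<in> carrier S"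
  "x \<in> carrier S \<Longrightarrow> scale c x \<in> carrier S" "tableau \<mu> t \<Longrightarrow> e t \<in> carrier S"
  unfolding S_carrier by (rule lin_span_closed; blast)+

lemma specht_induct [consumes 1, case_names zero add scale e]:
  assumes "v \<in> carrier S" "P 0" "\<And>p q. P p \<Longrightarrow> P q \<Longrightarrow> P (p + q)" "\<And>c p. P p \<Longrightarrow> P (scale c p)"
    and "\<And>t. tableau \<mu> t \<Longrightarrow> P (e t)"
  shows "P v"
  using assms(1) unfolding S_carrier by (induction rule: lin_span_induct) (use assms(2-5) in blast)+

lemma tact_specht_closed:
  assumes "a \<in> carrier (group_algebra n)" "v \<in> carrier S"
  shows "tact a v \<in> carrier S"
  using assms(1)[unfolded in_group_algebra]
proof (induction rule: free_induct)
  case (symbol \<sigma>)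
  show ?case using assms(2)
  proof (induction rule: specht_induct)
    case (e t)
    then show ?case using symbol act_e[OF e, of \<sigma>] specht_closed(4)[OF tableau_comp[OF e, of \<sigma>]] by simp
  qed (simp_all only: bilinear_ext_zero bilinear_ext_add bilinear_ext_scale specht_closed)
qed (simp_all only: bilinear_ext_zero bilinear_ext_add bilinear_ext_scale specht_closed)

lemma amodule_specht: "amodule (group_algebra n) S"
proof (intro amodule.intro amodule_axioms.intro)
  show "Module.module scalar_ring S"
  proof (rule moduleI)
    show "abelian_group S"
    proof (rule abelian_groupI)
      fix x assume "x \<in> carrier S"
      then have "scale (-1) x \<in> carrier S" by (rule specht_closed)
      moreover have "scale (-1) x + x = 0" by simp
      ultimately show "\<exists>y\<in>carrier S. y \<oplus>\<^bsub>S\<^esub> x = \<zero>\<^bsub>S\<^esub>" unfolding specht_simps(1,2) by blast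
    qed (simp_all only: specht_simps(1,2) specht_closed add.assoc add.commute add.left_commute add_0 add_0_right simp_thms)
  qed (simp_all only: specht_simps(2,3) specht_closed cring_scalar_ring scalar_ring_simps
      free.scale_left_distrib free.scale_right_distrib free.scale_scale free.scale_one)
qed (simp_all only: specht_simps(2-4) tact_specht_closed group_algebra_simps bilinear_ext_add
    bilinear_ext_scale tact_gmult)

sublocale S: amodule "group_algebra n" S
  by (rule amodule_specht)

lemma specht_generated:
  assumes t: "tableau \<mu> t" and W: "asubmodule (group_algebra n) S W" and "e t \<in> W"
  shows "W = carrier S"
proof -
  note W' = W[unfolded S.asubmodule_iff specht_simps(1-4)]
  have "e s \<in> W" if s: "tableau \<mu> s" for s
  proof -
    obtain \<sigma> where "\<sigma> permutes {..<n}" "e s = tact (symbol \<sigma>) (e t)" by (rule e_orbit[OF t s])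
    then show ?thesis using W' assms(3) symbol_in_group_algebra by metis
  qed
  note eW = this
  have "v \<in> W" if "v \<in> carrier S" for v
    using that
  proof (induction rule: specht_induct)
    case (e s)
    then show ?case by (rule eW)
  qed (use W' in blast)+
  moreover have "W \<subseteq> carrier S" using W by (auto simp: S.asubmodule_iff)
  ultimately show ?thesis by blast
qed

text \<open>The value <e_t, e_s> of the form for which the tabloids are orthonormal. By
  \<open>kappa_e\<close> it is also the factor with which \<open>kappa t\<close> sends
  \<open>e s\<close> to a multiple of \<open>e t\<close>.\<close>

definition pairing :: "(nat \<times> nat \<Rightarrow> nat) \<Rightarrow> (nat \<times> nat \<Rightarrow> nat) \<Rightarrow> 'k" where
  "pairing t s = (\<Sum>\<pi>\<in>column_stabilizer \<mu> s.
    of_int (sign \<pi>) * Poly_Mapping.lookup (e t) (tabloid_perm \<pi> (tabloid_of \<mu> s)))"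

lemma kappa_e:
  assumes t: "tableau \<mu> t" and s: "tableau \<mu> s"
  shows "tact (kappa t) (e s) = scale (pairing t s) (e t)"
proof -
  have "tact (kappa t) (symbol (tabloid_perm \<pi> (tabloid_of \<mu> s))) =
      scale (Poly_Mapping.lookup (e t) (tabloid_perm \<pi> (tabloid_of \<mu> s))) (e t)"
    if "\<pi> \<in> column_stabilizer \<mu> s" for \<pi>
  proof -
    have "tableau \<mu> (\<pi> \<circ> s)" using tableau_comp[OF s] that column_stabilizer_iff[OF s] by blast
    from kappa_tabloid[OF t this] show ?thesis unfolding tabloid_of_comp .
  qed
  then show ?thesis
    unfolding e_def[of s] polytabloid_def pairing_def bilinear_ext_sum free.scale_sum_left
    by (intro sum.cong) (simp_all add: bilinear_ext_scale)
qed

lemma kappa_specht: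
  assumes t: "tableau \<mu> t" and "v \<in> carrier S"
  shows "\<exists>c. tact (kappa t) v = scale c (e t)"
  using assms(2)
proof (induction rule: specht_induct)
  case zero
  show ?case by (intro exI[of _ 0]) simp
next
  case (add p q)
  then obtain c d where "tact (kappa t) p = scale c (e t)" "tact (kappa t) q = scale d (e t)" by blast
  then show ?case by (intro exI[of _ "c + d"]) (simp add: bilinear_ext_add free.scale_left_distrib)
next
  case (scale c p)
  then obtain d where "tact (kappa t) p = scale d (e t)" by blast
  then show ?case by (intro exI[of _ "c * d"]) (simp add: bilinear_ext_scale)
next
  case (e s)
  then show ?case using kappa_e[OF t] by blast
qed

text \<open>The image of \<open>kappa t\<close> on the Specht module consists of multiples of
  \<open>e t\<close>, and \<open>e t\<close> generates; the pairing ensures that the image is not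
  zero.\<close>

lemma local_specht:
  assumes t: "tableau \<mu> t" and s: "tableau \<mu> s" and "pairing t s \<noteq> 0"
  shows "local_module (group_algebra n) S (kappa t)"
proof (intro local_module.intro local_module_axioms.intro amodule_specht closed_algebra_group_algebra)
  show "kappa t \<in> carrier (group_algebra n)" by (rule kappa_in[OF t])
  have "tact (kappa t) (e s) \<noteq> 0" unfolding kappa_e[OF t s] using assms(3) e_nonzero[OF t] by simp
  then show "\<exists>v\<in>carrier S. act S (kappa t) v \<noteq> \<zero>\<^bsub>S\<^esub>"
    using specht_closed(4)[OF s] unfolding specht_simps(1,4) by blast
  fix v W assume v: "v \<in> carrier S" "act S (kappa t) v \<noteq> \<zero>\<^bsub>S\<^esub>" and W: "asubmodule (group_algebra n) S W"
    "act S (kappa t) v \<in> W"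
  obtain c where c: "tact (kappa t) v = scale c (e t)" using kappa_specht[OF t v(1)] by blast
  have "c \<noteq> 0" using v(2) c by auto
  have "scale (inverse c) (scale c (e t)) \<in> W"
    using W unfolding S.asubmodule_iff specht_simps(3,4) c by blast
  then have "e t \<in> W" using \<open>c \<noteq> 0\<close> by simp
  then show "W = carrier S" by (rule specht_generated[OF t W(1)])
qed

lemma tableau_exists: "\<exists>t. tableau \<mu> t"
  using finite_same_card_bij[of Y "{..<n}"] card_Y by (auto simp: tableau_def)

section \<open>Regular partitions: a nonzero pairing\<close>

text \<open>James' choice of a second tableau: reversing each row keeps the tabloid but changes the
  columns, so that few terms of the pairing survive.\<close>

definition reversed :: "(nat \<times> nat \<Rightarrow> nat) \<Rightarrow> (nat \<times> nat \<Rightarrow> nat)" where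
  "reversed t = (\<lambda>(i, j). t (i, \<mu> ! i - Suc j))"

lemma
  assumes t: "tableau \<mu> t"
  shows tableau_reversed: "tableau \<mu> (reversed t)"
    and row_reversed: "x < n \<Longrightarrow> row (reversed t) x = row t x"
    and col_reversed: "x < n \<Longrightarrow> col (reversed t) x + col t x + 1 = \<mu> ! row t x"
proof -
  let ?r = "\<lambda>(i, j). (i, \<mu> ! i - Suc j)"
  have r: "bij_betw ?r Y Y"
    by (rule bij_betw_byWitness[where f' = ?r]) (auto simp: in_Y)
  have eq: "reversed t = t \<circ> ?r" by (auto simp: reversed_def fun_eq_iff)
  show s: "tableau \<mu> (reversed t)"
    unfolding tableau_def eq using r t by (auto simp: tableau_def intro: bij_betw_trans)
  fix x assume x: "x < n"
  note c = cell[OF t x] cell[OF s x]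
  let ?i = "row (reversed t) x" and ?j = "col (reversed t) x"
  have Y: "(?i, \<mu> ! ?i - Suc ?j) \<in> Y" using c(3) by (auto simp: in_Y)
  have x_eq: "x = t (?i, \<mu> ! ?i - Suc ?j)" using c(4) by (simp add: reversed_def)
  show row: "row (reversed t) x = row t x" using row_col_t[OF t Y] x_eq by simp
  have "col t x = \<mu> ! ?i - Suc ?j" using row_col_t[OF t Y] x_eq by simp
  then show "col (reversed t) x + col t x + 1 = \<mu> ! row t x" using c(3) row by (auto simp: in_Y)
qed

text \<open>For the row length \<open>m\<close>, the column \<open>c\<close> and the reversed column
  \<open>d\<close> of an entry, \<open>m = c + d + 1\<close>. Since \<open>p\<close> preserves
  \<open>c\<close>, \<open>q\<close> preserves \<open>d\<close>, and the inverses send each entry to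
  the same row, rearranging sums shows that the inner product of \<open>m\<close> with its translate
  by \<open>p\<close> equals the squared norm of \<open>m\<close>. This is equality in the
  Cauchy-Schwarz inequality, so \<open>p\<close> preserves \<open>m\<close> and therefore
  \<open>d\<close>, and both permutations lie in the column stabilizer of the reversed
  tableau.\<close>

lemma reversed_stabilizers:
  assumes t: "tableau \<mu> t"
    and p: "p \<in> column_stabilizer \<mu> t" and q: "q \<in> column_stabilizer \<mu> (reversed t)"
    and eq: "tabloid_perm p (tabloid_of \<mu> t) = tabloid_perm q (tabloid_of \<mu> t)"
  shows "p = q"
proof -
  note s = tableau_reversed[OF t]
  let ?p = "Hilbert_Choice.inv p" and ?q = "Hilbert_Choice.inv q"
  have pp: "p permutes {..<n}" "q permutes {..<n}"
    using p q column_stabilizer_iff[OF t] column_stabilizer_iff[OF s] by blast+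
  note ip = permutes_inv[OF pp(1)] permutes_inv[OF pp(2)]
  have lt: "?p x < n" "?q x < n" if "x < n" for x
    using that permutes_in_image[OF ip(1), of x] permutes_in_image[OF ip(2), of x] by simp_all
  have rows: "row t (?p x) = row t (?q x)" if "x < n" for x
  proof -
    have "x \<in> tabloid_perm p (tabloid_of \<mu> t) (row t (?p x))"
      unfolding tabloid_perm_of[OF t pp(1)] using that by simp
    then show ?thesis unfolding eq tabloid_perm_of[OF t pp(2)] by simp
  qed
  define m where "m x = int (\<mu> ! row t x)" for x
  define c where "c x = int (col t x)" for x
  define d where "d x = int (col (reversed t) x)" for x
  have m_eq: "m x = c x + d x + 1" if "x < n" for x
    using col_reversed[OF t that] unfolding m_def c_def d_def by linarith
  have c_inv: "c (?p x) = c x" if "x < n" for x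
    using column_stabilizer_inv[OF t p] that unfolding column_stabilizer_iff[OF t] c_def by simp
  have d_inv: "d (?q x) = d x" if "x < n" for x
    using column_stabilizer_inv[OF s q] that unfolding column_stabilizer_iff[OF s] d_def by simp
  have m_pq: "m (?q x) = m (?p x)" if "x < n" for x using rows[OF that] by (simp add: m_def)
  have re_p: "(\<Sum>x<n. f (?p x)) = (\<Sum>x<n. f x)" for f :: "nat \<Rightarrow> int"
    using sum.permute[OF ip(1), of f] by (simp add: comp_def)
  have re_q: "(\<Sum>x<n. f (?q x)) = (\<Sum>x<n. f x)" for f :: "nat \<Rightarrow> int"
    using sum.permute[OF ip(2), of f] by (simp add: comp_def)
  have "(\<Sum>x<n. m x * m (?p x)) = (\<Sum>x<n. c (?p x) * m (?p x) + d (?q x) * m (?q x) + m (?p x))"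
  proof (intro sum.cong refl)
    fix x assume "x \<in> {..<n}"
    then have "x < n" by simp
    then show "m x * m (?p x) = c (?p x) * m (?p x) + d (?q x) * m (?q x) + m (?p x)"
      unfolding c_inv[OF \<open>x < n\<close>] d_inv[OF \<open>x < n\<close>] m_pq[OF \<open>x < n\<close>] m_eq[OF \<open>x < n\<close>]
      by (simp only: distrib_right mult_1)
  qed
  also have "\<dots> = (\<Sum>x<n. c x * m x) + (\<Sum>x<n. d x * m x) + (\<Sum>x<n. m x)"
    unfolding sum.distrib using re_p[of "\<lambda>x. c x * m x"] re_q[of "\<lambda>x. d x * m x"] re_p[of m] by simp
  also have "\<dots> = (\<Sum>x<n. (c x + d x + 1) * m x)" by (simp add: sum.distrib algebra_simps)
  also have "\<dots> = (\<Sum>x<n. m x * m x)" by (intro sum.cong) (simp_all add: m_eq)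
  finally have cross: "(\<Sum>x<n. m x * m (?p x)) = (\<Sum>x<n. m x * m x)" .
  have "(\<Sum>x<n. (m x - m (?p x))\<^sup>2) =
      (\<Sum>x<n. m x * m x) - 2 * (\<Sum>x<n. m x * m (?p x)) + (\<Sum>x<n. m (?p x) * m (?p x))"
    by (simp add: power2_eq_square algebra_simps sum.distrib sum_subtractf sum_distrib_left)
  also have "\<dots> = 0" unfolding cross using re_p[of "\<lambda>x. m x * m x"] by simp
  finally have "(\<Sum>x<n. (m x - m (?p x))\<^sup>2) = 0" .
  then have m_inv: "m (?p x) = m x" if "x < n" for x
    using that sum_nonneg_eq_0_iff[of "{..<n}" "\<lambda>x. (m x - m (?p x))\<^sup>2"] by simp
  have "d (?p x) = d x" if "x < n" for x
    using m_eq[OF that] m_eq[OF lt(1)[OF that]] m_inv[OF that] c_inv[OF that] by linarith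
  then have "?p \<in> column_stabilizer \<mu> (reversed t)"
    unfolding column_stabilizer_iff[OF s] using ip(1) by (simp add: d_def)
  then have ps: "p \<in> column_stabilizer \<mu> (reversed t)"
    using column_stabilizer_inv[OF s] permutes_inv_inv[OF pp(1)] by metis
  have "tabloid_of \<mu> (reversed t) i = tabloid_of \<mu> t i" for i
    unfolding tabloid_of_eq[OF t] tabloid_of_eq[OF s] using row_reversed[OF t] by auto
  then have "tabloid_of \<mu> (reversed t) = tabloid_of \<mu> t" by (rule ext)
  then show ?thesis using stabilizer_tabloid_inj[OF s ps q] eq by simp
qed

lemma count_list_row_lengths: "card {i. i < length \<mu> \<and> \<mu> ! i = l} = count_list \<mu> l"
  by (simp add: count_list_eq_length_filter length_filter_conv_card eq_commute)

text \<open>Only permutations in both column stabilizers contribute, each with 1, so the pairing is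
  the order of the intersection. This is the Young subgroup of the colouring by column and row
  length. A class has at most one entry in each row of its length, hence fewer entries than a
  positive characteristic, and its factorial is invertible.\<close>

lemma pairing_reversed_nonzero:
  assumes t: "tableau \<mu> t" and reg: "\<And>l. CHAR('k) > 0 \<Longrightarrow> l \<in> set \<mu> \<Longrightarrow> count_list \<mu> l < CHAR('k)"
  shows "pairing t (reversed t) \<noteq> 0"
proof -
  note s = tableau_reversed[OF t]
  let ?Ct = "column_stabilizer \<mu> t" and ?Cs = "column_stabilizer \<mu> (reversed t)"
  have tab: "tabloid_of \<mu> (reversed t) = tabloid_of \<mu> t"
    unfolding fun_eq_iff tabloid_of_eq[OF t] tabloid_of_eq[OF s] using row_reversed[OF t] by auto
  have summand: "of_int (sign q) * Poly_Mapping.lookup (e t) (tabloid_perm q (tabloid_of \<mu> t)) =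
      (if q \<in> ?Ct then 1 else 0)" if q: "q \<in> ?Cs" for q
  proof (cases "q \<in> ?Ct")
    case True
    then show ?thesis by (simp add: lookup_e_stabilizer[OF t])
  next
    case False
    then have "Poly_Mapping.lookup (e t) (tabloid_perm q (tabloid_of \<mu> t)) = 0"
      using reversed_stabilizers[OF t _ q] by (intro lookup_e_eq_zero[OF t]) blast
    then show ?thesis using False by simp
  qed
  have "pairing t (reversed t) = (\<Sum>q\<in>?Cs. if q \<in> ?Ct then 1 else 0)"
    unfolding pairing_def tab using summand by (intro sum.cong) simp_all
  also have "\<dots> = of_nat (card (?Cs \<inter> ?Ct))"
    using finite_column_stabilizer[OF s] by (simp add: sum.If_cases Int_def)
  finally have pairing: "pairing t (reversed t) = of_nat (card (?Cs \<inter> ?Ct))" .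
  let ?f = "\<lambda>x. (col t x, \<mu> ! row t x)"
  have "?Cs \<inter> ?Ct = {\<sigma>. \<sigma> permutes {..<n} \<and> (\<forall>x<n. ?f (\<sigma> x) = ?f x)}"
  proof (intro equalityI subsetI)
    fix \<sigma> assume "\<sigma> \<in> ?Cs \<inter> ?Ct"
    then have \<sigma>: "\<sigma> permutes {..<n}" "\<And>x. x < n \<Longrightarrow> col t (\<sigma> x) = col t x"
      "\<And>x. x < n \<Longrightarrow> col (reversed t) (\<sigma> x) = col (reversed t) x"
      unfolding Int_iff column_stabilizer_iff[OF t] column_stabilizer_iff[OF s] by simp_all
    have "\<mu> ! row t (\<sigma> x) = \<mu> ! row t x" if "x < n" for x
      using col_reversed[OF t, of x] col_reversed[OF t, of "\<sigma> x"] \<sigma>(2,3)[OF that] that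
        permutes_in_image[OF \<sigma>(1), of x] by simp
    then show "\<sigma> \<in> {\<sigma>. \<sigma> permutes {..<n} \<and> (\<forall>x<n. ?f (\<sigma> x) = ?f x)}" using \<sigma> by simp
  next
    fix \<sigma> assume "\<sigma> \<in> {\<sigma>. \<sigma> permutes {..<n} \<and> (\<forall>x<n. ?f (\<sigma> x) = ?f x)}"
    then have \<sigma>: "\<sigma> permutes {..<n}" "\<And>x. x < n \<Longrightarrow> col t (\<sigma> x) = col t x"
      "\<And>x. x < n \<Longrightarrow> \<mu> ! row t (\<sigma> x) = \<mu> ! row t x" by simp_all
    have "col (reversed t) (\<sigma> x) = col (reversed t) x" if "x < n" for x
      using col_reversed[OF t, of x] col_reversed[OF t, of "\<sigma> x"] \<sigma>(2,3)[OF that] that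
        permutes_in_image[OF \<sigma>(1), of x] by simp
    then show "\<sigma> \<in> ?Cs \<inter> ?Ct"
      unfolding column_stabilizer_iff[OF t] column_stabilizer_iff[OF s] Int_iff using \<sigma> by blast
  qed
  moreover obtain cs where cs: "distinct cs" "set cs = ?f ` {..<n}"
    using finite_distinct_list[of "?f ` {..<n}"] by auto
  let ?B = "\<lambda>c. {x. x < n \<and> ?f x = c}"
  have blocks: "disjoint_blocks (map ?B cs)" using cs(1) by (intro disjoint_blocks_map) auto
  have fact: "of_nat (fact (card (?B c))) \<noteq> (0 :: 'k)" if c: "c \<in> set cs" for c
  proof (rule of_nat_fact_nonzero)
    assume ch: "CHAR('k) > 0"
    obtain x where x: "x < n" "c = ?f x" using c cs(2) by auto
    let ?l = "\<mu> ! row t x"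
    have "?l \<in> set \<mu>" using cell(1)[OF t x(1)] by (simp add: in_Y)
    have "inj_on (row t) (?B c)"
      by (rule inj_onI) (use row_col_inj[OF t] in auto)
    moreover have "row t ` ?B c \<subseteq> {i. i < length \<mu> \<and> \<mu> ! i = ?l}"
      using cell(1)[OF t] x(2) by (auto simp: in_Y)
    ultimately have "card (?B c) \<le> card {i. i < length \<mu> \<and> \<mu> ! i = ?l}"
      by (rule card_inj_on_le) simp
    also have "\<dots> < CHAR('k)" unfolding count_list_row_lengths by (rule reg[OF ch \<open>?l \<in> set \<mu>\<close>])
    finally show "card (?B c) < CHAR('k)" .
  qed
  have "of_nat (\<Prod>P\<leftarrow>map ?B ds. fact (card P)) \<noteq> (0 :: 'k)" if "set ds \<subseteq> set cs" for ds
    using that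
  proof (induction ds)
    case (Cons d ds)
    then show ?case using fact[of d] by simp
  qed simp
  then have "of_nat (card (block_stabilizer (map ?B cs))) \<noteq> (0 :: 'k)"
    unfolding card_block_stabilizer[OF blocks] by blast
  ultimately show ?thesis
    unfolding pairing using colour_stabilizer_eq[OF cs(1), of ?f n] cs(2) by simp
qed

end

section \<open>Partitions that are not regular: all pairings vanish\<close>

context young
begin

text \<open>Permuting rows of equal length by \<rho> moves every entry within its column and so
  defines a column permutation \<open>z\<close>. Its order divides the odd number \<open>p\<close>,
  so it is even.\<close>

lemma row_rotation:
  assumes u: "tableau \<mu> u" and \<rho>: "\<And>i. i < length \<mu> \<Longrightarrow> \<rho> i < length \<mu> \<and> \<mu> ! \<rho> i = \<mu> ! i"
    and p: "\<rho> ^^ p = id" "odd p"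
  obtains z where "z \<in> column_stabilizer \<mu> u" "sign z = 1"
    "\<forall>i j. (i, j) \<in> Y \<longrightarrow> z (u (i, j)) = u (\<rho> i, j)"
    "tabloid_perm z (tabloid_of \<mu> u) = tabloid_of \<mu> u \<circ> \<rho>"
proof -
  define z where "z x = (if x < n then u (\<rho> (row u x), col u x) else x)" for x
  have zx: "z x < n" "row u (z x) = \<rho> (row u x)" "col u (z x) = col u x" if x: "x < n" for x
  proof -
    have "(\<rho> (row u x), col u x) \<in> Y" using cell(1)[OF u x] \<rho> by (simp add: in_Y)
    from row_col_t[OF u this] show "z x < n" "row u (z x) = \<rho> (row u x)" "col u (z x) = col u x"
      using x by (simp_all add: z_def)
  qed
  have zq: "(z ^^ q) x < n \<and> row u ((z ^^ q) x) = (\<rho> ^^ q) (row u x) \<and> col u ((z ^^ q) x) = col u x"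
    if "x < n" for q x
    using that by (induction q) (simp_all add: zx)
  have zout: "(z ^^ q) x = x" if "\<not> x < n" for q x
    by (induction q) (use that in \<open>simp_all add: z_def\<close>)
  have zp: "z ^^ p = id"
  proof
    fix x
    show "(z ^^ p) x = id x"
    proof (cases "x < n")
      case True
      show ?thesis using zq[OF True, of p] row_col_inj[OF u, of "(z ^^ p) x" x] True p(1) by simp
    qed (simp add: zout)
  qed
  \<comment> \<open>The inverse of \<open>z\<close> is its power \<open>z ^^ q\<close>, which yields
    bijectivity without forming an inverse of \<rho>.\<close>
  obtain q where q: "p = Suc q" using p(2) by (cases p) auto
  have inv: "z ((z ^^ q) x) = x" "(z ^^ q) (z x) = x" for x
    using fun_cong[OF zp, of x] unfolding q by (simp_all add: funpow_swap1)
  have "\<exists>!x. z x = y" for y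
    using inv by metis
  then have perm: "z permutes {..<n}" unfolding permutes_def by (simp add: z_def)
  then have stab: "z \<in> column_stabilizer \<mu> u" using zx(3) by (simp add: column_stabilizer_iff[OF u])
  have pz: "permutation z" by (rule column_stabilizer_permutation[OF u stab])
  have "permutation (z ^^ r) \<and> sign (z ^^ r) = sign z ^ r" for r
    by (induction r) (simp_all only: funpow.simps power_0 power_Suc permutation_compose[OF pz]
      sign_compose[OF pz] sign_id permutation_id simp_thms)
  then have "sign z ^ p = 1" using zp by (metis sign_id)
  then have "sign z = 1" using p(2) sign_cases[of z] by (auto simp: minus_one_power_iff)
  moreover have "z (u (i, j)) = u (\<rho> i, j)" if "(i, j) \<in> Y" for i j
    using row_col_t[OF u that] by (simp add: z_def)
  moreover have "tabloid_perm z (tabloid_of \<mu> u) = tabloid_of \<mu> u \<circ> \<rho>"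
  proof
    fix i
    have "y \<in> z ` {x. x < n \<and> row u x = i}" if y: "y < n" "row u y = \<rho> i" for y
    proof (rule image_eqI)
      show "y = z ((z ^^ q) y)" by (simp add: inv)
      have "(\<rho> ^^ q) (\<rho> i) = i" using fun_cong[OF p(1), of i] unfolding q by (simp add: funpow_swap1)
      then show "(z ^^ q) y \<in> {x. x < n \<and> row u x = i}" using zq[OF y(1), of q] y(2) by simp
    qed
    then show "tabloid_perm z (tabloid_of \<mu> u) i = (tabloid_of \<mu> u \<circ> \<rho>) i"
      unfolding tabloid_perm_def comp_apply tabloid_of_eq[OF u] using zx by auto
  qed
  ultimately show thesis using stab that by blast
qed

text \<open>A cyclic rotation of \<open>p\<close> rows of equal length lifts to column permutations
  of both tableaux. Composition with the one for \<open>s\<close> leaves the summands of the pairing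
  unchanged and distributes them over \<open>p\<close> phases of equal sum, so the total is a
  multiple of \<open>p\<close>.\<close>

lemma pairing_eq_zero:
  assumes t: "tableau \<mu> t" and s: "tableau \<mu> s"
    and p_pos: "CHAR('k) > 0" and k: "k \<in> set \<mu>" "CHAR('k) \<le> count_list \<mu> k"
  shows "pairing t s = 0"
proof -
  define p where "p = CHAR('k)"
  have "prime p" using p_pos by (simp add: p_def prime_CHAR_semidom)
  moreover have "p \<noteq> 2" using two of_nat_CHAR[where 'a='k] unfolding p_def by (metis of_nat_numeral)
  \<comment> \<open>Oddness makes the lifted rotations even permutations, so no signs
    interfere.\<close>
  ultimately have odd: "odd p" using primes_dvd_imp_eq two_is_prime_nat by blast
  have p0: "0 < p" using p_pos by (simp add: p_def)
  have "k > 0" using k(1) nonzero by (metis gr0I)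
  have "card {..<p} \<le> card {i. i < length \<mu> \<and> \<mu> ! i = k}"
    using k(2) by (simp add: count_list_row_lengths p_def)
  then obtain h where h: "h ` {..<p} \<subseteq> {i. i < length \<mu> \<and> \<mu> ! i = k}" "inj_on h {..<p}"
    using card_le_inj[of "{..<p}" "{i. i < length \<mu> \<and> \<mu> ! i = k}"] by auto
  have hk: "h a < length \<mu>" "\<mu> ! h a = k" if "a < p" for a using h(1) that by auto
  define \<rho> where "\<rho> i = (if i \<in> h ` {..<p} then h (Suc (the_inv_into {..<p} h i) mod p) else i)" for i
  have \<rho>_h: "\<rho> (h a) = h (Suc a mod p)" if "a < p" for a
    using that the_inv_into_f_f[OF h(2), of a] by (simp add: \<rho>_def)
  have \<rho>_else: "\<rho> i = i" if "i \<notin> h ` {..<p}" for i using that by (simp add: \<rho>_def)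
  have \<rho>: "\<rho> i < length \<mu> \<and> \<mu> ! \<rho> i = \<mu> ! i" if "i < length \<mu>" for i
  proof (cases "i \<in> h ` {..<p}")
    case True
    then obtain a where "a < p" "i = h a" by blast
    then show ?thesis using hk[of a] hk[of "Suc a mod p"] p0 \<rho>_h by simp
  qed (simp add: \<rho>_else that)
  have iterate: "(\<rho> ^^ q) (h a) = h ((a + q) mod p)" if "a < p" for q a
    by (induction q) (use that p0 in \<open>simp_all add: \<rho>_h mod_Suc_eq\<close>)
  moreover have "(\<rho> ^^ q) i = i" if "i \<notin> h ` {..<p}" for i q
    by (induction q) (use that \<rho>_else in simp_all)
  ultimately have \<rho>p: "\<rho> ^^ p = id"
  proof (intro ext)
    fix i
    show "(\<rho> ^^ p) i = id i"
      using iterate[of _ p] \<open>\<And>i q. i \<notin> h ` {..<p} \<Longrightarrow> (\<rho> ^^ q) i = i\<close>[of i p] by (cases "i \<in> h ` {..<p}") auto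
  qed
  have surj: "surj \<rho>"
  proof (rule surjI)
    show "\<rho> ((\<rho> ^^ (p - 1)) i) = i" for i
      using fun_cong[OF \<rho>p, of i] p0 by (cases p) simp_all
  qed
  then have comp_inj: "X \<circ> \<rho> = T \<circ> \<rho> \<longleftrightarrow> X = T" for X T :: tabloid
    by (metis surj_fun_eq fun_eq_iff UNIV_I)
  obtain zt where zt: "zt \<in> column_stabilizer \<mu> t" "sign zt = 1"
    "tabloid_perm zt (tabloid_of \<mu> t) = tabloid_of \<mu> t \<circ> \<rho>"
    by (rule row_rotation[OF t \<rho> \<rho>p odd])
  obtain z where z: "z \<in> column_stabilizer \<mu> s" "sign z = 1"
    "\<forall>i j. (i, j) \<in> Y \<longrightarrow> z (s (i, j)) = s (\<rho> i, j)"
    "tabloid_perm z (tabloid_of \<mu> s) = tabloid_of \<mu> s \<circ> \<rho>"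
    by (rule row_rotation[OF s \<rho> \<rho>p odd])
  have shift: "tabloid_perm \<sigma> (T \<circ> \<rho>) = tabloid_perm \<sigma> T \<circ> \<rho>" for \<sigma> T
    by (simp add: tabloid_perm_def fun_eq_iff)
  have bij: "bij_betw (\<lambda>\<sigma>. \<sigma> \<circ> w) (column_stabilizer \<mu> u) (column_stabilizer \<mu> u)"
    if u: "tableau \<mu> u" and w: "w \<in> column_stabilizer \<mu> u" for u w
  proof -
    have "surj w" using column_stabilizer_permutation[OF u w] by (simp add: bij_is_surj permutation_bijective)
    then have "inj_on (\<lambda>\<sigma>. \<sigma> \<circ> w) (column_stabilizer \<mu> u)"
      by (intro inj_onI) (metis surj_fun_eq fun_eq_iff UNIV_I comp_apply)
    then show ?thesis using image_comp_column_stabilizer[OF u w] by (simp add: bij_betw_def)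
  qed
  have sgn: "sign (\<sigma> \<circ> w) = sign \<sigma>"
    if "tableau \<mu> u" "w \<in> column_stabilizer \<mu> u" "sign w = 1" "\<sigma> \<in> column_stabilizer \<mu> u" for u w \<sigma>
    using that column_stabilizer_permutation[OF that(1)] by (simp add: sign_compose)
  \<comment> \<open>Rotating the rows of a tabloid does not change its coefficient in
    \<open>e t\<close>: on the tabloid of \<open>t\<close> the rotation is realised by the even
    column permutation \<open>zt\<close>, which can be absorbed into the summation index.\<close>
  have lookup: "Poly_Mapping.lookup (e t) (T \<circ> \<rho>) = Poly_Mapping.lookup (e t) T" for T
  proof -
    have "Poly_Mapping.lookup (e t) (T \<circ> \<rho>) = (\<Sum>\<sigma>\<in>column_stabilizer \<mu> t. of_int (sign (\<sigma> \<circ> zt)) *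
        (if tabloid_perm (\<sigma> \<circ> zt) (tabloid_of \<mu> t) = T \<circ> \<rho> then 1 else 0))"
      unfolding lookup_e[OF t] by (rule sum.reindex_bij_betw[OF bij[OF t zt(1)], symmetric])
    also have "\<dots> = Poly_Mapping.lookup (e t) T"
      unfolding lookup_e[OF t] tabloid_perm_comp zt(3) shift comp_inj
      by (intro sum.cong refl) (simp add: sgn[OF t zt(1,2)])
    finally show ?thesis .
  qed
  \<comment> \<open>The entries of \<open>s\<close> in the first column of the \<open>p\<close>
    chosen rows; these cells exist because the rows have positive length.\<close>
  define a where "a q = s (h q, 0)" for q
  have Ya: "(h q, 0) \<in> Y" if "q < p" for q using hk[OF that] \<open>k > 0\<close> by (simp add: in_Y)
  have a_inj: "q = r" if "a q = a r" "q < p" "r < p" for q r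
  proof -
    have "row s (a q) = h q" "row s (a r) = h r"
      unfolding a_def using row_col_t[OF s Ya[OF that(2)]] row_col_t[OF s Ya[OF that(3)]] by blast+
    then have "h q = h r" using that(1) by argo
    then show ?thesis by (rule inj_onD[OF h(2)]) (simp_all only: lessThan_iff that)
  qed
  have za: "z (a q) = a (Suc q mod p)" if "q < p" for q
    using z(3) Ya[OF that] \<rho>_h[OF that] by (simp add: a_def)
  define A where "A = a ` {..<p}"
  \<comment> \<open>The phase of \<pi> marks the entry of \<open>A\<close> on which \<pi> is
    smallest. For injective \<pi> there is exactly one, and composing with the rotation
    \<open>z\<close> shifts it by one place.\<close>
  define phase where "phase \<pi> = (THE q. q < p \<and> \<pi> (a q) = Min (\<pi> ` A))" for \<pi> :: "nat \<Rightarrow> nat"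
  have phase_eq: "phase \<pi> = q" if "inj \<pi>" "q < p" "\<pi> (a q) = Min (\<pi> ` A)" for \<pi> q
    unfolding phase_def
  proof (rule the_equality)
    fix r assume r: "r < p \<and> \<pi> (a r) = Min (\<pi> ` A)"
    then have "\<pi> (a r) = \<pi> (a q)" using that(3) by argo
    then have "a r = a q" using that(1) by (simp only: inj_eq)
    then show "r = q" using a_inj[of r q] r that(2) by blast
  qed (use that in blast)
  have phase: "phase \<pi> < p \<and> \<pi> (a (phase \<pi>)) = Min (\<pi> ` A)" if "inj \<pi>" for \<pi>
  proof -
    have "Min (\<pi> ` A) \<in> \<pi> ` A" using p0 by (intro Min_in) (auto simp: A_def)
    then obtain q where "q < p" "\<pi> (a q) = Min (\<pi> ` A)" unfolding A_def by auto
    then show ?thesis using phase_eq[OF that] by blast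
  qed
  have injC: "inj \<sigma>" if "\<sigma> \<in> column_stabilizer \<mu> s" for \<sigma>
    using column_stabilizer_permutation[OF s that] by (simp add: bij_is_inj permutation_bijective)
  have zA: "z ` A = A"
  proof (rule endo_inj_surj)
    show "z ` A \<subseteq> A" unfolding A_def using za p0 by auto
    show "inj_on z A" using injC[OF z(1)] by (rule inj_on_subset) simp
  qed (simp add: A_def)
  show ?thesis unfolding pairing_def
  proof (rule sum_cyclic_eq_zero[where z = "\<lambda>\<pi>. \<pi> \<circ> z" and phase = phase])
    show "of_nat p = (0 :: 'k)" by (simp add: p_def)
    show "bij_betw (\<lambda>\<pi>. \<pi> \<circ> z) (column_stabilizer \<mu> s) (column_stabilizer \<mu> s)" by (rule bij[OF s z(1)])
  next
    fix \<pi> assume \<pi>: "\<pi> \<in> column_stabilizer \<mu> s"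
    show "of_int (sign (\<pi> \<circ> z)) * Poly_Mapping.lookup (e t) (tabloid_perm (\<pi> \<circ> z) (tabloid_of \<mu> s)) =
        of_int (sign \<pi>) * Poly_Mapping.lookup (e t) (tabloid_perm \<pi> (tabloid_of \<mu> s))"
      unfolding tabloid_perm_comp z(4) shift lookup sgn[OF s z(1,2) \<pi>] ..
    show "phase \<pi> < p" using phase[OF injC[OF \<pi>]] by blast
    have "inj (\<pi> \<circ> z)" using injC[OF \<pi>] injC[OF z(1)] by (rule inj_compose)
    note q = phase[OF this]
    have "(\<pi> \<circ> z) ` A = \<pi> ` A" unfolding image_comp[symmetric] zA ..
    then have "\<pi> (a (Suc (phase (\<pi> \<circ> z)) mod p)) = Min (\<pi> ` A)" using q za[of "phase (\<pi> \<circ> z)"] by simp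
    then show "phase \<pi> = Suc (phase (\<pi> \<circ> z)) mod p" using p0 by (intro phase_eq injC[OF \<pi>]) simp_all
  qed (simp_all only: p0 finite_column_stabilizer[OF s])
qed

end

section \<open>Heads of Specht modules\<close>

context local_module
begin

lemma head_carrier: "carrier (module_head A V) = (\<lambda>x. core A V e +>\<^bsub>V\<^esub> x) ` carrier V"
  unfolding module_head_def module_radical_eq
  by (rule module_quotient.carrier_quotient[OF module_quotientI[OF asubmodule_core]])

lemma head_act:
  "a \<in> carrier A \<Longrightarrow> v \<in> carrier V \<Longrightarrow>
    act (module_head A V) a (core A V e +>\<^bsub>V\<^esub> v) = core A V e +>\<^bsub>V\<^esub> act V a v"
  unfolding module_head_def module_radical_eq by (rule quotient_act[OF asubmodule_core])

lemma head_zero_iff: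
  "v \<in> carrier V \<Longrightarrow> core A V e +>\<^bsub>V\<^esub> v = \<zero>\<^bsub>module_head A V\<^esub> \<longleftrightarrow> v \<in> core A V e"
  unfolding module_head_def module_radical_eq
    module_quotient.zero_quotient[OF module_quotientI[OF asubmodule_core]]
  by (rule module_quotient.coset_eq_W_iff[OF module_quotientI[OF asubmodule_core]])

end

lemma young_regular:
  "\<mu> \<in> regular_partitions p \<Longrightarrow> (2::'k::field) \<noteq> 0 \<Longrightarrow> young TYPE('k) \<mu>"
  by (simp add: young_def regular_partitions_def)

context young
begin

text \<open>Polytabloids are combinations of tabloids, so a test on tabloids suffices.\<close>

lemma specht_tabloids:
  assumes "\<And>s. tableau \<mu> s \<Longrightarrow> tact a (symbol (tabloid_of \<mu> s)) = 0" and "v \<in> carrier S"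
  shows "tact a v = 0"
  using assms(2)
proof (induction rule: specht_induct)
  case (e t)
  have "tact a (symbol (tabloid_perm \<sigma> (tabloid_of \<mu> t))) = 0" if "\<sigma> \<in> column_stabilizer \<mu> t" for \<sigma>
    unfolding tabloid_of_comp[symmetric]
    using that column_stabilizer_iff[OF e] by (intro assms(1) tableau_comp[OF e]) blast
  then show ?case unfolding e_def polytabloid_def bilinear_ext_sum
    by (intro sum.neutral) (simp add: bilinear_ext_scale)
qed (simp_all add: bilinear_ext_add bilinear_ext_scale)

lemma sum_row:
  assumes t: "tableau \<mu> t"
  shows "(\<Sum>x<n. row t x) = (\<Sum>c\<in>Y. fst c)"
proof -
  have "(\<Sum>c\<in>Y. row t (t c)) = (\<Sum>x<n. row t x)"
    using t by (intro sum.reindex_bij_betw) (simp add: tableau_def)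
  moreover have "(\<Sum>c\<in>Y. row t (t c)) = (\<Sum>c\<in>Y. fst c)"
    using row_col_t[OF t] by (intro sum.cong) auto
  ultimately show ?thesis by simp
qed

lemma local_regular:
  assumes "\<mu> \<in> regular_partitions CHAR('k)" and t: "tableau \<mu> t"
  shows "local_module (group_algebra n) S (kappa t)"
  using assms(1) by (intro local_specht[OF t tableau_reversed[OF t] pairing_reversed_nonzero[OF t]])
    (auto simp: regular_partitions_def)

lemma
  assumes "local_module (group_algebra n) S (kappa t)"
  shows simple_specht_head: "simple_amodule (group_algebra n) (module_head (group_algebra n) S)"
    and specht_head_unital: "x \<in> carrier (module_head (group_algebra n) S) \<Longrightarrow>
      act (module_head (group_algebra n) S) (symbol id) x = x"
proof -
  interpret L: local_module "group_algebra n" S "kappa t" by fact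
  show "simple_amodule (group_algebra n) (module_head (group_algebra n) S)" by (rule L.simple_head)
  assume "x \<in> carrier (module_head (group_algebra n) S)"
  then obtain v where v: "v \<in> carrier S" "x = core (group_algebra n) S (kappa t) +>\<^bsub>S\<^esub> v"
    unfolding L.head_carrier by blast
  have "act (module_head (group_algebra n) S) (symbol id) x =
      core (group_algebra n) S (kappa t) +>\<^bsub>S\<^esub> act S (symbol id) v"
    unfolding v(2) by (rule L.head_act) (simp_all only: symbol_in_group_algebra permutes_id v)
  then show "act (module_head (group_algebra n) S) (symbol id) x = x"
    unfolding v(2) specht_simps(4) tact_id .
qed

end

section \<open>Distinct regular partitions have non-isomorphic heads\<close>

text \<open>\<open>kappa t\<close> acts nontrivially on the head for \<mu>, hence through the
  isomorphism on the head for \<nu>, and so on some tabloid of shape \<nu>. A tabloid with two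
  entries of a column of \<open>t\<close> in the same row would be killed.\<close>

lemma collision_free_tableau:
  fixes \<mu> \<nu> :: "nat list"
  assumes M: "young TYPE('k::field) \<mu>" and N: "young TYPE('k) \<nu>" and n: "sum_list \<nu> = sum_list \<mu>"
    and reg: "\<mu> \<in> regular_partitions CHAR('k)" "\<nu> \<in> regular_partitions CHAR('k)"
    and iso: "amodule_iso (group_algebra (sum_list \<mu>))
      (module_head (group_algebra (sum_list \<mu>)) (specht_module \<mu> :: ('k, _, _) amodule))
      (module_head (group_algebra (sum_list \<mu>)) (specht_module \<nu>))"
    and t: "tableau \<mu> t"
  obtains s where "tableau \<nu> s"
    "\<And>x y. x < sum_list \<mu> \<Longrightarrow> y < sum_list \<mu> \<Longrightarrow> x \<noteq> y \<Longrightarrow> young.col \<mu> t x = young.col \<mu> t y \<Longrightarrow>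
      young.row \<nu> s x \<noteq> young.row \<nu> s y"
proof -
  interpret M: young \<mu> "TYPE('k)" by fact
  interpret N: young \<nu> "TYPE('k)" by fact
  let ?A = "group_algebra (sum_list \<mu>) :: ('k, _) module"
  obtain u where u: "tableau \<nu> u" using N.tableau_exists by blast
  interpret LM: local_module ?A "specht_module \<mu>" "M.kappa t" by (rule M.local_regular[OF reg(1) t])
  interpret LN: local_module ?A "specht_module \<nu>" "N.kappa u" using N.local_regular[OF reg(2) u] n by simp
  let ?HM = "module_head ?A (specht_module \<mu>)" and ?HN = "module_head ?A (specht_module \<nu>)"
  let ?k = "M.kappa t"
  have k: "?k \<in> carrier ?A" by (rule M.kappa_in[OF t])
  obtain f where f: "bij_betw f (carrier ?HM) (carrier ?HN)"
    "\<And>c v. v \<in> carrier ?HM \<Longrightarrow> f (c \<odot>\<^bsub>?HM\<^esub> v) = c \<odot>\<^bsub>?HN\<^esub> f v"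
    "\<And>a v. a \<in> carrier ?A \<Longrightarrow> v \<in> carrier ?HM \<Longrightarrow> f (act ?HM a v) = act ?HN a (f v)"
    using iso unfolding amodule_iso_def by blast
  have HM: "amodule ?A ?HM" and HN: "amodule ?A ?HN"
    using LM.simple_head LN.simple_head by (simp_all add: simple_amodule_def)
  have f_closed: "f v \<in> carrier ?HN" if "v \<in> carrier ?HM" for v using f(1) that by (auto simp: bij_betw_def)
  have f0: "f \<zero>\<^bsub>?HM\<^esub> = \<zero>\<^bsub>?HN\<^esub>" by (rule amodule_iso_zero[OF HM HN f(2) f_closed])
  have z: "\<zero>\<^bsub>?HM\<^esub> \<in> carrier ?HM" using HM by (simp add: amodule_def Module.module_def abelian_group_def abelian_monoid.zero_closed)
  obtain v where v: "v \<in> carrier (specht_module \<mu>)" "act (specht_module \<mu>) ?k v \<noteq> \<zero>\<^bsub>specht_module \<mu>\<^esub>"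
    using LM.nonzero by blast
  let ?v = "core ?A (specht_module \<mu>) ?k +>\<^bsub>specht_module \<mu>\<^esub> v"
  have vH: "?v \<in> carrier ?HM" unfolding LM.head_carrier using v(1) by blast
  have kv: "act ?HM ?k ?v \<noteq> \<zero>\<^bsub>?HM\<^esub>" unfolding LM.head_act[OF k v(1)]
    using LM.head_zero_iff[OF M.S.act_closed[OF k v(1)]] LM.act_e_not_in_core[OF v] by blast
  have kvH: "act ?HM ?k ?v \<in> carrier ?HM" using HM k vH by (simp add: amodule.act_closed)
  have fkv: "act ?HN ?k (f ?v) \<noteq> \<zero>\<^bsub>?HN\<^esub>"
    using kv f(1) kvH z unfolding f(3)[OF k vH, symmetric] f0[symmetric] by (auto simp: bij_betw_def dest: inj_onD)
  obtain w where w: "w \<in> carrier (specht_module \<nu>)"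
    "f ?v = core ?A (specht_module \<nu>) (N.kappa u) +>\<^bsub>specht_module \<nu>\<^esub> w"
    using f_closed[OF vH] unfolding LN.head_carrier by blast
  have "act (specht_module \<nu>) ?k w \<notin> core ?A (specht_module \<nu>) (N.kappa u)"
    using fkv unfolding w(2) LN.head_act[OF k w(1)] using LN.head_zero_iff[OF LN.act_closed[OF k w(1)]] by blast
  moreover have "0 \<in> core ?A (specht_module \<nu>) (N.kappa u)"
    using LN.asubmodule_core unfolding LN.asubmodule_iff specht_simps(1) by blast
  ultimately have "tact ?k w \<noteq> 0" by (metis specht_simps(4))
  then obtain s where s: "tableau \<nu> s" "tact ?k (symbol (tabloid_of \<nu> s)) \<noteq> 0"
    using N.specht_tabloids[OF _ w(1), of ?k] by blast
  show thesis
  proof (rule that[OF s(1)])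
    fix x y assume xy: "x < sum_list \<mu>" "y < sum_list \<mu>" "x \<noteq> y" "M.col t x = M.col t y"
    show "N.row s x \<noteq> N.row s y"
    proof
      assume row: "N.row s x = N.row s y"
      have "tact (M.kappa t) (symbol (tabloid_of \<nu> s)) = (0 :: tabloid \<Rightarrow>\<^sub>0 'k)" unfolding M.kappa_def
      proof (rule tact_signed_sum_eq_zero[OF M.two M.column_stabilizer_permutation[OF t] xy(3) refl])
        show "(\<lambda>p. p \<circ> Transposition.transpose x y) ` column_stabilizer \<mu> t = column_stabilizer \<mu> t"
          by (rule M.image_comp_column_stabilizer[OF t M.transpose_in_column_stabilizer[OF t xy(1,2,4)]])
        show "tabloid_perm (Transposition.transpose x y) (tabloid_of \<nu> s) = tabloid_of \<nu> s"
          using xy n by (intro N.tabloid_perm_transpose[OF s(1) _ _ row]) simp_all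
      qed
      then show False using s(2) by simp
    qed
  qed
qed

text \<open>The sum of row indices over all entries takes the role of the dominance order. A
  collision-free tableau bounds its value for \<mu> by that for \<nu>, the inverse isomorphism gives
  the reverse bound, and equality forces equal row lengths.\<close>

lemma specht_head_inject:
  fixes \<mu> \<nu> :: "nat list"
  assumes two: "(2::'k::field) \<noteq> 0" and n: "sum_list \<nu> = sum_list \<mu>"
    and reg: "\<mu> \<in> regular_partitions CHAR('k)" "\<nu> \<in> regular_partitions CHAR('k)"
    and iso: "amodule_iso (group_algebra (sum_list \<mu>))
      (module_head (group_algebra (sum_list \<mu>)) (specht_module \<mu> :: ('k, _, _) amodule))
      (module_head (group_algebra (sum_list \<mu>)) (specht_module \<nu>))"
  shows "\<mu> = \<nu>"
proof -
  interpret M: young \<mu> "TYPE('k)" by (rule young_regular[OF reg(1) two])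
  interpret N: young \<nu> "TYPE('k)" by (rule young_regular[OF reg(2) two])
  obtain t where t: "tableau \<mu> t" using M.tableau_exists by blast
  obtain u where u: "tableau \<nu> u" using N.tableau_exists by blast
  have HM: "amodule (group_algebra (sum_list \<mu>)) (module_head (group_algebra (sum_list \<mu>)) (specht_module \<mu> :: ('k, _, _) amodule))"
    using M.simple_specht_head[OF M.local_regular[OF reg(1) t]] by (simp add: simple_amodule_def)
  obtain s where s: "tableau \<nu> s"
    "\<And>x y. x < sum_list \<mu> \<Longrightarrow> y < sum_list \<mu> \<Longrightarrow> x \<noteq> y \<Longrightarrow> M.col t x = M.col t y \<Longrightarrow> N.row s x \<noteq> N.row s y"
    using collision_free_tableau[OF M.young_axioms N.young_axioms n reg iso t] by metis
  have iso': "amodule_iso (group_algebra (sum_list \<nu>))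
      (module_head (group_algebra (sum_list \<nu>)) (specht_module \<nu> :: ('k, _, _) amodule))
      (module_head (group_algebra (sum_list \<nu>)) (specht_module \<mu>))"
    unfolding n by (rule amodule_iso_sym[OF HM iso])
  obtain r where r: "tableau \<mu> r"
    "\<And>x y. x < sum_list \<nu> \<Longrightarrow> y < sum_list \<nu> \<Longrightarrow> x \<noteq> y \<Longrightarrow> N.col u x = N.col u y \<Longrightarrow> M.row r x \<noteq> M.row r y"
    using collision_free_tableau[OF N.young_axioms M.young_axioms n[symmetric] reg(2,1) iso' u] by metis
  have "(\<Sum>x<sum_list \<mu>. M.row t x) \<le> (\<Sum>x<sum_list \<mu>. N.row s x)"
    by (rule M.row_potential_le[OF t]) (rule s(2))
  moreover have "(\<Sum>x<sum_list \<nu>. N.row u x) \<le> (\<Sum>x<sum_list \<nu>. M.row r x)"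
    by (rule N.row_potential_le[OF u]) (rule r(2))
  ultimately have eq: "(\<Sum>x<sum_list \<mu>. N.row s x) = (\<Sum>x<sum_list \<mu>. M.row t x)"
    using M.sum_row[OF t] M.sum_row[OF r(1)] N.sum_row[OF u] N.sum_row[OF s(1)] n by simp
  have "card {x. x < sum_list \<mu> \<and> N.row s x = i} = card {j. (i, j) \<in> young_diagram \<mu>}" for i
    by (rule M.row_card_potential[OF t _ eq]) (rule s(2))
  then have card: "card {j. (i, j) \<in> young_diagram \<mu>} = card {j. (i, j) \<in> young_diagram \<nu>}" for i
    using N.row_card[OF s(1), of i] n by simp
  have len: "card {j. (i, j) \<in> young_diagram \<rho>} = (if i < length \<rho> then \<rho> ! i else 0)" for i \<rho>
    by (simp add: young_diagram_def)
  \<comment> \<open>Parts are positive, so the row lengths, read as 0 beyond the end, determine the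
    number of parts.\<close>
  have "i < length \<mu> \<longleftrightarrow> i < length \<nu>" for i
    using card[of i] M.nonzero N.nonzero unfolding len by (metis nth_mem)
  then have "length \<mu> = length \<nu>" by (metis linorder_neqE_nat less_irrefl)
  then show ?thesis
  proof (rule nth_equalityI)
    fix i assume "i < length \<mu>"
    then show "\<mu> ! i = \<nu> ! i" using card[of i] \<open>length \<mu> = length \<nu>\<close> unfolding len by simp
  qed
qed

section \<open>Tableaux with prescribed columns\<close>

lemma disjoint_blocks_nth:
  "disjoint_blocks Ps \<Longrightarrow> i < j \<Longrightarrow> j < length Ps \<Longrightarrow> Ps ! i \<inter> Ps ! j = {}"
proof (induction Ps arbitrary: i j)
  case (Cons P Ps)
  show ?case
  proof (cases i)
    case 0
    obtain j' where j: "j = Suc j'" "j' < length Ps" using Cons.prems 0 by (cases j) auto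
    then have "Ps ! j' \<subseteq> \<Union>(set Ps)" using nth_mem[OF j(2)] by blast
    then show ?thesis using Cons.prems(1) 0 j by auto
  next
    case (Suc i')
    then show ?thesis using Cons by (cases j) auto
  qed
qed simp

lemma disjoint_blocks_finite: "disjoint_blocks Ps \<Longrightarrow> P \<in> set Ps \<Longrightarrow> finite P"
  by (induction Ps) auto

lemma down_closed_eq_lessThan:
  fixes D :: "nat set"
  assumes "finite D" "\<And>i j. i \<in> D \<Longrightarrow> j \<le> i \<Longrightarrow> j \<in> D"
  shows "D = {..<card D}"
proof (cases "D = {}")
  case False
  have "D = {..Max D}"
    using assms(2)[OF Max_in[OF assms(1) False]] Max_ge[OF assms(1)] by (intro equalityI subsetI) simp_all
  then have "D = {..<Suc (Max D)}" by (simp only: lessThan_Suc_atMost)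
  moreover have "D = {..<k} \<Longrightarrow> D = {..<card D}" for k by simp
  ultimately show ?thesis by blast
qed simp

text \<open>Blocks of weakly decreasing size are the columns of a Young diagram; \<mu> is the
  conjugate of the partition formed by their sizes.\<close>

lemma tableau_of_columns:
  assumes Ps: "disjoint_blocks Ps" "{} \<notin> set Ps" "\<Union>(set Ps) = {..<m}"
      "sorted_wrt (\<lambda>P Q. card Q \<le> card P) Ps"
    and two: "(2::'k::field) \<noteq> 0"
  obtains \<mu> t where "young TYPE('k) \<mu>" "sum_list \<mu> = m" "tableau \<mu> t"
    "column_stabilizer \<mu> t = block_stabilizer Ps"
    "\<And>i j. (i, j) \<in> young_diagram \<mu> \<longleftrightarrow> j < length Ps \<and> i < card (Ps ! j)"
proof -
  let ?D = "\<lambda>i. {j. j < length Ps \<and> i < card (Ps ! j)}"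
  \<comment> \<open>The number of rows is the size of the first and largest block; without blocks
    there are no rows.\<close>
  define h where "h = (if Ps = [] then 0 else card (Ps ! 0))"
  define \<mu> where "\<mu> = map (\<lambda>i. card (?D i)) [0..<h]"
  \<comment> \<open>Any enumeration of a block could serve as its column; the increasing one is
    taken.\<close>
  define t where "t = (\<lambda>(i, j). sorted_list_of_set (Ps ! j) ! i)"
  have mono: "card (Ps ! j') \<le> card (Ps ! j)" if "j \<le> j'" "j' < length Ps" for j j'
    using sorted_wrt_nth_less[OF Ps(4), of j j'] that by (cases "j = j'") auto
  have D: "?D i = {..<card (?D i)}" for i
  proof (rule down_closed_eq_lessThan)
    fix j j' assume "j \<in> ?D i" "j' \<le> j"
    then show "j' \<in> ?D i" using mono[of j' j] by simp
  qed simp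
  have len: "length \<mu> = h" by (simp add: \<mu>_def)
  have Y: "(i, j) \<in> young_diagram \<mu> \<longleftrightarrow> j < length Ps \<and> i < card (Ps ! j)" for i j
  proof -
    have "j < length Ps \<and> i < card (Ps ! j) \<longleftrightarrow> j < card (?D i)" using D[of i] by blast
    moreover have "i < h" if "j < length Ps \<and> i < card (Ps ! j)"
      using mono[of 0 j] that by (auto simp: h_def)
    ultimately show ?thesis by (auto simp: young_diagram_def len \<mu>_def)
  qed
  have "sorted_wrt (\<ge>) \<mu>"
    unfolding \<mu>_def sorted_wrt_map
    by (rule sorted_wrt_mono_rel[OF _ sorted_wrt_upt]) (auto intro!: card_mono)
  moreover have "0 \<notin> set \<mu>"
  proof
    assume "0 \<in> set \<mu>"
    then obtain i where i: "i < h" "card (?D i) = 0" by (auto simp: \<mu>_def)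
    then have "0 \<in> ?D i" by (auto simp: h_def split: if_splits)
    then show False using i(2) by auto
  qed
  ultimately have young: "young TYPE('k) \<mu>" using two by (simp add: young_def)
  have fin: "finite (Ps ! j)" if "j < length Ps" for j
    using disjoint_blocks_finite[OF Ps(1)] that by simp
  have column: "t ` {(i, j'). (i, j') \<in> young_diagram \<mu> \<and> j' = j} = (if j < length Ps then Ps ! j else {})" for j
  proof (cases "j < length Ps")
    case True
    have "{(i, j'). (i, j') \<in> young_diagram \<mu> \<and> j' = j} = (\<lambda>i. (i, j)) ` {..<card (Ps ! j)}"
      using True by (auto simp: Y)
    then have "t ` {(i, j'). (i, j') \<in> young_diagram \<mu> \<and> j' = j} =
        (!) (sorted_list_of_set (Ps ! j)) ` {..<length (sorted_list_of_set (Ps ! j))}"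
      by (simp add: t_def image_image)
    also have "\<dots> = set (sorted_list_of_set (Ps ! j))"
      unfolding set_conv_nth by blast
    finally show ?thesis using True fin by simp
  qed (simp add: Y)
  have tY: "t ` young_diagram \<mu> = {..<m}"
  proof -
    have "t ` young_diagram \<mu> = t ` (\<Union>j. {(i, j'). (i, j') \<in> young_diagram \<mu> \<and> j' = j})"
      by (rule arg_cong[where f = "image t"]) blast
    also have "\<dots> = (\<Union>j. t ` {(i, j'). (i, j') \<in> young_diagram \<mu> \<and> j' = j})" by (rule image_UN)
    also have "\<dots> = \<Union>(set Ps)" unfolding column by (auto simp: set_conv_nth split: if_splits)
    finally show ?thesis using Ps(3) by simp
  qed
  have inj: "inj_on t (young_diagram \<mu>)"
  proof (rule inj_onI)
    fix c c' assume c: "c \<in> young_diagram \<mu>" "c' \<in> young_diagram \<mu>" "t c = t c'"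
    obtain i j i' j' where ij: "c = (i, j)" "c' = (i', j')" by fastforce
    have b: "j < length Ps" "i < card (Ps ! j)" "j' < length Ps" "i' < card (Ps ! j')"
      using c(1,2) unfolding ij Y by blast+
    have "t c \<in> Ps ! j" "t c' \<in> Ps ! j'"
      using b fin[OF b(1)] fin[OF b(3)] nth_mem[of i "sorted_list_of_set (Ps ! j)"]
        nth_mem[of i' "sorted_list_of_set (Ps ! j')"] unfolding ij t_def by simp_all
    note in_blocks = this(1) this(2)[folded c(3)]
    have j: "j = j'"
    proof (rule ccontr)
      assume "j \<noteq> j'"
      then have "Ps ! j \<inter> Ps ! j' = {}"
        using disjoint_blocks_nth[OF Ps(1), of j j'] disjoint_blocks_nth[OF Ps(1), of j' j] b(1,3)
        by (cases "j < j'") (simp_all add: Int_commute)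
      then show False using in_blocks by blast
    qed
    have "sorted_list_of_set (Ps ! j) ! i = sorted_list_of_set (Ps ! j) ! i'"
      using c(3) unfolding ij t_def j by simp
    then have "i = i'"
      using nth_eq_iff_index_eq[of "sorted_list_of_set (Ps ! j)" i i'] b(2,4) unfolding j by simp
    then show "c = c'" using j ij by simp
  qed
  interpret young \<mu> "TYPE('k)" by (rule young)
  have "card (young_diagram \<mu>) = m" using card_image[OF inj] tY by simp
  then have n: "sum_list \<mu> = m" using card_Y by simp
  have tab: "tableau \<mu> t" using inj tY n by (simp add: tableau_def bij_betw_def)
  have "column_stabilizer \<mu> t = block_stabilizer Ps"
  proof -
    have eqv: "(\<forall>j. \<sigma> ` t ` {(i, j'). (i, j') \<in> young_diagram \<mu> \<and> j' = j} = t ` {(i, j'). (i, j') \<in> young_diagram \<mu> \<and> j' = j})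
        \<longleftrightarrow> (\<forall>P\<in>set Ps. \<sigma> ` P = P)" for \<sigma>
    proof -
      have "\<sigma> ` (if j < length Ps then Ps ! j else {}) = (if j < length Ps then Ps ! j else {}) \<longleftrightarrow>
          (j < length Ps \<longrightarrow> \<sigma> ` (Ps ! j) = Ps ! j)" for j by simp
      then show ?thesis unfolding column all_set_conv_all_nth by (intro all_cong1)
    qed
    show ?thesis unfolding column_stabilizer_def block_stabilizer_def Ps(3) n
      by (intro Collect_cong conj_cong refl eqv)
  qed
  then show thesis by (rule that[OF young n tab _ Y])
qed

lemma disjoint_blocks_append:
  "disjoint_blocks (As @ Bs) \<Longrightarrow> \<Union>(set Cs) \<subseteq> \<Union>(set Bs) \<Longrightarrow> disjoint_blocks Cs \<Longrightarrow> disjoint_blocks (As @ Cs)"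
  by (induction As) auto

lemma disjoint_blocks_card: "disjoint_blocks Ps \<Longrightarrow> card (\<Union>(set Ps)) = sum_list (map card Ps)"
  by (induction Ps) (auto simp: card_Un_disjoint disjoint_blocks_finite)

text \<open>A transposition of two points of one block stabilizes every block and is its own
  inverse.\<close>

lemma image_comp_block_stabilizer:
  assumes Ps: "disjoint_blocks Ps" and B: "B \<in> set Ps" "x \<in> B" "y \<in> B"
  shows "(\<lambda>p. p \<circ> Transposition.transpose x y) ` block_stabilizer Ps = block_stabilizer Ps"
proof -
  let ?t = "Transposition.transpose x y"
  have t: "?t permutes \<Union>(set Ps)" using B by (intro permutes_swap_id) auto
  have tB: "?t ` B' = B'" if B': "B' \<in> set Ps" for B'
  proof -
    obtain i j where ij: "i < length Ps" "B = Ps ! i" "j < length Ps" "B' = Ps ! j"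
      using B(1) B' by (metis in_set_conv_nth)
    have "i = j \<or> B \<inter> B' = {}"
      using disjoint_blocks_nth[OF Ps, of i j] disjoint_blocks_nth[OF Ps, of j i] ij
      by (cases i j rule: linorder_cases) auto
    then have "x \<in> B' \<longleftrightarrow> y \<in> B'" using ij B(2,3) by auto
    then show ?thesis by (rule transpose_image_eq)
  qed
  have comp: "p \<circ> ?t \<in> block_stabilizer Ps" if "p \<in> block_stabilizer Ps" for p
  proof -
    have p: "p permutes \<Union>(set Ps)" "\<And>B. B \<in> set Ps \<Longrightarrow> p ` B = B"
      using that unfolding block_stabilizer_def by blast+
    have "(p \<circ> ?t) ` B = B" if "B \<in> set Ps" for B
      unfolding image_comp[symmetric] tB[OF that] p(2)[OF that] ..
    then show ?thesis using permutes_compose[OF t p(1)] unfolding block_stabilizer_def by blast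
  qed
  show ?thesis
  proof (intro equalityI subsetI)
    fix p assume p: "p \<in> block_stabilizer Ps"
    have "p = (p \<circ> ?t) \<circ> ?t" by (simp add: comp_assoc)
    then show "p \<in> (\<lambda>p. p \<circ> ?t) ` block_stabilizer Ps" using comp[OF p] by (rule image_eqI)
  qed (use comp in blast)
qed

context young
begin

text \<open>The annihilator of the whole permutation module on tabloids, not only of the Specht
  module: membership can be tested on single tabloids, where collisions of rows give zero.\<close>

abbreviation (input) tabloid_ann :: "((nat \<Rightarrow> nat) \<Rightarrow>\<^sub>0 'k) set" where
  "tabloid_ann \<equiv> {a \<in> carrier (group_algebra n).
    \<forall>s. tableau \<mu> s \<longrightarrow> tact a (symbol (tabloid_of \<mu> s)) = (0 :: tabloid \<Rightarrow>\<^sub>0 'k)}"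

lemma perm_ideal_tabloid_ann: "perm_ideal {..<n} tabloid_ann"
proof -
  interpret A: closed_algebra "group_algebra n :: ('k, _) module" by (rule closed_algebra_group_algebra)
  have right: "gmult x (symbol \<sigma>) \<in> tabloid_ann" if "\<sigma> permutes {..<n}" "x \<in> tabloid_ann" for \<sigma> x
    using that A.mult_closed[of x "symbol \<sigma>"] tableau_comp[of _ \<sigma>]
    by (auto simp: tact_gmult tact_symbol simp flip: tabloid_of_comp)
  have left: "gmult (symbol \<sigma>) x \<in> tabloid_ann" if "\<sigma> permutes {..<n}" "x \<in> tabloid_ann" for \<sigma> x
    using that A.mult_closed[of "symbol \<sigma>" x] by (auto simp: tact_gmult)
  have zero: "0 \<in> tabloid_ann" by (simp add: in_group_algebra)
  have add: "x + y \<in> tabloid_ann" if "x \<in> tabloid_ann" "y \<in> tabloid_ann" for x y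
    using that A.add_closed[of x y] by (simp add: bilinear_ext_add)
  have scl: "scale c x \<in> tabloid_ann" if "x \<in> tabloid_ann" for c x
    using that A.smult_closed[of x c] by (simp add: bilinear_ext_scale)
  show ?thesis unfolding perm_ideal_def free.subspace_def
    by (intro conjI ballI allI impI right left zero add scl)
qed

text \<open>
  If no two entries of the first \<open>i\<close> columns and of \<open>Z\<close> collided, row \<open>r\<close> would contain at most
  \<open>min (i + 1) (\<mu> ! r)\<close> of them, so that \<open>Z\<close> would be no larger than the next column.
\<close>

lemma greedy_columns:
  assumes Ps: "disjoint_blocks Ps" "\<Union>(set Ps) = {..<n}"
    and Y: "\<And>i j. (i, j) \<in> Y \<longleftrightarrow> j < length Ps \<and> i < card (Ps ! j)"
  shows "greedy tabloid_ann Ps"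
proof (rule greedyI)
  fix As P Bs Z
  assume Ps_eq: "Ps = As @ P # Bs" and Z: "Z \<subseteq> P \<union> \<Union>(set Bs)" and card_less: "card P < card Z"
  let ?Q = "As @ [Z]" and ?i = "length As"
  have sub: "\<Union>(set ?Q) \<subseteq> {..<n}" using Ps(2) Z unfolding Ps_eq by auto
  have "finite Z" using sub finite_subset[of Z "{..<n}"] by simp
  then have Q: "disjoint_blocks ?Q"
    using disjoint_blocks_append[of As "P # Bs" "[Z]"] Ps(1) Z unfolding Ps_eq by simp
  have "Poly_Mapping.keys (block_sum ?Q :: _ \<Rightarrow>\<^sub>0 'k) \<subseteq> {\<sigma>. \<sigma> permutes {..<n}}"
    by (rule subset_trans[OF keys_block_sum permutes_mono[OF sub]])
  moreover have "tact (block_sum ?Q) (symbol (tabloid_of \<mu> s)) = (0 :: tabloid \<Rightarrow>\<^sub>0 'k)" if s: "tableau \<mu> s" for s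
  proof (rule ccontr)
    assume nz: "tact (block_sum ?Q) (symbol (tabloid_of \<mu> s)) \<noteq> (0 :: tabloid \<Rightarrow>\<^sub>0 'k)"
    \<comment> \<open>Two entries of one block in the same row of \<open>s\<close> would make the
      signed sum cancel, against \<open>nz\<close>.\<close>
    have free: "x = y" if B: "B \<in> set ?Q" "x \<in> B" "y \<in> B" and row: "row s x = row s y" for B x y
    proof (rule ccontr)
      assume ne: "x \<noteq> y"
      have lt: "x < n" "y < n" using sub B by blast+
      have "tact (block_sum ?Q) (symbol (tabloid_of \<mu> s)) = (0 :: tabloid \<Rightarrow>\<^sub>0 'k)"
        unfolding block_sum_eq[OF Q]
      proof (rule tact_signed_sum_eq_zero[OF two _ ne refl])
        show "permutation p" if "p \<in> block_stabilizer ?Q" for p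
        proof (rule permutes_permutation)
          show "p permutes \<Union>(set ?Q)" using that unfolding block_stabilizer_def by blast
          show "finite (\<Union>(set ?Q))" using sub by (rule finite_subset) simp
        qed
        show "(\<lambda>p. p \<circ> Transposition.transpose x y) ` block_stabilizer ?Q = block_stabilizer ?Q"
          by (rule image_comp_block_stabilizer[OF Q B])
        show "tabloid_perm (Transposition.transpose x y) (tabloid_of \<mu> s) = tabloid_of \<mu> s"
          by (rule tabloid_perm_transpose[OF s lt row])
      qed
      then show False using nz by blast
    qed
    let ?X = "\<Union>(set ?Q)"
    have finX: "finite ?X" using sub by (rule finite_subset) simp
    \<comment> \<open>The right side counts the cells of row \<open>r\<close> in the first
      \<open>Suc ?i\<close> columns. One bound comes from the blocks, each of which meets the row at
      most once, the other from the length of the row.\<close>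
    have row_bound: "card {x \<in> ?X. row s x = r} \<le> (\<Sum>j<Suc ?i. if (r, j) \<in> Y then 1 else 0)"
      if r: "r < length \<mu>" for r
    proof -
      have one: "card {x \<in> ?Q ! k. row s x = r} \<le> 1" if k: "k < Suc ?i" for k
      proof -
        have "?Q ! k \<in> set ?Q" using k by (intro nth_mem) simp
        then have "finite {x \<in> ?Q ! k. row s x = r}" "\<forall>x\<in>{x \<in> ?Q ! k. row s x = r}. \<forall>y\<in>{x \<in> ?Q ! k. row s x = r}. x = y"
          using disjoint_blocks_finite[OF Q] free[of "?Q ! k"] by auto
        then show ?thesis by (simp only: card_le_Suc0_iff_eq One_nat_def)
      qed
      have "{x \<in> ?X. row s x = r} \<subseteq> (\<Union>k<Suc ?i. {x \<in> ?Q ! k. row s x = r})"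
      proof
        fix x assume x: "x \<in> {x \<in> ?X. row s x = r}"
        then obtain B where "B \<in> set ?Q" "x \<in> B" by blast
        then obtain k where "k < length ?Q" "x \<in> ?Q ! k" by (metis in_set_conv_nth)
        then show "x \<in> (\<Union>k<Suc ?i. {x \<in> ?Q ! k. row s x = r})" using x by auto
      qed
      moreover have "finite (\<Union>k<Suc ?i. {x \<in> ?Q ! k. row s x = r})"
      proof (intro finite_UN_I finite_lessThan)
        fix k assume "k \<in> {..<Suc ?i}"
        then have "?Q ! k \<in> set ?Q" by (intro nth_mem) simp
        then show "finite {x \<in> ?Q ! k. row s x = r}" using disjoint_blocks_finite[OF Q] by simp
      qed
      ultimately have "card {x \<in> ?X. row s x = r} \<le> card (\<Union>k<Suc ?i. {x \<in> ?Q ! k. row s x = r})"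
        by (intro card_mono)
      also have "\<dots> \<le> (\<Sum>k<Suc ?i. card {x \<in> ?Q ! k. row s x = r})" by (rule card_UN_le) simp
      also have "\<dots> \<le> (\<Sum>k<Suc ?i. 1)" using one by (intro sum_mono) simp
      finally have a: "card {x \<in> ?X. row s x = r} \<le> Suc ?i" by simp
      have "card {x \<in> ?X. row s x = r} \<le> card {x. x < n \<and> row s x = r}"
        using sub by (intro card_mono) auto
      also have "\<dots> = \<mu> ! r" unfolding row_card[OF s] using r by (simp add: in_Y)
      finally have "card {x \<in> ?X. row s x = r} \<le> card {..<min (Suc ?i) (\<mu> ! r)}" using a by simp
      also have "{..<min (Suc ?i) (\<mu> ! r)} = {j \<in> {..<Suc ?i}. (r, j) \<in> Y}" using r by (auto simp: in_Y)
      finally show ?thesis by (simp add: sum.If_cases Int_def del: sum.lessThan_Suc)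
    qed
    \<comment> \<open>Counted by columns, these cells are as many as the points of the blocks in
      \<open>As\<close> and of \<open>P\<close> together, which leaves no room for a larger
      \<open>Z\<close>.\<close>
    have colsum: "(\<Sum>r<length \<mu>. if (r, j) \<in> Y then 1 else 0) = card (Ps ! j)" if "j < Suc ?i" for j
    proof -
      have j: "j < length Ps" using that unfolding Ps_eq by simp
      have "{r \<in> {..<length \<mu>}. (r, j) \<in> Y} = {r. (r, j) \<in> Y}" by (auto simp: in_Y)
      also have "\<dots> = {..<card (Ps ! j)}" using j by (auto simp: Y)
      finally have "card {r \<in> {..<length \<mu>}. (r, j) \<in> Y} = card (Ps ! j)" by simp
      then show ?thesis by (simp add: sum.If_cases Int_def)
    qed
    have "sum_list (map card As) + card Z = card ?X" using disjoint_blocks_card[OF Q] by simp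
    also have "?X = (\<Union>r<length \<mu>. {x \<in> ?X. row s x = r})"
    proof (intro equalityI subsetI)
      fix x assume x: "x \<in> ?X"
      then have "x < n" using sub by blast
      then have "row s x < length \<mu>" using cell(1)[OF s, of x] by (simp add: in_Y)
      then show "x \<in> (\<Union>r<length \<mu>. {x \<in> ?X. row s x = r})" using x by (intro UN_I[of "row s x"]) blast+
    qed blast
    also have "card \<dots> \<le> (\<Sum>r<length \<mu>. card {x \<in> ?X. row s x = r})" by (rule card_UN_le) simp
    also have "\<dots> \<le> (\<Sum>r<length \<mu>. \<Sum>j<Suc ?i. if (r, j) \<in> Y then 1 else 0)"
      using row_bound by (intro sum_mono) simp
    also have "\<dots> = (\<Sum>j<Suc ?i. \<Sum>r<length \<mu>. if (r, j) \<in> Y then 1 else 0)" by (rule sum.swap)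
    also have "\<dots> = (\<Sum>j<Suc ?i. card (Ps ! j))" by (intro sum.cong refl colsum) simp
    also have "\<dots> = (\<Sum>j<length (As @ [P]). card ((As @ [P]) ! j))"
      by (intro sum.cong) (auto simp: Ps_eq nth_append)
    also have "\<dots> = sum_list (map card As) + card P"
      using sum_list_sum_nth[of "map card (As @ [P])"] by (simp add: atLeast0LessThan nth_append)
    finally show False using card_less by simp
  qed
  ultimately show "block_sum ?Q \<in> tabloid_ann" by (simp add: in_group_algebra)
qed

end

section \<open>Every simple module of a symmetric group is the head of a Specht module\<close>

theorem simple_group_module_iso:
  fixes V :: "('k::field, 'v, (nat \<Rightarrow> nat) \<Rightarrow>\<^sub>0 'k) amodule"
  assumes two: "(2::'k) \<noteq> 0" and simple: "simple_amodule (group_algebra m) V"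
    and unital: "\<And>v. v \<in> carrier V \<Longrightarrow> act V (symbol id) v = v"
  obtains \<mu> where "\<mu> \<in> regular_partitions CHAR('k)" "sum_list \<mu> = m"
    "amodule_iso (group_algebra m) V (module_head (group_algebra m) (specht_module \<mu>))"
proof -
  let ?A = "group_algebra m :: ('k, _) module"
  interpret V: amodule ?A V using simple by (simp add: simple_amodule_def)
  interpret A: closed_algebra ?A by (rule closed_algebra_group_algebra)
  have add: "a + b \<in> carrier ?A" "act V (a + b) v = act V a v \<oplus>\<^bsub>V\<^esub> act V b v"
    and mult: "gmult a b \<in> carrier ?A" "act V (gmult a b) v = act V a (act V b v)"
    if "a \<in> carrier ?A" "b \<in> carrier ?A" "v \<in> carrier V" for a b v
    using A.add_closed[OF that(1,2)] A.mult_closed[OF that(1,2)] V.act_add_left[OF that] V.act_mult[OF that] by simp_all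
  have scl: "scale c a \<in> carrier ?A" "act V (scale c a) v = c \<odot>\<^bsub>V\<^esub> act V a v"
    if "a \<in> carrier ?A" "v \<in> carrier V" for a c v
    using A.smult_closed[OF that(1)] V.act_smult_left[OF that] by simp_all
  have id: "symbol id \<in> carrier ?A" by (simp add: permutes_id)
  have zeroA: "0 \<in> carrier ?A" by (simp add: in_group_algebra)
  have zero: "act V 0 v = \<zero>\<^bsub>V\<^esub>" if v: "v \<in> carrier V" for v
    using scl(2)[OF zeroA v, of 0] V.act_closed[OF zeroA v] by (simp add: V.smult_zero_left)
  obtain v1 where v1: "v1 \<in> carrier V" "v1 \<noteq> \<zero>\<^bsub>V\<^esub>"
    using simple V.M.zero_closed unfolding simple_amodule_def by blast
  \<comment> \<open>With the annihilator of \<open>V\<close> as ideal, the greedy choice takes a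
    largest set whose alternating sum still acts nontrivially on \<open>V\<close>.\<close>
  define I where "I = {a \<in> carrier ?A. \<forall>v\<in>carrier V. act V a v = \<zero>\<^bsub>V\<^esub>}"
  have I: "perm_ideal {..<m} I"
  proof -
    have "gmult x (symbol \<sigma>) \<in> I \<and> gmult (symbol \<sigma>) x \<in> I" if "\<sigma> permutes {..<m}" "x \<in> I" for x \<sigma>
    proof -
      have \<sigma>: "symbol \<sigma> \<in> carrier ?A" using that(1) by simp
      have x: "x \<in> carrier ?A" "\<And>v. v \<in> carrier V \<Longrightarrow> act V x v = \<zero>\<^bsub>V\<^esub>" using that(2) by (simp_all add: I_def)
      show ?thesis using mult[OF x(1) \<sigma>] mult[OF \<sigma> x(1)] x v1(1)
        by (simp add: I_def V.act_closed[OF \<sigma>] V.act_zero_right[OF \<sigma>])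
    qed
    moreover have "x + y \<in> I" if "x \<in> I" "y \<in> I" for x y
      using that add[of x y] v1(1) by (simp add: I_def)
    moreover have "scale c x \<in> I" if "x \<in> I" for c x
      using that scl[of x _ c] v1(1) by (simp add: I_def V.smult_zero_right)
    moreover have "0 \<in> I" using zero zeroA by (simp add: I_def)
    ultimately show ?thesis unfolding perm_ideal_def free.subspace_def by blast
  qed
  have id_notin: "symbol id \<notin> I"
  proof
    assume "symbol id \<in> I"
    then have "act V (symbol id) v1 = \<zero>\<^bsub>V\<^esub>" using v1(1) unfolding I_def by blast
    then show False using unital[OF v1(1)] v1(2) by simp
  qed
  obtain Ps where Ps: "disjoint_blocks Ps" "\<Union>(set Ps) = {..<m}" "{} \<notin> set Ps" "greedy I Ps"
    "block_sum Ps \<notin> I" "sorted_wrt (\<lambda>P Q. card Q \<le> card P) Ps"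
    using greedy_exists[OF finite_lessThan I id_notin] by (elim exE conjE) (rule that; assumption)
  obtain \<mu> t where \<mu>: "young TYPE('k) \<mu>" "sum_list \<mu> = m" and t: "tableau \<mu> t"
    and stab: "column_stabilizer \<mu> t = block_stabilizer Ps"
    and Y: "\<And>i j. (i, j) \<in> young_diagram \<mu> \<longleftrightarrow> j < length Ps \<and> i < card (Ps ! j)"
    using tableau_of_columns[OF Ps(1,3,2,6) two] by metis
  interpret young \<mu> "TYPE('k)" by (rule \<mu>(1))
  define k where "k = kappa t"
  have k_eq: "k = block_sum Ps" unfolding k_def kappa_def stab block_sum_eq[OF Ps(1)] ..
  have kA: "k \<in> carrier ?A" using kappa_in[OF t] \<mu>(2) by (simp add: k_def)
  \<comment> \<open>Working modulo both annihilators at once makes the scalar in the sandwich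
    relation the same for \<open>V\<close> and for the tabloids.\<close>
  define J where "J = I \<inter> tabloid_ann"
  have "perm_ideal {..<m} tabloid_ann" using perm_ideal_tabloid_ann \<mu>(2) by simp
  then have J: "perm_ideal {..<m} J" using I
    unfolding J_def perm_ideal_def by (auto intro: free.subspace_inter)
  have "greedy tabloid_ann Ps" using Ps(2) \<mu>(2) by (intro greedy_columns[OF Ps(1) _ Y]) simp
  then have gJ: "greedy J Ps" unfolding J_def by (rule greedy_Int[OF Ps(4)])
  have subJ: "free.subspace J" using J by (simp add: perm_ideal_def)
  have sandwich: "\<exists>c d. d \<in> J \<and> gmult (gmult k a) k = scale c k + d" if "a \<in> carrier ?A" for a
    using that[unfolded in_group_algebra]
  proof (induction rule: free_induct)
    case zero
    show ?case by (intro exI[of _ 0]) (simp add: free.subspace_0[OF subJ])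
  next
    case (add p q)
    then obtain c d c' d' where "d \<in> J" "gmult (gmult k p) k = scale c k + d"
      "d' \<in> J" "gmult (gmult k q) k = scale c' k + d'" by blast
    then show ?case by (intro exI[of _ "c + c'"] exI[of _ "d + d'"])
      (simp add: bilinear_ext_add free.scale_left_distrib free.subspace_add[OF subJ])
  next
    case (scale r p)
    then obtain c d where "d \<in> J" "gmult (gmult k p) k = scale c k + d" by blast
    then show ?case by (intro exI[of _ "r * c"] exI[of _ "scale r d"])
      (simp add: bilinear_ext_scale free.scale_right_distrib free.subspace_scale[OF subJ])
  next
    case (symbol \<sigma>)
    then obtain c where "gmult (gmult k (symbol \<sigma>)) k - scale c k \<in> J"
      using block_sum_sandwich[OF Ps(1) _ gJ, of \<sigma>] J Ps(2) unfolding k_eq by auto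
    then show ?case by (intro exI[of _ c] exI[of _ "gmult (gmult k (symbol \<sigma>)) k - scale c k"]) simp
  qed
  obtain v0 where v0: "v0 \<in> carrier V" "act V k v0 \<noteq> \<zero>\<^bsub>V\<^esub>"
    using Ps(5) kA unfolding I_def k_eq by blast
  \<comment> \<open>A nonzero vector in the image of \<open>k\<close>; in \<open>V\<close> it plays
    the part that \<open>e t\<close> plays in the Specht module.\<close>
  define w where "w = act V k v0"
  have w: "w \<in> carrier V" "w \<noteq> \<zero>\<^bsub>V\<^esub>" using v0 V.act_closed[OF kA] by (simp_all add: w_def)
  \<comment> \<open>Both vectors are images under \<open>k\<close>: \<open>w\<close> comes from
    \<open>v0\<close>, and \<open>e t\<close> from the tabloid of \<open>t\<close>. So
    \<open>k a\<close> applied to either of them is governed by the same sandwich relation with the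
    same scalar.\<close>
  have key: "\<exists>c. act V k (act V a w) = c \<odot>\<^bsub>V\<^esub> w \<and> tact k (tact a (e t)) = scale c (e t)"
    if a: "a \<in> carrier ?A" for a
  proof -
    obtain c d where d: "d \<in> J" and eq: "gmult (gmult k a) k = scale c k + d" using sandwich[OF a] by blast
    have d': "d \<in> carrier ?A" "act V d v0 = \<zero>\<^bsub>V\<^esub>" "tact d (symbol (tabloid_of \<mu> t)) = (0 :: tabloid \<Rightarrow>\<^sub>0 'k)"
      using d v0(1) t by (simp_all add: J_def I_def)
    have "act V k (act V a w) = act V (gmult (gmult k a) k) v0"
      using mult(2)[OF mult(1)[OF kA a v0(1)] kA v0(1)] mult(2)[OF kA a w(1)] by (simp add: w_def)
    also have "\<dots> = c \<odot>\<^bsub>V\<^esub> w"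
      unfolding eq using add(2)[OF scl(1)[OF kA v0(1)] d'(1) v0(1)] scl(2)[OF kA v0(1)] d'(2) V.smult_closed[OF _ w(1)]
      by (simp add: w_def scalar_ring_def)
    finally have 1: "act V k (act V a w) = c \<odot>\<^bsub>V\<^esub> w" .
    have "tact k (tact a (e t)) = tact (gmult (gmult k a) k) (symbol (tabloid_of \<mu> t))"
      by (simp add: e_eq tact_gmult k_def)
    also have "\<dots> = scale c (e t)"
      unfolding eq e_eq by (simp add: bilinear_ext_add bilinear_ext_scale d'(3) k_def)
    finally show ?thesis using 1 by blast
  qed
  have cyc: "(\<lambda>a. act V a v) ` carrier ?A = carrier V" if "v \<in> carrier V" "v \<noteq> \<zero>\<^bsub>V\<^esub>" for v
    using that id unital[OF that(1)]
    by (intro simple_cyclic[OF simple closed_algebra_group_algebra, where ?a0.0 = "symbol id"]) simp_all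
  \<comment> \<open>If \<open>a w\<close> is nonzero it generates \<open>V\<close>, so some
    \<open>b\<close> takes it back to \<open>v0\<close>. Then \<open>k b a\<close> fixes
    \<open>w\<close>, which forces the scalar to be 1, and so \<open>k b a\<close> fixes
    \<open>e t\<close> as well.\<close>
  have recover: "\<exists>b\<in>carrier ?A. tact k (tact (gmult b a) (e t)) = e t"
    if a: "a \<in> carrier ?A" "act V a w \<noteq> \<zero>\<^bsub>V\<^esub>" for a
  proof -
    have "v0 \<in> (\<lambda>b. act V b (act V a w)) ` carrier ?A"
      using cyc[OF V.act_closed[OF a(1) w(1)] a(2)] v0(1) by simp
    then obtain b where b: "b \<in> carrier ?A" "v0 = act V b (act V a w)" by blast
    obtain c where c: "act V k (act V (gmult b a) w) = c \<odot>\<^bsub>V\<^esub> w" "tact k (tact (gmult b a) (e t)) = scale c (e t)"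
      using key[OF mult(1)[OF b(1) a(1) w(1)]] by blast
    have "w = c \<odot>\<^bsub>V\<^esub> w" using c(1) unfolding mult(2)[OF b(1) a(1) w(1)] b(2)[symmetric] w_def[symmetric] .
    have "c = 1"
    proof (rule ccontr)
      assume "c \<noteq> 1"
      have "(c - 1) \<odot>\<^bsub>V\<^esub> w \<oplus>\<^bsub>V\<^esub> w = c \<odot>\<^bsub>V\<^esub> w"
        using V.smult_l_distr[of "c - 1" 1 w] w(1) V.smult_one[OF w(1)] by (simp add: scalar_ring_def)
      then have "(c - 1) \<odot>\<^bsub>V\<^esub> w \<oplus>\<^bsub>V\<^esub> w = \<zero>\<^bsub>V\<^esub> \<oplus>\<^bsub>V\<^esub> w"
        using \<open>w = c \<odot>\<^bsub>V\<^esub> w\<close> w(1) by simp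
      then have z: "(c - 1) \<odot>\<^bsub>V\<^esub> w = \<zero>\<^bsub>V\<^esub>"
        using V.smult_closed[OF _ w(1)] w(1) by (simp add: scalar_ring_def)
      have "w = inverse (c - 1) \<odot>\<^bsub>V\<^esub> ((c - 1) \<odot>\<^bsub>V\<^esub> w)"
        using V.smult_assoc1[of "inverse (c - 1)" "c - 1" w] w(1) V.smult_one[OF w(1)] \<open>c \<noteq> 1\<close>
        by (simp add: scalar_ring_def)
      then show False using z w(2) by (simp add: V.smult_zero_right)
    qed
    then show ?thesis using c(2) b(1) by (intro bexI[of _ b]) simp_all
  qed
  \<comment> \<open>For \<open>a\<close> the identity, \<open>recover\<close> shows that
    \<open>k\<close> does not annihilate the Specht module. Hence some pairing is nonzero, which is
    what makes \<mu> regular.\<close>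
  obtain s where s: "tableau \<mu> s" "pairing t s \<noteq> 0"
  proof (rule ccontr)
    assume "\<not> thesis"
    then have no_pairing: "pairing t s = 0" if "tableau \<mu> s" for s using that \<open>\<And>s. tableau \<mu> s \<Longrightarrow> pairing t s \<noteq> 0 \<Longrightarrow> thesis\<close> by blast
    have z: "tact k v = 0" if "v \<in> carrier S" for v
      using that by (induction rule: specht_induct)
        (simp_all add: bilinear_ext_add bilinear_ext_scale k_def kappa_e[OF t] no_pairing)
    obtain b where b: "b \<in> carrier ?A" "tact k (tact (gmult b (symbol id)) (e t)) = e t"
      using recover[OF id] unital[OF w(1)] w(2) by auto
    have "tact b (e t) \<in> carrier S" using tact_specht_closed[OF _ specht_closed(4)[OF t]] b(1) \<mu>(2) by simp
    then show False using z[of "tact b (e t)"] b(2) e_nonzero[OF t] by simp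
  qed
  have reg: "\<mu> \<in> regular_partitions CHAR('k)"
    using pairing_eq_zero[OF t s(1)] s(2) sorted nonzero
    unfolding regular_partitions_def by (auto simp: not_less[symmetric])
  have L: "local_module ?A S k" using local_specht[OF t s] \<mu>(2) by (simp add: k_def)
  interpret L: local_module ?A S k by (rule L)
  let ?H = "module_head ?A S"
  define h where "h = core ?A S k +>\<^bsub>S\<^esub> e t"
  have eS: "e t \<in> carrier S" by (rule specht_closed(4)[OF t])
  have zero_iff: "act ?H a h = \<zero>\<^bsub>?H\<^esub> \<longleftrightarrow> tact a (e t) \<in> core ?A S k" if a: "a \<in> carrier ?A" for a
    unfolding h_def L.head_act[OF a eS] using L.head_zero_iff[OF L.act_closed[OF a eS]] by simp
  have H: "simple_amodule ?A ?H" by (rule L.simple_head)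
  have hH: "h \<in> carrier ?H" unfolding h_def L.head_carrier using eS by blast
  have in_core: "v \<in> core ?A S k \<longleftrightarrow> v \<in> carrier S \<and> (\<forall>b\<in>carrier ?A. tact k (tact b v) = 0)" for v
  proof -
    have "tact k v = 0" if "\<forall>b\<in>carrier ?A. tact k (tact b v) = 0" using bspec[OF that id] by simp
    then show ?thesis unfolding core_def by (auto simp del: specht_simps(5))
  qed
  \<comment> \<open>If \<open>a w = 0\<close>, all scalars belonging to the products
    \<open>b a\<close> vanish, so \<open>a\<close> sends \<open>e t\<close> into the core.
    Conversely \<open>recover\<close> detects a nonzero \<open>a w\<close>.\<close>
  have ann: "act V a w = \<zero>\<^bsub>V\<^esub> \<longleftrightarrow> act ?H a h = \<zero>\<^bsub>?H\<^esub>" if a: "a \<in> carrier ?A" for a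
  proof
    assume z: "act V a w = \<zero>\<^bsub>V\<^esub>"
    have "tact k (tact b (tact a (e t))) = 0" if b: "b \<in> carrier ?A" for b
    proof -
      obtain c where c: "act V k (act V (gmult b a) w) = c \<odot>\<^bsub>V\<^esub> w" "tact k (tact (gmult b a) (e t)) = scale c (e t)"
        using key[OF mult(1)[OF b a w(1)]] by blast
      have cw: "c \<odot>\<^bsub>V\<^esub> w = \<zero>\<^bsub>V\<^esub>"
        using c(1) unfolding mult(2)[OF b a w(1)] z V.act_zero_right[OF b] V.act_zero_right[OF kA] by simp
      have "c = 0"
      proof (rule ccontr)
        assume "c \<noteq> 0"
        then have "w = inverse c \<odot>\<^bsub>V\<^esub> (c \<odot>\<^bsub>V\<^esub> w)"
          using V.smult_assoc1[of "inverse c" c w] w(1) V.smult_one[OF w(1)] by (simp add: scalar_ring_def)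
        then show False using cw w(2) by (simp add: V.smult_zero_right)
      qed
      then show ?thesis using c(2) by (simp add: tact_gmult)
    qed
    then show "act ?H a h = \<zero>\<^bsub>?H\<^esub>" unfolding zero_iff[OF a] in_core
      using tact_specht_closed[OF _ eS, of a] a \<mu>(2) by simp
  next
    assume z: "act ?H a h = \<zero>\<^bsub>?H\<^esub>"
    show "act V a w = \<zero>\<^bsub>V\<^esub>"
    proof (rule ccontr)
      assume "act V a w \<noteq> \<zero>\<^bsub>V\<^esub>"
      then obtain b where "b \<in> carrier ?A" "tact k (tact b (tact a (e t))) = e t"
        using recover[OF a] by (auto simp: tact_gmult)
      then show False using z e_nonzero[OF t] unfolding zero_iff[OF a] in_core by force
    qed
  qed
  have "act V (symbol id) w \<noteq> \<zero>\<^bsub>V\<^esub>" using unital[OF w(1)] w(2) by simp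
  then have "act ?H (symbol id) h \<noteq> \<zero>\<^bsub>?H\<^esub>" using ann[OF id] by blast
  then have cycH: "(\<lambda>a. act ?H a h) ` carrier ?A = carrier ?H"
    by (rule simple_cyclic[OF H closed_algebra_group_algebra hH id])
  have "amodule_iso ?A V ?H"
    using H by (intro amodule_iso_cyclic[OF V.amodule_axioms _ closed_algebra_group_algebra w(1) cyc[OF w] hH cycH ann])
      (simp_all add: simple_amodule_def)
  then show thesis by (rule that[OF reg \<mu>(2)])
qed

section \<open>Classification of the simple modules of \<open>B\<close>\<close>

lemma two_nonzero:
  assumes "CHAR('k::field) \<noteq> 2"
  shows "(2::'k) \<noteq> 0"
proof
  assume "(2::'k) = 0"
  then have "of_nat 2 = (0::'k)" by simp
  then have "CHAR('k) dvd 2" by (simp only: of_nat_eq_0_iff_char_dvd)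
  moreover have "CHAR('k) \<noteq> 1"
  proof
    assume "CHAR('k) = 1"
    then show False using of_nat_CHAR[where 'a='k] by simp
  qed
  ultimately show False using assms by (metis prime_nat_iff two_is_prime_nat)
qed

lemma perm_embedding_id: "perm_embedding m (symbol id) = B_id m"
  by (simp add: perm_embedding_def B_id_def)

text \<open>Word spaces are images of elements of \<open>B\<close>, so an isomorphism matches them
  one by one, and in particular the first nonzero ones.\<close>

lemma shortest_word_space_cong:
  fixes V :: "('k::field, 'v, 'k brauer_element) amodule"
    and W :: "('k, 'w, 'k brauer_element) amodule"
  assumes V: "amodule (B_alg \<delta>) V" and W: "amodule (B_alg \<delta>) W" and iso: "amodule_iso (B_alg \<delta>) V W"
  shows "amodule_iso (B_zero \<delta>) (shortest_word_space V) (shortest_word_space W)"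
proof -
  interpret V: amodule "B_alg \<delta>" V by fact
  interpret W: amodule "B_alg \<delta>" W by fact
  obtain f where f: "bij_betw f (carrier V) (carrier W)"
    "\<And>v w. v \<in> carrier V \<Longrightarrow> w \<in> carrier V \<Longrightarrow> f (v \<oplus>\<^bsub>V\<^esub> w) = f v \<oplus>\<^bsub>W\<^esub> f w"
    "\<And>c v. v \<in> carrier V \<Longrightarrow> f (c \<odot>\<^bsub>V\<^esub> v) = c \<odot>\<^bsub>W\<^esub> f v"
    "\<And>a v. a \<in> carrier (B_alg \<delta>) \<Longrightarrow> v \<in> carrier V \<Longrightarrow> f (act V a v) = act W a (f v)"
    using iso unfolding amodule_iso_def by blast
  have im: "f ` carrier V = carrier W" using f(1) by (simp add: bij_betw_def)
  have f0: "f \<zero>\<^bsub>V\<^esub> = \<zero>\<^bsub>W\<^esub>" by (rule amodule_iso_zero[OF V W f(3)]) (use im in blast)+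
  have id: "(B_id k :: 'k brauer_element) \<in> carrier (B_alg \<delta>)" for k by simp
  have ws: "f ` word_space V k = word_space W k" for k
    unfolding word_space_def im[symmetric] image_image using f(4)[OF id] by (intro image_cong) simp_all
  have sub: "word_space V k \<subseteq> carrier V" for k
    using V.act_closed[OF id] by (auto simp: word_space_def)
  have triv: "word_space W k = {\<zero>\<^bsub>W\<^esub>} \<longleftrightarrow> word_space V k = {\<zero>\<^bsub>V\<^esub>}" for k
    using inj_on_image_eq_iff[OF bij_betw_imp_inj_on[OF f(1)] sub[of k], of "{\<zero>\<^bsub>V\<^esub>}"] V.M.zero_closed
    by (simp add: f0 ws)
  let ?m = "LEAST m. word_space V m \<noteq> {\<zero>\<^bsub>V\<^esub>}"
  have "bij_betw f (word_space V ?m) (word_space W ?m)" by (rule bij_betw_subset[OF f(1) sub ws])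
  then show ?thesis
    unfolding amodule_iso_def shortest_word_space_def triv
    using f(2-4) subsetD[OF sub[of ?m]] B_sharp_in_B[OF B_zero_in_B_sharp]
    by (intro exI[of _ f]) (simp, blast)
qed

locale regular_partition =
  fixes \<mu> :: "nat list" and \<delta> :: "'k::field"
  assumes regular: "\<mu> \<in> regular_partitions CHAR('k)" and two: "(2::'k) \<noteq> 0"
begin

sublocale P: young \<mu> "TYPE('k)"
  by unfold_locales (use regular two in \<open>simp_all add: regular_partitions_def\<close>)

abbreviation (input) D :: "('k, (tabloid \<Rightarrow>\<^sub>0 'k) set, (nat \<Rightarrow> nat) \<Rightarrow>\<^sub>0 'k) amodule" where
  "D \<equiv> module_head (group_algebra (sum_list \<mu>)) (specht_module \<mu>)"

lemma
  shows simple_D: "simple_amodule (group_algebra (sum_list \<mu>)) D"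
    and D_unital: "x \<in> carrier D \<Longrightarrow> act D (symbol id) x = x"
proof -
  obtain t where t: "tableau \<mu> t" using P.tableau_exists by blast
  note L = P.local_regular[OF regular t]
  show "simple_amodule (group_algebra (sum_list \<mu>)) D" by (rule P.simple_specht_head[OF L])
  show "act D (symbol id) x = x" if "x \<in> carrier D" by (rule P.specht_head_unital[OF L that])
qed

lemma amodule_D: "amodule (group_algebra (sum_list \<mu>)) D"
  using simple_D by (simp add: simple_amodule_def)

sublocale I: simple_inflation "sum_list \<mu>" D \<delta>
  by (intro simple_inflation.intro inflation.intro inflation_axioms.intro simple_inflation_axioms.intro)
    (rule amodule_D simple_D D_unital; assumption?)+

lemma unique_maximal_submodule: "\<exists>!W. maximal_submodule (B_alg \<delta>) (Delta_bar \<delta> \<mu>) W"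
  unfolding Delta_bar_def D_module_def I.T.maximal_submodule_iff by simp

lemma shortest_word_space_L_module:
  "amodule_iso (B_zero \<delta>) (shortest_word_space (L_module \<delta> \<mu>)) (D_module \<mu>)"
  unfolding L_module_def Delta_bar_def D_module_def by (rule I.shortest_word_space_iso)

lemma D_module_iso:
  "amodule_iso (B_zero \<delta>) (D_module \<mu>) (shortest_word_space (L_module \<delta> \<mu>))"
  unfolding L_module_def Delta_bar_def D_module_def by (rule I.iso_shortest_word_space)

lemma simple_L_module: "simple_B_module \<delta> (L_module \<delta> \<mu>)"
  unfolding simple_B_module_def L_module_def Delta_bar_def D_module_def
  using I.B_module_L I.simple_L by blast

lemma L_module_eq: "L_module \<delta> \<mu> = module_head (B_alg \<delta>) (Delta \<delta> (pullback (sym_component (sum_list \<mu>)) D))"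
  unfolding L_module_def Delta_bar_def D_module_def ..

end

text \<open>The shortest word space recovers \<open>D_module\<close> over \<open>B_zero\<close>. The
  idempotents \<open>B_id\<close> then tell the size of the partition, and the permutation diagrams
  the module structure over the group algebra.\<close>

lemma L_module_inject:
  fixes \<delta> :: "'k::field"
  assumes two: "(2::'k) \<noteq> 0"
    and reg: "\<mu> \<in> regular_partitions CHAR('k)" "\<nu> \<in> regular_partitions CHAR('k)"
    and iso: "amodule_iso (B_alg \<delta>) (L_module \<delta> \<mu>) (L_module \<delta> \<nu>)"
  shows "\<mu> = \<nu>"
proof -
  interpret M: regular_partition \<mu> \<delta> by (rule regular_partition.intro[OF reg(1) two])
  interpret N: regular_partition \<nu> \<delta> by (rule regular_partition.intro[OF reg(2) two])
  let ?m = "sum_list \<mu>" and ?n = "sum_list \<nu>"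
  let ?M = "module_head (group_algebra ?m) (specht_module \<mu>) :: ('k, (tabloid \<Rightarrow>\<^sub>0 'k) set, (nat \<Rightarrow> nat) \<Rightarrow>\<^sub>0 'k) amodule"
  let ?N = "module_head (group_algebra ?n) (specht_module \<nu>) :: ('k, (tabloid \<Rightarrow>\<^sub>0 'k) set, (nat \<Rightarrow> nat) \<Rightarrow>\<^sub>0 'k) amodule"
  have "amodule_iso (B_zero \<delta>) (shortest_word_space (L_module \<delta> \<mu>)) (shortest_word_space (L_module \<delta> \<nu>))"
    using M.simple_L_module N.simple_L_module
    by (intro shortest_word_space_cong iso) (simp_all add: simple_B_module_def simple_amodule_def)
  then have "amodule_iso (B_zero \<delta>) (D_module \<mu> :: ('k, _, _) amodule) (D_module \<nu>)"
    by (rule amodule_iso_trans[OF amodule_iso_trans[OF M.D_module_iso] N.shortest_word_space_L_module])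
  then obtain f where f: "bij_betw f (carrier ?M) (carrier ?N)"
    "\<And>v w. v \<in> carrier ?M \<Longrightarrow> w \<in> carrier ?M \<Longrightarrow> f (v \<oplus>\<^bsub>?M\<^esub> w) = f v \<oplus>\<^bsub>?N\<^esub> f w"
    "\<And>c v. v \<in> carrier ?M \<Longrightarrow> f (c \<odot>\<^bsub>?M\<^esub> v) = c \<odot>\<^bsub>?N\<^esub> f v"
    "\<And>b v. b \<in> carrier (B_zero \<delta>) \<Longrightarrow> v \<in> carrier ?M \<Longrightarrow>
      f (act ?M (sym_component ?m b) v) = act ?N (sym_component ?n b) (f v)"
    unfolding amodule_iso_def D_module_def pullback_simps by blast
  have f_closed: "f v \<in> carrier ?N" if "v \<in> carrier ?M" for v using f(1) that by (auto simp: bij_betw_def)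
  have f0: "f \<zero>\<^bsub>?M\<^esub> = \<zero>\<^bsub>?N\<^esub>"
    using amodule_iso_zero[OF M.I.amodule_X N.I.amodule_X, of f, unfolded pullback_simps, OF f(3) f_closed] .
  \<comment> \<open>For different sizes \<open>B_id ?m\<close> would act as the identity on the
    first module and as zero on the second.\<close>
  have n: "?n = ?m"
  proof (rule ccontr)
    assume ne: "?n \<noteq> ?m"
    obtain x where x: "x \<in> carrier ?M" "x \<noteq> \<zero>\<^bsub>?M\<^esub>"
      using M.simple_D M.I.H.M.zero_closed unfolding simple_amodule_def by blast
    have id: "symbol id \<in> carrier (group_algebra k)" for k by (simp add: permutes_id)
    have "B_id ?m \<in> carrier (B_zero \<delta>)"
      using perm_embedding_in[OF id, of ?m \<delta>] by (simp add: perm_embedding_id)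
    from f(4)[OF this x(1)] have "f x = act ?N 0 (f x)"
      using ne M.D_unital[OF x(1)] by (simp add: sym_component_B_id)
    also have "\<dots> = \<zero>\<^bsub>?N\<^esub>"
      using N.I.H.act_smult_left[OF id f_closed[OF x(1)], of 0] N.I.H.act_closed[OF id f_closed[OF x(1)]]
      by (simp add: N.I.H.smult_zero_left)
    finally have "f x = f \<zero>\<^bsub>?M\<^esub>" using f0 by simp
    then show False using f(1) x M.I.H.M.zero_closed by (auto simp: bij_betw_def dest: inj_onD)
  qed
  have "f (act ?M a v) = act ?N a (f v)" if "a \<in> carrier (group_algebra ?m)" "v \<in> carrier ?M" for a v
    using f(4)[OF perm_embedding_in[OF that(1)] that(2)] sym_component_perm_embedding[OF that(1)] n by simp
  then have "amodule_iso (group_algebra ?m) ?M ?N" unfolding amodule_iso_def using f(1-3) by blast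
  then show ?thesis using specht_head_inject[OF two n reg] n by simp
qed

context brauer_module
begin

lemma perm_embedding_word_space:
  assumes "a \<in> carrier (group_algebra m)" "v \<in> carrier V"
  shows "act V (perm_embedding m a) v \<in> word_space V m"
proof -
  have a: "perm_embedding m a \<in> B" by (rule perm_embedding_in_B[OF assms(1)])
  have "act V (B_id m) (act V (perm_embedding m a) v) = act V (perm_embedding m a) v"
    using act_bmult[OF _ a assms(2), of "B_id m"] bmult_perm_embedding_id(2)[OF assms(1), of \<delta>] by simp
  then show ?thesis unfolding word_space_iff using act_closed[OF a assms(2)] by blast
qed

text \<open>If \<open>b v\<close> is nonzero it generates \<open>V\<close>, so
  \<open>v = c b v\<close> for some \<open>c\<close>, and \<open>B_id m\<close> fixes
  \<open>v\<close>. Thus \<open>b v = 0\<close> can be tested by applying all \<open>c\<close> and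
  then \<open>B_id m\<close>, where only symmetric components act.\<close>

lemma simple_annihilator_iff:
  assumes simple: "simple_amodule (B_alg \<delta>) V"
    and low: "\<And>k. k < m \<Longrightarrow> word_space V k = {\<zero>\<^bsub>V\<^esub>}"
    and v: "v \<in> word_space V m" "v \<noteq> \<zero>\<^bsub>V\<^esub>" and b: "b \<in> B"
  shows "act V b v = \<zero>\<^bsub>V\<^esub> \<longleftrightarrow>
    (\<forall>c\<in>B. act V (perm_embedding m (sym_component m (bmult \<delta> c b))) v = \<zero>\<^bsub>V\<^esub>)"
proof -
  have vV: "v \<in> carrier V" "act V (B_id m) v = v" using v(1) by (simp_all add: word_space_iff)
  have top: "act V (perm_embedding m (sym_component m (bmult \<delta> c b))) v = act V (B_id m) (act V c (act V b v))"
    if c: "c \<in> B" for c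
  proof -
    have cb: "bmult \<delta> c b \<in> B" using B.mult_closed[OF c b] by simp
    show ?thesis unfolding act_bmult[OF c b vV(1), symmetric]
      by (rule act_perm_embedding[OF _ v(1) cb, symmetric]) (rule low)
  qed
  show ?thesis
  proof
    assume "act V b v = \<zero>\<^bsub>V\<^esub>"
    then show "\<forall>c\<in>B. act V (perm_embedding m (sym_component m (bmult \<delta> c b))) v = \<zero>\<^bsub>V\<^esub>"
      using top by (simp add: act_zero_right)
  next
    assume z: "\<forall>c\<in>B. act V (perm_embedding m (sym_component m (bmult \<delta> c b))) v = \<zero>\<^bsub>V\<^esub>"
    show "act V b v = \<zero>\<^bsub>V\<^esub>"
    proof (rule ccontr)
      assume nz: "act V b v \<noteq> \<zero>\<^bsub>V\<^esub>"
      obtain M where M: "finite M" "act V (sum B_id M) (act V b v) = act V b v" using act_left_unit[OF b vV(1)] .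
      have M0: "act V (sum B_id M) (act V b v) \<noteq> \<zero>\<^bsub>V\<^esub>" unfolding M(2) by (rule nz)
      have "(\<lambda>c. act V c (act V b v)) ` B = carrier V"
        by (rule simple_cyclic[OF simple B.closed_algebra_axioms act_closed[OF b vV(1)] sum_B_id_in_B[OF M(1)] M0])
      then obtain c where "c \<in> B" "v = act V c (act V b v)" using vV(1) by (metis imageE)
      then show False using z top vV(2) v(2) by metis
    qed
  qed
qed

end

theorem simple_B_module_iso_L:
  fixes V :: "('k::field, 'v, 'k brauer_element) amodule" and \<delta> :: 'k
  assumes two: "(2::'k) \<noteq> 0" and V: "simple_B_module \<delta> V"
  shows "\<exists>\<mu>\<in>regular_partitions CHAR('k). amodule_iso (B_alg \<delta>) V (L_module \<delta> \<mu>)"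
proof -
  have simple: "simple_amodule (B_alg \<delta>) V" and BV: "B_module \<delta> V" using V by (simp_all add: simple_B_module_def)
  interpret V: brauer_module \<delta> V using simple by (intro brauer_moduleI) (simp add: simple_amodule_def)
  obtain v1 where v1: "v1 \<in> carrier V" "v1 \<noteq> \<zero>\<^bsub>V\<^esub>"
    using simple V.M.zero_closed unfolding simple_amodule_def by blast
  \<comment> \<open>A nonzero vector is a finite sum of vectors from word spaces, so these cannot
    all vanish.\<close>
  have "\<exists>m. word_space V m \<noteq> {\<zero>\<^bsub>V\<^esub>}"
  proof (rule ccontr)
    assume a: "\<nexists>m. word_space V m \<noteq> {\<zero>\<^bsub>V\<^esub>}"
    obtain w where w: "\<forall>m. w m \<in> word_space V m" "v1 = finsum V w {m. w m \<noteq> \<zero>\<^bsub>V\<^esub>}"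
      using BV v1(1) unfolding B_module_def by blast
    have "w m = \<zero>\<^bsub>V\<^esub>" for m using w(1) a by blast
    then have "{m. w m \<noteq> \<zero>\<^bsub>V\<^esub>} = {}" by blast
    then have "v1 = \<zero>\<^bsub>V\<^esub>" unfolding w(2) by simp
    then show False using v1(2) by blast
  qed
  then obtain m where ne: "word_space V m \<noteq> {\<zero>\<^bsub>V\<^esub>}"
    and low: "\<And>k. k < m \<Longrightarrow> word_space V k = {\<zero>\<^bsub>V\<^esub>}"
    using exists_least_iff[of "\<lambda>m. word_space V m \<noteq> {\<zero>\<^bsub>V\<^esub>}"] by blast
  let ?A = "group_algebra m :: ('k, _) module"
  interpret A: closed_algebra ?A by (rule closed_algebra_group_algebra)
  define H where "H = pullback (perm_embedding m) (V\<lparr>carrier := word_space V m\<rparr>)"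
  have H: "carrier H = word_space V m" "\<zero>\<^bsub>H\<^esub> = \<zero>\<^bsub>V\<^esub>" "add H = add V" "module.smult H = module.smult V"
    "act H a = act V (perm_embedding m a)" for a
    by (simp_all add: H_def pullback_simps)
  note iff = V.word_space_iff
  have id: "(B_id m :: 'k brauer_element) \<in> carrier (B_alg \<delta>)" by simp
  have sub: "submodule (word_space V m) (scalar_ring :: 'k ring) V"
    unfolding submodule_scalar_ring_iff[OF V.module_axioms] iff
    using V.act_zero_right[OF id] V.act_add_right[OF id] V.act_smult_right[OF id]
    by (auto simp: iff V.smult_in)
  have "Module.module scalar_ring H"
    by (rule module_cong[OF submodule.submodule_is_module[OF sub V.module_axioms]]) (simp_all add: H)
  moreover have lin: "perm_embedding m (a + b) = perm_embedding m a + perm_embedding m b"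
    "perm_embedding m (scale c a) = scale c (perm_embedding m a)" for a b and c :: 'k
    by (simp_all add: perm_embedding_def lin_ext_add lin_ext_scale)
  ultimately have amodule_H: "amodule ?A H"
  proof (intro amodule.intro amodule_axioms.intro)
    fix a b v w and c :: 'k assume a: "a \<in> carrier ?A" and v: "v \<in> carrier H"
    have vV: "v \<in> carrier V" using v by (simp add: H iff)
    note pa = perm_embedding_in_B[OF a, of \<delta>]
    show "act H a v \<in> carrier H" unfolding H by (rule V.perm_embedding_word_space[OF a vV])
    show "act H (c \<odot>\<^bsub>?A\<^esub> a) v = c \<odot>\<^bsub>H\<^esub> act H a v"
      using V.act_scale[OF pa vV] by (simp add: H lin)
    show "act H a (c \<odot>\<^bsub>H\<^esub> v) = c \<odot>\<^bsub>H\<^esub> act H a v"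
      using V.act_smult_right[OF pa vV] by (simp add: H)
    show "act H (a \<oplus>\<^bsub>?A\<^esub> b) v = act H a v \<oplus>\<^bsub>H\<^esub> act H b v" if b: "b \<in> carrier ?A"
      using V.act_add[OF pa perm_embedding_in_B[OF b] vV] by (simp add: H lin)
    show "act H (a \<otimes>\<^bsub>?A\<^esub> b) v = act H a (act H b v)" if b: "b \<in> carrier ?A"
      using V.act_bmult[OF pa perm_embedding_in_B[OF b] vV] perm_embedding_mult[OF a b, of \<delta>] by (simp add: H)
    show "act H a (v \<oplus>\<^bsub>H\<^esub> w) = act H a v \<oplus>\<^bsub>H\<^esub> act H a w" if w: "w \<in> carrier H"
      using V.act_add_right[OF pa vV, of w] w by (simp add: H iff)
  qed assumption
  interpret H: amodule ?A H by (rule amodule_H)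
  have zero_ws: "\<zero>\<^bsub>V\<^esub> \<in> word_space V m" using V.act_zero_right[OF id] by (simp add: iff)
  have B_cyclic: "(\<lambda>b. act V b x) ` carrier (B_alg \<delta>) = carrier V"
    if "x \<in> word_space V m" "x \<noteq> \<zero>\<^bsub>V\<^esub>" for x
    using that iff[of x m] by (intro simple_cyclic[OF simple B.closed_algebra_axioms _ id]) simp_all
  \<comment> \<open>A nonzero \<open>x\<close> of the word space generates \<open>V\<close>. The
    element \<open>b\<close> taking \<open>x\<close> to a prescribed \<open>y\<close> may be
    replaced by its symmetric component, because \<open>y\<close> lies in the same word
    space.\<close>
  have simple_H: "simple_amodule ?A H" unfolding simple_amodule_def
  proof (intro conjI allI impI amodule_H)
    show "carrier H \<noteq> {\<zero>\<^bsub>H\<^esub>}" using ne by (simp add: H)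
    fix U assume U: "asubmodule ?A H U"
    note U' = U[unfolded H.asubmodule_iff H]
    show "U = {\<zero>\<^bsub>H\<^esub>} \<or> U = carrier H"
    proof (cases "\<exists>x\<in>U. x \<noteq> \<zero>\<^bsub>V\<^esub>")
      case True
      then obtain x where x: "x \<in> U" "x \<noteq> \<zero>\<^bsub>V\<^esub>" by blast
      have xw: "x \<in> word_space V m" using U' x(1) by blast
      have "y \<in> U" if y: "y \<in> word_space V m" for y
      proof -
        obtain b where b: "b \<in> carrier (B_alg \<delta>)" "y = act V b x"
          using B_cyclic[OF xw x(2)] y iff[of y m] by (metis imageE)
        have "y = act V (perm_embedding m (sym_component m b)) x"
          using V.act_perm_embedding[OF low xw b(1)] y b(2) iff[of y m] by simp
        then show ?thesis using U' x(1) sym_component_in[of m b] by blast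
      qed
      then show ?thesis using U' by (auto simp: H)
    next
      case False
      then show ?thesis using U' by (auto simp: H)
    qed
  qed
  have unital: "act H (symbol id) v = v" if "v \<in> carrier H" for v
    using that unfolding H(1,5) perm_embedding_id iff by blast
  obtain \<mu> where \<mu>: "\<mu> \<in> regular_partitions CHAR('k)" "sum_list \<mu> = m"
    and iso: "amodule_iso ?A H (module_head ?A (specht_module \<mu>))"
    using simple_group_module_iso[OF two simple_H unital] by metis
  interpret M: regular_partition \<mu> \<delta> by (rule regular_partition.intro[OF \<mu>(1) two])
  let ?D = "module_head ?A (specht_module \<mu>) :: ('k, (tabloid \<Rightarrow>\<^sub>0 'k) set, (nat \<Rightarrow> nat) \<Rightarrow>\<^sub>0 'k) amodule"
  have amodule_D: "amodule ?A ?D" using M.amodule_D \<mu>(2) by simp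
  obtain f where f: "bij_betw f (carrier H) (carrier ?D)"
    "\<And>c v. v \<in> carrier H \<Longrightarrow> f (c \<odot>\<^bsub>H\<^esub> v) = c \<odot>\<^bsub>?D\<^esub> f v"
    "\<And>a v. a \<in> carrier ?A \<Longrightarrow> v \<in> carrier H \<Longrightarrow> f (act H a v) = act ?D a (f v)"
    using iso unfolding amodule_iso_def by blast
  have f_closed: "f v \<in> carrier ?D" if "v \<in> carrier H" for v using f(1) that by (auto simp: bij_betw_def)
  have f0: "f \<zero>\<^bsub>H\<^esub> = \<zero>\<^bsub>?D\<^esub>" by (rule amodule_iso_zero[OF amodule_H amodule_D f(2) f_closed])
  have f_zero: "f x = \<zero>\<^bsub>?D\<^esub> \<longleftrightarrow> x = \<zero>\<^bsub>V\<^esub>" if x: "x \<in> carrier H" for x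
  proof
    assume "f x = \<zero>\<^bsub>?D\<^esub>"
    then have "f x = f \<zero>\<^bsub>H\<^esub>" using f0 by simp
    then have "x = \<zero>\<^bsub>H\<^esub>" using inj_onD[OF bij_betw_imp_inj_on[OF f(1)]] x H.M.zero_closed by blast
    then show "x = \<zero>\<^bsub>V\<^esub>" by (simp add: H)
  qed (use f0 in \<open>simp add: H\<close>)
  obtain v where v: "v \<in> word_space V m" "v \<noteq> \<zero>\<^bsub>V\<^esub>" using ne zero_ws by blast
  have vH: "v \<in> carrier H" using v(1) by (simp add: H)
  let ?L = "L_module \<delta> \<mu>"
  note LE = M.L_module_eq
  interpret L: brauer_module \<delta> ?L unfolding LE by (rule M.I.L.brauer_module_axioms)
  have fvD: "f v \<in> carrier (module_head (group_algebra (sum_list \<mu>)) (specht_module \<mu>) :: ('k, _, _) amodule)"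
    using f_closed[OF vH] \<mu>(2) by simp
  \<comment> \<open>The vector of \<open>?L\<close> corresponding to \<open>v\<close> when the
    shortest word spaces are identified through \<open>f\<close>.\<close>
  define y where "y = M.I.top_vector (f v)"
  have y: "y \<in> word_space ?L m" unfolding y_def LE using M.I.word_space_L \<mu>(2) f_closed[OF vH] by simp
  have y0: "y \<noteq> \<zero>\<^bsub>?L\<^esub>"
    using M.I.top_vector_eq_zero[OF fvD] f_zero[OF vH] v(2) \<mu>(2) unfolding y_def LE by auto
  have simple_L: "simple_amodule (B_alg \<delta>) ?L" using M.simple_L_module by (simp add: simple_B_module_def)
  have low_L: "word_space ?L k = {\<zero>\<^bsub>?L\<^esub>}" if "k < m" for k
    unfolding LE using that \<mu>(2) by (intro M.I.word_space_L_low) simp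
  have top_L: "act ?L (perm_embedding m a) y = \<zero>\<^bsub>?L\<^esub> \<longleftrightarrow> act V (perm_embedding m a) v = \<zero>\<^bsub>V\<^esub>"
    if a: "a \<in> carrier ?A" for a
  proof -
    have aD: "act ?D a (f v) \<in> carrier ?D" using amodule.act_closed[OF amodule_D a f_closed[OF vH]] .
    have "act ?L (perm_embedding m a) y = M.I.top_vector (act ?D a (f v))"
      unfolding y_def LE M.I.top_vector_act[OF perm_embedding_in[OF a] fvD]
      using sym_component_perm_embedding[OF a] \<mu>(2) by simp
    moreover have "M.I.top_vector (act ?D a (f v)) = \<zero>\<^bsub>?L\<^esub> \<longleftrightarrow> act ?D a (f v) = \<zero>\<^bsub>?D\<^esub>"
    proof
      show "M.I.top_vector (act ?D a (f v)) = \<zero>\<^bsub>?L\<^esub> \<Longrightarrow> act ?D a (f v) = \<zero>\<^bsub>?D\<^esub>"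
        using M.I.top_vector_eq_zero[of "act ?D a (f v)"] aD \<mu>(2) unfolding LE by simp
      assume z: "act ?D a (f v) = \<zero>\<^bsub>?D\<^esub>"
      have "M.I.top_vector \<zero>\<^bsub>?D\<^esub> = \<zero>\<^bsub>?L\<^esub>"
        using M.I.top_vector_smult[OF fvD, of 0] L.smult_zero_left[of y] M.I.H.smult_zero_left[OF fvD] y L.word_space_iff \<mu>(2)
        unfolding LE y_def by simp
      then show "M.I.top_vector (act ?D a (f v)) = \<zero>\<^bsub>?L\<^esub>" using z by simp
    qed
    moreover have "act ?D a (f v) = \<zero>\<^bsub>?D\<^esub> \<longleftrightarrow> act V (perm_embedding m a) v = \<zero>\<^bsub>V\<^esub>"
      using f(3)[OF a vH] f_zero[OF H.act_closed[OF a vH]] by (simp add: H)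
    ultimately show ?thesis by simp
  qed
  \<comment> \<open>Both annihilators are determined by how symmetric components act on the two
    vectors, and these actions correspond under \<open>f\<close>.\<close>
  have ann: "act V b v = \<zero>\<^bsub>V\<^esub> \<longleftrightarrow> act ?L b y = \<zero>\<^bsub>?L\<^esub>" if b: "b \<in> carrier (B_alg \<delta>)" for b
  proof -
    have "act V b v = \<zero>\<^bsub>V\<^esub> \<longleftrightarrow>
        (\<forall>c\<in>carrier (B_alg \<delta>). act V (perm_embedding m (sym_component m (bmult \<delta> c b))) v = \<zero>\<^bsub>V\<^esub>)"
      by (rule V.simple_annihilator_iff[OF simple _ v b]) (rule low)
    moreover have "act ?L b y = \<zero>\<^bsub>?L\<^esub> \<longleftrightarrow>
        (\<forall>c\<in>carrier (B_alg \<delta>). act ?L (perm_embedding m (sym_component m (bmult \<delta> c b))) y = \<zero>\<^bsub>?L\<^esub>)"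
      by (rule L.simple_annihilator_iff[OF simple_L _ y y0 b]) (rule low_L)
    ultimately show ?thesis by (simp only: top_L[OF sym_component_in])
  qed
  have y': "y \<in> carrier ?L" "act ?L (B_id m) y = y" using y by (simp_all add: L.word_space_iff)
  have cyc_L: "(\<lambda>b. act ?L b y) ` carrier (B_alg \<delta>) = carrier ?L"
    using y0 y' by (intro simple_cyclic[OF simple_L B.closed_algebra_axioms _ id]) simp_all
  have "amodule_iso (B_alg \<delta>) V ?L"
    using v(1) iff
    by (intro amodule_iso_cyclic[OF V.amodule_axioms L.amodule_axioms B.closed_algebra_axioms _ B_cyclic[OF v] y'(1) cyc_L ann]) simp_all
  then show ?thesis using \<mu>(1) by blast
qed

text \<open>The last three clauses express completeness of the list. The carrier of \<open>V\<close>
  has an arbitrary type, so that exhaustion is not restricted to the type in which the modules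
  \<open>L_module\<close> live.\<close>

theorem theorem2p8:
  fixes \<delta>\<^sub>0 :: "'k::alg_closed_field"
  assumes "CHAR('k) \<noteq> 2"
  shows
    "(\<forall>\<mu>\<in>regular_partitions CHAR('k).
        \<exists>!W. maximal_submodule (B_alg \<delta>\<^sub>0) (Delta_bar \<delta>\<^sub>0 \<mu>) W) \<and>
     (\<forall>\<mu>\<in>regular_partitions CHAR('k).
        amodule_iso (B_zero \<delta>\<^sub>0) (shortest_word_space (L_module \<delta>\<^sub>0 \<mu>)) (D_module \<mu>)) \<and>
     (\<forall>\<mu>\<in>regular_partitions CHAR('k). simple_B_module \<delta>\<^sub>0 (L_module \<delta>\<^sub>0 \<mu>)) \<and>
     (\<forall>\<mu>\<in>regular_partitions CHAR('k). \<forall>\<nu>\<in>regular_partitions CHAR('k).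
        amodule_iso (B_alg \<delta>\<^sub>0) (L_module \<delta>\<^sub>0 \<mu>) (L_module \<delta>\<^sub>0 \<nu>) \<longrightarrow> \<mu> = \<nu>) \<and>
     (\<forall>V :: ('k, 'v, 'k brauer_element) amodule. simple_B_module \<delta>\<^sub>0 V \<longrightarrow>
        (\<exists>\<mu>\<in>regular_partitions CHAR('k). amodule_iso (B_alg \<delta>\<^sub>0) V (L_module \<delta>\<^sub>0 \<mu>)))"
proof (intro conjI ballI allI impI)
  have two: "(2::'k) \<noteq> 0" by (rule two_nonzero[OF assms])
  fix \<mu> assume \<mu>: "\<mu> \<in> regular_partitions CHAR('k)"
  interpret regular_partition \<mu> \<delta>\<^sub>0 by (rule regular_partition.intro[OF \<mu> two])
  show "\<exists>!W. maximal_submodule (B_alg \<delta>\<^sub>0) (Delta_bar \<delta>\<^sub>0 \<mu>) W" by (rule unique_maximal_submodule)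
  show "amodule_iso (B_zero \<delta>\<^sub>0) (shortest_word_space (L_module \<delta>\<^sub>0 \<mu>)) (D_module \<mu>)"
    by (rule shortest_word_space_L_module)
  show "simple_B_module \<delta>\<^sub>0 (L_module \<delta>\<^sub>0 \<mu>)" by (rule simple_L_module)
next
  fix \<mu> \<nu> assume "\<mu> \<in> regular_partitions CHAR('k)" "\<nu> \<in> regular_partitions CHAR('k)"
    "amodule_iso (B_alg \<delta>\<^sub>0) (L_module \<delta>\<^sub>0 \<mu>) (L_module \<delta>\<^sub>0 \<nu>)"
  then show "\<mu> = \<nu>" by (rule L_module_inject[OF two_nonzero[OF assms]])
next
  fix V :: "('k, 'v, 'k brauer_element) amodule" assume "simple_B_module \<delta>\<^sub>0 V"
  then show "\<exists>\<mu>\<in>regular_partitions CHAR('k). amodule_iso (B_alg \<delta>\<^sub>0) V (L_module \<delta>\<^sub>0 \<mu>)"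
    by (rule simple_B_module_iso_L[OF two_nonzero[OF assms]])
qed

end
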